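(* Assume the Setting below with Conditions 1, 2 and 3', and assume $R_E^*=W_{E,\eta\eta}(\theta^*,\eta^* )$ and $W_{P,\theta\theta}(\theta^* )$ are nonsingular. Let $\hat\theta_N$ be the prediction error estimator and $\hat\eta_N$ the second-stage ECF estimator defined below. Then $$\hat\eta_N-\eta^*=-(R_E^* )^{-1}\frac1N V_{E,N\eta}(\hat\theta_N,\eta^* )+O^{Q/(2(p+q))}_M\big(N^{-1}\big).$$
   Context: Setting. Fix $h>0$, an integer $Q\ge2$ and integers $p,q\ge1$ ($p=\dim\theta$, $q=\dim\eta$). $(Z_t)$ is a real-valued Lévy process whose Lévy measure $\nu(dx)=\nu(dx,\eta^* )$ depends on an unknown parameter $\eta^*$ in an open set $G_\eta\subset\mathbb R^q$. Its increments $\Delta Z_n=Z_{nh}-Z_{(n-1)h}$, $n\in\mathbb Z$, are i.i.d., and it is assumed that $\mathbb E[\Delta Z_n]=0$. For $\eta\in G_\eta$, $\varphi(u,\eta)$ ($u\in\mathbb R$) denotes the characteristic function of $\Delta Z_n$ under parameter $\eta$; it is three times continuously differentiable in $\eta$. For $\theta$ in an open set $G_\theta\subset\mathbb R^p$, $A(\theta)$ is a causal time-invariant finite-dimensional linear SISO filter in innovation form, $(A(\theta)x)_n=x_n+\sum_{j\ge1}a_j(\theta)x_{n-j}$, depending three times continuously differentiably on $\theta$. The data are $\Delta y_n=A(\theta^* )\Delta Z_n$, $n\in\mathbb Z$, with unknown $\theta^*\in G_\theta$. The estimated innovation $\varepsilon_n(\theta)$, $n\ge1$, is the output of $A^{-1}(\theta)$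 driven by $(\Delta y_n)_{n\ge1}$ with zero initial conditions; $\varepsilon^*_n(\theta)=A^{-1}(\theta)\Delta y_n$, $n\in\mathbb Z$, is the stationary output. Subscripts $\theta,\eta,\rho$ denote partial derivatives. Condition 1: $\int_{|x|\ge1}|x|^r\,\nu(dx,\eta^* )<\infty$ for all $1\le r\le Q$. Condition 2: for $\theta\in G_\theta$, $A(\theta)$ and $A^{-1}(\theta)$ are exponentially stable: their impulse-response coefficients and their $\theta$-derivatives up to order 3 are bounded by $c\alpha^j$ (lag $j$), with $c>0$, $0<\alpha<1$ uniform on compact subsets of $G_\theta$. PE stage. $W_P(\theta)=\tfrac12\mathbb E[\varepsilon^*_n(\theta)^2]$. $\hat\theta_N$ is a measurably chosen solution in $D_\theta$ of $\sum_{n=1}^N\varepsilon_n(\theta)\varepsilon_{n\theta}(\theta)=0$. ECF stage. Fix $k\ge1$, real $u_1,\dots,u_k$ and a real symmetric positive definite $k\times k$ matrix $K$. $h_n(u;\theta,\eta)=e^{iu\varepsilon_n(\theta)}-\varphi(u,\eta)$, $h^*_n(u;\theta,\eta)=e^{iu\varepsilon^*_n(\theta)}-\varphi(u,\eta)$, $h_n(\theta,\eta)=(h_n(u_1;\theta,\eta),\dots,h_n(u_k;\theta,\eta))^T$, similarly $h^*_n$. $V_{E,N}(\theta,\eta)=\sum_{n=1}^Nh_n(\theta,\eta)^TK^{-1}\overline{h_n(\theta,\eta)}$, $W_E(\theta,\eta)=\mathbb E[h^*_n(\theta,\eta)^TK^{-1}\overline{h^*_n(\theta,\eta)}]$. $\hat\eta_N$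 is a measurably chosen solution in $D_\eta$ of $V_{E,N\eta}(\hat\theta_N,\eta)=0$. Here $D_\rho=D_\theta\times D_\eta$ and $D^*_\rho$ are compact with $(\theta^*,\eta^* )\in D^*_\rho\subset\operatorname{int}D_\rho$, $D_\rho\subset G_\theta\times G_\eta$. Condition 3': the equations $W_{P,\theta}(\theta)=0$ and $W_{E,\eta}(\theta^*,\eta)=0$ have the unique solutions $\theta^*$, resp. $\eta^*$, in $D_\theta$, resp. $D_\eta$. Notation: for random variables $X_N$ and a positive function $f$, $X_N=O^r_M(f(N))$ means $\sup_N\mathbb E^{1/s}|X_N|^s/f(N)<\infty$ for all $1\le s\le r$. *)

theory Defs
  imports "HOL-Probability.Probability"
begin

definition partial_d :: "(real^'n \<Rightarrow> 'b::real_normed_vector) \<Rightarrow> 'n \<Rightarrow> real^'n \<Rightarrow> 'b" where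
  "partial_d f i x = frechet_derivative f (at x) (axis i 1)"

fun Ck_on :: "nat \<Rightarrow> (real^'n) set \<Rightarrow> (real^'n \<Rightarrow> 'b::real_normed_vector) \<Rightarrow> bool" where
  "Ck_on 0 G f = continuous_on G f"
| "Ck_on (Suc k) G f =
     ((\<forall>x\<in>G. f differentiable (at x)) \<and> continuous_on G f \<and>
      (\<forall>i. Ck_on k G (\<lambda>x. partial_d f i x)))"

fun dpart :: "'n list \<Rightarrow> (real^'n \<Rightarrow> 'b::real_normed_vector) \<Rightarrow> real^'n \<Rightarrow> 'b" where
  "dpart [] f = f"
| "dpart (i # is) f = partial_d (dpart is f) i"

definition gradient :: "(real^'n \<Rightarrow> real) \<Rightarrow> real^'n \<Rightarrow> real^'n" where
  "gradient f x = (\<chi> i. partial_d f i x)"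

definition hessian :: "(real^'n \<Rightarrow> real) \<Rightarrow> real^'n \<Rightarrow> real^'n^'n" where
  "hessian f x = (\<chi> i j. partial_d (\<lambda>y. gradient f y $ j) i x)"

definition levy_measure :: "real measure \<Rightarrow> bool" where
  "levy_measure \<nu> \<longleftrightarrow> sets \<nu> = sets borel \<and> emeasure \<nu> {0} = 0 \<and>
     (\<integral>\<^sup>+ x. ennreal (min 1 (x\<^sup>2)) \<partial>\<nu>) < \<infinity>"

definition levy_exponent :: "real \<Rightarrow> real \<Rightarrow> real measure \<Rightarrow> real \<Rightarrow> complex" where
  "levy_exponent b s \<nu> u =
     \<i> * of_real (b * u) - of_real (s * u\<^sup>2 / 2) +
     (CLINT x|\<nu>. iexp (u * x) - 1 - \<i> * of_real (u * x * indicator {-1<..<1} x))"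

text \<open>Observed increments: dy_n = A(theta*) dZ_n, with a(theta,0) = 1 (innovation form).\<close>
definition dy :: "(real^'p \<Rightarrow> nat \<Rightarrow> real) \<Rightarrow> real^'p \<Rightarrow> (int \<Rightarrow> 'w \<Rightarrow> real) \<Rightarrow> int \<Rightarrow> 'w \<Rightarrow> real" where
  "dy a \<theta>s dZ n \<omega> = (\<Sum>j. a \<theta>s j * dZ (n - int j) \<omega>)"

text \<open>Estimated innovation eps_n(theta), n >= 1: output of the inverse filter (impulse
  response b) driven by dy_1, dy_2, ... with zero initial conditions.\<close>
definition eps :: "(real^'p \<Rightarrow> nat \<Rightarrow> real) \<Rightarrow> (real^'p \<Rightarrow> nat \<Rightarrow> real) \<Rightarrow> real^'p \<Rightarrow>
    (int \<Rightarrow> 'w \<Rightarrow> real) \<Rightarrow> real^'p \<Rightarrow> nat \<Rightarrow> 'w \<Rightarrow> real" where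
  "eps b a \<theta>s dZ \<theta> n \<omega> = (\<Sum>j<n. b \<theta> j * dy a \<theta>s dZ (int n - int j) \<omega>)"

text \<open>Stationary output eps*_n(theta) = A^{-1}(theta) dy_n.\<close>
definition eps_star :: "(real^'p \<Rightarrow> nat \<Rightarrow> real) \<Rightarrow> (real^'p \<Rightarrow> nat \<Rightarrow> real) \<Rightarrow> real^'p \<Rightarrow>
    (int \<Rightarrow> 'w \<Rightarrow> real) \<Rightarrow> real^'p \<Rightarrow> int \<Rightarrow> 'w \<Rightarrow> real" where
  "eps_star b a \<theta>s dZ \<theta> n \<omega> = (\<Sum>j. b \<theta> j * dy a \<theta>s dZ (n - int j) \<omega>)"

text \<open>Quadratic form z^T K^{-1} conj(z) (real, as K is real symmetric).\<close>
definition herm_form :: "real^'k^'k \<Rightarrow> ('k::finite \<Rightarrow> complex) \<Rightarrow> real" where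
  "herm_form Kinv z = Re (\<Sum>k\<in>UNIV. \<Sum>l\<in>UNIV. z k * of_real (Kinv $ k $ l) * cnj (z l))"

definition hvec :: "(real \<Rightarrow> real^'q \<Rightarrow> complex) \<Rightarrow> ('k \<Rightarrow> real) \<Rightarrow> real \<Rightarrow> real^'q \<Rightarrow> 'k \<Rightarrow> complex" where
  "hvec \<phi> u x \<eta> = (\<lambda>k. iexp (u k * x) - \<phi> (u k) \<eta>)"

definition W_P :: "'w measure \<Rightarrow> (real^'p \<Rightarrow> nat \<Rightarrow> real) \<Rightarrow> (real^'p \<Rightarrow> nat \<Rightarrow> real) \<Rightarrow> real^'p \<Rightarrow>
    (int \<Rightarrow> 'w \<Rightarrow> real) \<Rightarrow> real^'p \<Rightarrow> real" where
  "W_P M b a \<theta>s dZ \<theta> = 1/2 * (\<integral>\<omega>. (eps_star b a \<theta>s dZ \<theta> 0 \<omega>)\<^sup>2 \<partial>M)"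

definition V_P :: "(real^'p \<Rightarrow> nat \<Rightarrow> real) \<Rightarrow> (real^'p \<Rightarrow> nat \<Rightarrow> real) \<Rightarrow> real^'p \<Rightarrow>
    (int \<Rightarrow> 'w \<Rightarrow> real) \<Rightarrow> nat \<Rightarrow> real^'p \<Rightarrow> 'w \<Rightarrow> real" where
  "V_P b a \<theta>s dZ N \<theta> \<omega> = 1/2 * (\<Sum>n=1..N. (eps b a \<theta>s dZ \<theta> n \<omega>)\<^sup>2)"

definition V_E :: "real^'k^'k \<Rightarrow> ('k::finite \<Rightarrow> real) \<Rightarrow> (real \<Rightarrow> real^'q \<Rightarrow> complex) \<Rightarrow>
    (real^'p \<Rightarrow> nat \<Rightarrow> real) \<Rightarrow> (real^'p \<Rightarrow> nat \<Rightarrow> real) \<Rightarrow> real^'p \<Rightarrow>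
    (int \<Rightarrow> 'w \<Rightarrow> real) \<Rightarrow> nat \<Rightarrow> real^'p \<Rightarrow> real^'q \<Rightarrow> 'w \<Rightarrow> real" where
  "V_E K u \<phi> b a \<theta>s dZ N \<theta> \<eta> \<omega> =
     (\<Sum>n=1..N. herm_form (matrix_inv K) (hvec \<phi> u (eps b a \<theta>s dZ \<theta> n \<omega>) \<eta>))"

definition W_E :: "'w measure \<Rightarrow> real^'k^'k \<Rightarrow> ('k::finite \<Rightarrow> real) \<Rightarrow> (real \<Rightarrow> real^'q \<Rightarrow> complex) \<Rightarrow>
    (real^'p \<Rightarrow> nat \<Rightarrow> real) \<Rightarrow> (real^'p \<Rightarrow> nat \<Rightarrow> real) \<Rightarrow> real^'p \<Rightarrow>
    (int \<Rightarrow> 'w \<Rightarrow> real) \<Rightarrow> real^'p \<Rightarrow> real^'q \<Rightarrow> real" where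
  "W_E M K u \<phi> b a \<theta>s dZ \<theta> \<eta> =
     (\<integral>\<omega>. herm_form (matrix_inv K) (hvec \<phi> u (eps_star b a \<theta>s dZ \<theta> 0 \<omega>) \<eta>) \<partial>M)"

end

theory Submission
  imports Defs
begin

text \<open>
  The criterion of the second stage depends on the data only through the bounded empirical means
  $m_l = N^{-1} \sum_n \exp(i u_l \varepsilon_n(\hat\theta_N))$, in which its $\eta$-gradient is affine. Hence
  everything is deterministic once $\delta = \sum_l |m_l - \varphi(u_l, \eta^*)|$ is controlled. If $\delta$
  is small, Brouwer's theorem gives a zero of the perturbed estimating equation, so that $\hat\eta_N$ is a zero;
  the unique nondegenerate zero of the limit then gives $|\hat\eta_N - \eta^*| \le C \delta$, and a Taylor
  expansion at $\eta^*$ gives a remainder at most $C \delta^2$. If $\delta$ is not small, boundedness of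
  $D_\eta$ gives the same bound. So one needs $E\,\delta^{2s} = O(N^{-s})$.

  The same zero argument for the first stage reduces this to the supremum over $\theta$ of the error of
  $N^{-1} \sum_n \varepsilon_n \varepsilon_{n\theta}$. Expanding in the noise, this supremum is at most
  $\sum_{j,k} C \beta^{j+k} |Y_{jk}|$ with
  $Y_{jk} = N^{-1} \sum_n \Delta Z_{n-j} \Delta Z_{n-k} - \sigma^2 1_{j=k}$, because the impulse responses decay
  geometrically and uniformly in $\theta$; no maximal inequality is needed. The moments of $Y_{jk}$ are bounded by
  a Marcinkiewicz--Zygmund inequality, which follows from
  $|x+y|^r \le |x|^r + r |x|^{r-1} \mathrm{sgn}(x) y + C (|x|^{r-2} y^2 + |y|^r)$ and
  $|x|^{r-2} y^2 \le |x|^r / N + N^{r/2-1} |y|^r$.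

  Finally, $E |\Delta Z_n|^Q$ is finite since the law of $\Delta Z_n$ is a weak limit of Gaussian laws convolved with
  $n$-fold convolutions of rare centred jumps, whose $Q$-th moments are bounded uniformly by the same
  inequality for $|x+y|^r$.
\<close>

subsection \<open>Moments of sums with orthogonal increments\<close>

text \<open>The moment budget decides the shape of the argument. The remainder is quadratic in an
  error that already contains averages of products of two noise values, so its \<open>s\<close>-th
  moment costs noise moments of order \<open>4 * s\<close>; since p and q are at least 1, the
  assumed range of \<open>s\<close> gives \<open>4 * s \<le> Q\<close>, and for p = q = 1 nothing is
  left over. Errors of the two stages must therefore add up linearly and never multiply. To enforce
  this, all random quantities are collected in one scalar \<open>noise_error\<close>, and the rest
  is an inequality along a single path. Two obstacles remain. The estimators are zeros only when the
  domain contains a zero, so existence has to be proved, with a threshold that does not depend on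
  \<open>N\<close>. And the value of a divergent series is unspecified, so filters are composed only
  on the almost sure event where the noise is geometrically summable at all times.\<close>

lemma exp_minus_linear_le:
  fixes z :: real
  shows "exp z \<le> 1 + z + z\<^sup>2 * exp \<bar>z\<bar>"
proof -
  obtain t where t: "\<bar>t\<bar> \<le> \<bar>z\<bar>" "exp z = (\<Sum>m<2. z ^ m / fact m) + (exp t / fact 2) * z ^ 2"
    using Maclaurin_exp_le[of z 2] by auto
  have "exp t * z\<^sup>2 \<le> exp \<bar>z\<bar> * z\<^sup>2"
    using t(1) by (intro mult_right_mono) auto
  moreover have "exp t * z\<^sup>2 \<ge> 0" by simp
  moreover have "exp z = 1 + z + exp t * z\<^sup>2 / 2"
    using t(2) by (simp add: numeral_2_eq_2)
  ultimately show ?thesis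
    unfolding mult.commute[of "z\<^sup>2"] by linarith
qed

text \<open>If \<open>y\<close> is small relative to \<open>x\<close>, writing
  \<open>y = t * x\<close> and using \<open>1 + t \<le> exp t\<close> reduces the claim to the
  quadratic bound for \<open>exp\<close> and avoids differentiating a real power. Otherwise
  \<open>\<bar>x\<bar> \<le> 2 * \<bar>y\<bar>\<close> and every term is of the order of
  \<open>\<bar>y\<bar> powr r\<close>.\<close>

lemma powr_add_taylor:
  fixes r :: real
  assumes r: "r \<ge> 2"
  obtains C where "C > 0"
    "\<And>x y :: real. \<bar>x + y\<bar> powr r \<le> \<bar>x\<bar> powr r + r * (sgn x * \<bar>x\<bar> powr (r - 1) * y)
        + C * (\<bar>x\<bar> powr (r - 2) * y\<^sup>2 + \<bar>y\<bar> powr r)"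
proof
  \<comment> \<open>The first summand is the exponential remainder for small \<open>y\<close>; the
    others bound the left side and the linear term when
    \<open>\<bar>x\<bar> \<le> 2 * \<bar>y\<bar>\<close>.\<close>
  define C where "C = r\<^sup>2 * exp r + 3 powr r + r * 2 powr r"
  show "C > 0" using r by (simp add: C_def add_nonneg_pos add_pos_nonneg)
  fix x y :: real
  show "\<bar>x + y\<bar> powr r \<le> \<bar>x\<bar> powr r + r * (sgn x * \<bar>x\<bar> powr (r - 1) * y)
        + C * (\<bar>x\<bar> powr (r - 2) * y\<^sup>2 + \<bar>y\<bar> powr r)"
  proof (cases "\<bar>y\<bar> \<le> \<bar>x\<bar> / 2 \<and> x \<noteq> 0")
    case True
    define t where "t = y / x"
    have t: "\<bar>t\<bar> \<le> 1/2" "y = t * x"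
      using True by (auto simp: t_def abs_divide field_simps)
    have "x + y = x * (1 + t)" using t by (simp add: algebra_simps)
    hence 1: "\<bar>x + y\<bar> = \<bar>x\<bar> * (1 + t)" using t by (simp add: abs_mult abs_le_iff)
    have "(1 + t) powr r \<le> exp t powr r"
      using t r by (intro powr_mono2) (auto simp: exp_ge_add_one_self)
    also have "\<dots> = exp (r * t)" by (simp add: powr_def)
    also have "\<dots> \<le> 1 + r * t + (r * t)\<^sup>2 * exp \<bar>r * t\<bar>" by (rule exp_minus_linear_le)
    also have "\<dots> \<le> 1 + r * t + (r * t)\<^sup>2 * exp r"
    proof -
      have "\<bar>r * t\<bar> \<le> r" using t r mult_left_mono[of "\<bar>t\<bar>" 1 r] by (simp add: abs_mult)
      thus ?thesis by (intro add_left_mono mult_left_mono) auto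
    qed
    finally have 2: "(1 + t) powr r \<le> 1 + r * t + (r * t)\<^sup>2 * exp r" .
    have "\<bar>x + y\<bar> powr r = \<bar>x\<bar> powr r * (1 + t) powr r"
      unfolding 1 using t by (intro powr_mult) 
    also have "\<dots> \<le> \<bar>x\<bar> powr r * (1 + r * t + (r * t)\<^sup>2 * exp r)"
      using 2 by (intro mult_left_mono) auto
    also have "\<dots> = \<bar>x\<bar> powr r + r * (\<bar>x\<bar> powr r * t) + r\<^sup>2 * exp r * (\<bar>x\<bar> powr r * t\<^sup>2)"
      by (simp add: algebra_simps power_mult_distrib)
    also have "\<bar>x\<bar> powr r * t = sgn x * \<bar>x\<bar> powr (r - 1) * y"
    proof -
      have "\<bar>x\<bar> powr r = \<bar>x\<bar> powr (r - 1) * \<bar>x\<bar>"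
        using True by (simp add: powr_diff)
      thus ?thesis unfolding t(2) using True by (simp add: abs_sgn algebra_simps)
    qed
    also have "\<bar>x\<bar> powr r * t\<^sup>2 = \<bar>x\<bar> powr (r - 2) * y\<^sup>2"
    proof -
      have "\<bar>x\<bar> powr r = \<bar>x\<bar> powr (r - 2) * x\<^sup>2"
        using True by (simp add: powr_diff powr_numeral)
      thus ?thesis unfolding t(2) by (simp add: power_mult_distrib)
    qed
    also have "r\<^sup>2 * exp r * (\<bar>x\<bar> powr (r - 2) * y\<^sup>2) \<le> C * (\<bar>x\<bar> powr (r - 2) * y\<^sup>2 + \<bar>y\<bar> powr r)"
      using r by (intro mult_mono) (auto simp: C_def)
    finally show ?thesis by simp
  next
    case False
    hence xy: "\<bar>x\<bar> \<le> 2 * \<bar>y\<bar>" by auto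
    have "\<bar>x + y\<bar> powr r \<le> (3 * \<bar>y\<bar>) powr r"
      using xy r by (intro powr_mono2) auto
    also have "\<dots> = 3 powr r * \<bar>y\<bar> powr r" by (simp add: powr_mult)
    finally have 1: "\<bar>x + y\<bar> powr r \<le> 3 powr r * \<bar>y\<bar> powr r" .
    have "- (sgn x * \<bar>x\<bar> powr (r - 1) * y) \<le> \<bar>sgn x * \<bar>x\<bar> powr (r - 1) * y\<bar>" by simp
    also have "\<dots> \<le> 1 * \<bar>x\<bar> powr (r - 1) * \<bar>y\<bar>"
      by (simp add: abs_mult abs_sgn_eq)
    also have "\<dots> \<le> (2 * \<bar>y\<bar>) powr (r - 1) * \<bar>y\<bar>"
      using xy r by (auto intro!: mult_right_mono powr_mono2)
    also have "\<dots> \<le> 2 powr r * \<bar>y\<bar> powr r"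
    proof -
      have "\<bar>y\<bar> powr r = \<bar>y\<bar> powr (r - 1) * \<bar>y\<bar>" by (cases "y = 0") (auto simp: powr_diff)
      moreover have "(2::real) powr (r - 1) \<le> 2 powr r" by simp
      ultimately show ?thesis by (simp add: powr_mult mult_right_mono mult.assoc)
    qed
    finally have "r * (sgn x * \<bar>x\<bar> powr (r - 1) * y) \<ge> - (r * (2 powr r * \<bar>y\<bar> powr r))"
      using r mult_left_mono[of "- (sgn x * \<bar>x\<bar> powr (r - 1) * y)" "2 powr r * \<bar>y\<bar> powr r" r] by simp
    moreover have "C * (\<bar>x\<bar> powr (r - 2) * y\<^sup>2 + \<bar>y\<bar> powr r) \<ge> (3 powr r + r * 2 powr r) * \<bar>y\<bar> powr r"
      using r by (intro mult_mono) (auto simp: C_def)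
    moreover have "\<bar>x\<bar> powr r \<ge> 0" by simp
    ultimately show ?thesis using 1 unfolding distrib_right mult.assoc by linarith
  qed
qed

lemma powr_le_one_plus:
  fixes x p q :: real
  assumes "0 \<le> x" "0 \<le> p" "p \<le> q"
  shows "x powr p \<le> 1 + x powr q"
proof (cases "x \<le> 1")
  case True
  hence "x powr p \<le> 1" using assms powr_mono2[of p x 1] by simp
  thus ?thesis by (simp add: add_increasing2)
next
  case False
  hence "x powr p \<le> x powr q" using assms by (intro powr_mono) auto
  thus ?thesis by simp
qed

text \<open>Replacing both factors by the larger one is a crude Young inequality with constant 1; it
  takes the place of Hoelder for moments of products.\<close>

lemma powr_mult_le_add:
  fixes x y p q :: real
  assumes "0 \<le> x" "0 \<le> y" "0 \<le> p" "0 \<le> q"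
  shows "x powr p * y powr q \<le> x powr (p + q) + y powr (p + q)"
proof (cases "x \<le> y")
  case True
  hence "x powr p * y powr q \<le> y powr p * y powr q"
    using assms by (intro mult_right_mono powr_mono2) auto
  thus ?thesis by (simp add: powr_add[symmetric] add_increasing)
next
  case False
  hence "x powr p * y powr q \<le> x powr p * x powr q"
    using assms by (intro mult_left_mono powr_mono2) auto
  thus ?thesis by (simp add: powr_add[symmetric] add_increasing2)
qed

lemma powr_add_le:
  fixes x y r :: real
  assumes "0 \<le> x" "0 \<le> y" "0 \<le> r"
  shows "(x + y) powr r \<le> 2 powr r * (x powr r + y powr r)"
proof -
  have "(x + y) powr r \<le> (2 * max x y) powr r"
    using assms by (intro powr_mono2) auto
  also have "\<dots> = 2 powr r * max x y powr r" using assms by (simp add: powr_mult)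
  also have "\<dots> \<le> 2 powr r * (x powr r + y powr r)"
    by (intro mult_left_mono) (auto simp: max_def)
  finally show ?thesis .
qed

lemma (in prob_space) moment_integrable_mono:
  fixes X :: "'a \<Rightarrow> real"
  assumes [measurable]: "X \<in> borel_measurable M"
    and "integrable M (\<lambda>\<omega>. \<bar>X \<omega>\<bar> powr q)" "0 \<le> p" "p \<le> q"
  shows "integrable M (\<lambda>\<omega>. \<bar>X \<omega>\<bar> powr p)"
  by (rule Bochner_Integration.integrable_bound[of _ "\<lambda>\<omega>. 1 + \<bar>X \<omega>\<bar> powr q"])
    (use assms powr_le_one_plus[of "\<bar>X _\<bar>" p q] in \<open>auto simp: add_increasing\<close>)

text \<open>Weighting the two terms by powers of \<^term>\<open>N\<close> keeps the recursion for the moments of \<^term>\<open>N\<close>-fold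
  sums closed without any appeal to second moments.\<close>

lemma powr_square_le_scaled:
  fixes x y r N :: real
  assumes r: "r \<ge> 2" and N: "N \<ge> 1"
  shows "\<bar>x\<bar> powr (r - 2) * y\<^sup>2 \<le> \<bar>x\<bar> powr r / N + N powr (r/2 - 1) * \<bar>y\<bar> powr r"
proof (cases "N * y\<^sup>2 \<le> x\<^sup>2")
  case True
  hence "\<bar>x\<bar> powr (r - 2) * y\<^sup>2 \<le> \<bar>x\<bar> powr (r - 2) * (x\<^sup>2 / N)"
    using N by (intro mult_left_mono) (auto simp: field_simps)
  also have "\<dots> = \<bar>x\<bar> powr r / N"
  proof -
    have "\<bar>x\<bar> powr r = \<bar>x\<bar> powr (r - 2) * x\<^sup>2"
      by (cases "x = 0") (auto simp: powr_diff powr_numeral)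
    thus ?thesis by simp
  qed
  finally show ?thesis by (simp add: add_increasing2)
next
  case False
  have y: "y \<noteq> 0" using False by auto
  have "\<bar>x\<bar> \<le> sqrt N * \<bar>y\<bar>"
    using False real_sqrt_le_mono[of "x\<^sup>2" "N * y\<^sup>2"] by (simp add: real_sqrt_mult)
  hence "\<bar>x\<bar> powr (r - 2) * y\<^sup>2 \<le> (sqrt N * \<bar>y\<bar>) powr (r - 2) * y\<^sup>2"
    using r by (intro mult_right_mono powr_mono2) auto
  also have "\<dots> = N powr (r/2 - 1) * (\<bar>y\<bar> powr (r - 2) * y\<^sup>2)"
    using N by (simp add: powr_mult powr_half_sqrt[symmetric] powr_powr diff_divide_distrib)
  also have "\<bar>y\<bar> powr (r - 2) * y\<^sup>2 = \<bar>y\<bar> powr r"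
    using y by (auto simp: powr_diff powr_numeral)
  finally show ?thesis using N by (simp add: add_increasing)
qed

lemma (in prob_space) moment_add_integrable:
  fixes X Y :: "'a \<Rightarrow> real"
  assumes [measurable]: "X \<in> borel_measurable M" "Y \<in> borel_measurable M"
    and "integrable M (\<lambda>\<omega>. \<bar>X \<omega>\<bar> powr r)" "integrable M (\<lambda>\<omega>. \<bar>Y \<omega>\<bar> powr r)" "0 \<le> r"
  shows "integrable M (\<lambda>\<omega>. \<bar>X \<omega> + Y \<omega>\<bar> powr r)"
proof (rule Bochner_Integration.integrable_bound[of _ "\<lambda>\<omega>. 2 powr r * (\<bar>X \<omega>\<bar> powr r + \<bar>Y \<omega>\<bar> powr r)"])
  show "AE \<omega> in M. norm (\<bar>X \<omega> + Y \<omega>\<bar> powr r) \<le> norm (2 powr r * (\<bar>X \<omega>\<bar> powr r + \<bar>Y \<omega>\<bar> powr r))"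
  proof (rule AE_I2)
    fix \<omega>
    have "\<bar>X \<omega> + Y \<omega>\<bar> powr r \<le> (\<bar>X \<omega>\<bar> + \<bar>Y \<omega>\<bar>) powr r"
      using assms by (intro powr_mono2) auto
    also have "\<dots> \<le> 2 powr r * (\<bar>X \<omega>\<bar> powr r + \<bar>Y \<omega>\<bar> powr r)"
      using assms by (intro powr_add_le) auto
    finally show "norm (\<bar>X \<omega> + Y \<omega>\<bar> powr r) \<le> norm (2 powr r * (\<bar>X \<omega>\<bar> powr r + \<bar>Y \<omega>\<bar> powr r))"
      by simp
  qed
qed (use assms in auto)

lemma (in prob_space) moment_mult_integrable:
  fixes X Y :: "'a \<Rightarrow> real"
  assumes [measurable]: "X \<in> borel_measurable M" "Y \<in> borel_measurable M"
    and "integrable M (\<lambda>\<omega>. \<bar>X \<omega>\<bar> powr (p + q))" "integrable M (\<lambda>\<omega>. \<bar>Y \<omega>\<bar> powr (p + q))" "0 \<le> p" "0 \<le> q"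
  shows "integrable M (\<lambda>\<omega>. \<bar>X \<omega>\<bar> powr p * \<bar>Y \<omega>\<bar> powr q)"
proof (rule Bochner_Integration.integrable_bound[of _ "\<lambda>\<omega>. \<bar>X \<omega>\<bar> powr (p + q) + \<bar>Y \<omega>\<bar> powr (p + q)"])
  show "AE \<omega> in M. norm (\<bar>X \<omega>\<bar> powr p * \<bar>Y \<omega>\<bar> powr q) \<le> norm (\<bar>X \<omega>\<bar> powr (p + q) + \<bar>Y \<omega>\<bar> powr (p + q))"
    using powr_mult_le_add[OF abs_ge_zero abs_ge_zero assms(5,6)] by (intro AE_I2) simp
qed (use assms in simp_all)

text \<open>The vanishing expectation kills the linear term of \<open>powr_add_taylor\<close> and is
  the only trace of independence, so dependent summands of martingale type are covered as well. With
  the horizon \<open>N\<close> fixed in advance, the moments of the partial sums obey a linear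
  recursion with factor \<open>1 + K / N\<close>, whose growth over \<open>N\<close> steps stays
  below \<open>exp K\<close>.\<close>

lemma (in prob_space) orthogonal_sum_moment:
  fixes r :: real
  assumes r: "r \<ge> 2"
  obtains C where "C > 0" "\<And>(\<xi> :: nat \<Rightarrow> 'a \<Rightarrow> real) B N.
     \<lbrakk>\<And>n. \<xi> n \<in> borel_measurable M; \<And>n. integrable M (\<lambda>\<omega>. \<bar>\<xi> n \<omega>\<bar> powr r);
      \<And>n. expectation (\<lambda>\<omega>. \<bar>\<xi> n \<omega>\<bar> powr r) \<le> B;
      \<And>n. expectation (\<lambda>\<omega>. sgn (\<Sum>i<n. \<xi> i \<omega>) * \<bar>\<Sum>i<n. \<xi> i \<omega>\<bar> powr (r - 1) * \<xi> n \<omega>) = 0; N \<ge> 1\<rbrakk>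
     \<Longrightarrow> integrable M (\<lambda>\<omega>. \<bar>\<Sum>i<N. \<xi> i \<omega>\<bar> powr r) \<and>
         expectation (\<lambda>\<omega>. \<bar>\<Sum>i<N. \<xi> i \<omega>\<bar> powr r) \<le> C * real N powr (r/2) * B"
proof -
  obtain K where K: "K > 0" "\<And>x y :: real. \<bar>x + y\<bar> powr r \<le> \<bar>x\<bar> powr r + r * (sgn x * \<bar>x\<bar> powr (r - 1) * y)
        + K * (\<bar>x\<bar> powr (r - 2) * y\<^sup>2 + \<bar>y\<bar> powr r)"
    using powr_add_taylor[OF r] by blast
  show thesis
  proof (rule that[of "exp K * (2 * K)"])
    show "exp K * (2 * K) > 0" using K by simp
    fix \<xi> :: "nat \<Rightarrow> 'a \<Rightarrow> real" and B :: real and N :: nat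
    assume [measurable]: "\<And>n. \<xi> n \<in> borel_measurable M"
      and int: "\<And>n. integrable M (\<lambda>\<omega>. \<bar>\<xi> n \<omega>\<bar> powr r)"
      and B: "\<And>n. expectation (\<lambda>\<omega>. \<bar>\<xi> n \<omega>\<bar> powr r) \<le> B"
      and orth: "\<And>n. expectation (\<lambda>\<omega>. sgn (\<Sum>i<n. \<xi> i \<omega>) * \<bar>\<Sum>i<n. \<xi> i \<omega>\<bar> powr (r - 1) * \<xi> n \<omega>) = 0"
      and N: "N \<ge> 1"
    define S where "S n \<omega> = (\<Sum>i<n. \<xi> i \<omega>)" for n \<omega>
    have [measurable]: "S n \<in> borel_measurable M" for n unfolding S_def by measurable
    have B0: "B \<ge> 0" using B[of 0] by (rule order_trans[rotated]) simp
    have intS: "integrable M (\<lambda>\<omega>. \<bar>S n \<omega>\<bar> powr r)" for n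
    proof (induction n)
      case 0 thus ?case by (simp add: S_def)
    next
      case (Suc n)
      have "S (Suc n) = (\<lambda>\<omega>. S n \<omega> + \<xi> n \<omega>)" by (simp add: S_def fun_eq_iff)
      thus ?case using Suc int[of n] r by (simp add: moment_add_integrable)
    qed
    \<comment> \<open>Per step, the scaled quadratic term and the \<open>r\<close>-th power of the
      new summand each cost at most half of \<open>d\<close>, the latter because
      \<open>N powr (r/2 - 1)\<close> is at least 1. Over \<open>N\<close> steps this accumulates to
      the order \<open>N powr (r/2)\<close>.\<close>
    define d where "d = 2 * K * real N powr (r/2 - 1) * B"
    have d0: "d \<ge> 0" using B0 K by (simp add: d_def)
    have step: "expectation (\<lambda>\<omega>. \<bar>S (Suc n) \<omega>\<bar> powr r) \<le> (1 + K / N) * expectation (\<lambda>\<omega>. \<bar>S n \<omega>\<bar> powr r) + d" for n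
    proof -
      have intc: "integrable M (\<lambda>\<omega>. sgn (S n \<omega>) * \<bar>S n \<omega>\<bar> powr (r - 1) * \<xi> n \<omega>)"
      proof (rule Bochner_Integration.integrable_bound)
        show "integrable M (\<lambda>\<omega>. \<bar>S n \<omega>\<bar> powr (r - 1) * \<bar>\<xi> n \<omega>\<bar> powr 1)"
          using intS[of n] int[of n] r by (intro moment_mult_integrable) auto
      qed (auto simp: abs_mult abs_sgn_eq)
      let ?rhs = "\<lambda>\<omega>. (1 + K / N) * \<bar>S n \<omega>\<bar> powr r + r * (sgn (S n \<omega>) * \<bar>S n \<omega>\<bar> powr (r - 1) * \<xi> n \<omega>)
             + (2 * K * real N powr (r/2 - 1)) * \<bar>\<xi> n \<omega>\<bar> powr r"
      have "expectation (\<lambda>\<omega>. \<bar>S (Suc n) \<omega>\<bar> powr r) \<le> expectation ?rhs"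
      proof (rule integral_mono)
        show "integrable M ?rhs" using intc intS[of n] int[of n] by auto
        fix \<omega>
        let ?X = "\<bar>S n \<omega>\<bar> powr r" and ?Y = "\<bar>\<xi> n \<omega>\<bar> powr r"
        have "\<bar>S (Suc n) \<omega>\<bar> powr r = \<bar>S n \<omega> + \<xi> n \<omega>\<bar> powr r" by (simp add: S_def)
        also note K(2)[of "S n \<omega>" "\<xi> n \<omega>"]
        finally have 1: "\<bar>S (Suc n) \<omega>\<bar> powr r \<le> ?X + r * (sgn (S n \<omega>) * \<bar>S n \<omega>\<bar> powr (r - 1) * \<xi> n \<omega>)
             + K * (\<bar>S n \<omega>\<bar> powr (r - 2) * (\<xi> n \<omega>)\<^sup>2 + ?Y)" .
        have "\<bar>S n \<omega>\<bar> powr (r - 2) * (\<xi> n \<omega>)\<^sup>2 \<le> \<bar>S n \<omega>\<bar> powr r / N + real N powr (r/2 - 1) * \<bar>\<xi> n \<omega>\<bar> powr r"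
          using r N by (intro powr_square_le_scaled) auto
        moreover have "?Y \<le> real N powr (r/2 - 1) * \<bar>\<xi> n \<omega>\<bar> powr r"
          using r N mult_right_mono[of 1 "real N powr (r/2 - 1)" "\<bar>\<xi> n \<omega>\<bar> powr r"] by (simp add: ge_one_powr_ge_zero)
        ultimately have "\<bar>S n \<omega>\<bar> powr (r - 2) * (\<xi> n \<omega>)\<^sup>2 + ?Y \<le> ?X / N + 2 * (real N powr (r/2 - 1) * ?Y)"
          by linarith
        hence "K * (\<bar>S n \<omega>\<bar> powr (r - 2) * (\<xi> n \<omega>)\<^sup>2 + ?Y) \<le> K * (?X / N + 2 * (real N powr (r/2 - 1) * ?Y))"
          using K(1) by (intro mult_left_mono) auto
        with 1 show "\<bar>S (Suc n) \<omega>\<bar> powr r \<le> ?rhs \<omega>"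
          by (simp add: distrib_left distrib_right)
      qed (rule intS)
      also have "\<dots> = (1 + K / N) * expectation (\<lambda>\<omega>. \<bar>S n \<omega>\<bar> powr r) + (2 * K * real N powr (r/2 - 1)) * expectation (\<lambda>\<omega>. \<bar>\<xi> n \<omega>\<bar> powr r)"
        using intc intS[of n] int[of n] orth[of n] by (simp add: S_def)
      also have "\<dots> \<le> (1 + K / N) * expectation (\<lambda>\<omega>. \<bar>S n \<omega>\<bar> powr r) + (2 * K * real N powr (r/2 - 1)) * B"
        using K(1) B by (intro add_left_mono mult_left_mono) auto
      finally show ?thesis by (simp add: d_def)
    qed
    have bound: "expectation (\<lambda>\<omega>. \<bar>S n \<omega>\<bar> powr r) \<le> n * (1 + K / N) ^ n * d" for n
    proof (induction n)
      case 0 thus ?case by (simp add: S_def)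
    next
      case (Suc n)
      have "(1 + K / N) * expectation (\<lambda>\<omega>. \<bar>S n \<omega>\<bar> powr r) + d \<le> (1 + K / N) * (n * (1 + K / N) ^ n * d) + (1 + K / N) ^ Suc n * d"
      proof (rule add_mono)
        show "(1 + K / N) * expectation (\<lambda>\<omega>. \<bar>S n \<omega>\<bar> powr r) \<le> (1 + K / N) * (n * (1 + K / N) ^ n * d)"
          using Suc K(1) by (intro mult_left_mono) auto
        have "(1 + K / N) ^ Suc n \<ge> 1" using K(1) by (intro one_le_power) auto
        thus "d \<le> (1 + K / N) ^ Suc n * d" using d0 mult_right_mono by fastforce
      qed
      also have "\<dots> = Suc n * (1 + K / N) ^ Suc n * d" by (simp add: distrib_right mult.assoc mult.left_commute)
      finally show ?case using step[of n] by linarith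
    qed
    have "(1 + K / N) ^ N \<le> exp (K / N) ^ N"
      using K(1) by (intro power_mono) (auto simp: exp_ge_add_one_self)
    also have "\<dots> = exp K" using N by (simp add: exp_of_nat_mult[symmetric])
    finally have e: "(1 + K / N) ^ N \<le> exp K" .
    have "expectation (\<lambda>\<omega>. \<bar>S N \<omega>\<bar> powr r) \<le> N * (1 + K / N) ^ N * d" by (rule bound)
    also have "\<dots> \<le> N * exp K * d" using e d0 by (intro mult_right_mono mult_left_mono) auto
    also have "\<dots> = exp K * (2 * K) * real N powr (r/2) * B"
      using N by (simp add: d_def powr_diff)
    finally show "integrable M (\<lambda>\<omega>. \<bar>\<Sum>i<N. \<xi> i \<omega>\<bar> powr r) \<and>
         expectation (\<lambda>\<omega>. \<bar>\<Sum>i<N. \<xi> i \<omega>\<bar> powr r) \<le> exp K * (2 * K) * real N powr (r/2) * B"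
      using intS[of N] by (simp add: S_def)
  qed
qed

section \<open>Jensen inequalities and random series\<close>

text \<open>Bernoulli's inequality for a real exponent, from convexity of \<open>exp\<close> at the
  points \<open>0\<close> and \<open>r * ln x\<close> with weights \<open>1 - 1 / r\<close> and
  \<open>1 / r\<close>. It is the supporting line in the Jensen inequalities.\<close>

lemma powr_ge_tangent:
  fixes x r :: real
  assumes "x \<ge> 0" "r \<ge> 1"
  shows "1 + r * (x - 1) \<le> x powr r"
proof (cases "x = 0")
  case True
  thus ?thesis using assms by simp
next
  case False
  hence x: "x > 0" using assms by simp
  have "exp ((1 - 1 / r) *\<^sub>R 0 + (1 / r) *\<^sub>R (r * ln x)) \<le> (1 - 1 / r) * exp 0 + (1 / r) * exp (r * ln x)"
    using assms by (intro convex_onD[OF exp_convex]) auto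
  hence "x \<le> 1 - 1 / r + x powr r / r"
    using x assms by (simp add: powr_def)
  hence "r * x \<le> r * (1 - 1 / r + x powr r / r)"
    using assms by (intro mult_left_mono) auto
  thus ?thesis using assms by (simp add: algebra_simps)
qed

text \<open>Jensen with weights that are not normalised: summing the tangent inequality at the
  weighted mean cancels the linear part, and homogeneity leaves the power \<open>r - 1\<close> of
  the total weight.\<close>

lemma weighted_sum_powr_le:
  fixes w y :: "nat \<Rightarrow> real"
  assumes w: "\<And>i. w i \<ge> 0" and y: "\<And>i. y i \<ge> 0" and r: "r \<ge> 1" and W: "(\<Sum>i<n. w i) \<le> W"
  shows "(\<Sum>i<n. w i * y i) powr r \<le> W powr (r - 1) * (\<Sum>i<n. w i * y i powr r)"
proof (cases "(\<Sum>i<n. w i * y i) = 0")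
  case True
  thus ?thesis using w by (simp add: sum_nonneg)
next
  case False
  define S where "S = (\<Sum>i<n. w i * y i)"
  have S: "S > 0" using False w y by (simp add: S_def sum_nonneg less_le)
  define V where "V = (\<Sum>i<n. w i)"
  have "V \<noteq> 0"
  proof
    assume "V = 0"
    hence "\<forall>i\<in>{..<n}. w i = 0" unfolding V_def using w by (subst (asm) sum_nonneg_eq_0_iff) auto
    thus False using False by simp
  qed
  hence V: "V > 0" using w by (simp add: V_def sum_nonneg less_le)
  define t where "t = S / V"
  have t: "t > 0" using S V by (simp add: t_def)
  have "(\<Sum>i<n. w i * (t powr r * (1 + r * (y i / t - 1)))) \<le> (\<Sum>i<n. w i * y i powr r)"
  proof (intro sum_mono mult_left_mono w)
    fix i
    have "t powr r * (1 + r * (y i / t - 1)) \<le> t powr r * (y i / t) powr r"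
      using t y r by (intro mult_left_mono powr_ge_tangent) auto
    also have "\<dots> = y i powr r" using t y by (simp add: powr_mult[symmetric])
    finally show "t powr r * (1 + r * (y i / t - 1)) \<le> y i powr r" .
  qed
  also have "(\<Sum>i<n. w i * (t powr r * (1 + r * (y i / t - 1)))) = t powr r * V + t powr r * r * (S / t - V)"
  proof -
    have "w i * (t powr r * (1 + r * (y i / t - 1))) = t powr r * w i + t powr r * r * (w i * y i / t - w i)" for i
      by (simp add: algebra_simps)
    thus ?thesis
      by (simp add: V_def S_def sum.distrib sum_distrib_left[symmetric] sum_subtractf sum_divide_distrib)
  qed
  also have "S / t - V = 0" using S V by (simp add: t_def)
  finally have 1: "t powr r * V \<le> (\<Sum>i<n. w i * y i powr r)" by simp
  have "S powr r = (t * V) powr r" using V by (simp add: t_def)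
  also have "\<dots> = V powr (r - 1) * (t powr r * V)" using V t by (simp add: powr_mult powr_diff)
  also have "\<dots> \<le> W powr (r - 1) * (\<Sum>i<n. w i * y i powr r)"
    using 1 V r W t by (intro mult_mono powr_mono2) (auto simp: V_def)
  finally show ?thesis by (simp add: S_def)
qed

text \<open>Jensen on partial sums followed by Fatou gives the moment. Almost sure convergence is a
  separate conclusion, because without it the value of the series would be arbitrary.\<close>

lemma (in prob_space) weighted_series_moment:
  fixes y :: "nat \<Rightarrow> 'a \<Rightarrow> real"
  assumes [measurable]: "\<And>i. y i \<in> borel_measurable M"
    and y: "\<And>i \<omega>. y i \<omega> \<ge> 0" and w: "\<And>i. w i \<ge> 0" "summable w" and r: "r \<ge> 1" and B: "B \<ge> 0"
    and bound: "\<And>i. (\<integral>\<^sup>+\<omega>. ennreal (y i \<omega> powr r) \<partial>M) \<le> ennreal B"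
  shows "AE \<omega> in M. summable (\<lambda>i. w i * y i \<omega>)"
    and "(\<integral>\<^sup>+\<omega>. ennreal ((\<Sum>i. w i * y i \<omega>) powr r) \<partial>M) \<le> ennreal (suminf w powr r * B)"
proof -
  \<comment> \<open>First moments bounded uniformly in \<open>i\<close> make the expected series
    finite, hence the series convergent almost surely.\<close>
  have y1: "(\<integral>\<^sup>+\<omega>. ennreal (y i \<omega>) \<partial>M) \<le> ennreal (1 + B)" for i
  proof -
    have "(\<integral>\<^sup>+\<omega>. ennreal (y i \<omega>) \<partial>M) \<le> (\<integral>\<^sup>+\<omega>. 1 + ennreal (y i \<omega> powr r) \<partial>M)"
    proof (intro nn_integral_mono)
      fix \<omega>
      have "y i \<omega> \<le> 1 + y i \<omega> powr r"
        using powr_le_one_plus[of "y i \<omega>" 1 r] y r by simp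
      thus "ennreal (y i \<omega>) \<le> 1 + ennreal (y i \<omega> powr r)"
        by (metis ennreal_leI ennreal_1 ennreal_plus powr_ge_zero zero_le_one)
    qed
    also have "\<dots> = 1 + (\<integral>\<^sup>+\<omega>. ennreal (y i \<omega> powr r) \<partial>M)"
      by (subst nn_integral_add) (auto simp: emeasure_space_1)
    also have "\<dots> \<le> 1 + ennreal B" using bound by (intro add_left_mono)
    finally show ?thesis using B by simp
  qed
  have "(\<integral>\<^sup>+\<omega>. (\<Sum>i. ennreal (w i * y i \<omega>)) \<partial>M) = (\<Sum>i. \<integral>\<^sup>+\<omega>. ennreal (w i * y i \<omega>) \<partial>M)"
    by (intro nn_integral_suminf) auto
  also have "\<dots> = (\<Sum>i. ennreal (w i) * \<integral>\<^sup>+\<omega>. ennreal (y i \<omega>) \<partial>M)"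
    using w y by (simp add: ennreal_mult nn_integral_cmult)
  also have "\<dots> \<le> (\<Sum>i. ennreal (w i) * ennreal (1 + B))"
    using y1 by (intro suminf_le mult_left_mono) auto
  also have "\<dots> = ennreal (suminf w) * ennreal (1 + B)"
    using w by (simp add: ennreal_suminf_multc suminf_ennreal2)
  also have "\<dots> < \<infinity>" by (simp add: ennreal_mult_less_top)
  finally have "AE \<omega> in M. (\<Sum>i. ennreal (w i * y i \<omega>)) \<noteq> \<infinity>"
    by (intro nn_integral_noteq_infinite) auto
  thus sm: "AE \<omega> in M. summable (\<lambda>i. w i * y i \<omega>)"
    by eventually_elim (use w y in \<open>auto intro!: summable_suminf_not_top\<close>)
  have W: "(\<Sum>i<n. w i) \<le> suminf w" for n using w by (intro sum_le_suminf) auto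
  have W0: "suminf w \<ge> 0" using w by (intro suminf_nonneg) auto
  have fin: "(\<integral>\<^sup>+\<omega>. ennreal ((\<Sum>i<n. w i * y i \<omega>) powr r) \<partial>M) \<le> ennreal (suminf w powr r * B)" for n
  proof -
    have "(\<integral>\<^sup>+\<omega>. ennreal ((\<Sum>i<n. w i * y i \<omega>) powr r) \<partial>M)
       \<le> (\<integral>\<^sup>+\<omega>. ennreal (suminf w powr (r - 1) * (\<Sum>i<n. w i * y i \<omega> powr r)) \<partial>M)"
      using w y r W by (intro nn_integral_mono ennreal_leI weighted_sum_powr_le) auto
    also have "\<dots> = (\<integral>\<^sup>+\<omega>. ennreal (suminf w powr (r - 1)) * (\<Sum>i<n. ennreal (w i) * ennreal (y i \<omega> powr r)) \<partial>M)"
      using w by (simp add: ennreal_mult sum_nonneg flip: sum_ennreal)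
    also have "\<dots> = ennreal (suminf w powr (r - 1)) * (\<Sum>i<n. ennreal (w i) * \<integral>\<^sup>+\<omega>. ennreal (y i \<omega> powr r) \<partial>M)"
      by (simp add: nn_integral_cmult nn_integral_sum)
    also have "\<dots> \<le> ennreal (suminf w powr (r - 1)) * (\<Sum>i<n. ennreal (w i) * ennreal B)"
      using bound by (intro mult_left_mono sum_mono) auto
    also have "\<dots> = ennreal (suminf w powr (r - 1) * ((\<Sum>i<n. w i) * B))"
      using w B by (simp add: ennreal_mult[symmetric] sum_nonneg sum_distrib_right)
    also have "\<dots> \<le> ennreal (suminf w powr (r - 1) * (suminf w * B))"
      using W B by (intro ennreal_leI mult_left_mono mult_right_mono) auto
    also have "suminf w powr (r - 1) * (suminf w * B) = suminf w powr r * B"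
      using W0 by (cases "suminf w = 0") (auto simp: powr_diff)
    finally show ?thesis .
  qed
  have "(\<integral>\<^sup>+\<omega>. ennreal ((\<Sum>i. w i * y i \<omega>) powr r) \<partial>M)
      = (\<integral>\<^sup>+\<omega>. liminf (\<lambda>n. ennreal ((\<Sum>i<n. w i * y i \<omega>) powr r)) \<partial>M)"
  proof (rule nn_integral_cong_AE, use sm in eventually_elim)
    case (elim \<omega>)
    have "(\<lambda>n. (\<Sum>i<n. w i * y i \<omega>) powr r) \<longlonglongrightarrow> (\<Sum>i. w i * y i \<omega>) powr r"
      using elim r w y by (intro tendsto_powr2 summable_LIMSEQ tendsto_const) (auto intro!: always_eventually sum_nonneg)
    hence "(\<lambda>n. ennreal ((\<Sum>i<n. w i * y i \<omega>) powr r)) \<longlonglongrightarrow> ennreal ((\<Sum>i. w i * y i \<omega>) powr r)"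
      by (intro tendsto_ennrealI)
    thus ?case using lim_imp_Liminf[OF trivial_limit_sequentially] by metis
  qed
  also have "\<dots> \<le> liminf (\<lambda>n. \<integral>\<^sup>+\<omega>. ennreal ((\<Sum>i<n. w i * y i \<omega>) powr r) \<partial>M)"
    by (intro nn_integral_liminf) auto
  also have "\<dots> \<le> ennreal (suminf w powr r * B)"
    using fin by (intro Liminf_le) auto
  finally show "(\<integral>\<^sup>+\<omega>. ennreal ((\<Sum>i. w i * y i \<omega>) powr r) \<partial>M) \<le> ennreal (suminf w powr r * B)" .
qed

section \<open>The rate N^(-1/2) in L^r\<close>

text \<open>\<open>C\<close> is the \<open>r\<close>-th power of the usual constant. It stays
  explicit because series over lags need one constant for all lags.\<close>

definition root_n_bounded :: "'w measure \<Rightarrow> real \<Rightarrow> real \<Rightarrow> (nat \<Rightarrow> 'w \<Rightarrow> real) \<Rightarrow> bool" where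
  "root_n_bounded M r C X \<longleftrightarrow> C \<ge> 0 \<and> (\<forall>N\<ge>1. X N \<in> borel_measurable M \<and>
     (\<integral>\<^sup>+\<omega>. ennreal (\<bar>X N \<omega>\<bar> powr r) \<partial>M) \<le> ennreal (C * real N powr (- r / 2)))"

lemma root_n_bounded_mono:
  assumes "root_n_bounded M r C X" "C \<le> D"
  shows "root_n_bounded M r D X"
proof -
  have "ennreal (C * real N powr (- r / 2)) \<le> ennreal (D * real N powr (- r / 2))" for N
    using assms(2) by (intro ennreal_leI mult_right_mono) auto
  thus ?thesis using assms order_trans unfolding root_n_bounded_def by fastforce
qed

lemma root_n_bounded_cong:
  assumes "root_n_bounded M r C X" "\<And>N \<omega>. N \<ge> 1 \<Longrightarrow> Y N \<omega> = X N \<omega>"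
  shows "root_n_bounded M r C Y"
proof -
  have "Y N = X N" if "N \<ge> 1" for N using assms(2)[OF that] by (simp add: fun_eq_iff)
  thus ?thesis using assms(1) by (simp add: root_n_bounded_def)
qed

lemma root_n_bounded_abs:
  "root_n_bounded M r C X \<Longrightarrow> root_n_bounded M r C (\<lambda>N \<omega>. \<bar>X N \<omega>\<bar>)"
  by (auto simp: root_n_bounded_def)

lemma root_n_bounded_add:
  assumes X: "root_n_bounded M r C X" and Y: "root_n_bounded M r D Y" and r: "r \<ge> 0"
  shows "root_n_bounded M r (2 powr r * (C + D)) (\<lambda>N \<omega>. X N \<omega> + Y N \<omega>)"
  unfolding root_n_bounded_def
proof (intro conjI allI impI)
  show "0 \<le> 2 powr r * (C + D)" using X Y by (simp add: root_n_bounded_def)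
  fix N :: nat assume N: "N \<ge> 1"
  have [measurable]: "X N \<in> borel_measurable M" "Y N \<in> borel_measurable M"
    using X Y N by (auto simp: root_n_bounded_def)
  have CD: "C \<ge> 0" "D \<ge> 0" using X Y by (auto simp: root_n_bounded_def)
  show "(\<lambda>\<omega>. X N \<omega> + Y N \<omega>) \<in> borel_measurable M" by measurable
  have "(\<integral>\<^sup>+\<omega>. ennreal (\<bar>X N \<omega> + Y N \<omega>\<bar> powr r) \<partial>M)
      \<le> (\<integral>\<^sup>+\<omega>. ennreal (2 powr r) * (ennreal (\<bar>X N \<omega>\<bar> powr r) + ennreal (\<bar>Y N \<omega>\<bar> powr r)) \<partial>M)"
  proof (rule nn_integral_mono)
    fix \<omega>
    have "\<bar>X N \<omega> + Y N \<omega>\<bar> powr r \<le> (\<bar>X N \<omega>\<bar> + \<bar>Y N \<omega>\<bar>) powr r"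
      using r by (intro powr_mono2) auto
    also have "\<dots> \<le> 2 powr r * (\<bar>X N \<omega>\<bar> powr r + \<bar>Y N \<omega>\<bar> powr r)"
      using r by (intro powr_add_le) auto
    finally show "ennreal (\<bar>X N \<omega> + Y N \<omega>\<bar> powr r)
      \<le> ennreal (2 powr r) * (ennreal (\<bar>X N \<omega>\<bar> powr r) + ennreal (\<bar>Y N \<omega>\<bar> powr r))"
      by (simp add: ennreal_mult'[symmetric] ennreal_leI flip: ennreal_plus)
  qed
  also have "\<dots> = ennreal (2 powr r) * ((\<integral>\<^sup>+\<omega>. ennreal (\<bar>X N \<omega>\<bar> powr r) \<partial>M) + (\<integral>\<^sup>+\<omega>. ennreal (\<bar>Y N \<omega>\<bar> powr r) \<partial>M))"
    by (simp add: nn_integral_cmult nn_integral_add)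
  also have "\<dots> \<le> ennreal (2 powr r) * (ennreal (C * real N powr (- r / 2)) + ennreal (D * real N powr (- r / 2)))"
    using X Y N by (intro mult_left_mono add_mono) (auto simp: root_n_bounded_def)
  also have "\<dots> = ennreal (2 powr r * (C + D) * real N powr (- r / 2))"
    using CD by (simp add: ennreal_mult'[symmetric] distrib_left distrib_right mult.assoc flip: ennreal_plus)
  finally show "(\<integral>\<^sup>+\<omega>. ennreal (\<bar>X N \<omega> + Y N \<omega>\<bar> powr r) \<partial>M)
     \<le> ennreal (2 powr r * (C + D) * real N powr (- r / 2))" .
qed

lemma root_n_bounded_sum:
  assumes "finite I" "\<And>i. i \<in> I \<Longrightarrow> \<exists>C. root_n_bounded M r C (X i)" "r \<ge> 0"
  shows "\<exists>C. root_n_bounded M r C (\<lambda>N \<omega>. \<Sum>i\<in>I. X i N \<omega>)"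
  using assms(1,2)
proof (induction I rule: finite_induct)
  case empty
  have "root_n_bounded M r 0 (\<lambda>N \<omega>. 0)" by (simp add: root_n_bounded_def)
  thus ?case by auto
next
  case (insert i I)
  then obtain C D where "root_n_bounded M r C (X i)" "root_n_bounded M r D (\<lambda>N \<omega>. \<Sum>i\<in>I. X i N \<omega>)"
    by blast
  from root_n_bounded_add[OF this assms(3)] show ?case
    using insert.hyps by auto
qed

text \<open>Summation over lags with fixed weights keeps the rate. This is what replaces a supremum
  over the parameter: the weights dominate the impulse responses of all parameters at once.\<close>

lemma (in prob_space) root_n_bounded_series:
  assumes X: "\<And>i. root_n_bounded M r C (X i)" and w: "\<And>i. w i \<ge> 0" "summable w" and r: "r \<ge> 1"
  shows "root_n_bounded M r (suminf w powr r * C) (\<lambda>N \<omega>. \<Sum>i. w i * \<bar>X i N \<omega>\<bar>)"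
    and "N \<ge> 1 \<Longrightarrow> AE \<omega> in M. summable (\<lambda>i. w i * \<bar>X i N \<omega>\<bar>)"
proof -
  have C: "C \<ge> 0" using X[of 0] by (simp add: root_n_bounded_def)
  have m: "(\<lambda>\<omega>. \<bar>X i N \<omega>\<bar>) \<in> borel_measurable M" if "N \<ge> 1" for i N
    using X[of i] that unfolding root_n_bounded_def by (intro borel_measurable_abs) auto
  have b: "(\<integral>\<^sup>+\<omega>. ennreal (\<bar>X i N \<omega>\<bar> powr r) \<partial>M) \<le> ennreal (C * real N powr (- r / 2))" if "N \<ge> 1" for i N
    using X[of i] that unfolding root_n_bounded_def by simp
  have C': "0 \<le> C * real N powr (- r / 2)" for N using C by simp
  note * = weighted_series_moment[where y = "\<lambda>i. \<lambda>\<omega>. \<bar>X i N \<omega>\<bar>" and r = r and B = "C * real N powr (- r / 2)" for N,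
      OF m abs_ge_zero w(1) w(2) r C' b]
  show "N \<ge> 1 \<Longrightarrow> AE \<omega> in M. summable (\<lambda>i. w i * \<bar>X i N \<omega>\<bar>)" using *(1) by simp
  have nn: "\<bar>\<Sum>i. w i * \<bar>X i N \<omega>\<bar>\<bar> powr r = (\<Sum>i. w i * \<bar>X i N \<omega>\<bar>) powr r"
    if "summable (\<lambda>i. w i * \<bar>X i N \<omega>\<bar>)" for N \<omega>
    using suminf_nonneg[OF that] w by simp
  show "root_n_bounded M r (suminf w powr r * C) (\<lambda>N \<omega>. \<Sum>i. w i * \<bar>X i N \<omega>\<bar>)"
    unfolding root_n_bounded_def
  proof (intro conjI allI impI)
    fix N :: nat assume N: "N \<ge> 1"
    note [measurable] = m[OF N]
    show "(\<lambda>\<omega>. \<Sum>i. w i * \<bar>X i N \<omega>\<bar>) \<in> borel_measurable M" by measurable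
    have "(\<integral>\<^sup>+\<omega>. ennreal (\<bar>\<Sum>i. w i * \<bar>X i N \<omega>\<bar>\<bar> powr r) \<partial>M) = (\<integral>\<^sup>+\<omega>. ennreal ((\<Sum>i. w i * \<bar>X i N \<omega>\<bar>) powr r) \<partial>M)"
      by (rule nn_integral_cong_AE, use *(1)[OF N N] in eventually_elim) (simp add: nn)
    thus "(\<integral>\<^sup>+\<omega>. ennreal (\<bar>\<Sum>i. w i * \<bar>X i N \<omega>\<bar>\<bar> powr r) \<partial>M) \<le> ennreal (suminf w powr r * C * real N powr (- r / 2))"
      using *(2)[OF N N] by (simp add: mult.assoc)
  qed (use C in simp)
qed

subsection \<open>Averages of i.i.d. noise\<close>

text \<open>Averages of products of two noise values are controlled in \<open>L^r\<close>, whence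
  the moment of order \<open>2 * r\<close>.\<close>

locale iid_noise = prob_space M for M :: "'w measure" +
  fixes Z :: "int \<Rightarrow> 'w \<Rightarrow> real" and r :: real
  assumes indep: "indep_vars (\<lambda>_. borel) Z UNIV"
    and same_law: "\<And>n. distr M borel (Z n) = distr M borel (Z 0)"
    and r2: "r \<ge> 2"
    and moment: "integrable M (\<lambda>\<omega>. \<bar>Z 0 \<omega>\<bar> powr (2 * r))"
    and mean0: "expectation (Z 0) = 0"
begin

lemma Z_measurable [measurable]: "Z n \<in> borel_measurable M"
  using indep by (auto simp: indep_vars_def)

lemma integrable_Z_iff:
  fixes f :: "real \<Rightarrow> real"
  assumes [measurable]: "f \<in> borel_measurable borel"
  shows "integrable M (\<lambda>\<omega>. f (Z n \<omega>)) \<longleftrightarrow> integrable M (\<lambda>\<omega>. f (Z 0 \<omega>))"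
  using integrable_distr_eq[of "Z n" M borel f] integrable_distr_eq[of "Z 0" M borel f]
  by (simp add: same_law[of n])

lemma expectation_Z:
  fixes f :: "real \<Rightarrow> 'c::{banach,second_countable_topology}"
  assumes [measurable]: "f \<in> borel_measurable borel"
  shows "expectation (\<lambda>\<omega>. f (Z n \<omega>)) = expectation (\<lambda>\<omega>. f (Z 0 \<omega>))"
  using integral_distr[of "Z n" M borel f] integral_distr[of "Z 0" M borel f]
  by (simp add: same_law[of n])

lemma moment_Z: "0 \<le> p \<Longrightarrow> p \<le> 2 * r \<Longrightarrow> integrable M (\<lambda>\<omega>. \<bar>Z n \<omega>\<bar> powr p)"
  using moment_integrable_mono[OF Z_measurable, where q = "2 * r"] integrable_Z_iff[of "\<lambda>x. \<bar>x\<bar> powr (2 * r)" n] moment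
  by simp

lemma integrable_Z: "integrable M (Z n)"
  using moment_Z[of 1 n] r2 by (simp add: integrable_abs_iff)

lemma mean_Z: "expectation (Z n) = 0"
  using expectation_Z[of "\<lambda>x. x" n] mean0 by simp

lemma integrable_Z_mult: "integrable M (\<lambda>\<omega>. Z m \<omega> * Z n \<omega>)"
proof (rule Bochner_Integration.integrable_bound)
  show "integrable M (\<lambda>\<omega>. \<bar>Z m \<omega>\<bar> powr 1 * \<bar>Z n \<omega>\<bar> powr 1)"
    using moment_Z[of 2] r2 by (intro moment_mult_integrable) auto
qed (auto simp: abs_mult)

text \<open>\<open>A\<close> may be infinite: the averages below take for it the whole past before
  time \<open>k\<close>, so that one choice serves partial sums of any length.\<close>

lemma indep_factor:
  assumes F: "F \<in> borel_measurable (PiM A (\<lambda>_. borel))" and f: "f \<in> borel_measurable borel" and k: "k \<notin> A"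
    and int: "integrable M (\<lambda>\<omega>. F (restrict (\<lambda>i. Z i \<omega>) A) :: real)" "integrable M (\<lambda>\<omega>. f (Z k \<omega>) :: real)"
  shows "expectation (\<lambda>\<omega>. F (restrict (\<lambda>i. Z i \<omega>) A) * f (Z k \<omega>)) =
         expectation (\<lambda>\<omega>. F (restrict (\<lambda>i. Z i \<omega>) A)) * expectation (\<lambda>\<omega>. f (Z k \<omega>))"
proof -
  have "indep_var (PiM A (\<lambda>_. borel)) (\<lambda>\<omega>. restrict (\<lambda>i. Z i \<omega>) A) (PiM {k} (\<lambda>_. borel)) (\<lambda>\<omega>. restrict (\<lambda>i. Z i \<omega>) {k})"
    by (rule indep_var_restrict[OF indep]) (use k in auto)
  hence "indep_var borel (F \<circ> (\<lambda>\<omega>. restrict (\<lambda>i. Z i \<omega>) A)) borel ((\<lambda>x. f (x k)) \<circ> (\<lambda>\<omega>. restrict (\<lambda>i. Z i \<omega>) {k}))"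
    by (rule indep_var_compose) (use F f in measurable)
  hence "indep_var borel (\<lambda>\<omega>. F (restrict (\<lambda>i. Z i \<omega>) A)) borel (\<lambda>\<omega>. f (Z k \<omega>))"
    by (simp add: comp_def)
  thus ?thesis using int by (rule indep_var_lebesgue_integral)
qed

lemma uncorrelated:
  assumes "m \<noteq> n"
  shows "expectation (\<lambda>\<omega>. Z m \<omega> * Z n \<omega>) = 0"
proof -
  have F: "(\<lambda>x. x m) \<in> borel_measurable (PiM {m} (\<lambda>_. borel))"
    by (rule measurable_component_singleton) simp
  have "expectation (\<lambda>\<omega>. restrict (\<lambda>i. Z i \<omega>) {m} m * Z n \<omega>) =
      expectation (\<lambda>\<omega>. restrict (\<lambda>i. Z i \<omega>) {m} m) * expectation (\<lambda>\<omega>. Z n \<omega>)"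
    by (rule indep_factor[OF F, where f = "\<lambda>x. x" and k = n]) (use assms integrable_Z in auto)
  thus ?thesis by (simp add: mean_Z)
qed

lemma average_of_orthogonal:
  obtains C where "C > 0" "\<And>\<xi> B.
     \<lbrakk>\<And>n. \<xi> n \<in> borel_measurable M; \<And>n. integrable M (\<lambda>\<omega>. \<bar>\<xi> n \<omega>\<bar> powr r);
      \<And>n. expectation (\<lambda>\<omega>. \<bar>\<xi> n \<omega>\<bar> powr r) \<le> B;
      \<And>n. expectation (\<lambda>\<omega>. sgn (\<Sum>i<n. \<xi> i \<omega>) * \<bar>\<Sum>i<n. \<xi> i \<omega>\<bar> powr (r - 1) * \<xi> n \<omega>) = 0\<rbrakk>
     \<Longrightarrow> root_n_bounded M r (C * B) (\<lambda>N \<omega>. (1 / real N) * (\<Sum>i<N. \<xi> i \<omega>))"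
proof -
  obtain C where C: "C > 0" "\<And>(\<xi> :: nat \<Rightarrow> 'w \<Rightarrow> real) B N.
     \<lbrakk>\<And>n. \<xi> n \<in> borel_measurable M; \<And>n. integrable M (\<lambda>\<omega>. \<bar>\<xi> n \<omega>\<bar> powr r);
      \<And>n. expectation (\<lambda>\<omega>. \<bar>\<xi> n \<omega>\<bar> powr r) \<le> B;
      \<And>n. expectation (\<lambda>\<omega>. sgn (\<Sum>i<n. \<xi> i \<omega>) * \<bar>\<Sum>i<n. \<xi> i \<omega>\<bar> powr (r - 1) * \<xi> n \<omega>) = 0; N \<ge> 1\<rbrakk>
     \<Longrightarrow> integrable M (\<lambda>\<omega>. \<bar>\<Sum>i<N. \<xi> i \<omega>\<bar> powr r) \<and>
         expectation (\<lambda>\<omega>. \<bar>\<Sum>i<N. \<xi> i \<omega>\<bar> powr r) \<le> C * real N powr (r/2) * B"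
    using orthogonal_sum_moment[OF r2] by blast
  show thesis
  proof (rule that[OF C(1)])
    fix \<xi> :: "nat \<Rightarrow> 'w \<Rightarrow> real" and B
    assume A: "\<And>n. \<xi> n \<in> borel_measurable M" "\<And>n. integrable M (\<lambda>\<omega>. \<bar>\<xi> n \<omega>\<bar> powr r)"
      "\<And>n. expectation (\<lambda>\<omega>. \<bar>\<xi> n \<omega>\<bar> powr r) \<le> B"
      "\<And>n. expectation (\<lambda>\<omega>. sgn (\<Sum>i<n. \<xi> i \<omega>) * \<bar>\<Sum>i<n. \<xi> i \<omega>\<bar> powr (r - 1) * \<xi> n \<omega>) = 0"
    note [measurable] = A(1)
    have B: "B \<ge> 0" using A(3)[of 0] by (rule order_trans[rotated]) simp
    show "root_n_bounded M r (C * B) (\<lambda>N \<omega>. (1 / real N) * (\<Sum>i<N. \<xi> i \<omega>))"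
      unfolding root_n_bounded_def
    proof (intro conjI allI impI)
      fix N :: nat assume N: "N \<ge> 1"
      note S = C(2)[OF A N]
      have "(\<integral>\<^sup>+\<omega>. ennreal (\<bar>(1 / real N) * (\<Sum>i<N. \<xi> i \<omega>)\<bar> powr r) \<partial>M)
         = (\<integral>\<^sup>+\<omega>. ennreal (real N powr (- r)) * ennreal (\<bar>\<Sum>i<N. \<xi> i \<omega>\<bar> powr r) \<partial>M)"
        using N by (intro nn_integral_cong)
          (simp add: abs_mult powr_divide powr_minus_divide ennreal_mult'[symmetric])
      also have "\<dots> = ennreal (real N powr (- r)) * ennreal (expectation (\<lambda>\<omega>. \<bar>\<Sum>i<N. \<xi> i \<omega>\<bar> powr r))"
        using S by (simp add: nn_integral_cmult nn_integral_eq_integral)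
      also have "\<dots> = ennreal (real N powr (- r) * expectation (\<lambda>\<omega>. \<bar>\<Sum>i<N. \<xi> i \<omega>\<bar> powr r))"
        by (simp add: ennreal_mult')
      also have "\<dots> \<le> ennreal (real N powr (- r) * (C * real N powr (r/2) * B))"
        using S by (intro ennreal_leI mult_left_mono) auto
      also have "real N powr (- r) * (C * real N powr (r/2) * B) = C * B * (real N powr (- r) * real N powr (r/2))"
        by simp
      also have "real N powr (- r) * real N powr (r/2) = real N powr (- r / 2)"
        by (simp add: powr_add[symmetric])
      finally show "(\<integral>\<^sup>+\<omega>. ennreal (\<bar>(1 / real N) * (\<Sum>i<N. \<xi> i \<omega>)\<bar> powr r) \<partial>M)
          \<le> ennreal (C * B * real N powr (- r / 2))" .
    qed (use C(1) B in auto)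
  qed
qed

lemma sum_moment_integrable:
  fixes X :: "nat \<Rightarrow> 'w \<Rightarrow> real" and n :: nat
  assumes [measurable]: "\<And>i. X i \<in> borel_measurable M"
    and "\<And>i. integrable M (\<lambda>\<omega>. \<bar>X i \<omega>\<bar> powr p)" "p \<ge> 0"
  shows "integrable M (\<lambda>\<omega>. \<bar>\<Sum>i<n. X i \<omega>\<bar> powr p)"
proof (induction n)
  case (Suc n)
  have "integrable M (\<lambda>\<omega>. \<bar>(\<Sum>i<n. X i \<omega>) + X n \<omega>\<bar> powr p)"
    using Suc assms(2,3) by (intro moment_add_integrable) auto
  thus ?case by simp
qed simp

lemma sgn_powr_measurable [measurable]: "(\<lambda>x::real. sgn x * \<bar>x\<bar> powr p) \<in> borel_measurable borel"
  by measurable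

lemma sgn_powr_integrable:
  assumes [measurable]: "S \<in> borel_measurable M" "Y \<in> borel_measurable M"
    and "integrable M (\<lambda>\<omega>. \<bar>S \<omega>\<bar> powr r)" "integrable M (\<lambda>\<omega>. \<bar>Y \<omega>\<bar> powr r)"
  shows "integrable M (\<lambda>\<omega>. sgn (S \<omega>) * \<bar>S \<omega>\<bar> powr (r - 1) * Y \<omega> :: real)"
proof (rule Bochner_Integration.integrable_bound)
  show "integrable M (\<lambda>\<omega>. \<bar>S \<omega>\<bar> powr (r - 1) * \<bar>Y \<omega>\<bar> powr 1)"
    using assms r2 by (intro moment_mult_integrable) auto
qed (auto simp: abs_mult abs_sgn_eq)

lemma average_function:
  assumes f [measurable]: "f \<in> borel_measurable borel"
    and int: "integrable M (\<lambda>\<omega>. \<bar>f (Z 0 \<omega>)\<bar> powr r)" and mean: "expectation (\<lambda>\<omega>. f (Z 0 \<omega>)) = 0"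
  shows "\<exists>C. \<forall>j. root_n_bounded M r C (\<lambda>N \<omega>. (1 / real N) * (\<Sum>n=1..N. f (Z (int n - j) \<omega>)))"
proof -
  obtain C where C: "C > 0" "\<And>\<xi> B.
     \<lbrakk>\<And>n. \<xi> n \<in> borel_measurable M; \<And>n. integrable M (\<lambda>\<omega>. \<bar>\<xi> n \<omega>\<bar> powr r);
      \<And>n. expectation (\<lambda>\<omega>. \<bar>\<xi> n \<omega>\<bar> powr r) \<le> B;
      \<And>n. expectation (\<lambda>\<omega>. sgn (\<Sum>i<n. \<xi> i \<omega>) * \<bar>\<Sum>i<n. \<xi> i \<omega>\<bar> powr (r - 1) * \<xi> n \<omega>) = 0\<rbrakk>
     \<Longrightarrow> root_n_bounded M r (C * B) (\<lambda>N \<omega>. (1 / real N) * (\<Sum>i<N. \<xi> i \<omega>))"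
    by (rule average_of_orthogonal) blast
  \<comment> \<open>Since all noise values have the same law, this bound does not involve the shift
    \<open>j\<close>, so one constant serves all shifts.\<close>
  define B where "B = expectation (\<lambda>\<omega>. \<bar>f (Z 0 \<omega>)\<bar> powr r)"
  show ?thesis
  proof (intro exI allI)
    fix j
    define \<xi> where "\<xi> n \<omega> = f (Z (int (Suc n) - j) \<omega>)" for n \<omega>
    have [measurable]: "\<xi> n \<in> borel_measurable M" for n unfolding \<xi>_def by measurable
    have int': "integrable M (\<lambda>\<omega>. \<bar>\<xi> n \<omega>\<bar> powr r)" for n
      unfolding \<xi>_def using integrable_Z_iff[of "\<lambda>x. \<bar>f x\<bar> powr r"] int by simp
    have "root_n_bounded M r (C * B) (\<lambda>N \<omega>. (1 / real N) * (\<Sum>i<N. \<xi> i \<omega>))"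
    proof (rule C(2))
      show "expectation (\<lambda>\<omega>. \<bar>\<xi> n \<omega>\<bar> powr r) \<le> B" for n
        unfolding \<xi>_def B_def using expectation_Z[of "\<lambda>x. \<bar>f x\<bar> powr r" "int (Suc n) - j"] by simp
      fix n
      define A where "A = {..<int (Suc n) - j}"
      define F where "F x = sgn (\<Sum>i<n. f (x (int (Suc i) - j))) * \<bar>\<Sum>i<n. f (x (int (Suc i) - j))\<bar> powr (r - 1)" for x :: "int \<Rightarrow> real"
      have mf[measurable]: "F \<in> borel_measurable (PiM A (\<lambda>_. borel))"
      proof -
        have "(\<lambda>x. f (x (int (Suc i) - j))) \<in> borel_measurable (PiM A (\<lambda>_. borel))" if "i < n" for i
          by (rule measurable_compose[OF _ f], rule measurable_component_singleton) (use that in \<open>auto simp: A_def\<close>)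
        hence "(\<lambda>x. \<Sum>i<n. f (x (int (Suc i) - j))) \<in> borel_measurable (PiM A (\<lambda>_. borel))"
          by (intro borel_measurable_sum) auto
        from measurable_compose[OF this sgn_powr_measurable] show ?thesis unfolding F_def .
      qed
      have eq: "F (restrict (\<lambda>i. Z i \<omega>) A) = sgn (\<Sum>i<n. \<xi> i \<omega>) * \<bar>\<Sum>i<n. \<xi> i \<omega>\<bar> powr (r - 1)" for \<omega>
        by (simp add: F_def A_def \<xi>_def)
      have "integrable M (\<lambda>\<omega>. sgn (\<Sum>i<n. \<xi> i \<omega>) * \<bar>\<Sum>i<n. \<xi> i \<omega>\<bar> powr (r - 1) * 1)"
        using int' r2 by (intro sgn_powr_integrable sum_moment_integrable) auto
      moreover have "integrable M (\<lambda>\<omega>. f (Z (int (Suc n) - j) \<omega>))"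
        using moment_integrable_mono[OF _ int'[of n], of 1] r2 by (simp add: \<xi>_def integrable_abs_iff)
      moreover have "expectation (\<lambda>\<omega>. f (Z (int (Suc n) - j) \<omega>)) = 0"
        using expectation_Z[of f "int (Suc n) - j"] mean by simp
      ultimately show "expectation (\<lambda>\<omega>. sgn (\<Sum>i<n. \<xi> i \<omega>) * \<bar>\<Sum>i<n. \<xi> i \<omega>\<bar> powr (r - 1) * \<xi> n \<omega>) = 0"
        using indep_factor[OF mf f, of "int (Suc n) - j"] unfolding eq
        by (simp add: \<xi>_def[of n] A_def)
    qed (use int' in auto)
    thus "root_n_bounded M r (C * B) (\<lambda>N \<omega>. (1 / real N) * (\<Sum>n=1..N. f (Z (int n - j) \<omega>)))"
      by (simp add: \<xi>_def lessThan_atLeast0 sum.atLeast1_atMost_eq)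
  qed
qed

text \<open>The products are dependent, but for \<open>j < k\<close> the factor at lag
  \<open>j\<close> is later than every other noise value in the current product and in all earlier
  ones. It is therefore independent of the rest and centred, which is the orthogonality
  needed.\<close>

lemma average_product:
  "\<exists>C. \<forall>j k. j < k \<longrightarrow> root_n_bounded M r C (\<lambda>N \<omega>. (1 / real N) * (\<Sum>n=1..N. Z (int n - j) \<omega> * Z (int n - k) \<omega>))"
proof -
  obtain C where C: "C > 0" "\<And>\<xi> B.
     \<lbrakk>\<And>n. \<xi> n \<in> borel_measurable M; \<And>n. integrable M (\<lambda>\<omega>. \<bar>\<xi> n \<omega>\<bar> powr r);
      \<And>n. expectation (\<lambda>\<omega>. \<bar>\<xi> n \<omega>\<bar> powr r) \<le> B;
      \<And>n. expectation (\<lambda>\<omega>. sgn (\<Sum>i<n. \<xi> i \<omega>) * \<bar>\<Sum>i<n. \<xi> i \<omega>\<bar> powr (r - 1) * \<xi> n \<omega>) = 0\<rbrakk>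
     \<Longrightarrow> root_n_bounded M r (C * B) (\<lambda>N \<omega>. (1 / real N) * (\<Sum>i<N. \<xi> i \<omega>))"
    by (rule average_of_orthogonal) blast
  \<comment> \<open>A product of two \<open>r\<close>-th powers is at most the sum of the two powers
    of order \<open>2 * r\<close>; hence the factor 2.\<close>
  define B where "B = 2 * expectation (\<lambda>\<omega>. \<bar>Z 0 \<omega>\<bar> powr (2 * r))"
  show ?thesis
  proof (intro exI allI impI)
    fix j k :: int assume jk: "j < k"
    define \<xi> where "\<xi> n \<omega> = Z (int (Suc n) - j) \<omega> * Z (int (Suc n) - k) \<omega>" for n \<omega>
    have [measurable]: "\<xi> n \<in> borel_measurable M" for n unfolding \<xi>_def by measurable
    have absxi: "\<bar>\<xi> n \<omega>\<bar> powr r = \<bar>Z (int (Suc n) - j) \<omega>\<bar> powr r * \<bar>Z (int (Suc n) - k) \<omega>\<bar> powr r" for n \<omega>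
      by (simp add: \<xi>_def abs_mult powr_mult)
    have mom: "integrable M (\<lambda>\<omega>. \<bar>Z m \<omega>\<bar> powr (2 * r))" for m
      using moment_Z[of "2 * r"] r2 by simp
    have int': "integrable M (\<lambda>\<omega>. \<bar>\<xi> n \<omega>\<bar> powr r)" for n
      unfolding absxi using moment_Z[of "2 * r"] r2 by (intro moment_mult_integrable) (auto simp: mult_2[symmetric])
    have "root_n_bounded M r (C * B) (\<lambda>N \<omega>. (1 / real N) * (\<Sum>i<N. \<xi> i \<omega>))"
    proof (rule C(2))
      show "expectation (\<lambda>\<omega>. \<bar>\<xi> n \<omega>\<bar> powr r) \<le> B" for n
      proof -
        have "expectation (\<lambda>\<omega>. \<bar>\<xi> n \<omega>\<bar> powr r) \<le>
            expectation (\<lambda>\<omega>. \<bar>Z (int (Suc n) - j) \<omega>\<bar> powr (2 * r) + \<bar>Z (int (Suc n) - k) \<omega>\<bar> powr (2 * r))"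
        proof (rule integral_mono[OF int'])
          show "\<bar>\<xi> n \<omega>\<bar> powr r \<le> \<bar>Z (int (Suc n) - j) \<omega>\<bar> powr (2 * r) + \<bar>Z (int (Suc n) - k) \<omega>\<bar> powr (2 * r)" for \<omega>
            unfolding absxi
            using powr_mult_le_add[of "\<bar>Z (int (Suc n) - j) \<omega>\<bar>" "\<bar>Z (int (Suc n) - k) \<omega>\<bar>" r r] r2 by (simp flip: mult_2)
        qed (intro Bochner_Integration.integrable_add mom)
        also have "\<dots> = B"
          using mom expectation_Z[of "\<lambda>x. \<bar>x\<bar> powr (2 * r)" "int (Suc n) - j"]
            expectation_Z[of "\<lambda>x. \<bar>x\<bar> powr (2 * r)" "int (Suc n) - k"] by (simp add: B_def)
        finally show ?thesis .
      qed
      fix n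
      define A where "A = {..<int (Suc n) - j}"
      \<comment> \<open>The factor at the older lag \<open>k\<close> also belongs to the past and is
        absorbed into \<open>F\<close>; only the centred factor at lag \<open>j\<close> is split
        off.\<close>
      define F where "F x = sgn (\<Sum>i<n. x (int (Suc i) - j) * x (int (Suc i) - k)) *
         \<bar>\<Sum>i<n. x (int (Suc i) - j) * x (int (Suc i) - k)\<bar> powr (r - 1) * x (int (Suc n) - k)" for x :: "int \<Rightarrow> real"
      have mf[measurable]: "F \<in> borel_measurable (PiM A (\<lambda>_. borel))"
      proof -
        have c: "(\<lambda>x::int \<Rightarrow> real. x i) \<in> borel_measurable (PiM A (\<lambda>_. borel))" if "i \<in> A" for i
          by (rule measurable_component_singleton) (use that in \<open>auto simp: A_def\<close>)
        have "(\<lambda>x::int \<Rightarrow> real. \<Sum>i<n. x (int (Suc i) - j) * x (int (Suc i) - k)) \<in> borel_measurable (PiM A (\<lambda>_. borel))"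
          using jk by (intro borel_measurable_sum borel_measurable_times c) (auto simp: A_def)
        from measurable_compose[OF this sgn_powr_measurable] show ?thesis 
          unfolding F_def using jk by (intro borel_measurable_times c) (auto simp: A_def)
      qed
      have eq: "F (restrict (\<lambda>i. Z i \<omega>) A) = sgn (\<Sum>i<n. \<xi> i \<omega>) * \<bar>\<Sum>i<n. \<xi> i \<omega>\<bar> powr (r - 1) * Z (int (Suc n) - k) \<omega>" for \<omega>
        using jk by (simp add: F_def A_def \<xi>_def)
      have "integrable M (\<lambda>\<omega>. sgn (\<Sum>i<n. \<xi> i \<omega>) * \<bar>\<Sum>i<n. \<xi> i \<omega>\<bar> powr (r - 1) * Z (int (Suc n) - k) \<omega>)"
        using int' r2 moment_Z[of r] by (intro sgn_powr_integrable sum_moment_integrable) auto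
      thus "expectation (\<lambda>\<omega>. sgn (\<Sum>i<n. \<xi> i \<omega>) * \<bar>\<Sum>i<n. \<xi> i \<omega>\<bar> powr (r - 1) * \<xi> n \<omega>) = 0"
        using indep_factor[OF mf, of "\<lambda>x. x" "int (Suc n) - j"] unfolding eq
        by (simp add: \<xi>_def[of n] A_def integrable_Z mean_Z mult_ac)
    qed (use int' in auto)
    thus "root_n_bounded M r (C * B) (\<lambda>N \<omega>. (1 / real N) * (\<Sum>n=1..N. Z (int n - j) \<omega> * Z (int n - k) \<omega>))"
      by (simp add: \<xi>_def lessThan_atLeast0 sum.atLeast1_atMost_eq)
  qed
qed

definition \<sigma>2 :: real where "\<sigma>2 = expectation (\<lambda>\<omega>. (Z 0 \<omega>)\<^sup>2)"

definition cov_error :: "nat \<Rightarrow> nat \<Rightarrow> nat \<Rightarrow> 'w \<Rightarrow> real" where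
  "cov_error j k N \<omega> = (1 / real N) * (\<Sum>n=1..N. Z (int n - int j) \<omega> * Z (int n - int k) \<omega>) - (if j = k then \<sigma>2 else 0)"

text \<open>The diagonal is an average of i.i.d. centred squares; off the diagonal the error is
  symmetric in the lags, so the case \<open>j < k\<close> suffices. One constant for all pairs is
  what the double series over lags requires.\<close>

lemma cov_error_bound: "\<exists>C. \<forall>j k. root_n_bounded M r C (cov_error j k)"
proof -
  obtain C1 where C1: "\<And>j k :: int. j < k \<Longrightarrow> root_n_bounded M r C1 (\<lambda>N \<omega>. (1 / real N) * (\<Sum>n=1..N. Z (int n - j) \<omega> * Z (int n - k) \<omega>))"
    using average_product by blast
  have i2: "integrable M (\<lambda>\<omega>. (Z 0 \<omega>)\<^sup>2)" using integrable_Z_mult[of 0 0] by (simp add: power2_eq_square)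
  have sq: "(Z 0 \<omega>)\<^sup>2 powr r = \<bar>Z 0 \<omega>\<bar> powr (2 * r)" for \<omega>
  proof -
    have "(Z 0 \<omega>)\<^sup>2 = \<bar>Z 0 \<omega>\<bar> powr 2" by simp
    thus ?thesis by (simp only: powr_powr)
  qed
  have "integrable M (\<lambda>\<omega>. \<bar>(Z 0 \<omega>)\<^sup>2 + (- \<sigma>2)\<bar> powr r)"
    using r2 moment by (intro moment_add_integrable) (simp_all add: sq)
  hence "\<exists>C. \<forall>j. root_n_bounded M r C (\<lambda>N \<omega>. (1 / real N) * (\<Sum>n=1..N. (Z (int n - j) \<omega>)\<^sup>2 - \<sigma>2))"
    using i2 by (intro average_function) (auto simp: \<sigma>2_def prob_space)
  then obtain C2 where C2: "\<And>j :: int. root_n_bounded M r C2 (\<lambda>N \<omega>. (1 / real N) * (\<Sum>n=1..N. (Z (int n - j) \<omega>)\<^sup>2 - \<sigma>2))"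
    by blast
  show ?thesis
  proof (intro exI[of _ "max C1 C2"] allI)
    fix j k
    show "root_n_bounded M r (max C1 C2) (cov_error j k)"
    proof (cases j k rule: linorder_cases)
      case less
      thus ?thesis using root_n_bounded_mono[OF C1[of "int j" "int k"], of "max C1 C2"] by (simp add: cov_error_def[abs_def])
    next
      case greater
      thus ?thesis using root_n_bounded_mono[OF C1[of "int k" "int j"], of "max C1 C2"] by (simp add: cov_error_def[abs_def] mult.commute)
    next
      case equal
      have "root_n_bounded M r (max C1 C2) (\<lambda>N \<omega>. (1 / real N) * (\<Sum>n=1..N. (Z (int n - int j) \<omega>)\<^sup>2 - \<sigma>2))"
        using root_n_bounded_mono[OF C2[of "int j"]] by simp
      thus ?thesis
        by (rule root_n_bounded_cong)
          (simp add: cov_error_def equal sum_subtractf power2_eq_square right_diff_distrib)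
    qed
  qed
qed

text \<open>Up to a constant, dominates the output at time \<open>n\<close> of every filter whose
  impulse response decays at rate \<beta>, whatever its parameter.\<close>

definition U :: "real \<Rightarrow> int \<Rightarrow> 'w \<Rightarrow> real" where
  "U \<beta> n \<omega> = (\<Sum>i. \<beta> ^ i * \<bar>Z (n - int i) \<omega>\<bar>)"

lemma U_measurable [measurable]: "U \<beta> n \<in> borel_measurable M"
  unfolding U_def by measurable

lemma
  assumes \<beta>: "0 < \<beta>" "\<beta> < 1"
  shows U_summable: "AE \<omega> in M. \<forall>n. summable (\<lambda>i. \<beta> ^ i * \<bar>Z (n - int i) \<omega>\<bar>)"
    and U_moment: "\<exists>B\<ge>0. \<forall>n. (\<integral>\<^sup>+\<omega>. ennreal (U \<beta> n \<omega> powr (2 * r)) \<partial>M) \<le> ennreal B"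
proof -
  define B where "B = expectation (\<lambda>\<omega>. \<bar>Z 0 \<omega>\<bar> powr (2 * r))"
  have B: "B \<ge> 0" by (simp add: B_def)
  have b: "(\<integral>\<^sup>+\<omega>. ennreal (\<bar>Z n \<omega>\<bar> powr (2 * r)) \<partial>M) \<le> ennreal B" for n
    using moment_Z[of "2 * r" n] expectation_Z[of "\<lambda>x. \<bar>x\<bar> powr (2 * r)" n] r2
    by (simp add: nn_integral_eq_integral B_def)
  have \<beta>': "\<And>i::nat. 0 \<le> \<beta> ^ i" "summable (\<lambda>i::nat. \<beta> ^ i)" using \<beta> by (auto intro: summable_geometric)
  have r1: "2 * r \<ge> 1" using r2 by simp
  note * = weighted_series_moment[where y = "\<lambda>i \<omega>. \<bar>Z (n - int i) \<omega>\<bar>" and r = "2 * r" for n, OF _ _ \<beta>' r1 B b]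
  show "AE \<omega> in M. \<forall>n. summable (\<lambda>i. \<beta> ^ i * \<bar>Z (n - int i) \<omega>\<bar>)"
    unfolding AE_all_countable using *(1) by simp
  show "\<exists>B\<ge>0. \<forall>n. (\<integral>\<^sup>+\<omega>. ennreal (U \<beta> n \<omega> powr (2 * r)) \<partial>M) \<le> ennreal B"
    using *(2) B by (intro exI[of _ "(\<Sum>i. \<beta> ^ i) powr (2 * r) * B"]) (simp add: U_def)
qed

end

subsection \<open>Linear filters along a summable path\<close>

definition conv :: "(nat \<Rightarrow> real) \<Rightarrow> (nat \<Rightarrow> real) \<Rightarrow> nat \<Rightarrow> real" (infixl \<open>\<star>\<^sub>c\<close> 70) where
  "conv x a m = (\<Sum>i\<le>m. x i * a (m - i))"

definition lin :: "(nat \<Rightarrow> real) \<Rightarrow> (int \<Rightarrow> real) \<Rightarrow> int \<Rightarrow> real" where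
  "lin x z n = (\<Sum>j. x j * z (n - int j))"

text \<open>Encodes zero initial conditions: at time \<open>n\<close> only the inputs at times 1 to
  \<open>n\<close>, that is the lags below \<open>n\<close>, reach the output.\<close>

definition trunc :: "nat \<Rightarrow> (nat \<Rightarrow> real) \<Rightarrow> nat \<Rightarrow> real" where
  "trunc n x j = (if j < n then x j else 0)"

text \<open>Convolving two kernels of rate \<alpha> costs a factor \<open>j + 1\<close>, which is
  absorbed by passing to a larger rate \<beta>.\<close>

lemma geometric_polynomial_bound:
  fixes \<alpha> \<beta> :: real
  assumes "0 < \<alpha>" "\<alpha> < \<beta>"
  obtains K where "K > 0" "\<And>j::nat. real (Suc j) * \<alpha> ^ j \<le> K * \<beta> ^ j"
proof -
  have "(\<lambda>j. real j * (\<alpha> / \<beta>) ^ j) \<longlonglongrightarrow> 0"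
    using assms by (intro powser_times_n_limit_0) auto
  moreover have "(\<lambda>j. (\<alpha> / \<beta>) ^ j) \<longlonglongrightarrow> 0"
    using assms by (intro LIMSEQ_power_zero) auto
  ultimately have "(\<lambda>j. real j * (\<alpha> / \<beta>) ^ j + (\<alpha> / \<beta>) ^ j) \<longlonglongrightarrow> 0 + 0"
    by (rule tendsto_add)
  hence "Bseq (\<lambda>j. real j * (\<alpha> / \<beta>) ^ j + (\<alpha> / \<beta>) ^ j)" by (intro convergent_imp_Bseq convergentI)
  then obtain K where K: "K > 0" "\<And>j. \<bar>real j * (\<alpha> / \<beta>) ^ j + (\<alpha> / \<beta>) ^ j\<bar> \<le> K"
    by (auto simp: Bseq_def)
  show thesis
  proof (rule that[OF K(1)])
    fix j :: nat
    have "(real j * (\<alpha> / \<beta>) ^ j + (\<alpha> / \<beta>) ^ j) * \<beta> ^ j \<le> K * \<beta> ^ j"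
      using K(2)[of j] assms by (intro mult_right_mono) auto
    also have "(real j * (\<alpha> / \<beta>) ^ j + (\<alpha> / \<beta>) ^ j) * \<beta> ^ j = real (Suc j) * \<alpha> ^ j"
      using assms by (simp add: power_divide distrib_right)
    finally show "real (Suc j) * \<alpha> ^ j \<le> K * \<beta> ^ j" .
  qed
qed

lemma conv_bound:
  assumes x: "\<And>j. \<bar>x j\<bar> \<le> c * \<alpha> ^ j" and a: "\<And>j. \<bar>a j\<bar> \<le> d * \<alpha> ^ j"
    and K: "\<And>j::nat. real (Suc j) * \<alpha> ^ j \<le> K * \<beta> ^ j" and c: "0 \<le> c" "0 \<le> d" "0 < \<alpha>"
  shows "\<bar>(x \<star>\<^sub>c a) m\<bar> \<le> c * d * K * \<beta> ^ m"
proof -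
  have "\<bar>(x \<star>\<^sub>c a) m\<bar> \<le> (\<Sum>i\<le>m. \<bar>x i * a (m - i)\<bar>)" unfolding conv_def by (rule sum_abs)
  also have "\<dots> \<le> (\<Sum>i\<le>m. c * d * \<alpha> ^ m)"
  proof (rule sum_mono)
    fix i assume i: "i \<in> {..m}"
    have "\<bar>x i * a (m - i)\<bar> \<le> (c * \<alpha> ^ i) * (d * \<alpha> ^ (m - i))"
      unfolding abs_mult using x a c by (intro mult_mono) auto
    also have "\<dots> = c * d * \<alpha> ^ m" using i by (simp flip: power_add)
    finally show "\<bar>x i * a (m - i)\<bar> \<le> c * d * \<alpha> ^ m" .
  qed
  also have "\<dots> = c * d * (real (Suc m) * \<alpha> ^ m)" by simp
  also have "\<dots> \<le> c * d * (K * \<beta> ^ m)" using K c by (intro mult_left_mono) auto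
  finally show ?thesis by (simp add: mult_ac)
qed

lemma trunc_bound: "(\<And>j. \<bar>x j\<bar> \<le> c * \<alpha> ^ j) \<Longrightarrow> 0 \<le> c \<Longrightarrow> 0 < \<alpha> \<Longrightarrow> \<bar>trunc n x j\<bar> \<le> c * \<alpha> ^ j"
  by (simp add: trunc_def)

lemma infsum_nat: "f summable_on UNIV \<Longrightarrow> infsum f UNIV = suminf f" for f :: "nat \<Rightarrow> real"
  by (metis has_sum_imp_sums has_sum_infsum sums_unique)

text \<open>Absolute convergence along the antidiagonals makes the family unconditionally summable
  over pairs, so both iterated sums equal the sum over pairs. The map from \<open>(j, i)\<close> to
  \<open>(j + i, j)\<close> matches the two index sets.\<close>

lemma suminf_exchange_triangle:
  fixes f :: "nat \<Rightarrow> nat \<Rightarrow> real"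
  assumes s: "summable (\<lambda>m. \<Sum>j\<le>m. \<bar>f j (m - j)\<bar>)"
  shows "(\<Sum>j. \<Sum>i. f j i) = (\<Sum>m. \<Sum>j\<le>m. f j (m - j))"
proof -
  define g where "g = (\<lambda>(m, j). f j (m - j))"
  have "(\<lambda>m. \<Sum>j\<le>m. \<bar>f j (m - j)\<bar>) summable_on UNIV"
    using s by (subst summable_on_UNIV_nonneg_real_iff) (auto intro: sum_nonneg)
  hence "(\<lambda>m. infsum (\<lambda>j. \<bar>f j (m - j)\<bar>) {..m}) summable_on UNIV" by simp
  hence abs1: "(\<lambda>p. norm (g p)) summable_on Sigma UNIV (\<lambda>m. {..m})"
    by (subst Infinite_Sum.abs_summable_on_Sigma_iff) (auto simp: g_def sum_nonneg)
  have bij: "bij_betw (\<lambda>(j, i). (j + i, j)) UNIV (Sigma UNIV (\<lambda>m::nat. {..m}))"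
    by (rule bij_betwI[where g = "\<lambda>(m, j). (j, m - j)"]) auto
  have abs2: "(\<lambda>p. norm ((\<lambda>(j, i). f j i) p)) summable_on UNIV"
    using abs1 summable_on_reindex_bij_betw[OF bij, of "\<lambda>p. norm (g p)"]
    by (simp add: g_def case_prod_unfold)
  have s2: "(\<lambda>(j, i). f j i) summable_on (UNIV \<times> UNIV)"
    using Infinite_Sum.abs_summable_summable[OF abs2] by simp
  have eq: "infsum (\<lambda>(j, i). f j i) UNIV = infsum g (Sigma UNIV (\<lambda>m. {..m}))"
    using infsum_reindex_bij_betw[OF bij, of g] by (simp add: g_def case_prod_unfold)
  have "infsum g (Sigma UNIV (\<lambda>m. {..m})) = infsum (\<lambda>m. infsum (\<lambda>j. f j (m - j)) {..m}) UNIV"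
    using infsum_Sigma'_banach[of "\<lambda>m j. f j (m - j)" UNIV "\<lambda>m. {..m}"] Infinite_Sum.abs_summable_summable[OF abs1]
    by (simp add: g_def)
  also have "\<dots> = (\<Sum>m. \<Sum>j\<le>m. f j (m - j))"
  proof -
    have "summable (\<lambda>m. norm (\<Sum>j\<le>m. f j (m - j)))"
      by (rule summable_comparison_test'[OF s, of 0]) (simp add: sum_abs)
    hence "(\<lambda>m. \<Sum>j\<le>m. f j (m - j)) summable_on UNIV"
      by (rule norm_summable_imp_summable_on)
    thus ?thesis by (simp add: infsum_nat)
  qed
  finally have R: "infsum g (Sigma UNIV (\<lambda>m. {..m})) = (\<Sum>m. \<Sum>j\<le>m. f j (m - j))" .
  have row: "f j summable_on UNIV" for j
    using summable_on_SigmaD1[of f UNIV "\<lambda>_. UNIV" j] s2 by simp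
  have out: "(\<lambda>j. infsum (f j) UNIV) summable_on UNIV"
    using summable_on_Sigma_banach[of f UNIV "\<lambda>_. UNIV"] s2 by simp
  have "infsum (\<lambda>(j, i). f j i) UNIV = infsum (\<lambda>j. infsum (f j) UNIV) UNIV"
    using infsum_Sigma'_banach[of f UNIV "\<lambda>_. UNIV"] s2 by simp
  also have "\<dots> = (\<Sum>j. \<Sum>i. f j i)"
    using row out by (simp add: infsum_nat)
  finally show ?thesis using eq R by simp
qed

lemma abs_suminf_le:
  fixes f g :: "nat \<Rightarrow> real"
  assumes "\<And>j. \<bar>f j\<bar> \<le> g j" "summable g"
  shows "summable f" "\<bar>suminf f\<bar> \<le> suminf g"
proof -
  have a: "summable (\<lambda>j. \<bar>f j\<bar>)"
    by (rule summable_comparison_test'[OF assms(2), of 0]) (use assms(1) in simp)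
  thus "summable f" by (rule summable_rabs_cancel)
  have "\<bar>suminf f\<bar> \<le> (\<Sum>j. \<bar>f j\<bar>)" by (rule summable_rabs[OF a])
  also have "\<dots> \<le> suminf g" using assms a by (intro suminf_le) auto
  finally show "\<bar>suminf f\<bar> \<le> suminf g" .
qed

text \<open>One realisation of the noise. Geometric summability at every time is all that the filter
  calculus takes from it, so the estimates below are deterministic.\<close>

locale summable_path =
  fixes z :: "int \<Rightarrow> real" and \<beta> :: real
  assumes \<beta>: "0 < \<beta>" "\<beta> < 1" and summ: "\<And>n. summable (\<lambda>i. \<beta> ^ i * \<bar>z (n - int i)\<bar>)"
begin

definition V :: "int \<Rightarrow> real" where "V n = (\<Sum>i. \<beta> ^ i * \<bar>z (n - int i)\<bar>)"

lemma V_nonneg: "V n \<ge> 0"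
  unfolding V_def using \<beta> by (intro suminf_nonneg summ) auto

context
  fixes x :: "nat \<Rightarrow> real" and c :: real
  assumes x: "\<And>j. \<bar>x j\<bar> \<le> c * \<beta> ^ j"
begin

lemma kernel_le: "\<bar>x j * z (n - int j)\<bar> \<le> c * (\<beta> ^ j * \<bar>z (n - int j)\<bar>)"
  using mult_right_mono[OF x[of j], of "\<bar>z (n - int j)\<bar>"] by (simp add: abs_mult mult.assoc)

lemma lin_summable: "summable (\<lambda>j. x j * z (n - int j))"
  and lin_le: "\<bar>lin x z n\<bar> \<le> c * V n"
  using abs_suminf_le[OF kernel_le summable_mult[OF summ]]
  by (simp_all add: lin_def V_def suminf_mult[OF summ])

lemma lin_sums: "(\<lambda>j. x j * z (n - int j)) sums lin x z n"
  unfolding lin_def using lin_summable by (rule summable_sums)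

text \<open>If the first \<open>n\<close> coefficients vanish, the output at time \<open>n\<close>
  depends only on inputs at times up to 0, and shifting the lag by \<open>n\<close> extracts the
  factor \<open>\<beta> ^ n\<close>. This measures the effect of the initial conditions.\<close>

lemma lin_tail:
  assumes "\<And>j. j < n \<Longrightarrow> x j = 0"
  shows "\<bar>lin x z (int n)\<bar> \<le> c * \<beta> ^ n * V 0"
proof -
  have "lin x z (int n) = (\<Sum>j. x (j + n) * z (int n - int (j + n)))"
    unfolding lin_def using suminf_split_initial_segment[OF lin_summable, of "int n" n] assms by simp
  also have "\<bar>\<dots>\<bar> \<le> (\<Sum>j. c * \<beta> ^ n * (\<beta> ^ j * \<bar>z (0 - int j)\<bar>))"
  proof (rule abs_suminf_le(2))
    show "\<bar>x (j + n) * z (int n - int (j + n))\<bar> \<le> c * \<beta> ^ n * (\<beta> ^ j * \<bar>z (0 - int j)\<bar>)" for j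
      using kernel_le[of "j + n" "int n"] by (simp add: power_add mult_ac)
  qed (intro summable_mult summ)
  also have "\<dots> = c * \<beta> ^ n * V 0" unfolding V_def by (rule suminf_mult[OF summ])
  finally show ?thesis .
qed

end

lemma lin_diff:
  assumes "\<And>j. \<bar>x j\<bar> \<le> c * \<beta> ^ j" "\<And>j. \<bar>y j\<bar> \<le> d * \<beta> ^ j"
  shows "lin (\<lambda>j. x j - y j) z n = lin x z n - lin y z n"
  using sums_diff[OF lin_sums[OF assms(1)] lin_sums[OF assms(2)], of n n]
  by (simp add: lin_def sums_iff left_diff_distrib)

text \<open>Cascaded filters convolve. The kernels decay at rate \<alpha> while the path is summable
  at the larger rate \<beta>; the gap pays for the number of terms in the convolution and makes the
  double series absolutely convergent.\<close>

lemma lin_lin: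
  assumes x: "\<And>j. \<bar>x j\<bar> \<le> c * \<alpha> ^ j" and a: "\<And>j. \<bar>a j\<bar> \<le> d * \<alpha> ^ j"
    and K: "\<And>j::nat. real (Suc j) * \<alpha> ^ j \<le> K * \<beta> ^ j" and c: "0 \<le> c" "0 \<le> d" "0 < \<alpha>"
  shows "lin x (lin a z) n = lin (x \<star>\<^sub>c a) z n"
proof -
  have "summable (\<lambda>m. \<Sum>j\<le>m. \<bar>x j * (a (m - j) * z (n - int j - int (m - j)))\<bar>)"
  proof (rule summable_comparison_test'[OF summable_mult[OF summ[of n], of "c * d * K"], of 0])
    fix m
    have "(\<Sum>j\<le>m. \<bar>x j * (a (m - j) * z (n - int j - int (m - j)))\<bar>)
        = ((\<lambda>j. \<bar>x j\<bar>) \<star>\<^sub>c (\<lambda>j. \<bar>a j\<bar>)) m * \<bar>z (n - int m)\<bar>"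
      unfolding conv_def sum_distrib_right by (intro sum.cong) (auto simp: abs_mult of_nat_diff)
    also have "\<dots> \<le> c * d * K * \<beta> ^ m * \<bar>z (n - int m)\<bar>"
      using conv_bound[of "\<lambda>j. \<bar>x j\<bar>" c \<alpha> "\<lambda>j. \<bar>a j\<bar>" d K \<beta> m] x a K c
      by (intro mult_right_mono) auto
    finally show "norm (\<Sum>j\<le>m. \<bar>x j * (a (m - j) * z (n - int j - int (m - j)))\<bar>)
        \<le> c * d * K * (\<beta> ^ m * \<bar>z (n - int m)\<bar>)" by (simp add: sum_nonneg mult.assoc)
  qed
  from suminf_exchange_triangle[where f = "\<lambda>j i. x j * (a i * z (n - int j - int i))", OF this]
  have 1: "(\<Sum>j. \<Sum>i. x j * (a i * z (n - int j - int i)))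
     = (\<Sum>m. \<Sum>j\<le>m. x j * (a (m - j) * z (n - int j - int (m - j))))" .
  \<comment> \<open>The inner series needs a bound on \<open>a\<close> at the rate of the path;
    \<open>K\<close> transfers it from \<alpha> to \<beta>.\<close>
  have a': "\<bar>a j\<bar> \<le> d * K * \<beta> ^ j" for j
  proof -
    have "\<alpha> ^ j \<le> real (Suc j) * \<alpha> ^ j" using c by simp
    also note K[of j]
    finally have "d * \<alpha> ^ j \<le> d * (K * \<beta> ^ j)" using c by (intro mult_left_mono)
    thus ?thesis using a[of j] by (simp add: mult.assoc)
  qed
  have "(\<Sum>j. \<Sum>i. x j * (a i * z (n - int j - int i))) = lin x (lin a z) n"
    unfolding lin_def by (intro suminf_cong suminf_mult lin_summable[OF a'])
  moreover have "(\<Sum>m. \<Sum>j\<le>m. x j * (a (m - j) * z (n - int j - int (m - j)))) = lin (x \<star>\<^sub>c a) z n"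
    unfolding lin_def by (intro suminf_cong) (auto simp: conv_def sum_distrib_right mult.assoc of_nat_diff)
  ultimately show ?thesis using 1 by simp
qed

text \<open>The error of the average is the double series of \<open>P j * Q k * Y j k\<close>. The
  kernels enter the bound only through \<open>D\<close> and \<beta>, so when they depend on a
  parameter the bound is automatically uniform in it.\<close>

lemma lin_product_average:
  fixes Y :: "nat \<Rightarrow> nat \<Rightarrow> real"
  assumes P: "\<And>j. \<bar>P j\<bar> \<le> D * \<beta> ^ j" and Q: "\<And>j. \<bar>Q j\<bar> \<le> D * \<beta> ^ j"
    and Y: "\<And>j k. Y j k = (1 / real N) * (\<Sum>n=1..N. z (int n - int j) * z (int n - int k)) - (if j = k then s else 0)"
    and s1: "\<And>j. summable (\<lambda>k. \<beta> ^ k * \<bar>Y j k\<bar>)" and s2: "summable (\<lambda>j. \<beta> ^ j * (\<Sum>k. \<beta> ^ k * \<bar>Y j k\<bar>))"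
  shows "\<bar>(1 / real N) * (\<Sum>n=1..N. lin P z (int n) * lin Q z (int n)) - s * (\<Sum>m. P m * Q m)\<bar>
     \<le> D\<^sup>2 * (\<Sum>j. \<beta> ^ j * (\<Sum>k. \<beta> ^ k * \<bar>Y j k\<bar>))"
proof -
  have D: "D \<ge> 0" using P[of 0] by simp
  \<comment> \<open>The inner series of \<open>Q k * Y j k\<close> over \<open>k\<close> in closed
    form; the subtracted term comes from the diagonal entry \<open>k = j\<close>.\<close>
  define T where "T j = (1 / real N) * (\<Sum>n=1..N. z (int n - int j) * lin Q z (int n)) - s * Q j" for j
  have T: "(\<lambda>k. Q k * Y j k) sums T j" for j
  proof -
    have "(\<lambda>k. (1 / real N) * (\<Sum>n=1..N. z (int n - int j) * (Q k * z (int n - int k))) - (if k = j then s * Q k else 0)) sums T j"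
      unfolding T_def
      by (intro sums_diff sums_mult sums_sum lin_sums[OF Q] sums_single)
    moreover have "(1 / real N) * (\<Sum>n=1..N. z (int n - int j) * (Q k * z (int n - int k))) - (if k = j then s * Q k else 0) = Q k * Y j k" for k
    proof -
      have "(\<Sum>n=1..N. z (int n - int j) * (Q k * z (int n - int k))) = Q k * (\<Sum>n=1..N. z (int n - int j) * z (int n - int k))"
        by (simp add: sum_distrib_left mult_ac)
      thus ?thesis by (simp add: Y right_diff_distrib)
    qed
    ultimately show ?thesis by simp
  qed
  have T_le: "\<bar>T j\<bar> \<le> D * (\<Sum>k. \<beta> ^ k * \<bar>Y j k\<bar>)" for j
  proof -
    have "\<bar>\<Sum>k. Q k * Y j k\<bar> \<le> (\<Sum>k. D * (\<beta> ^ k * \<bar>Y j k\<bar>))"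
    proof (rule abs_suminf_le(2))
      show "\<bar>Q k * Y j k\<bar> \<le> D * (\<beta> ^ k * \<bar>Y j k\<bar>)" for k
        using mult_right_mono[OF Q[of k], of "\<bar>Y j k\<bar>"] by (simp add: abs_mult mult.assoc)
    qed (intro summable_mult s1)
    thus ?thesis using T[of j] s1 by (simp add: sums_iff suminf_mult)
  qed
  have PQ: "summable (\<lambda>m. P m * Q m)"
  proof (rule abs_suminf_le(1))
    show "\<bar>P m * Q m\<bar> \<le> D\<^sup>2 * (\<beta> * \<beta>) ^ m" for m
      using mult_mono[OF P[of m] Q[of m]] D \<beta> by (simp add: abs_mult power2_eq_square power_mult_distrib mult_ac)
    show "summable (\<lambda>m. D\<^sup>2 * (\<beta> * \<beta>) ^ m)"
      using \<beta> mult_strict_mono[of \<beta> 1 \<beta> 1] by (intro summable_mult summable_geometric) auto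
  qed
  have "(\<lambda>j. (1 / real N) * (\<Sum>n=1..N. (P j * z (int n - int j)) * lin Q z (int n)) - s * (P j * Q j)) sums
      ((1 / real N) * (\<Sum>n=1..N. lin P z (int n) * lin Q z (int n)) - s * (\<Sum>m. P m * Q m))"
    by (intro sums_diff sums_mult sums_sum sums_mult2 lin_sums[OF P] summable_sums[OF PQ])
  moreover have "(1 / real N) * (\<Sum>n=1..N. (P j * z (int n - int j)) * lin Q z (int n)) - s * (P j * Q j) = P j * T j" for j
    by (simp add: T_def right_diff_distrib sum_distrib_left mult_ac)
  ultimately have "(\<lambda>j. P j * T j) sums ((1 / real N) * (\<Sum>n=1..N. lin P z (int n) * lin Q z (int n)) - s * (\<Sum>m. P m * Q m))"
    by simp
  moreover have "\<bar>\<Sum>j. P j * T j\<bar> \<le> (\<Sum>j. D\<^sup>2 * (\<beta> ^ j * (\<Sum>k. \<beta> ^ k * \<bar>Y j k\<bar>)))"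
  proof (rule abs_suminf_le(2))
    show "\<bar>P j * T j\<bar> \<le> D\<^sup>2 * (\<beta> ^ j * (\<Sum>k. \<beta> ^ k * \<bar>Y j k\<bar>))" for j
      using mult_mono[OF P[of j] T_le[of j]] D \<beta> by (simp add: abs_mult power2_eq_square mult_ac)
  qed (intro summable_mult s2)
  ultimately show ?thesis using s2 by (simp add: sums_iff suminf_mult)
qed

text \<open>The kernel \<open>p n\<close> stands for the truncated inverse filter convolved with the
  true one: it agrees with \<open>P\<close> on the lags below \<open>n\<close> but need not vanish
  beyond. The product at time \<open>n\<close> is then wrong by a multiple of
  \<open>\<beta> ^ n\<close>, which is summable in \<open>n\<close>, so the average is wrong by
  order \<open>1 / N\<close> only.\<close>

lemma lin_product_average_perturbed:
  fixes Y :: "nat \<Rightarrow> nat \<Rightarrow> real" and p q :: "nat \<Rightarrow> nat \<Rightarrow> real"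
  assumes P: "\<And>j. \<bar>P j\<bar> \<le> D * \<beta> ^ j" and Q: "\<And>j. \<bar>Q j\<bar> \<le> D * \<beta> ^ j"
    and p: "\<And>n j. \<bar>p n j\<bar> \<le> D * \<beta> ^ j" "\<And>n j. j < n \<Longrightarrow> p n j = P j"
    and q: "\<And>n j. \<bar>q n j\<bar> \<le> D * \<beta> ^ j" "\<And>n j. j < n \<Longrightarrow> q n j = Q j"
    and Y: "\<And>j k. Y j k = (1 / real N) * (\<Sum>n=1..N. z (int n - int j) * z (int n - int k)) - (if j = k then s else 0)"
    and s1: "\<And>j. summable (\<lambda>k. \<beta> ^ k * \<bar>Y j k\<bar>)" and s2: "summable (\<lambda>j. \<beta> ^ j * (\<Sum>k. \<beta> ^ k * \<bar>Y j k\<bar>))"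
    and s3: "summable (\<lambda>n. \<beta> ^ n * (V 0 * V (int n)))"
  shows "\<bar>(1 / real N) * (\<Sum>n=1..N. lin (p n) z (int n) * lin (q n) z (int n)) - s * (\<Sum>m. P m * Q m)\<bar>
     \<le> 4 * D\<^sup>2 * ((\<Sum>j. \<beta> ^ j * (\<Sum>k. \<beta> ^ k * \<bar>Y j k\<bar>)) + (1 / real N) * (\<Sum>n. \<beta> ^ n * (V 0 * V (int n))))"
proof -
  have D: "D \<ge> 0" using P[of 0] by simp
  have close: "\<bar>lin (p n) z (int n) - lin P z (int n)\<bar> \<le> 2 * D * \<beta> ^ n * V 0"
    if P: "\<And>j. \<bar>P j\<bar> \<le> D * \<beta> ^ j" and p: "\<And>n j. \<bar>p n j\<bar> \<le> D * \<beta> ^ j" "\<And>n j. j < n \<Longrightarrow> p n j = P j"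
    for p :: "nat \<Rightarrow> nat \<Rightarrow> real" and P n
  proof -
    have "\<bar>p n j - P j\<bar> \<le> 2 * D * \<beta> ^ j" for j
      using abs_triangle_ineq4[of "p n j" "P j"] P[of j] p(1)[of n j] by linarith
    from lin_tail[of "\<lambda>j. p n j - P j", OF this] p(2)
    show ?thesis using lin_diff[OF p(1)[of n] P] by simp
  qed
  have diff: "\<bar>lin (p n) z (int n) * lin (q n) z (int n) - lin P z (int n) * lin Q z (int n)\<bar> \<le> 4 * D\<^sup>2 * (\<beta> ^ n * (V 0 * V (int n)))" for n
  proof -
    have eq: "lin (p n) z (int n) * lin (q n) z (int n) - lin P z (int n) * lin Q z (int n) =
       (lin (p n) z (int n) - lin P z (int n)) * lin (q n) z (int n) + (lin (q n) z (int n) - lin Q z (int n)) * lin P z (int n)"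
      by (simp add: algebra_simps)
    have "\<bar>lin (p n) z (int n) * lin (q n) z (int n) - lin P z (int n) * lin Q z (int n)\<bar>
        \<le> \<bar>lin (p n) z (int n) - lin P z (int n)\<bar> * \<bar>lin (q n) z (int n)\<bar> + \<bar>lin (q n) z (int n) - lin Q z (int n)\<bar> * \<bar>lin P z (int n)\<bar>"
      unfolding eq by (rule order_trans[OF abs_triangle_ineq]) (simp add: abs_mult)
    also have "\<dots> \<le> (2 * D * \<beta> ^ n * V 0) * (D * V (int n)) + (2 * D * \<beta> ^ n * V 0) * (D * V (int n))"
    proof -
      note 1 = close[of P p n, OF P p] and 2 = close[of Q q n, OF Q q]
      show ?thesis
        by (rule add_mono[OF mult_mono[OF 1 lin_le[of "q n", OF q(1)] order_trans[OF abs_ge_zero 1] abs_ge_zero]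
              mult_mono[OF 2 lin_le[of P, OF P] order_trans[OF abs_ge_zero 2] abs_ge_zero]])
    qed
    also have "\<dots> = 4 * D\<^sup>2 * (\<beta> ^ n * (V 0 * V (int n)))" by (simp add: power2_eq_square)
    finally show ?thesis .
  qed
  have "\<bar>(1 / real N) * (\<Sum>n=1..N. lin (p n) z (int n) * lin (q n) z (int n)) - (1 / real N) * (\<Sum>n=1..N. lin P z (int n) * lin Q z (int n))\<bar>
     = (1 / real N) * \<bar>\<Sum>n=1..N. lin (p n) z (int n) * lin (q n) z (int n) - lin P z (int n) * lin Q z (int n)\<bar>"
    by (simp add: sum_subtractf abs_divide flip: diff_divide_distrib)
  also have "\<dots> \<le> (1 / real N) * (\<Sum>n=1..N. 4 * D\<^sup>2 * (\<beta> ^ n * (V 0 * V (int n))))"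
    by (intro mult_left_mono order_trans[OF sum_abs] sum_mono diff) auto
  also have "\<dots> = 4 * D\<^sup>2 * ((1 / real N) * (\<Sum>n=1..N. \<beta> ^ n * (V 0 * V (int n))))"
    by (simp add: sum_distrib_left[symmetric])
  also have "\<dots> \<le> 4 * D\<^sup>2 * ((1 / real N) * (\<Sum>n. \<beta> ^ n * (V 0 * V (int n))))"
    using \<beta> V_nonneg by (intro mult_left_mono sum_le_suminf s3) auto
  finally have 1: "\<bar>(1 / real N) * (\<Sum>n=1..N. lin (p n) z (int n) * lin (q n) z (int n)) - (1 / real N) * (\<Sum>n=1..N. lin P z (int n) * lin Q z (int n))\<bar>
      \<le> 4 * D\<^sup>2 * ((1 / real N) * (\<Sum>n. \<beta> ^ n * (V 0 * V (int n))))" .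
  note 2 = lin_product_average[OF P Q Y s1 s2]
  have "0 \<le> (\<Sum>j. \<beta> ^ j * (\<Sum>k. \<beta> ^ k * \<bar>Y j k\<bar>))"
    using \<beta> by (intro suminf_nonneg s2 mult_nonneg_nonneg s1) auto
  hence "0 \<le> D\<^sup>2 * (\<Sum>j. \<beta> ^ j * (\<Sum>k. \<beta> ^ k * \<bar>Y j k\<bar>))" by simp
  thus ?thesis using 1 2 unfolding distrib_left by linarith
qed

end

subsection \<open>A uniform bound on the noise\<close>

lemma root_n_bounded_divide:
  fixes X :: "'a \<Rightarrow> real"
  assumes [measurable]: "X \<in> borel_measurable M" and r: "r \<ge> 0" and B: "B \<ge> 0"
    and X: "(\<integral>\<^sup>+\<omega>. ennreal (\<bar>X \<omega>\<bar> powr r) \<partial>M) \<le> ennreal B"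
  shows "root_n_bounded M r B (\<lambda>N \<omega>. (1 / real N) * X \<omega>)"
  unfolding root_n_bounded_def
proof (intro conjI allI impI B)
  fix N :: nat assume N: "N \<ge> 1"
  have "(\<integral>\<^sup>+\<omega>. ennreal (\<bar>(1 / real N) * X \<omega>\<bar> powr r) \<partial>M) = (\<integral>\<^sup>+\<omega>. ennreal (real N powr (- r)) * ennreal (\<bar>X \<omega>\<bar> powr r) \<partial>M)"
    using N by (intro nn_integral_cong) (simp add: abs_mult powr_divide powr_minus_divide ennreal_mult'[symmetric])
  also have "\<dots> = ennreal (real N powr (- r)) * (\<integral>\<^sup>+\<omega>. ennreal (\<bar>X \<omega>\<bar> powr r) \<partial>M)"
    by (simp add: nn_integral_cmult)
  also have "\<dots> \<le> ennreal (real N powr (- r / 2)) * ennreal B"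
    using N r X by (intro mult_mono ennreal_leI powr_mono) auto
  finally show "(\<integral>\<^sup>+\<omega>. ennreal (\<bar>(1 / real N) * X \<omega>\<bar> powr r) \<partial>M) \<le> ennreal (B * real N powr (- r / 2))"
    using B by (simp add: ennreal_mult mult.commute)
qed measurable

context iid_noise
begin

text \<open>Controls the time average of \<bar>Z\<bar> at each lag and through it that of
  \<open>U\<close>, which acts as a random Lipschitz constant of the innovations in the
  parameter.\<close>

definition abs_error :: "nat \<Rightarrow> nat \<Rightarrow> 'w \<Rightarrow> real" where
  "abs_error j N \<omega> = (1 / real N) * (\<Sum>n=1..N. \<bar>Z (int n - int j) \<omega>\<bar>) - expectation (\<lambda>\<omega>. \<bar>Z 0 \<omega>\<bar>)"

lemma abs_error_bound: "\<exists>C. \<forall>j. root_n_bounded M r C (abs_error j)"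
proof -
  let ?\<mu> = "expectation (\<lambda>\<omega>. \<bar>Z 0 \<omega>\<bar>)"
  have "integrable M (\<lambda>\<omega>. \<bar>\<bar>Z 0 \<omega>\<bar> + (- ?\<mu>)\<bar> powr r)"
    using r2 moment_Z[of r 0] by (intro moment_add_integrable) auto
  hence "\<exists>C. \<forall>j. root_n_bounded M r C (\<lambda>N \<omega>. (1 / real N) * (\<Sum>n=1..N. \<bar>Z (int n - j) \<omega>\<bar> - ?\<mu>))"
    using integrable_Z[of 0] by (intro average_function) (auto simp: prob_space)
  then obtain C where C: "\<And>j :: int. root_n_bounded M r C (\<lambda>N \<omega>. (1 / real N) * (\<Sum>n=1..N. \<bar>Z (int n - j) \<omega>\<bar> - ?\<mu>))"
    by blast
  have "root_n_bounded M r C (abs_error j)" for j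
    by (rule root_n_bounded_cong[OF C[of "int j"]])
      (simp add: abs_error_def sum_subtractf right_diff_distrib)
  thus ?thesis by blast
qed

definition ecf_error :: "real \<Rightarrow> nat \<Rightarrow> 'w \<Rightarrow> complex" where
  "ecf_error u N \<omega> = (\<Sum>n=1..N. iexp (u * Z (int n) \<omega>)) / of_nat N - expectation (\<lambda>\<omega>. iexp (u * Z 0 \<omega>))"

lemma ecf_error_bound: "\<exists>C. root_n_bounded M r C (\<lambda>N \<omega>. cmod (ecf_error u N \<omega>))"
proof -
  have trig: "\<exists>C. root_n_bounded M r C (\<lambda>N \<omega>. (1 / real N) * (\<Sum>n=1..N. f (Z (int n) \<omega>) - expectation (\<lambda>\<omega>. f (Z 0 \<omega>))))"
    if [measurable]: "f \<in> borel_measurable borel" and f: "\<And>x. \<bar>f x\<bar> \<le> 1" for f :: "real \<Rightarrow> real"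
  proof -
    let ?\<mu> = "expectation (\<lambda>\<omega>. f (Z 0 \<omega>))"
    have int: "integrable M (\<lambda>\<omega>. f (Z 0 \<omega>))"
      using f by (intro integrable_const_bound[of _ 1]) auto
    have "integrable M (\<lambda>\<omega>. \<bar>f (Z 0 \<omega>)\<bar> powr r)"
      using f r2 by (intro integrable_const_bound[of _ 1]) (auto simp: powr_le_one_le intro!: powr_le1)
    hence "integrable M (\<lambda>\<omega>. \<bar>f (Z 0 \<omega>) + (- ?\<mu>)\<bar> powr r)"
      using r2 by (intro moment_add_integrable) auto
    hence "\<exists>C. \<forall>j. root_n_bounded M r C (\<lambda>N \<omega>. (1 / real N) * (\<Sum>n=1..N. f (Z (int n - j) \<omega>) - ?\<mu>))"
      using int by (intro average_function[where f = "\<lambda>x. f x - ?\<mu>"]) (auto simp: prob_space)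
    then obtain C where "\<And>j. root_n_bounded M r C (\<lambda>N \<omega>. (1 / real N) * (\<Sum>n=1..N. f (Z (int n - j) \<omega>) - ?\<mu>))"
      by blast
    from this[of 0] show ?thesis by auto
  qed
  let ?c = "\<lambda>N \<omega>. (1 / real N) * (\<Sum>n=1..N. cos (u * Z (int n) \<omega>) - expectation (\<lambda>\<omega>. cos (u * Z 0 \<omega>)))"
  let ?s = "\<lambda>N \<omega>. (1 / real N) * (\<Sum>n=1..N. sin (u * Z (int n) \<omega>) - expectation (\<lambda>\<omega>. sin (u * Z 0 \<omega>)))"
  obtain C D where "root_n_bounded M r C ?c" "root_n_bounded M r D ?s"
    using trig[of "\<lambda>x. cos (u * x)"] trig[of "\<lambda>x. sin (u * x)"] by auto
  hence *: "root_n_bounded M r (2 powr r * (C + D)) (\<lambda>N \<omega>. \<bar>?c N \<omega>\<bar> + \<bar>?s N \<omega>\<bar>)"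
    using r2 by (intro root_n_bounded_add root_n_bounded_abs) auto
  have int: "integrable M (\<lambda>\<omega>. iexp (u * Z 0 \<omega>))" by (intro integrable_iexp) auto
  have le: "cmod (ecf_error u N \<omega>) \<le> \<bar>?c N \<omega>\<bar> + \<bar>?s N \<omega>\<bar>" if N: "N \<ge> 1" for N \<omega>
  proof -
    have "Re (ecf_error u N \<omega>) = ?c N \<omega>"
      using N integral_Re[OF int] by (simp add: ecf_error_def Re_exp sum_subtractf diff_divide_distrib Re_divide_of_nat)
    moreover have "Im (ecf_error u N \<omega>) = ?s N \<omega>"
      using N integral_Im[OF int] by (simp add: ecf_error_def Im_exp sum_subtractf diff_divide_distrib Im_divide_of_nat)
    ultimately show ?thesis using cmod_le[of "ecf_error u N \<omega>"] by simp
  qed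
  have "root_n_bounded M r (2 powr r * (C + D)) (\<lambda>N \<omega>. cmod (ecf_error u N \<omega>))"
    unfolding root_n_bounded_def
  proof (intro conjI allI impI)
    show "0 \<le> 2 powr r * (C + D)" using * by (simp add: root_n_bounded_def)
    fix N :: nat assume N: "N \<ge> 1"
    show "(\<lambda>\<omega>. cmod (ecf_error u N \<omega>)) \<in> borel_measurable M" unfolding ecf_error_def by measurable
    have "(\<integral>\<^sup>+\<omega>. ennreal (\<bar>cmod (ecf_error u N \<omega>)\<bar> powr r) \<partial>M) \<le> (\<integral>\<^sup>+\<omega>. ennreal (\<bar>\<bar>?c N \<omega>\<bar> + \<bar>?s N \<omega>\<bar>\<bar> powr r) \<partial>M)"
      using le[OF N] r2 by (intro nn_integral_mono ennreal_leI powr_mono2) auto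
    also have "\<dots> \<le> ennreal (2 powr r * (C + D) * real N powr (- r / 2))"
      using * N unfolding root_n_bounded_def by blast
    finally show "(\<integral>\<^sup>+\<omega>. ennreal (\<bar>cmod (ecf_error u N \<omega>)\<bar> powr r) \<partial>M) \<le> ennreal (2 powr r * (C + D) * real N powr (- r / 2))" .
  qed
  thus ?thesis ..
qed

lemma U_abs_moment:
  assumes \<beta>: "0 < \<beta>" "\<beta> < 1"
  shows "\<exists>B\<ge>0. \<forall>n. (\<integral>\<^sup>+\<omega>. ennreal (\<bar>U \<beta> n \<omega>\<bar> powr (2 * r)) \<partial>M) \<le> ennreal B"
proof -
  have "AE \<omega> in M. \<forall>n. 0 \<le> U \<beta> n \<omega>"
    using U_summable[OF \<beta>] by eventually_elim (use \<beta> in \<open>auto simp: U_def intro!: suminf_nonneg\<close>)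
  hence "AE \<omega> in M. ennreal (\<bar>U \<beta> n \<omega>\<bar> powr (2 * r)) = ennreal (U \<beta> n \<omega> powr (2 * r))" for n
    by eventually_elim simp
  hence "(\<integral>\<^sup>+\<omega>. ennreal (\<bar>U \<beta> n \<omega>\<bar> powr (2 * r)) \<partial>M) = (\<integral>\<^sup>+\<omega>. ennreal (U \<beta> n \<omega> powr (2 * r)) \<partial>M)" for n
    by (rule nn_integral_cong_AE)
  thus ?thesis using U_moment[OF \<beta>] by simp
qed

text \<open>The summands absorb, in this order: the error of the prediction error score, the effect
  of the initial conditions on that score, their effect on the innovations at the true parameter,
  the fluctuation of the random Lipschitz constant, and the sampling error of the empirical
  characteristic function of the noise. The inner absolute values make each summand the absolute
  value form to which the rate lemmas apply.\<close>

definition noise_error :: "real \<Rightarrow> ('k::finite \<Rightarrow> real) \<Rightarrow> nat \<Rightarrow> 'w \<Rightarrow> real" where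
  "noise_error \<beta> u N \<omega> =
     (\<Sum>j. \<beta> ^ j * \<bar>\<Sum>k. \<beta> ^ k * \<bar>cov_error j k N \<omega>\<bar>\<bar>) +
     (1 / real N) * (\<Sum>n. \<beta> ^ n * (\<bar>U \<beta> 0 \<omega>\<bar> * \<bar>U \<beta> (int n) \<omega>\<bar>)) +
     (1 / real N) * \<bar>U \<beta> 0 \<omega>\<bar> +
     (\<Sum>j. \<beta> ^ j * \<bar>abs_error j N \<omega>\<bar>) +
     (\<Sum>k\<in>UNIV. cmod (ecf_error (u k) N \<omega>))"

text \<open>Outside this almost sure event the series defining the filters may diverge, and their values are
  then unspecified.\<close>

definition good_path :: "real \<Rightarrow> nat \<Rightarrow> 'w \<Rightarrow> bool" where
  "good_path \<beta> N \<omega> \<longleftrightarrow> summable_path (\<lambda>n. Z n \<omega>) \<beta> \<and>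
     (\<forall>j. summable (\<lambda>k. \<beta> ^ k * \<bar>cov_error j k N \<omega>\<bar>)) \<and>
     summable (\<lambda>j. \<beta> ^ j * \<bar>\<Sum>k. \<beta> ^ k * \<bar>cov_error j k N \<omega>\<bar>\<bar>) \<and>
     summable (\<lambda>n. \<beta> ^ n * (\<bar>U \<beta> 0 \<omega>\<bar> * \<bar>U \<beta> (int n) \<omega>\<bar>)) \<and>
     summable (\<lambda>j. \<beta> ^ j * \<bar>abs_error j N \<omega>\<bar>)"

lemma
  fixes u :: "'k::finite \<Rightarrow> real"
  assumes \<beta>: "0 < \<beta>" "\<beta> < 1"
  shows noise_error_bound: "\<exists>C. root_n_bounded M r C (noise_error \<beta> u)"
    and AE_good_path: "N \<ge> 1 \<Longrightarrow> AE \<omega> in M. good_path \<beta> N \<omega>"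
proof -
  have \<beta>': "\<And>i::nat. 0 \<le> \<beta> ^ i" "summable (\<lambda>i::nat. \<beta> ^ i)" using \<beta> by (auto intro: summable_geometric)
  have r1: "r \<ge> 1" "r \<ge> 0" using r2 by auto
  obtain C1 where C1: "\<And>j k. root_n_bounded M r C1 (cov_error j k)" using cov_error_bound by blast
  \<comment> \<open>The constant of the inner series is the same for all \<open>j\<close>, so the
    bound for series applies a second time, to the sum over \<open>j\<close>.\<close>
  note inner = root_n_bounded_series[where X = "cov_error j" for j, OF C1 \<beta>' r1(1)]
  note outer = root_n_bounded_series[where X = "\<lambda>j N \<omega>. \<Sum>k. \<beta> ^ k * \<bar>cov_error j k N \<omega>\<bar>", OF inner(1) \<beta>' r1(1)]
  obtain C2 where C2: "\<And>j. root_n_bounded M r C2 (abs_error j)" using abs_error_bound by blast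
  note ae = root_n_bounded_series[where X = abs_error, OF C2 \<beta>' r1(1)]
  obtain B where B: "B \<ge> 0" "\<And>n. (\<integral>\<^sup>+\<omega>. ennreal (\<bar>U \<beta> n \<omega>\<bar> powr (2 * r)) \<partial>M) \<le> ennreal B"
    using U_abs_moment[OF \<beta>] by blast
  \<comment> \<open>The effect of the initial conditions on a product involves two values of
    \<open>U\<close>; its \<open>r\<close>-th moment uses the moment of order
    \<open>2 * r\<close>.\<close>
  have UU: "(\<integral>\<^sup>+\<omega>. ennreal ((\<bar>U \<beta> 0 \<omega>\<bar> * \<bar>U \<beta> (int n) \<omega>\<bar>) powr r) \<partial>M) \<le> ennreal (2 * B)" for n
  proof -
    have "(\<integral>\<^sup>+\<omega>. ennreal ((\<bar>U \<beta> 0 \<omega>\<bar> * \<bar>U \<beta> (int n) \<omega>\<bar>) powr r) \<partial>M)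
       \<le> (\<integral>\<^sup>+\<omega>. ennreal (\<bar>U \<beta> 0 \<omega>\<bar> powr (2 * r)) + ennreal (\<bar>U \<beta> (int n) \<omega>\<bar> powr (2 * r)) \<partial>M)"
    proof (rule nn_integral_mono)
      fix \<omega>
      have "(\<bar>U \<beta> 0 \<omega>\<bar> * \<bar>U \<beta> (int n) \<omega>\<bar>) powr r \<le> \<bar>U \<beta> 0 \<omega>\<bar> powr (2 * r) + \<bar>U \<beta> (int n) \<omega>\<bar> powr (2 * r)"
        using powr_mult_le_add[of "\<bar>U \<beta> 0 \<omega>\<bar>" "\<bar>U \<beta> (int n) \<omega>\<bar>" r r] r1 by (simp add: powr_mult flip: mult_2)
      thus "ennreal ((\<bar>U \<beta> 0 \<omega>\<bar> * \<bar>U \<beta> (int n) \<omega>\<bar>) powr r) \<le> ennreal (\<bar>U \<beta> 0 \<omega>\<bar> powr (2 * r)) + ennreal (\<bar>U \<beta> (int n) \<omega>\<bar> powr (2 * r))"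
        by (simp add: ennreal_leI flip: ennreal_plus)
    qed
    also have "\<dots> \<le> ennreal B + ennreal B"
      by (subst nn_integral_add) (auto intro!: add_mono B(2))
    finally show ?thesis using B(1) by (simp flip: ennreal_plus)
  qed
  have U0: "(\<integral>\<^sup>+\<omega>. ennreal (\<bar>\<bar>U \<beta> 0 \<omega>\<bar>\<bar> powr r) \<partial>M) \<le> ennreal (1 + B)"
  proof -
    have "(\<integral>\<^sup>+\<omega>. ennreal (\<bar>\<bar>U \<beta> 0 \<omega>\<bar>\<bar> powr r) \<partial>M) \<le> (\<integral>\<^sup>+\<omega>. 1 + ennreal (\<bar>U \<beta> 0 \<omega>\<bar> powr (2 * r)) \<partial>M)"
    proof (rule nn_integral_mono)
      fix \<omega>
      have "\<bar>\<bar>U \<beta> 0 \<omega>\<bar>\<bar> powr r \<le> 1 + \<bar>U \<beta> 0 \<omega>\<bar> powr (2 * r)"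
        using powr_le_one_plus[of "\<bar>U \<beta> 0 \<omega>\<bar>" r "2 * r"] r1 by simp
      thus "ennreal (\<bar>\<bar>U \<beta> 0 \<omega>\<bar>\<bar> powr r) \<le> 1 + ennreal (\<bar>U \<beta> 0 \<omega>\<bar> powr (2 * r))"
        by (metis ennreal_leI ennreal_1 ennreal_plus powr_ge_zero zero_le_one)
    qed
    also have "\<dots> \<le> 1 + ennreal B"
      by (subst nn_integral_add) (auto simp: emeasure_space_1 intro!: add_mono B(2))
    finally show ?thesis using B(1) by simp
  qed
  have UUm: "\<And>n. (\<lambda>\<omega>. \<bar>U \<beta> 0 \<omega>\<bar> * \<bar>U \<beta> (int n) \<omega>\<bar>) \<in> borel_measurable M" by measurable
  have UU0: "0 \<le> \<bar>U \<beta> 0 \<omega>\<bar> * \<bar>U \<beta> (int n) \<omega>\<bar>" for n \<omega> by simp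
  have B2: "0 \<le> 2 * B" using B by simp
  note UUs = weighted_series_moment[where y = "\<lambda>n \<omega>. \<bar>U \<beta> 0 \<omega>\<bar> * \<bar>U \<beta> (int n) \<omega>\<bar>", OF UUm UU0 \<beta>' r1(1) B2 UU]
  have pos: "\<bar>\<Sum>n. \<beta> ^ n * (\<bar>U \<beta> 0 \<omega>\<bar> * \<bar>U \<beta> (int n) \<omega>\<bar>)\<bar> = (\<Sum>n. \<beta> ^ n * (\<bar>U \<beta> 0 \<omega>\<bar> * \<bar>U \<beta> (int n) \<omega>\<bar>))"
    if "summable (\<lambda>n. \<beta> ^ n * (\<bar>U \<beta> 0 \<omega>\<bar> * \<bar>U \<beta> (int n) \<omega>\<bar>))" for \<omega>
    using \<beta> by (intro abs_of_nonneg suminf_nonneg that) auto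
  have "(\<integral>\<^sup>+\<omega>. ennreal (\<bar>\<Sum>n. \<beta> ^ n * (\<bar>U \<beta> 0 \<omega>\<bar> * \<bar>U \<beta> (int n) \<omega>\<bar>)\<bar> powr r) \<partial>M) \<le> ennreal ((\<Sum>i. \<beta> ^ i) powr r * (2 * B))"
  proof -
    have "AE \<omega> in M. ennreal (\<bar>\<Sum>n. \<beta> ^ n * (\<bar>U \<beta> 0 \<omega>\<bar> * \<bar>U \<beta> (int n) \<omega>\<bar>)\<bar> powr r)
        = ennreal ((\<Sum>n. \<beta> ^ n * (\<bar>U \<beta> 0 \<omega>\<bar> * \<bar>U \<beta> (int n) \<omega>\<bar>)) powr r)"
      using UUs(1) by eventually_elim (simp only: pos)
    from nn_integral_cong_AE[OF this] show ?thesis using UUs(2) by simp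
  qed
  hence R2: "root_n_bounded M r ((\<Sum>i. \<beta> ^ i) powr r * (2 * B)) (\<lambda>N \<omega>. (1 / real N) * (\<Sum>n. \<beta> ^ n * (\<bar>U \<beta> 0 \<omega>\<bar> * \<bar>U \<beta> (int n) \<omega>\<bar>)))"
    using r1 B by (intro root_n_bounded_divide) auto
  have R3: "root_n_bounded M r (1 + B) (\<lambda>N \<omega>. (1 / real N) * \<bar>U \<beta> 0 \<omega>\<bar>)"
    using r1 B U0 by (intro root_n_bounded_divide) auto
  obtain C5 where R5: "root_n_bounded M r C5 (\<lambda>N \<omega>. \<Sum>k\<in>UNIV. cmod (ecf_error (u k) N \<omega>))"
    using root_n_bounded_sum[of UNIV M r "\<lambda>k N \<omega>. cmod (ecf_error (u k) N \<omega>)"] ecf_error_bound r1 by auto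
  show "\<exists>C. root_n_bounded M r C (noise_error \<beta> u)"
    unfolding noise_error_def[abs_def]
    by (rule exI, rule root_n_bounded_add[OF root_n_bounded_add[OF root_n_bounded_add[OF
          root_n_bounded_add[OF outer(1) R2 r1(2)] R3 r1(2)] ae(1) r1(2)] R5 r1(2)])
  assume N: "N \<ge> 1"
  have "AE \<omega> in M. \<forall>j. summable (\<lambda>k. \<beta> ^ k * \<bar>cov_error j k N \<omega>\<bar>)"
    unfolding AE_all_countable using inner(2)[OF N] by blast
  thus "AE \<omega> in M. good_path \<beta> N \<omega>"
    using outer(2)[OF N] UUs(1) ae(2)[OF N] U_summable[OF \<beta>]
    by eventually_elim (simp add: good_path_def summable_path_def \<beta>)
qed

text \<open>Orthogonality of the noise gives the formula for partial sums; their squares are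
  dominated by \<open>c\<^sup>2 * (U \<beta> n \<omega>)\<^sup>2\<close>, which is integrable
  because the moment of order \<open>2 * r\<close> of \<open>U\<close> is finite.\<close>

lemma expectation_lin_square:
  assumes \<beta>: "0 < \<beta>" "\<beta> < 1" and x: "\<And>j. \<bar>x j\<bar> \<le> c * \<beta> ^ j"
  shows "expectation (\<lambda>\<omega>. (lin x (\<lambda>n. Z n \<omega>) n)\<^sup>2) = \<sigma>2 * (\<Sum>j. (x j)\<^sup>2)"
proof -
  have c: "c \<ge> 0" using x[of 0] by simp
  obtain B where B: "B \<ge> 0" "\<And>n. (\<integral>\<^sup>+\<omega>. ennreal (\<bar>U \<beta> n \<omega>\<bar> powr (2 * r)) \<partial>M) \<le> ennreal B"
    using U_abs_moment[OF \<beta>] by blast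
  have "integrable M (\<lambda>\<omega>. \<bar>U \<beta> n \<omega>\<bar> powr (2 * r))"
    using B(2)[of n] by (intro integrableI_bounded) (auto intro: le_less_trans)
  hence "integrable M (\<lambda>\<omega>. \<bar>U \<beta> n \<omega>\<bar> powr 2)"
    by (rule moment_integrable_mono[OF U_measurable]) (use r2 in simp_all)
  hence "integrable M (\<lambda>\<omega>. (U \<beta> n \<omega>)\<^sup>2)" by simp
  hence U2: "integrable M (\<lambda>\<omega>. c\<^sup>2 * (U \<beta> n \<omega>)\<^sup>2)" by (rule integrable_mult_right)
  let ?S = "\<lambda>m \<omega>. \<Sum>j<m. x j * Z (n - int j) \<omega>"
  have lim: "AE \<omega> in M. (\<lambda>m. (?S m \<omega>)\<^sup>2) \<longlonglongrightarrow> (lin x (\<lambda>n. Z n \<omega>) n)\<^sup>2"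
    and dom: "AE \<omega> in M. \<forall>m. norm ((?S m \<omega>)\<^sup>2) \<le> c\<^sup>2 * (U \<beta> n \<omega>)\<^sup>2"
  proof -
    have "AE \<omega> in M. (\<lambda>m. (?S m \<omega>)\<^sup>2) \<longlonglongrightarrow> (lin x (\<lambda>n. Z n \<omega>) n)\<^sup>2 \<and> (\<forall>m. norm ((?S m \<omega>)\<^sup>2) \<le> c\<^sup>2 * (U \<beta> n \<omega>)\<^sup>2)"
      using U_summable[OF \<beta>]
    proof eventually_elim
      case (elim \<omega>)
      then interpret summable_path "\<lambda>n. Z n \<omega>" \<beta> by unfold_locales (use \<beta> in auto)
      have "(\<lambda>m. ?S m \<omega>) \<longlonglongrightarrow> lin x (\<lambda>n. Z n \<omega>) n"
        using lin_sums[OF x] by (simp add: sums_def)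
      moreover have "norm ((?S m \<omega>)\<^sup>2) \<le> c\<^sup>2 * (U \<beta> n \<omega>)\<^sup>2" for m
      proof -
        have "\<bar>?S m \<omega>\<bar> \<le> (\<Sum>j<m. c * (\<beta> ^ j * \<bar>Z (n - int j) \<omega>\<bar>))"
          by (intro order_trans[OF sum_abs] sum_mono kernel_le x)
        also have "\<dots> = c * (\<Sum>j<m. \<beta> ^ j * \<bar>Z (n - int j) \<omega>\<bar>)" by (simp add: sum_distrib_left)
        also have "\<dots> \<le> c * U \<beta> n \<omega>"
          unfolding U_def using c \<beta> by (intro mult_left_mono sum_le_suminf summ) auto
        finally have "\<bar>?S m \<omega>\<bar>\<^sup>2 \<le> (c * U \<beta> n \<omega>)\<^sup>2" by (rule power_mono) simp
        thus ?thesis by (simp add: power_mult_distrib)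
      qed
      ultimately show ?case by (auto intro: tendsto_power)
    qed
    thus "AE \<omega> in M. (\<lambda>m. (?S m \<omega>)\<^sup>2) \<longlonglongrightarrow> (lin x (\<lambda>n. Z n \<omega>) n)\<^sup>2"
      and "AE \<omega> in M. \<forall>m. norm ((?S m \<omega>)\<^sup>2) \<le> c\<^sup>2 * (U \<beta> n \<omega>)\<^sup>2" by auto
  qed
  have [measurable]: "(\<lambda>\<omega>. lin x (\<lambda>n. Z n \<omega>) n) \<in> borel_measurable M" unfolding lin_def by measurable
  have L: "(\<lambda>m. expectation (\<lambda>\<omega>. (?S m \<omega>)\<^sup>2)) \<longlonglongrightarrow> expectation (\<lambda>\<omega>. (lin x (\<lambda>n. Z n \<omega>) n)\<^sup>2)"
    by (rule integral_dominated_convergence[OF _ _ U2 lim]) (use dom in \<open>auto elim: eventually_mono\<close>)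
  have E: "expectation (\<lambda>\<omega>. (?S m \<omega>)\<^sup>2) = \<sigma>2 * (\<Sum>j<m. (x j)\<^sup>2)" for m
  proof -
    have eq: "(?S m \<omega>)\<^sup>2 = (\<Sum>j<m. \<Sum>k<m. x j * x k * (Z (n - int j) \<omega> * Z (n - int k) \<omega>))" for \<omega>
      by (simp add: power2_eq_square sum_product mult_ac)
    have "expectation (\<lambda>\<omega>. (?S m \<omega>)\<^sup>2) = (\<Sum>j<m. \<Sum>k<m. x j * x k * expectation (\<lambda>\<omega>. Z (n - int j) \<omega> * Z (n - int k) \<omega>))"
      unfolding eq by (simp add: integrable_Z_mult)
    also have "\<dots> = (\<Sum>j<m. \<Sum>k<m. if k = j then x j * x k * \<sigma>2 else 0)"
    proof (intro sum.cong refl)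
      fix j k
      have "expectation (\<lambda>\<omega>. Z (n - int j) \<omega> * Z (n - int k) \<omega>) = (if k = j then \<sigma>2 else 0)"
      proof (cases "k = j")
        case True
        thus ?thesis using expectation_Z[of "\<lambda>x. x\<^sup>2" "n - int j"] by (simp add: \<sigma>2_def power2_eq_square)
      next
        case False
        thus ?thesis using uncorrelated[of "n - int j" "n - int k"] by simp
      qed
      thus "x j * x k * expectation (\<lambda>\<omega>. Z (n - int j) \<omega> * Z (n - int k) \<omega>) = (if k = j then x j * x k * \<sigma>2 else 0)"
        by simp
    qed
    also have "\<dots> = \<sigma>2 * (\<Sum>j<m. (x j)\<^sup>2)"
      by (simp add: sum.delta sum_distrib_left power2_eq_square mult_ac)
    finally show ?thesis .
  qed
  have "summable (\<lambda>j. (x j)\<^sup>2)"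
  proof (rule abs_suminf_le(1))
    show "\<bar>(x j)\<^sup>2\<bar> \<le> c\<^sup>2 * (\<beta>\<^sup>2) ^ j" for j
      using power_mono[OF x[of j], of 2] by (simp add: power_mult_distrib power_mult[symmetric] mult.commute)
    show "summable (\<lambda>j. c\<^sup>2 * (\<beta>\<^sup>2) ^ j)"
      using \<beta> by (intro summable_mult summable_geometric) (auto simp: power_less_one_iff abs_square_less_1)
  qed
  from tendsto_mult_left[OF summable_LIMSEQ[OF this], of \<sigma>2] have "(\<lambda>m. \<sigma>2 * (\<Sum>j<m. (x j)\<^sup>2)) \<longlonglongrightarrow> \<sigma>2 * (\<Sum>j. (x j)\<^sup>2)" .
  thus ?thesis using L unfolding E by (rule LIMSEQ_unique[symmetric])
qed

end

subsection \<open>Moments of infinitely divisible laws\<close>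

text \<open>The law of a random walk with initial law \<open>L\<close> and \<open>n\<close>
  independent steps of law \<open>p\<close>. Below, \<open>L\<close> is the Gaussian part with the
  drift and each step a centred rare jump.\<close>

primrec conv_power :: "real measure \<Rightarrow> real measure \<Rightarrow> nat \<Rightarrow> real measure" where
  "conv_power L p 0 = L"
| "conv_power L p (Suc n) = distr (conv_power L p n \<Otimes>\<^sub>M p) borel (\<lambda>(x, y). x + y)"

lemma real_distribution_add:
  assumes "real_distribution L" "real_distribution p"
  shows "real_distribution (distr (L \<Otimes>\<^sub>M p) borel (\<lambda>(x, y). x + y))"
proof -
  interpret L: real_distribution L by fact
  interpret p: real_distribution p by fact
  interpret P: pair_prob_space L p ..
  show ?thesis
    unfolding real_distribution_def real_distribution_axioms_def
    by (auto intro!: P.prob_space_distr)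
qed

lemma real_distribution_conv_power:
  "real_distribution L \<Longrightarrow> real_distribution p \<Longrightarrow> real_distribution (conv_power L p n)"
  by (induction n) (auto intro: real_distribution_add)

lemma nn_integral_distr_add:
  assumes "real_distribution L" "real_distribution p" and [measurable]: "f \<in> borel_measurable borel"
  shows "(\<integral>\<^sup>+x. f x \<partial>distr (L \<Otimes>\<^sub>M p) borel (\<lambda>(x, y). x + y)) = (\<integral>\<^sup>+x. \<integral>\<^sup>+y. f (x + y) \<partial>p \<partial>L)"
proof -
  interpret L: real_distribution L by fact
  interpret p: real_distribution p by fact
  interpret P: pair_prob_space L p ..
  have "(\<integral>\<^sup>+x. f x \<partial>distr (L \<Otimes>\<^sub>M p) borel (\<lambda>(x, y). x + y)) = (\<integral>\<^sup>+w. f (fst w + snd w) \<partial>(L \<Otimes>\<^sub>M p))"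
    by (subst nn_integral_distr) (auto simp: case_prod_unfold)
  also have "\<dots> = (\<integral>\<^sup>+x. \<integral>\<^sup>+y. f (x + y) \<partial>p \<partial>L)"
    by (subst p.nn_integral_fst[symmetric]) auto
  finally show ?thesis .
qed

lemma char_distr_pair_add:
  assumes "real_distribution L" "real_distribution p"
  shows "char (distr (L \<Otimes>\<^sub>M p) borel (\<lambda>(x, y). x + y)) t = char L t * char p t"
proof -
  interpret L: real_distribution L by fact
  interpret p: real_distribution p by fact
  interpret P: pair_prob_space L p ..
  have "char (distr (L \<Otimes>\<^sub>M p) borel (\<lambda>(x, y). x + y)) t = (CLINT w|L \<Otimes>\<^sub>M p. iexp (t * (fst w + snd w)))"
    unfolding char_def by (subst integral_distr) (auto simp: case_prod_unfold)
  also have "\<dots> = (CLINT x|L. CLINT y|p. iexp (t * (x + y)))"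
    by (subst P.integral_fst'[symmetric]) (auto intro!: P.integrable_const_bound[of _ 1] simp: case_prod_unfold)
  also have "\<dots> = (CLINT x|L. CLINT y|p. iexp (t * x) * iexp (t * y))"
    by (simp add: distrib_left exp_add)
  also have "\<dots> = char L t * char p t"
    by (simp add: char_def)
  finally show ?thesis .
qed

lemma char_conv_power:
  "real_distribution L \<Longrightarrow> real_distribution p \<Longrightarrow> char (conv_power L p n) t = char L t * char p t ^ n"
  by (induction n) (simp_all add: char_distr_pair_add real_distribution_conv_power)

text \<open>Centred steps remove the linear term of \<open>powr_add_taylor\<close>, and
  \<open>\<bar>x\<bar> powr (r - 2) \<le> 1 + \<bar>x\<bar> powr r\<close> closes the recursion
  without lower moments. A step multiplies the moment by at most \<open>1 + C * c / n\<close> and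
  adds \<open>2 * C * c / n\<close>, so the bound after \<open>n\<close> steps depends on
  \<open>c\<close> but not on \<open>n\<close>.\<close>

lemma conv_power_moment:
  fixes r :: real
  assumes r: "r \<ge> 2"
  obtains C where "C > 0" "\<And>L p c A0 (n::nat).
     \<lbrakk>real_distribution L; real_distribution p; n \<ge> 1; c \<ge> 0; A0 \<ge> 0;
      (\<integral>\<^sup>+x. ennreal (\<bar>x\<bar> powr r) \<partial>L) \<le> ennreal A0; integrable p (\<lambda>y. \<bar>y\<bar> powr r); (LINT y|p. y) = 0;
      (LINT y|p. y\<^sup>2) \<le> c / n; (LINT y|p. \<bar>y\<bar> powr r) \<le> c / n\<rbrakk>
     \<Longrightarrow> (\<integral>\<^sup>+x. ennreal (\<bar>x\<bar> powr r) \<partial>conv_power L p n) \<le> ennreal (exp (C * c) * (A0 + 2 * (C * c)))"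
proof -
  obtain C where C: "C > 0" "\<And>x y :: real. \<bar>x + y\<bar> powr r \<le> \<bar>x\<bar> powr r + r * (sgn x * \<bar>x\<bar> powr (r - 1) * y)
        + C * (\<bar>x\<bar> powr (r - 2) * y\<^sup>2 + \<bar>y\<bar> powr r)"
    using powr_add_taylor[OF r] by blast
  show thesis
  proof (rule that[OF C(1)])
    fix L p c A0 and n :: nat
    assume L: "real_distribution L" and p: "real_distribution p" and n: "n \<ge> 1" and c: "c \<ge> 0" and A0: "A0 \<ge> 0"
      and mL: "(\<integral>\<^sup>+x. ennreal (\<bar>x\<bar> powr r) \<partial>L) \<le> ennreal A0" and ip: "integrable p (\<lambda>y. \<bar>y\<bar> powr r)"
      and mean: "(LINT y|p. y) = 0" and m2: "(LINT y|p. y\<^sup>2) \<le> c / n" and mr: "(LINT y|p. \<bar>y\<bar> powr r) \<le> c / n"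
    interpret p: real_distribution p by fact
    have [measurable]: "(\<lambda>y. y) \<in> borel_measurable p" by simp
    have i1: "integrable p (\<lambda>y. y)"
      using p.moment_integrable_mono[OF _ ip, of 1] r by (simp add: integrable_abs_iff)
    have i2: "integrable p (\<lambda>y. y\<^sup>2)"
      using p.moment_integrable_mono[OF _ ip, of 2] r by simp
    define d where "d = C * c / n"
    have d: "d \<ge> 0" using C(1) c by (simp add: d_def)
    have inner: "(\<integral>\<^sup>+y. ennreal (\<bar>x + y\<bar> powr r) \<partial>p) \<le> ennreal ((1 + d) * \<bar>x\<bar> powr r + 2 * d)" for x
    proof -
      let ?g = "\<lambda>y. \<bar>x\<bar> powr r + r * (sgn x * \<bar>x\<bar> powr (r - 1)) * y + C * (\<bar>x\<bar> powr (r - 2)) * y\<^sup>2 + C * \<bar>y\<bar> powr r"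
      have ig: "integrable p ?g" using i1 i2 ip by auto
      have le: "\<bar>x + y\<bar> powr r \<le> ?g y" for y using C(2)[of x y] by (simp add: distrib_left mult.assoc)
      have "(\<integral>\<^sup>+y. ennreal (\<bar>x + y\<bar> powr r) \<partial>p) \<le> (\<integral>\<^sup>+y. ennreal (?g y) \<partial>p)"
        by (intro nn_integral_mono ennreal_leI le)
      also have "\<dots> = ennreal (LINT y|p. ?g y)"
        using ig le by (intro nn_integral_eq_integral AE_I2) (auto intro: order_trans[OF powr_ge_zero])
      also have "(LINT y|p. ?g y) = \<bar>x\<bar> powr r + C * (\<bar>x\<bar> powr (r - 2)) * (LINT y|p. y\<^sup>2) + C * (LINT y|p. \<bar>y\<bar> powr r)"
        using i1 i2 ip mean by (simp add: p.prob_space[unfolded p.space_eq_univ])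
      also have "\<dots> \<le> \<bar>x\<bar> powr r + C * (1 + \<bar>x\<bar> powr r) * (c / n) + C * (c / n)"
        using C(1) m2 mr c r powr_le_one_plus[of "\<bar>x\<bar>" "r - 2" r]
        by (intro add_mono mult_mono order_refl) auto
      also have "\<dots> = (1 + d) * \<bar>x\<bar> powr r + 2 * d"
        by (simp add: d_def algebra_simps)
      finally show ?thesis by (simp add: ennreal_leI)
    qed
    have bound: "(\<integral>\<^sup>+x. ennreal (\<bar>x\<bar> powr r) \<partial>conv_power L p k) \<le> ennreal ((1 + d) ^ k * (A0 + k * (2 * d)))" for k
    proof (induction k)
      case 0 thus ?case using mL by simp
    next
      case (Suc k)
      interpret Lk: real_distribution "conv_power L p k" using L p by (rule real_distribution_conv_power)
      have [measurable]: "(\<lambda>y. y) \<in> borel_measurable (conv_power L p k)" by simp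
      have pos: "0 \<le> (1 + d) ^ k * (A0 + k * (2 * d))" using d A0 by simp
      have "(\<integral>\<^sup>+x. ennreal (\<bar>x\<bar> powr r) \<partial>conv_power L p (Suc k)) = (\<integral>\<^sup>+x. \<integral>\<^sup>+y. ennreal (\<bar>x + y\<bar> powr r) \<partial>p \<partial>conv_power L p k)"
        using Lk.real_distribution_axioms p by (simp add: nn_integral_distr_add)
      also have "\<dots> \<le> (\<integral>\<^sup>+x. ennreal (1 + d) * ennreal (\<bar>x\<bar> powr r) + ennreal (2 * d) \<partial>conv_power L p k)"
        using inner d by (intro nn_integral_mono) (simp add: ennreal_mult'[symmetric] flip: ennreal_plus)
      also have "\<dots> = ennreal (1 + d) * (\<integral>\<^sup>+x. ennreal (\<bar>x\<bar> powr r) \<partial>conv_power L p k) + ennreal (2 * d)"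
        by (simp add: nn_integral_add nn_integral_cmult Lk.emeasure_space_1[unfolded Lk.space_eq_univ])
      also have "\<dots> \<le> ennreal (1 + d) * ennreal ((1 + d) ^ k * (A0 + k * (2 * d))) + ennreal (2 * d)"
        using Suc by (intro add_mono mult_left_mono) auto
      also have "\<dots> = ennreal ((1 + d) ^ Suc k * (A0 + k * (2 * d)) + 2 * d)"
        using pos d by (simp add: ennreal_mult'[symmetric] mult.assoc flip: ennreal_plus)
      also have "\<dots> \<le> ennreal ((1 + d) ^ Suc k * (A0 + Suc k * (2 * d)))"
      proof (rule ennreal_leI)
        have "1 * (2 * d) \<le> (1 + d) ^ Suc k * (2 * d)"
          using d by (intro mult_right_mono one_le_power) auto
        thus "(1 + d) ^ Suc k * (A0 + k * (2 * d)) + 2 * d \<le> (1 + d) ^ Suc k * (A0 + Suc k * (2 * d))"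
          by (simp add: algebra_simps)
      qed
      finally show ?case .
    qed
    have "(1 + d) ^ n \<le> exp d ^ n" using d by (intro power_mono) (auto simp: exp_ge_add_one_self)
    also have "\<dots> = exp (C * c)" using n by (simp add: d_def exp_of_nat_mult[symmetric])
    finally have "(1 + d) ^ n * (A0 + n * (2 * d)) \<le> exp (C * c) * (A0 + 2 * (C * c))"
      using n A0 d C(1) c by (intro mult_mono) (auto simp: d_def)
    thus "(\<integral>\<^sup>+x. ennreal (\<bar>x\<bar> powr r) \<partial>conv_power L p n) \<le> ennreal (exp (C * c) * (A0 + 2 * (C * c)))"
      using bound[of n] by (meson ennreal_leI order_trans)
  qed
qed

section \<open>Compound Poisson steps\<close>

definition lazy_law :: "real \<Rightarrow> real measure \<Rightarrow> real measure" where
  "lazy_law q \<rho> = distr (measure_pmf (bernoulli_pmf q) \<Otimes>\<^sub>M \<rho>) borel (\<lambda>(b, x). if b then x else 0)"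

context
  fixes q :: real and \<rho> :: "real measure"
  assumes q: "0 \<le> q" "q \<le> 1" and \<rho>: "real_distribution \<rho>"
begin

interpretation \<rho>: real_distribution \<rho> by (rule \<rho>)
interpretation P: pair_prob_space "measure_pmf (bernoulli_pmf q)" \<rho> ..

lemma real_distribution_lazy_law: "real_distribution (lazy_law q \<rho>)"
  unfolding lazy_law_def real_distribution_def real_distribution_axioms_def
  by (auto intro!: P.prob_space_distr)

lemma nn_integral_lazy_law:
  assumes [measurable]: "f \<in> borel_measurable borel"
  shows "(\<integral>\<^sup>+x. f x \<partial>lazy_law q \<rho>) = ennreal q * (\<integral>\<^sup>+x. f x \<partial>\<rho>) + ennreal (1 - q) * f 0"
proof -
  have "(\<integral>\<^sup>+x. f x \<partial>lazy_law q \<rho>) = (\<integral>\<^sup>+w. f (if fst w then snd w else 0) \<partial>(measure_pmf (bernoulli_pmf q) \<Otimes>\<^sub>M \<rho>))"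
    unfolding lazy_law_def by (subst nn_integral_distr) (auto simp: case_prod_unfold)
  also have "\<dots> = (\<integral>\<^sup>+b. \<integral>\<^sup>+x. f (if b then x else 0) \<partial>\<rho> \<partial>measure_pmf (bernoulli_pmf q))"
    by (subst \<rho>.nn_integral_fst[symmetric]) (auto cong: if_cong)
  also have "\<dots> = ennreal q * (\<integral>\<^sup>+x. f x \<partial>\<rho>) + ennreal (1 - q) * f 0"
    using q by (simp add: \<rho>.emeasure_space_1[unfolded \<rho>.space_eq_univ] mult.commute)
  finally show ?thesis .
qed

lemma
  fixes f :: "real \<Rightarrow> 'b::{banach,second_countable_topology}"
  assumes f: "integrable \<rho> f"
  shows integrable_lazy_law: "integrable (lazy_law q \<rho>) f"
    and integral_lazy_law: "(LINT x|lazy_law q \<rho>. f x) = q *\<^sub>R (LINT x|\<rho>. f x) + (1 - q) *\<^sub>R f 0"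
proof -
  have [measurable]: "f \<in> borel_measurable borel" using f by auto
  have fin: "(\<integral>\<^sup>+x. ennreal (norm (f x)) \<partial>\<rho>) < \<infinity>" using f by (simp add: integrable_iff_bounded)
  show int: "integrable (lazy_law q \<rho>) f"
    unfolding integrable_iff_bounded
    by (subst nn_integral_lazy_law) (use fin in \<open>auto simp: lazy_law_def ennreal_mult_less_top\<close>)
  have "integrable (measure_pmf (bernoulli_pmf q) \<Otimes>\<^sub>M \<rho>) (\<lambda>w. f (if fst w then snd w else 0))"
    using int unfolding lazy_law_def by (subst (asm) integrable_distr_eq) (auto simp: case_prod_unfold)
  hence i: "integrable (measure_pmf (bernoulli_pmf q) \<Otimes>\<^sub>M \<rho>) (\<lambda>(b, x). f (if b then x else 0))"
    by (simp add: case_prod_unfold)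
  have "(LINT x|lazy_law q \<rho>. f x) = (LINT w|(measure_pmf (bernoulli_pmf q) \<Otimes>\<^sub>M \<rho>). (\<lambda>(b, x). f (if b then x else 0)) w)"
    unfolding lazy_law_def by (subst integral_distr) (auto simp: case_prod_unfold)
  also have "\<dots> = (LINT b|measure_pmf (bernoulli_pmf q). LINT x|\<rho>. f (if b then x else 0))"
    using P.integral_fst'[OF i] by simp
  also have "\<dots> = q *\<^sub>R (LINT x|\<rho>. f x) + (1 - q) *\<^sub>R f 0"
    using q by (subst integral_measure_pmf[of UNIV]) (auto simp: UNIV_bool \<rho>.prob_space[unfolded \<rho>.space_eq_univ])
  finally show "(LINT x|lazy_law q \<rho>. f x) = q *\<^sub>R (LINT x|\<rho>. f x) + (1 - q) *\<^sub>R f 0" .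
qed

end

text \<open>The discretised jump process with jumps in \<open>E\<close> over a short time
  \<open>t\<close>: at most one jump, occurring with probability \<open>t * measure \<nu> E\<close>
  and distributed as the normalised restriction of \<nu>. If \<open>E\<close> is a null set, the
  point mass at 0 keeps the expression a probability law.\<close>

definition jump_law :: "real \<Rightarrow> real measure \<Rightarrow> real set \<Rightarrow> real measure" where
  "jump_law t \<nu> E = lazy_law (t * measure \<nu> E) (if measure \<nu> E = 0 then return borel 0 else uniform_measure \<nu> E)"

context
  fixes t :: real and \<nu> :: "real measure" and E :: "real set"
  assumes t: "0 \<le> t" "t * measure \<nu> E \<le> 1" and E: "E \<in> sets borel" "emeasure \<nu> E < \<infinity>" and \<nu>: "sets \<nu> = sets borel"
begin

private definition "\<rho> = (if measure \<nu> E = 0 then return borel 0 else uniform_measure \<nu> E)"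

private lemma \<rho>: "real_distribution \<rho>"
proof -
  have "prob_space (uniform_measure \<nu> E)" if "measure \<nu> E \<noteq> 0"
    using that E by (intro prob_space_uniform_measure) (auto simp: measure_def)
  moreover have "prob_space (return borel (0::real))" by (intro prob_space_return) simp
  ultimately have "prob_space \<rho>" by (simp add: \<rho>_def)
  thus ?thesis unfolding real_distribution_def real_distribution_axioms_def
    using \<nu> sets_eq_imp_space_eq[OF \<nu>] by (auto simp: \<rho>_def)
qed

private lemma q: "0 \<le> t * measure \<nu> E" "t * measure \<nu> E \<le> 1" using t by auto

lemma real_distribution_jump_law: "real_distribution (jump_law t \<nu> E)"
  unfolding jump_law_def \<rho>_def[symmetric] by (rule real_distribution_lazy_law[OF q \<rho>])

lemma
  fixes f :: "real \<Rightarrow> 'b::{banach,second_countable_topology}"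
  assumes f: "integrable \<nu> (\<lambda>x. indicator E x *\<^sub>R f x)" and [measurable]: "f \<in> borel_measurable borel"
  shows integrable_jump_law: "integrable (jump_law t \<nu> E) f"
    and integral_jump_law: "(LINT x|jump_law t \<nu> E. f x) = t *\<^sub>R (LINT x|\<nu>. indicator E x *\<^sub>R f x) + (1 - t * measure \<nu> E) *\<^sub>R f 0"
proof -
  have [measurable_cong]: "sets \<nu> = sets borel" by (rule \<nu>)
  have *: "integrable \<rho> f \<and> measure \<nu> E *\<^sub>R (LINT x|\<rho>. f x) = (LINT x|\<nu>. indicator E x *\<^sub>R f x)"
  proof (cases "measure \<nu> E = 0")
    case True
    hence "emeasure \<nu> E = 0" using E(2) by (auto simp: measure_def enn2real_eq_0_iff)
    hence "AE x in \<nu>. x \<notin> E" using E(1) \<nu> by (intro AE_not_in) (simp add: null_sets_def)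
    hence "AE x in \<nu>. indicator E x *\<^sub>R f x = 0" by eventually_elim simp
    hence "(LINT x|\<nu>. indicator E x *\<^sub>R f x) = 0" by (intro integral_eq_zero_AE)
    moreover have "integrable \<rho> f" using True
      by (simp add: \<rho>_def integrable_iff_bounded nn_integral_return)
    ultimately show ?thesis using True by simp
  next
    case False
    have Em [measurable]: "E \<in> sets \<nu>" using E \<nu> by simp
    have eq: "uniform_measure \<nu> E = density \<nu> (\<lambda>x. ennreal (indicator E x / measure \<nu> E))"
    proof -
      have "indicator E x / emeasure \<nu> E = ennreal (indicator E x / measure \<nu> E)" for x
      proof -
        have "emeasure \<nu> E = ennreal (measure \<nu> E)" using E(2) by (intro emeasure_eq_ennreal_measure) auto
        moreover have "measure \<nu> E > 0" using False by (simp add: zero_less_measure_iff)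
        ultimately show ?thesis using divide_ennreal[of 1 "measure \<nu> E"] by (cases "x \<in> E") auto
      qed
      thus ?thesis by (simp add: uniform_measure_def)
    qed
    have nn: "AE x in \<nu>. 0 \<le> indicator E x / measure \<nu> E" by simp
    have sc: "(indicator E x / measure \<nu> E) *\<^sub>R f x = (1 / measure \<nu> E) *\<^sub>R (indicator E x *\<^sub>R f x)" for x
      by simp
    have "integrable \<rho> f"
      using False f unfolding \<rho>_def by (simp add: eq integrable_density sc del: scaleR_scaleR)
    moreover have "(LINT x|\<rho>. f x) = (1 / measure \<nu> E) *\<^sub>R (LINT x|\<nu>. indicator E x *\<^sub>R f x)"
      using False unfolding \<rho>_def by (simp add: eq integral_density sc del: scaleR_scaleR)
    ultimately show ?thesis using False by simp
  qed
  show "integrable (jump_law t \<nu> E) f"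
    unfolding jump_law_def \<rho>_def[symmetric] using * by (intro integrable_lazy_law[OF q \<rho>]) simp
  show "(LINT x|jump_law t \<nu> E. f x) = t *\<^sub>R (LINT x|\<nu>. indicator E x *\<^sub>R f x) + (1 - t * measure \<nu> E) *\<^sub>R f 0"
    unfolding jump_law_def \<rho>_def[symmetric] using *
    by (subst integral_lazy_law[OF q \<rho>]) (auto simp flip: scaleR_scaleR)
qed

end

text \<open>Jensen through the tangent at \<open>t = expectation \<bar>X\<bar>\<close>, whose linear
  part integrates to zero; the case \<open>t = 0\<close> has no such tangent and is trivial.\<close>

lemma (in prob_space) abs_expectation_powr_le:
  fixes X :: "'a \<Rightarrow> real"
  assumes [measurable]: "X \<in> borel_measurable M" and X: "integrable M (\<lambda>\<omega>. \<bar>X \<omega>\<bar> powr r)" and r: "r \<ge> 1"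
  shows "\<bar>expectation X\<bar> powr r \<le> expectation (\<lambda>\<omega>. \<bar>X \<omega>\<bar> powr r)"
proof -
  have i: "integrable M (\<lambda>\<omega>. \<bar>X \<omega>\<bar>)"
    using moment_integrable_mono[OF _ X, of 1] r by simp
  define t where "t = expectation (\<lambda>\<omega>. \<bar>X \<omega>\<bar>)"
  have le: "\<bar>expectation X\<bar> \<le> t" unfolding t_def by (rule integral_abs_bound)
  show ?thesis
  proof (cases "t = 0")
    case True
    thus ?thesis using le by (simp add: integral_nonneg_AE)
  next
    case False
    hence t: "t > 0" using le by linarith
    have "expectation (\<lambda>\<omega>. t powr r * (1 + r * (\<bar>X \<omega>\<bar> / t - 1))) \<le> expectation (\<lambda>\<omega>. \<bar>X \<omega>\<bar> powr r)"
    proof (rule integral_mono[OF _ X])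
      show "integrable M (\<lambda>\<omega>. t powr r * (1 + r * (\<bar>X \<omega>\<bar> / t - 1)))" using i by auto
      fix \<omega>
      have "t powr r * (1 + r * (\<bar>X \<omega>\<bar> / t - 1)) \<le> t powr r * (\<bar>X \<omega>\<bar> / t) powr r"
        using t r by (intro mult_left_mono powr_ge_tangent) auto
      also have "\<dots> = \<bar>X \<omega>\<bar> powr r" using t by (simp add: powr_mult[symmetric])
      finally show "t powr r * (1 + r * (\<bar>X \<omega>\<bar> / t - 1)) \<le> \<bar>X \<omega>\<bar> powr r" .
    qed
    also have "expectation (\<lambda>\<omega>. t powr r * (1 + r * (\<bar>X \<omega>\<bar> / t - 1))) = t powr r"
      using i t by (simp add: prob_space t_def[symmetric])
    finally show ?thesis using le r powr_mono2[of r "\<bar>expectation X\<bar>" t] by simp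
  qed
qed

lemma exp_approx_quadratic:
  fixes w :: complex
  assumes "norm w \<le> 1"
  shows "norm (1 + w - exp w) \<le> 3 * (norm w)\<^sup>2"
proof -
  have "norm (exp w - (\<Sum>k\<le>1. w ^ k / fact k)) \<le> exp \<bar>Re w\<bar> * norm w ^ Suc 1 / fact 1"
    by (rule Taylor_exp)
  also have "exp \<bar>Re w\<bar> \<le> 3"
    using abs_Re_le_cmod[of w] assms exp_le by (meson exp_le_cancel_iff order_trans)
  finally have "norm (exp w - (1 + w)) \<le> 3 * (norm w)\<^sup>2"
    by (simp add: numeral_2_eq_2 mult_right_mono)
  thus ?thesis by (simp add: norm_minus_commute)
qed

lemma gaussian_moment:
  fixes r c s :: real
  assumes r: "r \<ge> 0"
  defines "L \<equiv> distr std_normal_distribution borel (\<lambda>x. c + s * x)"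
  shows "real_distribution L"
    and "\<exists>A\<ge>0. (\<integral>\<^sup>+x. ennreal (\<bar>x\<bar> powr r) \<partial>L) \<le> ennreal A"
    and "char L u = iexp (u * c) * exp (- (complex_of_real (s\<^sup>2 * u\<^sup>2 / 2)))"
proof -
  interpret N: real_distribution std_normal_distribution by (rule real_dist_normal_dist)
  show "real_distribution L"
    unfolding real_distribution_def real_distribution_axioms_def L_def by (auto intro!: N.prob_space_distr)
  obtain k :: nat where k: "r \<le> real (2 * k)"
  proof -
    obtain k :: nat where "r / 2 \<le> real k" using real_arch_simple by blast
    thus ?thesis by (intro that[of k]) simp
  qed
  have "integrable std_normal_distribution (\<lambda>x. \<bar>x\<bar> powr real (2 * k))"
  proof -
    \<comment> \<open>At \<open>x = 0\<close> and \<open>k = 0\<close> the real power is 0 but the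
      natural power is 1, hence the case distinction.\<close>
    have "\<bar>x\<bar> powr real (2 * k) = (if x = 0 then 0 else x ^ (2 * k))" for x :: real
      using powr_realpow[of "\<bar>x\<bar>" "2 * k"] by (simp add: power_even_abs del: of_nat_mult)
    moreover have "integrable std_normal_distribution (\<lambda>x. if x = 0 then 0 else x ^ (2 * k))"
      by (rule Bochner_Integration.integrable_bound[OF integrable_std_normal_distribution_moment[of "2 * k"]]) auto
    ultimately show ?thesis by simp
  qed
  from N.moment_integrable_mono[OF _ this r k]
  have "integrable std_normal_distribution (\<lambda>x. \<bar>s\<bar> powr r * \<bar>x\<bar> powr r)"
    by (intro integrable_mult_right) simp
  hence "integrable std_normal_distribution (\<lambda>x. \<bar>s * x\<bar> powr r)"
    by (simp only: abs_mult powr_mult abs_ge_zero)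
  hence "integrable std_normal_distribution (\<lambda>x. \<bar>c + s * x\<bar> powr r)"
    using r by (intro N.moment_add_integrable) auto
  hence "(\<integral>\<^sup>+x. ennreal (\<bar>c + s * x\<bar> powr r) \<partial>std_normal_distribution) = ennreal (LINT x|std_normal_distribution. \<bar>c + s * x\<bar> powr r)"
    by (intro nn_integral_eq_integral) auto
  hence "(\<integral>\<^sup>+x. ennreal (\<bar>x\<bar> powr r) \<partial>L) = ennreal (LINT x|std_normal_distribution. \<bar>c + s * x\<bar> powr r)"
    unfolding L_def by (subst nn_integral_distr) auto
  thus "\<exists>A\<ge>0. (\<integral>\<^sup>+x. ennreal (\<bar>x\<bar> powr r) \<partial>L) \<le> ennreal A"
    by (intro exI[of _ "LINT x|std_normal_distribution. \<bar>c + s * x\<bar> powr r"]) simp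
  have "char L u = (CLINT x|std_normal_distribution. iexp (u * c) * iexp ((u * s) * x))"
    unfolding char_def L_def by (subst integral_distr) (auto simp: exp_add[symmetric] algebra_simps)
  also have "\<dots> = iexp (u * c) * char std_normal_distribution (u * s)"
    by (simp add: char_def)
  also have "char std_normal_distribution (u * s) = exp (- (complex_of_real (s\<^sup>2 * u\<^sup>2 / 2)))"
    unfolding char_std_normal_distribution by (simp add: power_mult_distrib mult.commute exp_of_real[symmetric])
  finally show "char L u = iexp (u * c) * exp (- (complex_of_real (s\<^sup>2 * u\<^sup>2 / 2)))" .
qed

section \<open>Moments of weak limits and of Levy laws\<close>

text \<open>Truncated at height \<open>T\<close>, the power is bounded and continuous, so its
  integrals pass to the weak limit; Fatou then removes the truncation.\<close>

lemma weak_limit_moment: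
  assumes \<mu>: "\<And>n. real_distribution (\<mu> n)" "real_distribution \<mu>'" and char: "\<And>t. (\<lambda>n. char (\<mu> n) t) \<longlonglongrightarrow> char \<mu>' t"
    and r: "r > 0" and K: "K \<ge> 0" and m: "\<And>n. (\<integral>\<^sup>+x. ennreal (\<bar>x\<bar> powr r) \<partial>\<mu> n) \<le> ennreal K"
  shows "(\<integral>\<^sup>+x. ennreal (\<bar>x\<bar> powr r) \<partial>\<mu>') \<le> ennreal K"
proof -
  interpret \<mu>: real_distribution "\<mu> n" for n by (rule \<mu>(1))
  interpret \<mu>': real_distribution \<mu>' by (rule \<mu>(2))
  have w: "weak_conv_m \<mu> \<mu>'" using \<mu> char by (rule levy_continuity)
  let ?f = "\<lambda>T x. min (\<bar>x\<bar> powr r) (real T)"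
  have fm [measurable]: "?f T \<in> borel_measurable borel" for T by measurable
  have T: "(\<integral>\<^sup>+x. ennreal (?f T x) \<partial>\<mu>') \<le> ennreal K" for T :: nat
  proof -
    have "(\<lambda>n. LINT x|\<mu> n. ?f T x) \<longlonglongrightarrow> (LINT x|\<mu>'. ?f T x)"
    proof (rule weak_conv_imp_integral_bdd_continuous_conv[OF \<mu> w])
      show "isCont (?f T) x" for x using r by (intro continuous_intros) (auto)
      show "norm (?f T x) \<le> real T" for x by simp
    qed
    moreover have "(LINT x|\<mu> n. ?f T x) \<le> K" for n
    proof -
      have "ennreal (LINT x|\<mu> n. ?f T x) = (\<integral>\<^sup>+x. ennreal (?f T x) \<partial>\<mu> n)"
        by (intro nn_integral_eq_integral[symmetric] \<mu>.integrable_const_bound[of _ "real T"]) auto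
      also have "\<dots> \<le> (\<integral>\<^sup>+x. ennreal (\<bar>x\<bar> powr r) \<partial>\<mu> n)" by (intro nn_integral_mono ennreal_leI) simp
      also note m
      finally show ?thesis using K by simp
    qed
    ultimately have "(LINT x|\<mu>'. ?f T x) \<le> K" by (intro LIMSEQ_le_const2) auto
    moreover have "(\<integral>\<^sup>+x. ennreal (?f T x) \<partial>\<mu>') = ennreal (LINT x|\<mu>'. ?f T x)"
      by (intro nn_integral_eq_integral \<mu>'.integrable_const_bound[of _ "real T"]) auto
    ultimately show ?thesis by (simp add: ennreal_leI)
  qed
  have "(\<integral>\<^sup>+x. ennreal (\<bar>x\<bar> powr r) \<partial>\<mu>') = (\<integral>\<^sup>+x. liminf (\<lambda>T. ennreal (?f T x)) \<partial>\<mu>')"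
  proof (rule nn_integral_cong)
    fix x :: real
    obtain T0 :: nat where T0: "\<bar>x\<bar> powr r \<le> real T0" using real_arch_simple by blast
    have "eventually (\<lambda>T. ennreal (\<bar>x\<bar> powr r) = ennreal (?f T x)) sequentially"
      using eventually_ge_at_top[of T0] by eventually_elim (use T0 in simp)
    hence "(\<lambda>T. ennreal (?f T x)) \<longlonglongrightarrow> ennreal (\<bar>x\<bar> powr r)"
      by (rule Lim_transform_eventually[OF tendsto_const])
    thus "ennreal (\<bar>x\<bar> powr r) = liminf (\<lambda>T. ennreal (?f T x))"
      using lim_imp_Liminf[OF trivial_limit_sequentially] by metis
  qed
  also have "\<dots> \<le> liminf (\<lambda>T. \<integral>\<^sup>+x. ennreal (?f T x) \<partial>\<mu>')" by (intro nn_integral_liminf) simp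
  also have "\<dots> \<le> ennreal K" using T by (intro Liminf_le) auto
  finally show ?thesis .
qed

text \<open>A finite second moment of \<nu> permits compensating all jumps, not only those below 1.
  Cutting off small jumps leaves a finite measure; time \<open>h\<close> is divided into
  \<open>n m\<close> steps, each with at most one jump and each centred separately. A step then has
  second and \<open>r\<close>-th moments of order \<open>1 / n m\<close>, exactly the scaling for
  which \<open>conv_power_moment\<close> is uniform in \<open>m\<close>.\<close>

lemma levy_moment:
  fixes \<mu> \<nu> :: "real measure" and h b s r :: real
  assumes \<mu>: "real_distribution \<mu>" and \<nu>: "levy_measure \<nu>" and h: "h > 0" and s: "s \<ge> 0" and r: "r \<ge> 2"
    and big: "(\<integral>\<^sup>+ x. ennreal (indicator {x. \<bar>x\<bar> \<ge> 1} x * \<bar>x\<bar> powr r) \<partial>\<nu>) < \<infinity>"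
    and char: "\<And>u. char \<mu> u = exp (of_real h * levy_exponent b s \<nu> u)"
  shows "(\<integral>\<^sup>+x. ennreal (\<bar>x\<bar> powr r) \<partial>\<mu>) < \<infinity>"
proof -
  have sets [measurable_cong]: "sets \<nu> = sets borel" using \<nu> by (simp add: levy_measure_def)
  have small: "(\<integral>\<^sup>+ x. ennreal (min 1 (x\<^sup>2)) \<partial>\<nu>) < \<infinity>" using \<nu> by (simp add: levy_measure_def)
  let ?B = "{x::real. \<bar>x\<bar> \<ge> 1}"
  have Ir: "integrable \<nu> (\<lambda>x. indicator ?B x * \<bar>x\<bar> powr r)"
    using big by (intro integrableI_nonneg) auto
  have I2: "integrable \<nu> (\<lambda>x. x\<^sup>2)"
  proof (rule Bochner_Integration.integrable_bound)
    have "integrable \<nu> (\<lambda>x. min 1 (x\<^sup>2))" using small by (intro integrableI_nonneg) auto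
    thus "integrable \<nu> (\<lambda>x. min 1 (x\<^sup>2) + indicator ?B x * \<bar>x\<bar> powr r)" using Ir by (rule Bochner_Integration.integrable_add)
    show "AE x in \<nu>. norm (x\<^sup>2) \<le> norm (min 1 (x\<^sup>2) + indicator ?B x * \<bar>x\<bar> powr r)"
    proof (rule AE_I2)
      fix x :: real
      show "norm (x\<^sup>2) \<le> norm (min 1 (x\<^sup>2) + indicator ?B x * \<bar>x\<bar> powr r)"
      proof (cases "\<bar>x\<bar> \<ge> 1")
        case True
        hence "x\<^sup>2 \<le> \<bar>x\<bar> powr r" using powr_mono[of 2 r "\<bar>x\<bar>"] r by simp
        thus ?thesis using True by (simp add: add_increasing)
      next
        case False
        hence "x\<^sup>2 \<le> 1" by (simp add: abs_square_le_1)
        thus ?thesis using False by simp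
      qed
    qed
  qed simp
  define M2 where "M2 = (LINT x|\<nu>. x\<^sup>2)"
  define Mr where "Mr = (LINT x|\<nu>. indicator ?B x * \<bar>x\<bar> powr r)"
  have M0: "M2 \<ge> 0" "Mr \<ge> 0" by (simp_all add: M2_def Mr_def)
  have I1: "integrable \<nu> (\<lambda>x. indicator ?B x * x)"
  proof (rule Bochner_Integration.integrable_bound[OF I2])
    show "AE x in \<nu>. norm (indicator ?B x * x) \<le> norm (x\<^sup>2)"
    proof (rule AE_I2)
      fix x :: real
      show "norm (indicator ?B x * x) \<le> norm (x\<^sup>2)"
        using mult_left_mono[of 1 "\<bar>x\<bar>" "\<bar>x\<bar>"] by (auto simp: indicator_def power2_eq_square abs_mult)
    qed
  qed simp
  define m1 where "m1 = (LINT x|\<nu>. indicator ?B x * x)"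
  \<comment> \<open>The integrand with all jumps compensated; the mean \<open>m1\<close> of the
    large jumps moves into the drift \<open>c0\<close> in return.\<close>
  define g :: "real \<Rightarrow> real \<Rightarrow> complex" where "g u x = iexp (u * x) - 1 - \<i> * of_real (u * x)" for u x
  have g_le: "norm (g u x) \<le> u\<^sup>2 * x\<^sup>2" for u x
  proof -
    have "norm (g u x) \<le> \<bar>u * x\<bar> ^ Suc 1 / fact (Suc 1)"
      using iexp_approx1[of "u * x" 1] by (simp add: g_def algebra_simps)
    also have "\<dots> = (u\<^sup>2 * x\<^sup>2) / 2"
      by (simp add: power_mult_distrib abs_mult power2_eq_square[symmetric] numeral_2_eq_2[symmetric])
    also have "\<dots> \<le> u\<^sup>2 * x\<^sup>2" by simp
    finally show ?thesis .
  qed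
  have [measurable]: "g u \<in> borel_measurable borel" for u unfolding g_def[abs_def] by measurable
  have Ig: "integrable \<nu> (g u)" for u
    by (rule Bochner_Integration.integrable_bound[OF integrable_mult_right[OF I2, of "u\<^sup>2"]])
      (use g_le in auto)
  define \<Psi> where "\<Psi> u = (CLINT x|\<nu>. g u x)" for u
  define c0 where "c0 = h * (b + m1)"
  have exponent: "of_real h * levy_exponent b s \<nu> u = \<i> * of_real (u * c0) - of_real (h * s * u\<^sup>2 / 2) + of_real h * \<Psi> u" for u
  proof -
    have "(CLINT x|\<nu>. iexp (u * x) - 1 - \<i> * of_real (u * x * indicator {-1<..<1} x)) =
      (CLINT x|\<nu>. g u x + (\<i> * of_real u) * of_real (indicator ?B x * x))"
      by (intro Bochner_Integration.integral_cong refl) (auto simp: g_def indicator_def algebra_simps abs_if split: if_splits)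
    also have "\<dots> = \<Psi> u + (\<i> * of_real u) * of_real m1"
    proof -
      have "integrable \<nu> (\<lambda>x. (\<i> * of_real u) * complex_of_real (indicator ?B x * x))"
        using I1 by (intro integrable_mult_right integrable_of_real)
      from Bochner_Integration.integral_add[OF Ig this] show ?thesis
        by (simp only: \<Psi>_def m1_def integral_mult_right_zero integral_complex_of_real)
    qed
    finally show ?thesis unfolding levy_exponent_def c0_def by (simp add: algebra_simps)
  qed
  define E where "E m = {x::real. 1 / real (Suc m) \<le> \<bar>x\<bar>}" for m :: nat
  have [measurable]: "E m \<in> sets borel" for m unfolding E_def by measurable
  have E_fin: "emeasure \<nu> (E m) < \<infinity>" for m
  proof -
    have "emeasure \<nu> (E m) = (\<integral>\<^sup>+x. indicator (E m) x \<partial>\<nu>)" by simp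
    also have "\<dots> \<le> (\<integral>\<^sup>+x. ennreal ((real (Suc m))\<^sup>2 * x\<^sup>2) \<partial>\<nu>)"
    proof (rule nn_integral_mono)
      fix x :: real
      have "1 \<le> (real (Suc m))\<^sup>2 * x\<^sup>2" if "x \<in> E m"
      proof -
        have "1 \<le> real (Suc m) * \<bar>x\<bar>" using that by (simp add: E_def field_simps)
        hence "1\<^sup>2 \<le> (real (Suc m) * \<bar>x\<bar>)\<^sup>2" by (intro power_mono) auto
        thus ?thesis by (simp add: power_mult_distrib)
      qed
      thus "indicator (E m) x \<le> ennreal ((real (Suc m))\<^sup>2 * x\<^sup>2)"
        by (cases "x \<in> E m") (auto simp: ennreal_1[symmetric] simp del: ennreal_1 intro!: ennreal_leI)
    qed
    also have "\<dots> < \<infinity>"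
      using integrable_mult_right[OF I2, of "(real (Suc m))\<^sup>2"] by (subst nn_integral_eq_integral) auto
    finally show ?thesis .
  qed
  define lam where "lam m = h * measure \<nu> (E m)" for m
  have lam0: "lam m \<ge> 0" for m using h by (simp add: lam_def)
  \<comment> \<open>With this many steps \<open>(lam m)\<^sup>2 / n m\<close> is at most
    \<open>1 / Suc m\<close>, which drives the exponential approximation, and
    \<open>1 + 2 * lam m \<le> n m\<close>, which keeps the jump probability and the norm of
    \<open>w m\<close> below 1.\<close>
  define n where "n m = nat \<lceil>real (Suc m) * (1 + lam m)\<^sup>2\<rceil>" for m
  have n_ge: "real (n m) \<ge> real (Suc m) * (1 + lam m)\<^sup>2" for m
    unfolding n_def by (rule real_nat_ceiling_ge)
  have n_ge': "real (n m) \<ge> 1 + 2 * lam m" for m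
  proof -
    have "1 + 2 * lam m \<le> 1 * (1 + lam m)\<^sup>2" by (simp add: power2_eq_square algebra_simps)
    also have "\<dots> \<le> real (Suc m) * (1 + lam m)\<^sup>2" by (intro mult_right_mono) auto
    finally show ?thesis using n_ge[of m] by linarith
  qed
  have n1: "real (n m) \<ge> 1" "n m \<ge> 1" "real (n m) > 0" for m using n_ge'[of m] lam0[of m] by linarith+
  define t where "t m = h / real (n m)" for m
  have t: "0 \<le> t m" "t m * measure \<nu> (E m) \<le> 1" for m
  proof -
    show "0 \<le> t m" using h by (simp add: t_def)
    have "lam m \<le> real (n m)" using n_ge'[of m] lam0[of m] by linarith
    thus "t m * measure \<nu> (E m) \<le> 1" using n1(3)[of m] by (simp add: t_def lam_def)
  qed
  define p' where "p' m = jump_law (t m) \<nu> (E m)" for m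
  note jump = t E_fin sets
  have p'[simp]: "real_distribution (p' m)" for m
    unfolding p'_def by (rule real_distribution_jump_law) (use jump in auto)
  interpret p': real_distribution "p' m" for m by (rule p')
  have Er: "indicator (E m) x * \<bar>x\<bar> powr r \<le> x\<^sup>2 + indicator ?B x * \<bar>x\<bar> powr r" for m and x :: real
  proof (cases "\<bar>x\<bar> \<ge> 1")
    case False
    have "\<bar>x\<bar> powr r \<le> \<bar>x\<bar> powr 2" using False r by (intro powr_mono') auto
    thus ?thesis using False by (auto simp: indicator_def)
  qed (auto simp: indicator_def)
  have IEr: "integrable \<nu> (\<lambda>x. indicator (E m) x * \<bar>x\<bar> powr r)" for m
    by (rule Bochner_Integration.integrable_bound[OF Bochner_Integration.integrable_add[OF I2 Ir]])
      (use Er in \<open>auto simp: sets\<close>)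
  have pr: "integrable (p' m) (\<lambda>x. \<bar>x\<bar> powr r)" "(LINT x|p' m. \<bar>x\<bar> powr r) \<le> t m * (M2 + Mr)" for m
  proof -
    note * = integrable_jump_law[where f = "\<lambda>x. \<bar>x\<bar> powr r"] integral_jump_law[where f = "\<lambda>x. \<bar>x\<bar> powr r"]
    show "integrable (p' m) (\<lambda>x. \<bar>x\<bar> powr r)"
      unfolding p'_def by (rule *(1)) (use jump IEr in auto)
    have "(LINT x|p' m. \<bar>x\<bar> powr r) = t m * (LINT x|\<nu>. indicator (E m) x * \<bar>x\<bar> powr r)"
      unfolding p'_def by (subst *(2)) (use jump IEr in auto)
    also have "(LINT x|\<nu>. indicator (E m) x * \<bar>x\<bar> powr r) \<le> M2 + Mr"
    proof -
      have "(LINT x|\<nu>. indicator (E m) x * \<bar>x\<bar> powr r) \<le> (LINT x|\<nu>. x\<^sup>2 + indicator ?B x * \<bar>x\<bar> powr r)"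
        by (rule integral_mono[OF IEr Bochner_Integration.integrable_add[OF I2 Ir] Er])
      also have "\<dots> = M2 + Mr"
        unfolding M2_def Mr_def by (rule Bochner_Integration.integral_add[OF I2 Ir])
      finally show ?thesis .
    qed
    finally show "(LINT x|p' m. \<bar>x\<bar> powr r) \<le> t m * (M2 + Mr)" using t by (simp add: mult_left_mono)
  qed
  have p2: "integrable (p' m) (\<lambda>x. x\<^sup>2)" "(LINT x|p' m. x\<^sup>2) \<le> t m * M2" for m
  proof -
    have i: "integrable \<nu> (\<lambda>x. indicator (E m) x *\<^sub>R x\<^sup>2)"
      using I2 by (intro integrable_mult_indicator) (auto simp: sets)
    note * = integrable_jump_law[where f = "\<lambda>x. x\<^sup>2"] integral_jump_law[where f = "\<lambda>x. x\<^sup>2"]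
    show "integrable (p' m) (\<lambda>x. x\<^sup>2)"
      unfolding p'_def by (rule *(1)) (use jump i in auto)
    have "(LINT x|p' m. x\<^sup>2) = t m * (LINT x|\<nu>. indicator (E m) x *\<^sub>R x\<^sup>2)"
      unfolding p'_def by (subst *(2)) (use jump i in auto)
    also have "(LINT x|\<nu>. indicator (E m) x *\<^sub>R x\<^sup>2) \<le> M2"
      unfolding M2_def using i I2 by (intro integral_mono) (auto simp: indicator_def)
    finally show "(LINT x|p' m. x\<^sup>2) \<le> t m * M2" using t by (simp add: mult_left_mono)
  qed
  have p1: "integrable (p' m) (\<lambda>x. x)" for m
    using p'.moment_integrable_mono[OF _ pr(1), of _ 1] r by (simp add: integrable_abs_iff)
  define \<mu>1 where "\<mu>1 m = (LINT x|p' m. x)" for m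
  define p where "p m = distr (p' m) borel (\<lambda>x. x - \<mu>1 m)" for m
  have p: "real_distribution (p m)" for m
    unfolding p_def real_distribution_def real_distribution_axioms_def by (auto intro!: p'.prob_space_distr)
  \<comment> \<open>Centring costs a factor \<open>2 powr r\<close> from the power of a sum and
    another 2 because, by Jensen, the power of the mean is at most the moment.\<close>
  define c where "c = 2 powr (r + 1) * h * (M2 + Mr)"
  have c0': "c \<ge> 0" using h M0 by (simp add: c_def)
  have ipc: "integrable (p' m) (\<lambda>x. \<bar>x - \<mu>1 m\<bar> powr r)" for m
    using p'.moment_add_integrable[of "\<lambda>x. x" m "\<lambda>x. - \<mu>1 m" r] pr(1) r by simp
  have ip: "integrable (p m) (\<lambda>x. \<bar>x\<bar> powr r)" for m
    unfolding p_def using ipc by (subst integrable_distr_eq) auto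
  have mean: "(LINT x|p m. x) = 0" for m
  proof -
    have "(LINT x|p m. x) = (LINT x|p' m. x - \<mu>1 m)"
      unfolding p_def by (subst integral_distr) auto
    also have "\<dots> = (LINT x|p' m. x) - (LINT x|p' m. \<mu>1 m)"
      by (rule Bochner_Integration.integral_diff[OF p1]) simp
    also have "\<dots> = 0"
      by (simp add: p'.prob_space[unfolded p'.space_eq_univ] flip: \<mu>1_def)
    finally show ?thesis .
  qed
  have tc: "t m * (M2 + Mr) * 2 powr (r + 1) = c / n m" for m
    by (simp add: t_def c_def)
  have var: "(LINT x|p m. x\<^sup>2) \<le> c / n m" for m
  proof -
    have "(LINT x|p m. x\<^sup>2) = (LINT x|p' m. (x - \<mu>1 m)\<^sup>2)"
      unfolding p_def by (subst integral_distr) auto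
    also have "\<dots> = (LINT x|p' m. x\<^sup>2 - 2 * \<mu>1 m * x + (\<mu>1 m)\<^sup>2)"
      by (simp add: power2_diff algebra_simps)
    also have "\<dots> = (LINT x|p' m. x\<^sup>2) - (\<mu>1 m)\<^sup>2"
      using p1 p2(1) by (simp add: \<mu>1_def[symmetric] p'.prob_space[unfolded p'.space_eq_univ] power2_eq_square)
    also have "\<dots> \<le> t m * M2 * 1"
      using p2(2)[of m] zero_le_power2[of "\<mu>1 m"] unfolding mult_1_right by linarith
    also have "\<dots> \<le> t m * (M2 + Mr) * 2 powr (r + 1)"
      using t M0 r by (intro mult_mono mult_left_mono) (auto intro!: ge_one_powr_ge_zero)
    finally show ?thesis by (simp add: tc)
  qed
  have mr: "(LINT x|p m. \<bar>x\<bar> powr r) \<le> c / n m" for m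
  proof -
    have "(LINT x|p m. \<bar>x\<bar> powr r) = (LINT x|p' m. \<bar>x - \<mu>1 m\<bar> powr r)"
      unfolding p_def by (subst integral_distr) auto
    also have "\<dots> \<le> (LINT x|p' m. 2 powr r * (\<bar>x\<bar> powr r + \<bar>\<mu>1 m\<bar> powr r))"
    proof (rule integral_mono[OF ipc])
      fix x
      have "\<bar>x - \<mu>1 m\<bar> powr r \<le> (\<bar>x\<bar> + \<bar>\<mu>1 m\<bar>) powr r"
        using r by (intro powr_mono2) auto
      also have "\<dots> \<le> 2 powr r * (\<bar>x\<bar> powr r + \<bar>\<mu>1 m\<bar> powr r)" using r by (intro powr_add_le) auto
      finally show "\<bar>x - \<mu>1 m\<bar> powr r \<le> 2 powr r * (\<bar>x\<bar> powr r + \<bar>\<mu>1 m\<bar> powr r)" .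
    qed (use pr(1) in auto)
    also have "\<dots> = 2 powr r * ((LINT x|p' m. \<bar>x\<bar> powr r) + \<bar>\<mu>1 m\<bar> powr r)"
      using pr(1) by (simp add: p'.prob_space[unfolded p'.space_eq_univ])
    also have "\<dots> \<le> 2 powr r * ((LINT x|p' m. \<bar>x\<bar> powr r) + (LINT x|p' m. \<bar>x\<bar> powr r))"
      unfolding \<mu>1_def using r pr(1) by (intro mult_left_mono add_left_mono p'.abs_expectation_powr_le) auto
    also have "\<dots> = 2 powr (r + 1) * (LINT x|p' m. \<bar>x\<bar> powr r)" by (simp add: powr_add)
    also have "\<dots> \<le> 2 powr (r + 1) * (t m * (M2 + Mr))" using pr(2) by (intro mult_left_mono) auto
    finally show ?thesis by (simp add: tc[symmetric] mult_ac)
  qed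
  define L where "L = distr std_normal_distribution borel (\<lambda>x. c0 + sqrt (h * s) * x)"
  have L: "real_distribution L" and charL: "char L u = iexp (u * c0) * exp (- (complex_of_real (h * s * u\<^sup>2 / 2)))" for u
    unfolding L_def using gaussian_moment(1,3)[of r c0 "sqrt (h * s)"] r h s by auto
  obtain A0 where A0: "A0 \<ge> 0" "(\<integral>\<^sup>+x. ennreal (\<bar>x\<bar> powr r) \<partial>L) \<le> ennreal A0"
    unfolding L_def using gaussian_moment(2)[of r c0 "sqrt (h * s)"] r by auto
  obtain C where C: "C > 0" "\<And>L p c A0 (n::nat).
     \<lbrakk>real_distribution L; real_distribution p; n \<ge> 1; c \<ge> 0; A0 \<ge> 0;
      (\<integral>\<^sup>+x. ennreal (\<bar>x\<bar> powr r) \<partial>L) \<le> ennreal A0; integrable p (\<lambda>y. \<bar>y\<bar> powr r); (LINT y|p. y) = 0;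
      (LINT y|p. y\<^sup>2) \<le> c / n; (LINT y|p. \<bar>y\<bar> powr r) \<le> c / n\<rbrakk>
     \<Longrightarrow> (\<integral>\<^sup>+x. ennreal (\<bar>x\<bar> powr r) \<partial>conv_power L p n) \<le> ennreal (exp (C * c) * (A0 + 2 * (C * c)))"
    using conv_power_moment[OF r] by blast
  define X where "X m = conv_power L (p m) (n m)" for m
  have X: "real_distribution (X m)" for m unfolding X_def by (rule real_distribution_conv_power[OF L p])
  define K where "K = exp (C * c) * (A0 + 2 * (C * c))"
  have K: "K \<ge> 0" using A0 C(1) c0' by (simp add: K_def)
  have mX: "(\<integral>\<^sup>+x. ennreal (\<bar>x\<bar> powr r) \<partial>X m) \<le> ennreal K" for m
    unfolding X_def K_def by (rule C(2)[OF L p n1(2) c0' A0 ip mean var mr])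
  have conv: "(\<lambda>m. char (X m) u) \<longlonglongrightarrow> char \<mu> u" for u
  proof -
    \<comment> \<open>The first-order exponent of one step before centring, whose characteristic
      function is exactly \<open>1 + w m\<close>.\<close>
    define w where "w m = t m *\<^sub>R (CLINT x|\<nu>. indicator (E m) x *\<^sub>R (iexp (u * x) - 1))" for m
    define \<Psi>m where "\<Psi>m m = (CLINT x|\<nu>. indicator (E m) x *\<^sub>R g u x)" for m
    have iE1: "integrable \<nu> (\<lambda>x. indicator (E m) x *\<^sub>R x)" for m
    proof (rule Bochner_Integration.integrable_bound[OF integrable_mult_right[OF I2, of "real (Suc m)"]])
      show "AE x in \<nu>. norm (indicator (E m) x *\<^sub>R x) \<le> norm (real (Suc m) * x\<^sup>2)"
      proof (rule AE_I2)
        fix x :: real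
        have "\<bar>x\<bar> \<le> real (Suc m) * x\<^sup>2" if "x \<in> E m"
        proof -
          have "1 \<le> real (Suc m) * \<bar>x\<bar>" using that by (simp add: E_def field_simps)
          from mult_right_mono[OF this, of "\<bar>x\<bar>"] show ?thesis by (simp add: power2_eq_square mult.assoc)
        qed
        thus "norm (indicator (E m) x *\<^sub>R x) \<le> norm (real (Suc m) * x\<^sup>2)" by (cases "x \<in> E m") auto
      qed
    qed (auto simp: sets)
    have iEbdd: "integrable \<nu> (\<lambda>x. indicator (E m) x *\<^sub>R f x)" if [measurable]: "f \<in> borel_measurable borel" and "\<And>x. norm (f x) \<le> 2"
      for m and f :: "real \<Rightarrow> complex"
      using E_fin that by (intro integrableI_bounded_set_indicator[of _ _ _ 2]) (auto simp: sets)
    have le2: "norm (iexp (u * x) - 1) \<le> 2" for x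
      using norm_triangle_ineq4[of "iexp (u * x)" 1] by simp
    have cp': "char (p' m) u = 1 + w m" for m
    proof -
      have A: "char (p' m) u = t m *\<^sub>R (CLINT x|\<nu>. indicator (E m) x *\<^sub>R iexp (u * x)) + (1 - t m * measure \<nu> (E m)) *\<^sub>R 1"
        unfolding char_def p'_def by (subst integral_jump_law) (use jump in \<open>auto intro!: iEbdd\<close>)
      have "(CLINT x|\<nu>. indicator (E m) x *\<^sub>R (iexp (u * x) - 1)) =
          (CLINT x|\<nu>. indicator (E m) x *\<^sub>R iexp (u * x)) - (CLINT x|\<nu>. indicator (E m) x *\<^sub>R 1)"
        unfolding scaleR_diff_right by (intro Bochner_Integration.integral_diff iEbdd) auto
      moreover have "(CLINT x|\<nu>. indicator (E m) x *\<^sub>R 1) = measure \<nu> (E m)"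
        using E_fin[of m] by (subst integral_scaleR_left) (auto simp: sets scaleR_conv_of_real)
      ultimately have W: "(CLINT x|\<nu>. indicator (E m) x *\<^sub>R (iexp (u * x) - 1)) =
          (CLINT x|\<nu>. indicator (E m) x *\<^sub>R iexp (u * x)) - measure \<nu> (E m)" by (simp only:)
      show ?thesis
        unfolding A w_def W by (simp add: scaleR_conv_of_real right_diff_distrib)
    qed
    have cp: "char (p m) u = iexp (- (u * \<mu>1 m)) * (1 + w m)" for m
    proof -
      have "char (p m) u = (CLINT x|p' m. iexp (- (u * \<mu>1 m)) * iexp (u * x))"
        unfolding char_def p_def by (subst integral_distr) (auto simp: exp_add[symmetric] algebra_simps)
      also have "\<dots> = iexp (- (u * \<mu>1 m)) * char (p' m) u" by (simp add: char_def)
      finally show ?thesis by (simp add: cp')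
    qed
    have iE: "integrable \<nu> (\<lambda>x. indicator (E m) x *\<^sub>R (iexp (u * x) - 1))" for m by (intro iEbdd le2) auto
    have w_le: "norm (w m) \<le> 2 * lam m / n m" for m
    proof -
      have "norm (CLINT x|\<nu>. indicator (E m) x *\<^sub>R (iexp (u * x) - 1)) \<le> (LINT x|\<nu>. indicator (E m) x *\<^sub>R 2)"
      proof (rule order_trans[OF integral_norm_bound integral_mono])
        show "integrable \<nu> (\<lambda>x. norm (indicator (E m) x *\<^sub>R (iexp (u * x) - 1)))" using iE by (rule integrable_norm)
        show "integrable \<nu> (\<lambda>x. indicator (E m) x *\<^sub>R (2::real))"
          using E_fin[of m] by (intro integrable_scaleR_left integrable_real_indicator) (auto simp: sets)
        show "norm (indicator (E m) x *\<^sub>R (iexp (u * x) - 1)) \<le> indicator (E m) x *\<^sub>R 2" for x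
          using le2[of x] by (simp add: indicator_def)
      qed
      also have "\<dots> = 2 * measure \<nu> (E m)" using E_fin[of m] by (subst integral_scaleR_left) (auto simp: sets)
      finally have "t m * norm (CLINT x|\<nu>. indicator (E m) x *\<^sub>R (iexp (u * x) - 1)) \<le> t m * (2 * measure \<nu> (E m))"
        using t by (intro mult_left_mono) auto
      thus ?thesis using h by (simp add: w_def t_def lam_def mult_ac)
    qed
    have w1: "norm (w m) \<le> 1" for m
    proof -
      have "2 * lam m / n m \<le> 1" using n_ge'[of m] n1[of m] by (simp add: field_simps)
      thus ?thesis using w_le[of m] by linarith
    qed
    \<comment> \<open>With nonpositive real part, \<open>exp (w m)\<close> lies in the unit disc, as
      does the characteristic function \<open>1 + w m\<close>. Hence \<open>n\<close>-th powers
      differ by at most \<open>n\<close> times the difference of the bases.\<close>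
    have Re_w: "Re (w m) \<le> 0" for m
    proof -
      have "Re (CLINT x|\<nu>. indicator (E m) x *\<^sub>R (iexp (u * x) - 1)) = (LINT x|\<nu>. Re (indicator (E m) x *\<^sub>R (iexp (u * x) - 1)))"
        using integral_Re[OF iE] by simp
      also have "\<dots> \<le> (LINT x|\<nu>. 0)"
      proof (rule integral_mono)
        show "integrable \<nu> (\<lambda>x. Re (indicator (E m) x *\<^sub>R (iexp (u * x) - 1)))" using iE by (rule integrable_Re)
      qed (auto simp: indicator_def Re_exp)
      also have "\<dots> = 0" by simp
      finally show ?thesis using t(1)[of m] by (simp add: w_def mult_nonneg_nonpos)
    qed
    have close: "norm ((1 + w m) ^ n m - exp (w m) ^ n m) \<le> 12 / real (Suc m)" for m
    proof -
      have "norm ((1 + w m) ^ n m - exp (w m) ^ n m) \<le> n m * norm (1 + w m - exp (w m))"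
        using p'.cmod_char_le_1[of m u] Re_w[of m] by (intro norm_power_diff) (auto simp: cp')
      also have "\<dots> \<le> n m * (3 * (norm (w m))\<^sup>2)"
        by (intro mult_left_mono exp_approx_quadratic w1) auto
      also have "\<dots> \<le> n m * (3 * (2 * lam m / n m)\<^sup>2)"
        using w_le by (intro mult_left_mono power_mono) auto
      also have "\<dots> = 12 * ((lam m)\<^sup>2 / n m)" using n1[of m] by (simp add: power2_eq_square field_simps)
      also have "(lam m)\<^sup>2 / n m \<le> 1 / real (Suc m)"
      proof -
        have "(lam m)\<^sup>2 * real (Suc m) \<le> (1 + lam m)\<^sup>2 * real (Suc m)"
          using lam0[of m] by (intro mult_right_mono power_mono) auto
        also have "\<dots> \<le> n m" using n_ge[of m] by (simp add: mult.commute)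
        finally show ?thesis using n1[of m] by (simp add: field_simps)
      qed
      finally show ?thesis by simp
    qed
    have mean_eq: "real (n m) * \<mu>1 m = h * (LINT x|\<nu>. indicator (E m) x *\<^sub>R x)" for m
    proof -
      have "\<mu>1 m = t m * (LINT x|\<nu>. indicator (E m) x *\<^sub>R x)"
        unfolding \<mu>1_def p'_def by (subst integral_jump_law) (use jump iE1 in auto)
      thus ?thesis using n1[of m] by (simp add: t_def)
    qed
    \<comment> \<open>The phases from centring sum up to the compensator: since
      \<open>n m * t m = h\<close>, they combine with the powers of \<open>exp (w m)\<close> into
      the compensated exponent restricted to \<open>E m\<close>.\<close>
    have prod: "iexp (- (u * \<mu>1 m)) ^ n m * exp (w m) ^ n m = exp (h * \<Psi>m m)" for m
    proof -
      have i2: "integrable \<nu> (\<lambda>x. \<i> * of_real u * of_real (indicator (E m) x *\<^sub>R x))"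
        using iE1[of m] by (intro integrable_mult_right integrable_of_real)
      have "\<Psi>m m = (CLINT x|\<nu>. indicator (E m) x *\<^sub>R (iexp (u * x) - 1) - \<i> * of_real u * of_real (indicator (E m) x *\<^sub>R x))"
        unfolding \<Psi>m_def by (intro Bochner_Integration.integral_cong) (auto simp: g_def indicator_def)
      also have "\<dots> = (CLINT x|\<nu>. indicator (E m) x *\<^sub>R (iexp (u * x) - 1)) - \<i> * of_real u * of_real (LINT x|\<nu>. indicator (E m) x *\<^sub>R x)"
        using iE i2 by (subst Bochner_Integration.integral_diff)
          (auto simp only: integral_mult_right_zero integral_complex_of_real)
      finally have \<Psi>_eq: "\<Psi>m m = (CLINT x|\<nu>. indicator (E m) x *\<^sub>R (iexp (u * x) - 1)) - \<i> * of_real u * of_real (LINT x|\<nu>. indicator (E m) x *\<^sub>R x)" .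
      define I J where "I = (CLINT x|\<nu>. indicator (E m) x *\<^sub>R (iexp (u * x) - 1))" and "J = (LINT x|\<nu>. indicator (E m) x *\<^sub>R x)"
      have "real (n m) * t m = h" using n1[of m] by (simp add: t_def)
      hence nt: "of_nat (n m) * complex_of_real (t m) = of_real h" by (metis of_real_mult of_real_of_nat_eq)
      have n\<mu>: "of_nat (n m) * complex_of_real (\<mu>1 m) = of_real h * of_real J"
        using mean_eq[of m] unfolding J_def[symmetric] by (metis of_real_mult of_real_of_nat_eq)
      have "of_nat (n m) * (\<i> * of_real (- (u * \<mu>1 m))) + of_nat (n m) * w m
          = (of_nat (n m) * of_real (t m)) * I - \<i> * of_real u * (of_nat (n m) * of_real (\<mu>1 m))"
        unfolding w_def I_def[symmetric] by (simp add: scaleR_conv_of_real)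
      also have "\<dots> = h * \<Psi>m m"
        unfolding nt n\<mu> \<Psi>_eq I_def[symmetric] J_def[symmetric] by (simp add: right_diff_distrib)
      finally show ?thesis by (simp only: exp_of_nat_mult[symmetric] exp_add[symmetric])
    qed
    have lim0: "(\<lambda>m. iexp (- (u * \<mu>1 m)) ^ n m * ((1 + w m) ^ n m - exp (w m) ^ n m)) \<longlonglongrightarrow> 0"
    proof (rule Lim_null_comparison)
      show "\<forall>\<^sub>F m in sequentially. norm (iexp (- (u * \<mu>1 m)) ^ n m * ((1 + w m) ^ n m - exp (w m) ^ n m)) \<le> 12 / real (Suc m)"
        using close by (intro always_eventually allI) (simp add: norm_mult norm_power)
      show "(\<lambda>m. 12 / real (Suc m)) \<longlonglongrightarrow> 0"
        using LIMSEQ_Suc[OF lim_const_over_n[of 12]] by simp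
    qed
    have lim\<Psi>: "\<Psi>m \<longlonglongrightarrow> \<Psi> u"
      unfolding \<Psi>m_def \<Psi>_def
    proof (rule integral_dominated_convergence)
      show "integrable \<nu> (\<lambda>x. norm (g u x))" using Ig by auto
      show "AE x in \<nu>. (\<lambda>m. indicator (E m) x *\<^sub>R g u x) \<longlonglongrightarrow> g u x"
      proof (rule AE_I2)
        fix x :: real
        show "(\<lambda>m. indicator (E m) x *\<^sub>R g u x) \<longlonglongrightarrow> g u x"
        proof (cases "x = 0")
          case True thus ?thesis by (simp add: g_def)
        next
          case False
          hence "0 < \<bar>x\<bar>" by simp
          then obtain k where k: "1 / real (Suc k) < \<bar>x\<bar>" using nat_approx_posE by blast
          have "eventually (\<lambda>m. g u x = indicator (E m) x *\<^sub>R g u x) sequentially"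
            using eventually_ge_at_top[of k]
          proof eventually_elim
            case (elim m)
            hence "1 / real (Suc m) \<le> 1 / real (Suc k)" by (simp add: field_simps)
            thus ?case using k by (simp add: E_def)
          qed
          thus ?thesis by (rule Lim_transform_eventually[OF tendsto_const])
        qed
      qed
      show "AE x in \<nu>. norm (indicator (E m) x *\<^sub>R g u x) \<le> norm (g u x)" for m
        by (auto simp: indicator_def)
    qed (auto simp: sets)
    have charX: "char (X m) u = char L u * (iexp (- (u * \<mu>1 m)) ^ n m * ((1 + w m) ^ n m - exp (w m) ^ n m) + exp (h * \<Psi>m m))" for m
      unfolding X_def char_conv_power[OF L p] cp prod[symmetric]
      by (simp add: power_mult_distrib right_diff_distrib)
    have "(\<lambda>m. char (X m) u) \<longlonglongrightarrow> char L u * (0 + exp (h * \<Psi> u))"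
      unfolding charX by (intro tendsto_intros lim0 lim\<Psi>)
    moreover have "char L u * (0 + exp (h * \<Psi> u)) = char \<mu> u"
      unfolding char exponent charL by (simp add: exp_add[symmetric] algebra_simps)
    ultimately show ?thesis by simp
  qed
  have "(\<integral>\<^sup>+x. ennreal (\<bar>x\<bar> powr r) \<partial>\<mu>) \<le> ennreal K"
    by (rule weak_limit_moment[OF X \<mu> conv _ K mX]) (use r in simp)
  thus ?thesis by (rule le_less_trans) simp
qed

subsection \<open>Zeros of perturbed equations\<close>

text \<open>The last assumption on \<open>x\<close> models an estimator: it must be a zero only if
  \<open>D\<close> contains one. Below the threshold \<open>\<delta>0\<close> a zero of
  \<open>v\<close> exists near \<open>x0\<close>, so \<open>v x = 0\<close> and
  \<open>norm (w x) \<le> \<delta>\<close>, which bounds the distance to \<open>x0\<close>. Above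
  the threshold the bounded size of \<open>D\<close> is itself at most a multiple of \<delta>, so
  one linear bound covers both cases.\<close>

lemma z_estimator:
  fixes w :: "'a::euclidean_space \<Rightarrow> 'a"
  assumes D: "compact D" "x0 \<in> interior D" and cont: "continuous_on D w"
    and zero: "\<And>x. x \<in> D \<Longrightarrow> w x = 0 \<longleftrightarrow> x = x0"
    and der: "(w has_derivative L) (at x0)" and inj: "\<And>h. L h = 0 \<Longrightarrow> h = 0"
  obtains C \<delta>0 where "C > 0" "\<delta>0 > 0"
    "\<And>v \<delta> x. \<lbrakk>continuous_on D v; \<And>y. y \<in> D \<Longrightarrow> norm (v y - w y) \<le> \<delta>; x \<in> D;
        (\<exists>y\<in>D. v y = 0) \<longrightarrow> v x = 0\<rbrakk> \<Longrightarrow> norm (x - x0) \<le> C * \<delta> \<and> (\<delta> \<le> \<delta>0 \<longrightarrow> v x = 0)"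
proof -
  have x0D: "x0 \<in> D" using D interior_subset by blast
  have w0: "w x0 = 0" using zero[OF x0D] by simp
  have L: "linear L" using der has_derivative_linear by blast
  have "inj L" using L inj by (simp add: linear_injective_0)
  then obtain L' where L': "linear L'" "\<And>x. L' (L x) = x"
    using linear_injective_isomorphism[OF L] by blast
  obtain B where B: "B > 0" "\<And>y. norm (L' y) \<le> B * norm y"
    using linear_bounded_pos[OF L'(1)] by blast
  obtain R where R: "R > 0" "\<And>x. x \<in> D \<Longrightarrow> norm (x - x0) \<le> R"
  proof -
    obtain R0 where "\<forall>x\<in>D. norm x \<le> R0" using compact_imp_bounded[OF D(1)] by (auto simp: bounded_iff)
    hence "norm (x - x0) \<le> \<bar>R0\<bar> + norm x0 + 1" if "x \<in> D" for x
      using norm_triangle_ineq4[of x x0] that by (smt (verit))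
    thus ?thesis using that[of "\<bar>R0\<bar> + norm x0 + 1"] by (simp add: add_nonneg_pos)
  qed
  \<comment> \<open>The factor \<open>1 / (2 * B)\<close> makes the linearisation error at most half
    the distance to \<open>x0\<close> once \<open>L'\<close> is applied.\<close>
  obtain \<rho> where \<rho>: "\<rho> > 0" "cball x0 \<rho> \<subseteq> D"
    and near: "\<And>x. norm (x - x0) \<le> \<rho> \<Longrightarrow> norm (w x - L (x - x0)) \<le> 1 / (2 * B) * norm (x - x0)"
  proof -
    obtain e where e: "e > 0" "cball x0 e \<subseteq> D" using D(2) mem_interior_cball by metis
    have "\<forall>e>0. \<exists>d>0. \<forall>y. norm (y - x0) < d \<longrightarrow> norm (w y - w x0 - L (y - x0)) \<le> e * norm (y - x0)"
      using der by (simp add: has_derivative_at_alt)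
    then obtain d where d: "d > 0" "\<And>y. norm (y - x0) < d \<Longrightarrow> norm (w y - w x0 - L (y - x0)) \<le> 1 / (2 * B) * norm (y - x0)"
      using B(1) by (metis mult_pos_pos zero_less_divide_1_iff zero_less_numeral)
    show ?thesis
    proof (rule that[of "min e (d/2)"])
      show "cball x0 (min e (d/2)) \<subseteq> D" using e(2) by auto
    qed (use e(1) d w0 in auto)
  qed
  have nearL': "norm (L' (w x) - (x - x0)) \<le> norm (x - x0) / 2" if "norm (x - x0) \<le> \<rho>" for x
  proof -
    have "L' (w x) - (x - x0) = L' (w x - L (x - x0))"
      using L' by (simp add: linear_diff)
    hence "norm (L' (w x) - (x - x0)) \<le> B * norm (w x - L (x - x0))" using B(2) by simp
    also have "\<dots> \<le> B * (1 / (2 * B) * norm (x - x0))" using near[OF that] B(1) by (intro mult_left_mono) auto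
    also have "\<dots> = norm (x - x0) / 2" using B(1) by simp
    finally show ?thesis .
  qed
  \<comment> \<open>Identification with a rate: near \<open>x0\<close> the injective derivative
    bounds the distance by \<open>norm (w x)\<close>, and on the compact remainder
    \<open>norm (w x)\<close> has a positive minimum because \<open>x0\<close> is the only
    zero.\<close>
  have "\<exists>C1>0. \<forall>x\<in>D. norm (x - x0) \<le> C1 * norm (w x)"
  proof -
    have in_ball: "norm (x - x0) \<le> 2 * B * norm (w x)" if "norm (x - x0) \<le> \<rho>" for x
    proof -
      have "norm (x - x0) \<le> norm (L' (w x)) + norm (L' (w x) - (x - x0))"
        by (metis norm_minus_commute norm_triangle_sub)
      thus ?thesis using nearL'[OF that] B(2)[of "w x"] by linarith
    qed
    show ?thesis
    proof (cases "D - ball x0 \<rho> = {}")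
      case True
      hence "norm (x - x0) \<le> \<rho>" if "x \<in> D" for x
        using that by (auto simp: dist_norm norm_minus_commute)
      thus ?thesis using in_ball B(1) by (intro exI[of _ "2 * B"]) auto
    next
      case False
      have "compact (D - ball x0 \<rho>)" using D(1) by (intro compact_diff) auto
      moreover have "continuous_on (D - ball x0 \<rho>) (\<lambda>x. norm (w x))"
        by (intro continuous_on_norm continuous_on_subset[OF cont]) auto
      ultimately obtain y where y: "y \<in> D - ball x0 \<rho>" "\<And>x. x \<in> D - ball x0 \<rho> \<Longrightarrow> norm (w y) \<le> norm (w x)"
        using continuous_attains_inf[of "D - ball x0 \<rho>" "\<lambda>x. norm (w x)"] False by blast
      have "w y \<noteq> 0" using zero[of y] y(1) \<rho>(1) by auto
      hence m: "norm (w y) > 0" by simp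
      show ?thesis
      proof (intro exI[of _ "2 * B + R / norm (w y)"] conjI ballI)
        show "0 < 2 * B + R / norm (w y)" using B(1) R(1) m by (simp add: add_pos_pos)
        fix x assume x: "x \<in> D"
        show "norm (x - x0) \<le> (2 * B + R / norm (w y)) * norm (w x)"
        proof (cases "norm (x - x0) < \<rho>")
          case True
          hence "norm (x - x0) \<le> 2 * B * norm (w x)" using in_ball by simp
          also have "\<dots> \<le> (2 * B + R / norm (w y)) * norm (w x)" using R(1) by (intro mult_right_mono) auto
          finally show ?thesis .
        next
          case False
          hence "norm (w y) \<le> norm (w x)" using x y(2) by (auto simp: dist_norm norm_minus_commute)
          hence "R * 1 \<le> R * (norm (w x) / norm (w y))" using m R(1) by (intro mult_left_mono) auto
          also have "\<dots> \<le> (2 * B + R / norm (w y)) * norm (w x)" using B(1) by (simp add: distrib_right)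
          finally show ?thesis using R(2)[OF x] by simp
        qed
      qed
    qed
  qed
  then obtain C1 where C1: "C1 > 0" "\<And>x. x \<in> D \<Longrightarrow> norm (x - x0) \<le> C1 * norm (w x)" by blast
  \<comment> \<open>Chosen so that \<open>\<rho> / 2 + B * \<delta>0 = \<rho>\<close>, which makes
    the map \<open>y - L' (v y)\<close> send the ball into itself.\<close>
  define \<delta>0 where "\<delta>0 = \<rho> / (2 * B)"
  have \<delta>0: "\<delta>0 > 0" using \<rho>(1) B(1) by (simp add: \<delta>0_def)
  show thesis
  proof (rule that[of "C1 + R / \<delta>0" \<delta>0])
    show "C1 + R / \<delta>0 > 0" using C1 R \<delta>0 by (simp add: add_pos_pos)
    fix v \<delta> x
    assume v: "continuous_on D v" "\<And>y. y \<in> D \<Longrightarrow> norm (v y - w y) \<le> \<delta>" and x: "x \<in> D"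
      and sol: "(\<exists>y\<in>D. v y = 0) \<longrightarrow> v x = 0"
    have \<delta>: "\<delta> \<ge> 0" using v(2)[OF x] norm_ge_zero order_trans by blast
    have ex: "v x = 0" if "\<delta> \<le> \<delta>0"
    proof -
      have "continuous_on (cball x0 \<rho>) (\<lambda>y. y - L' (v y))"
        by (intro continuous_intros linear_continuous_on_compose[OF _ L'(1)] continuous_on_subset[OF v(1) \<rho>(2)])
      moreover have "(\<lambda>y. y - L' (v y)) \<in> cball x0 \<rho> \<rightarrow> cball x0 \<rho>"
      proof
        fix y assume "y \<in> cball x0 \<rho>"
        hence y: "norm (y - x0) \<le> \<rho>" "y \<in> D" using \<rho>(2) by (auto simp: dist_norm norm_minus_commute)
        have eq: "x0 - (y - L' (v y)) = (L' (w y) - (y - x0)) + L' (v y - w y)"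
          using L'(1) by (simp add: linear_diff)
        have "norm (x0 - (y - L' (v y))) \<le> norm (L' (w y) - (y - x0)) + norm (L' (v y - w y))"
          unfolding eq by (rule norm_triangle_ineq)
        also have "\<dots> \<le> \<rho> / 2 + B * \<delta>0"
        proof (rule add_mono)
          show "norm (L' (w y) - (y - x0)) \<le> \<rho> / 2" using nearL'[OF y(1)] y(1) by simp
          have "norm (L' (v y - w y)) \<le> B * norm (v y - w y)" by (rule B(2))
          also have "\<dots> \<le> B * \<delta>0" using v(2)[OF y(2)] that B(1) by (intro mult_left_mono) auto
          finally show "norm (L' (v y - w y)) \<le> B * \<delta>0" .
        qed
        also have "\<dots> = \<rho>" using B(1) by (simp add: \<delta>0_def)
        finally show "y - L' (v y) \<in> cball x0 \<rho>" by (simp add: dist_norm)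
      qed
      ultimately obtain y where y: "y \<in> cball x0 \<rho>" "y - L' (v y) = y"
        using brouwer[of "cball x0 \<rho>" "\<lambda>y. y - L' (v y)"] \<rho>(1) by auto
      have "L' (v y) = 0" using y(2) by simp
      \<comment> \<open>In finite dimension the left inverse of an injective endomorphism is
        injective, so the fixed point is a zero of \<open>v\<close>.\<close>
      moreover have "inj L'"
        using L'(1,2) \<open>inj L\<close> L by (metis linear_injective_left_inverse linear_inj_imp_surj linear_surjective_isomorphism injI o_apply surj_def linear_injective_isomorphism)
      ultimately have "v y = 0" using L'(1) by (metis linear_0 injD)
      thus ?thesis using sol y(1) \<rho>(2) by blast
    qed
    have "norm (x - x0) \<le> (C1 + R / \<delta>0) * \<delta>"
    proof (cases "\<delta> \<le> \<delta>0")
      case True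
      have "norm (w x) \<le> \<delta>" using v(2)[OF x] ex[OF True] by simp
      hence "norm (x - x0) \<le> C1 * \<delta>" using C1(2)[OF x] C1(1) by (meson mult_left_mono less_imp_le order_trans)
      also have "\<dots> \<le> (C1 + R / \<delta>0) * \<delta>" using R(1) \<delta>0 \<delta> by (intro mult_right_mono) auto
      finally show ?thesis .
    next
      case False
      have "norm (x - x0) \<le> R" by (rule R(2)[OF x])
      also have "\<dots> \<le> R * (\<delta> / \<delta>0)"
        using False R(1) \<delta>0 mult_left_mono[of 1 "\<delta> / \<delta>0" R] by simp
      also have "\<dots> \<le> (C1 + R / \<delta>0) * \<delta>" using C1(1) \<delta> by (simp add: distrib_right)
      finally show ?thesis .
    qed
    thus "norm (x - x0) \<le> (C1 + R / \<delta>0) * \<delta> \<and> (\<delta> \<le> \<delta>0 \<longrightarrow> v x = 0)" using ex by blast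
  qed (rule \<delta>0)
qed

text \<open>At a zero \<open>x\<close> of \<open>v\<close>, the vector
  \<open>x - x0 + L' (v x0)\<close> is the image under \<open>- L'\<close> of two errors: the
  increment of \<open>v - w\<close> and the linearisation error of \<open>w\<close>. Both are
  quadratic in \<delta>, since \<open>norm (x - x0)\<close> is at most a multiple of \<delta>. The
  increment hypothesis spares an expansion of the random function \<open>v\<close> itself.\<close>

lemma z_estimator_expansion:
  fixes w :: "'a::euclidean_space \<Rightarrow> 'a"
  assumes D: "compact D" "x0 \<in> interior D" and cont: "continuous_on D w"
    and zero: "\<And>x. x \<in> D \<Longrightarrow> w x = 0 \<longleftrightarrow> x = x0"
    and der: "(w has_derivative L) (at x0)" and L': "linear L'" "\<And>h. L' (L h) = h"
    and quad: "\<And>x. x \<in> D \<Longrightarrow> norm (w x - L (x - x0)) \<le> A * (norm (x - x0))\<^sup>2"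
  obtains C where "C > 0"
    "\<And>v \<delta> x. \<lbrakk>continuous_on D v; \<And>y. y \<in> D \<Longrightarrow> norm (v y - w y) \<le> \<delta>;
        \<And>y. y \<in> D \<Longrightarrow> norm (v y - v x0 - (w y - w x0)) \<le> \<delta> * norm (y - x0); x \<in> D;
        (\<exists>y\<in>D. v y = 0) \<longrightarrow> v x = 0\<rbrakk> \<Longrightarrow> norm (x - x0 + L' (v x0)) \<le> C * \<delta>\<^sup>2"
proof -
  have x0D: "x0 \<in> D" using D interior_subset by blast
  have w0: "w x0 = 0" using zero[OF x0D] by simp
  have L: "linear L" using der has_derivative_linear by blast
  have inj: "L h = 0 \<Longrightarrow> h = 0" for h using L'(2)[of h] linear_0[OF L'(1)] by simp
  obtain C \<delta>0 where C: "C > 0" "\<delta>0 > 0"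
    "\<And>v \<delta> x. \<lbrakk>continuous_on D v; \<And>y. y \<in> D \<Longrightarrow> norm (v y - w y) \<le> \<delta>; x \<in> D;
        (\<exists>y\<in>D. v y = 0) \<longrightarrow> v x = 0\<rbrakk> \<Longrightarrow> norm (x - x0) \<le> C * \<delta> \<and> (\<delta> \<le> \<delta>0 \<longrightarrow> v x = 0)"
    using z_estimator[OF D cont zero der inj] by metis
  obtain B where B: "B > 0" "\<And>y. norm (L' y) \<le> B * norm y"
    using linear_bounded_pos[OF L'(1)] by blast
  show thesis
  \<comment> \<open>The first summand serves \<open>\<delta> \<le> \<delta>0\<close>. For larger
    \<delta> the trivial linear bound \<open>(C + B) * \<delta>\<close> is turned into a quadratic
    one by the factor \<open>\<delta> / \<delta>0\<close>.\<close>
  proof (rule that[of "B * (C + \<bar>A\<bar> * C\<^sup>2) + (C + B) / \<delta>0"])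
    show "0 < B * (C + \<bar>A\<bar> * C\<^sup>2) + (C + B) / \<delta>0"
      using B(1) C(1,2) by (intro add_nonneg_pos) auto
    fix v \<delta> x
    assume v: "continuous_on D v" "\<And>y. y \<in> D \<Longrightarrow> norm (v y - w y) \<le> \<delta>"
        "\<And>y. y \<in> D \<Longrightarrow> norm (v y - v x0 - (w y - w x0)) \<le> \<delta> * norm (y - x0)" and x: "x \<in> D"
      and sol: "(\<exists>y\<in>D. v y = 0) \<longrightarrow> v x = 0"
    have \<delta>: "\<delta> \<ge> 0" using v(2)[OF x] norm_ge_zero order_trans by blast
    have xx: "norm (x - x0) \<le> C * \<delta>" "\<delta> \<le> \<delta>0 \<Longrightarrow> v x = 0" using C(3)[OF v(1,2) x sol] by auto
    show "norm (x - x0 + L' (v x0)) \<le> (B * (C + \<bar>A\<bar> * C\<^sup>2) + (C + B) / \<delta>0) * \<delta>\<^sup>2"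
    proof (cases "\<delta> \<le> \<delta>0")
      case True
      have "x - x0 + L' (v x0) = L' (- ((v x - v x0 - (w x - w x0)) + (w x - L (x - x0))))"
        using xx(2)[OF True] w0 L'
        by (simp add: linear_diff[OF L'(1)] linear_add[OF L'(1)] linear_neg[OF L'(1)])
      hence "norm (x - x0 + L' (v x0)) \<le> B * norm ((v x - v x0 - (w x - w x0)) + (w x - L (x - x0)))"
        using B(2) by (metis norm_minus_cancel)
      also have "\<dots> \<le> B * (norm (v x - v x0 - (w x - w x0)) + norm (w x - L (x - x0)))"
        using B(1) by (intro mult_left_mono norm_triangle_ineq) auto
      also have "\<dots> \<le> B * (\<delta> * (C * \<delta>) + \<bar>A\<bar> * (C * \<delta>)\<^sup>2)"
      proof (intro mult_left_mono add_mono)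
        show "norm (v x - v x0 - (w x - w x0)) \<le> \<delta> * (C * \<delta>)"
          using v(3)[OF x] mult_left_mono[OF xx(1) \<delta>] by linarith
        have "norm (w x - L (x - x0)) \<le> A * (norm (x - x0))\<^sup>2" by (rule quad[OF x])
        also have "\<dots> \<le> \<bar>A\<bar> * (C * \<delta>)\<^sup>2" using xx(1) by (intro mult_mono power_mono) auto
        finally show "norm (w x - L (x - x0)) \<le> \<bar>A\<bar> * (C * \<delta>)\<^sup>2" .
      qed (use B(1) in auto)
      also have "\<dots> = B * (C + \<bar>A\<bar> * C\<^sup>2) * \<delta>\<^sup>2" by (simp add: power2_eq_square algebra_simps)
      also have "\<dots> \<le> (B * (C + \<bar>A\<bar> * C\<^sup>2) + (C + B) / \<delta>0) * \<delta>\<^sup>2"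
        using B(1) C(1,2) by (intro mult_right_mono) auto
      finally show ?thesis .
    next
      case False
      have "norm (x - x0 + L' (v x0)) \<le> norm (x - x0) + norm (L' (v x0))" by (rule norm_triangle_ineq)
      also have "\<dots> \<le> C * \<delta> + B * \<delta>"
      proof (rule add_mono[OF xx(1)])
        have "norm (L' (v x0)) \<le> B * norm (v x0)" by (rule B(2))
        also have "\<dots> \<le> B * \<delta>" using v(2)[OF x0D] w0 B(1) by (intro mult_left_mono) auto
        finally show "norm (L' (v x0)) \<le> B * \<delta>" .
      qed
      also have "\<dots> = ((C + B) * \<delta>) * 1" by (simp add: algebra_simps)
      also have "\<dots> \<le> ((C + B) * \<delta>) * (\<delta> / \<delta>0)"
        using False C(1,2) B(1) \<delta> by (intro mult_left_mono) auto
      also have "\<dots> = (C + B) / \<delta>0 * \<delta>\<^sup>2" by (simp add: power2_eq_square)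
      also have "\<dots> \<le> (B * (C + \<bar>A\<bar> * C\<^sup>2) + (C + B) / \<delta>0) * \<delta>\<^sup>2"
        using B(1) C(1,2) by (intro mult_right_mono) auto
      finally show ?thesis .
    qed
  qed
qed

subsection \<open>Smoothness of the inverse filter\<close>

lemma partial_d_eqI: "(f has_derivative f') (at x) \<Longrightarrow> partial_d f i x = f' (axis i 1)"
  unfolding partial_d_def using frechet_derivative_at by metis

lemma has_derivative_partial_d:
  fixes f :: "real^'n \<Rightarrow> 'b::real_normed_vector"
  assumes "f differentiable (at x)"
  shows "(f has_derivative (\<lambda>h. \<Sum>i\<in>UNIV. (h $ i) *\<^sub>R partial_d f i x)) (at x)"
proof -
  have d: "(f has_derivative frechet_derivative f (at x)) (at x)"
    using assms frechet_derivative_works by blast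
  have lin: "linear (frechet_derivative f (at x))" using d has_derivative_linear by blast
  have "frechet_derivative f (at x) h = (\<Sum>i\<in>UNIV. (h $ i) *\<^sub>R partial_d f i x)" for h
  proof -
    have "h = (\<Sum>i\<in>UNIV. (h $ i) *\<^sub>R axis i 1)"
      by (simp add: vec_eq_iff axis_def if_distrib cong: if_cong)
    hence "frechet_derivative f (at x) h = (\<Sum>i\<in>UNIV. frechet_derivative f (at x) ((h $ i) *\<^sub>R axis i 1))"
      by (metis linear_sum[OF lin])
    thus ?thesis by (simp add: linear_cmul[OF lin] partial_d_def)
  qed
  thus ?thesis using d by presburger
qed

lemma gradient_eqI: "(f has_derivative (\<lambda>h. g \<bullet> h)) (at x) \<Longrightarrow> gradient f x = g"
  by (simp add: gradient_def vec_eq_iff partial_d_eqI inner_axis)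

lemma partial_d_cong_open:
  assumes G: "open G" "x \<in> G" and eq: "\<And>y. y \<in> G \<Longrightarrow> f y = g y"
  shows "partial_d f i x = partial_d g i x" "f differentiable (at x) \<longleftrightarrow> g differentiable (at x)"
proof -
  have *: "(f has_derivative f') (at x) \<longleftrightarrow> (g has_derivative f') (at x)" for f'
    using has_derivative_transform_within_open[OF _ G, of f f' UNIV g]
      has_derivative_transform_within_open[OF _ G, of g f' UNIV f] eq by auto
  show "partial_d f i x = partial_d g i x" by (simp add: partial_d_def frechet_derivative_def *)
  show "f differentiable (at x) \<longleftrightarrow> g differentiable (at x)" by (simp add: differentiable_def *)
qed

lemma partial_d_lipschitz:
  fixes f :: "real^'n \<Rightarrow> 'b::real_normed_vector"
  assumes S: "convex S" and f: "\<And>x. x \<in> S \<Longrightarrow> f differentiable (at x)"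
    and B: "\<And>x i. x \<in> S \<Longrightarrow> norm (partial_d f i x) \<le> B" and xy: "x \<in> S" "y \<in> S"
  shows "norm (f x - f y) \<le> real CARD('n) * B * norm (x - y)"
proof (rule differentiable_bound[OF S _ _ xy])
  fix z assume z: "z \<in> S"
  show "(f has_derivative (\<lambda>h. \<Sum>i\<in>UNIV. (h $ i) *\<^sub>R partial_d f i z)) (at z within S)"
    using has_derivative_partial_d[OF f[OF z]] by (rule has_derivative_at_withinI)
  show "onorm (\<lambda>h. \<Sum>i\<in>UNIV. (h $ i) *\<^sub>R partial_d f i z) \<le> real CARD('n) * B"
  proof (rule onorm_le)
    fix h :: "real^'n"
    have "norm (\<Sum>i\<in>UNIV. (h $ i) *\<^sub>R partial_d f i z) \<le> (\<Sum>i\<in>(UNIV::'n set). norm h * B)"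
    proof (rule order_trans[OF norm_sum sum_mono])
      fix i
      show "norm ((h $ i) *\<^sub>R partial_d f i z) \<le> norm h * B"
        unfolding norm_scaleR using B[OF z] component_le_norm_cart[of h i] by (intro mult_mono) auto
    qed
    thus "norm (\<Sum>i\<in>UNIV. (h $ i) *\<^sub>R partial_d f i z) \<le> real CARD('n) * B * norm h" by (simp add: mult_ac)
  qed
qed

text \<open>Differentiation of a series at one point only: the terms need a derivative at
  \<open>x0\<close> and increments from \<open>x0\<close> with summable constants. The pointwise
  form matters for the score, whose terms involve factors that are merely continuous.\<close>

lemma has_derivative_series_dominated:
  fixes f :: "nat \<Rightarrow> 'a::real_normed_vector \<Rightarrow> real"
  assumes der: "\<And>n. (f n has_derivative f' n) (at x0)" and \<rho>: "\<rho> > 0"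
    and lip: "\<And>n x. norm (x - x0) < \<rho> \<Longrightarrow> \<bar>f n x - f n x0\<bar> \<le> B n * norm (x - x0)"
    and bd: "\<And>n h. \<bar>f' n h\<bar> \<le> B n * norm h" and B: "summable B"
    and s0: "summable (\<lambda>n. f n x0)"
  shows "((\<lambda>x. \<Sum>n. f n x) has_derivative (\<lambda>h. \<Sum>n. f' n h)) (at x0)"
proof -
  have sf': "summable (\<lambda>n. f' n h)" and f'_le: "\<bar>\<Sum>n. f' n h\<bar> \<le> (\<Sum>n. B n) * norm h" for h
    using abs_suminf_le[of "\<lambda>n. f' n h" "\<lambda>n. B n * norm h"] bd summable_mult2[OF B, of "norm h"]
    by (auto simp: suminf_mult2[OF B])
  have lin: "linear (f' n)" for n using der has_derivative_linear by blast
  have sd: "summable (\<lambda>n. f n x - f n x0)" if "norm (x - x0) < \<rho>" for x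
    by (rule abs_suminf_le(1)[of _ "\<lambda>n. B n * norm (x - x0)"]) (use lip that B in \<open>auto intro: summable_mult2\<close>)
  show ?thesis
    unfolding has_derivative_at_alt
  proof (intro conjI allI impI)
    show "bounded_linear (\<lambda>h. \<Sum>n. f' n h)"
    proof (rule bounded_linear_intro)
      show "(\<Sum>n. f' n (x + y)) = (\<Sum>n. f' n x) + (\<Sum>n. f' n y)" for x y
        by (simp add: linear_add[OF lin] suminf_add[OF sf' sf'])
      show "(\<Sum>n. f' n (c *\<^sub>R x)) = c *\<^sub>R (\<Sum>n. f' n x)" for c x
        by (simp add: linear_cmul[OF lin] suminf_mult[OF sf'])
      show "norm (\<Sum>n. f' n x) \<le> norm x * (\<Sum>n. B n)" for x
        using f'_le[of x] by (simp add: mult.commute)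
    qed
    fix e :: real assume e: "e > 0"
    \<comment> \<open>The tail enters twice, through increments and through derivatives, so
      \<open>e / 4\<close> here costs \<open>e / 2\<close>; the finite head costs another
      \<open>e / 4\<close>.\<close>
    obtain N where N: "\<bar>\<Sum>n. B (n + N)\<bar> < e / 4"
      using suminf_exist_split[of "e / 4" B] B e by auto
    have BN: "summable (\<lambda>n. B (n + N))" using B by (rule summable_ignore_initial_segment)
    have "((\<lambda>x. \<Sum>n<N. f n x) has_derivative (\<lambda>h. \<Sum>n<N. f' n h)) (at x0)"
      by (intro has_derivative_sum der)
    then obtain d where d: "d > 0" "\<And>x. norm (x - x0) < d \<Longrightarrow>
        norm ((\<Sum>n<N. f n x) - (\<Sum>n<N. f n x0) - (\<Sum>n<N. f' n (x - x0))) \<le> e / 4 * norm (x - x0)"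
      unfolding has_derivative_at_alt using e by (metis zero_less_divide_iff zero_less_numeral)
    show "\<exists>d>0. \<forall>y. norm (y - x0) < d \<longrightarrow> norm ((\<Sum>n. f n y) - (\<Sum>n. f n x0) - (\<Sum>n. f' n (y - x0))) \<le> e * norm (y - x0)"
    proof (intro exI[of _ "min d \<rho>"] conjI allI impI)
      show "min d \<rho> > 0" using d \<rho> by simp
      fix y assume "norm (y - x0) < min d \<rho>"
      hence y: "norm (y - x0) < d" "norm (y - x0) < \<rho>" by auto
      let ?g = "\<lambda>n. f n y - f n x0 - f' n (y - x0)"
      have sg: "summable ?g" by (intro summable_diff sd y sf')
      have sy: "summable (\<lambda>n. f n y)" using summable_add[OF sd[OF y(2)] s0] by simp
      have "(\<Sum>n. f n y) - (\<Sum>n. f n x0) - (\<Sum>n. f' n (y - x0)) = (\<Sum>n. ?g n)"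
        by (simp add: suminf_diff sy s0 sf' summable_diff)
      also have "\<dots> = (\<Sum>n. ?g (n + N)) + (\<Sum>n<N. ?g n)"
        by (rule suminf_split_initial_segment[OF sg])
      finally have eq: "(\<Sum>n. f n y) - (\<Sum>n. f n x0) - (\<Sum>n. f' n (y - x0)) = (\<Sum>n. ?g (n + N)) + (\<Sum>n<N. ?g n)" .
      have "\<bar>\<Sum>n. ?g (n + N)\<bar> \<le> (\<Sum>n. B (n + N) * (2 * norm (y - x0)))"
      proof (rule abs_suminf_le(2))
        show "\<bar>?g (n + N)\<bar> \<le> B (n + N) * (2 * norm (y - x0))" for n
          using lip[OF y(2), of "n + N"] bd[of "n + N" "y - x0"] by linarith
      qed (intro summable_mult2 BN)
      also have "\<dots> = (\<Sum>n. B (n + N)) * (2 * norm (y - x0))" by (rule suminf_mult2[OF BN, symmetric])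
      also have "\<dots> \<le> (e / 4) * (2 * norm (y - x0))" using N by (intro mult_right_mono) auto
      finally have 1: "\<bar>\<Sum>n. ?g (n + N)\<bar> \<le> e / 2 * norm (y - x0)" by simp
      have 2: "\<bar>\<Sum>n<N. ?g n\<bar> \<le> e / 4 * norm (y - x0)" using d(2)[OF y(1)] by (simp add: sum_subtractf)
      have "\<bar>(\<Sum>n. ?g (n + N)) + (\<Sum>n<N. ?g n)\<bar> \<le> e / 2 * norm (y - x0) + e / 4 * norm (y - x0)"
        by (rule order_trans[OF abs_triangle_ineq add_mono[OF 1 2]])
      also have "\<dots> = (3 * e / 4) * norm (y - x0)" by (simp add: algebra_simps)
      also have "\<dots> \<le> e * norm (y - x0)" using e by (intro mult_right_mono) auto
      finally show "norm ((\<Sum>n. f n y) - (\<Sum>n. f n x0) - (\<Sum>n. f' n (y - x0))) \<le> e * norm (y - x0)"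
        unfolding eq by simp
    qed
  qed
qed

section \<open>Continuously differentiable functions\<close>

definition C1_on :: "(real^'n) set \<Rightarrow> (real^'n \<Rightarrow> 'b::real_normed_vector) \<Rightarrow> bool" where
  "C1_on G f \<longleftrightarrow> (\<forall>x\<in>G. f differentiable (at x)) \<and> (\<forall>i. continuous_on G (\<lambda>x. partial_d f i x))"

lemma C1_on_continuous: "C1_on G f \<Longrightarrow> continuous_on G f"
  by (auto simp: C1_on_def differentiable_imp_continuous_within continuous_at_imp_continuous_on)

lemma Ck_on_imp_C1_on: "Ck_on (Suc (Suc k)) G f \<Longrightarrow> C1_on G f"
  by (simp add: C1_on_def)

lemma C1_on_const: "C1_on G (\<lambda>x. c)"
proof -
  have "partial_d (\<lambda>x. c) i x = 0" for i :: 'a and x by (rule partial_d_eqI[OF has_derivative_const])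
  thus ?thesis by (simp add: C1_on_def)
qed

lemma C1_on_cong: "open G \<Longrightarrow> (\<And>x. x \<in> G \<Longrightarrow> f x = g x) \<Longrightarrow> C1_on G f \<longleftrightarrow> C1_on G g"
  unfolding C1_on_def by (intro conj_cong all_cong1 ball_cong continuous_on_cong partial_d_cong_open) auto

lemma partial_d_mult:
  fixes f g :: "real^'n \<Rightarrow> real"
  assumes "f differentiable (at x)" "g differentiable (at x)"
  shows "partial_d (\<lambda>x. f x * g x) i x = partial_d f i x * g x + f x * partial_d g i x"
    and "(\<lambda>x. f x * g x) differentiable (at x)"
proof -
  obtain f' g' where d: "(f has_derivative f') (at x)" "(g has_derivative g') (at x)"
    using assms by (auto simp: differentiable_def)
  note m = has_derivative_mult[OF d]
  show "partial_d (\<lambda>x. f x * g x) i x = partial_d f i x * g x + f x * partial_d g i x"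
    using partial_d_eqI[OF m] partial_d_eqI[OF d(1)] partial_d_eqI[OF d(2)] by simp
  show "(\<lambda>x. f x * g x) differentiable (at x)" using m by (auto simp: differentiable_def)
qed

lemma C1_on_mult:
  fixes f g :: "real^'n \<Rightarrow> real"
  assumes f: "C1_on G f" and g: "C1_on G g"
  shows "C1_on G (\<lambda>x. f x * g x)"
proof -
  have "continuous_on G (\<lambda>x. partial_d f i x * g x + f x * partial_d g i x)" for i
  proof -
    have "continuous_on G f" "continuous_on G g" using f g by (auto intro: C1_on_continuous)
    moreover have "continuous_on G (\<lambda>x. partial_d f i x)" "continuous_on G (\<lambda>x. partial_d g i x)"
      using f g by (auto simp: C1_on_def)
    ultimately show ?thesis by (intro continuous_on_add continuous_on_mult)
  qed
  moreover have "partial_d (\<lambda>x. f x * g x) i x = partial_d f i x * g x + f x * partial_d g i x" if "x \<in> G" for i x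
    using f g that by (intro partial_d_mult) (auto simp: C1_on_def)
  ultimately have "continuous_on G (\<lambda>x. partial_d (\<lambda>x. f x * g x) i x)" for i
    by (simp cong: continuous_on_cong)
  thus ?thesis using f g by (auto simp: C1_on_def intro: partial_d_mult(2))
qed

lemma partial_d_sum:
  fixes f :: "'i \<Rightarrow> real^'n \<Rightarrow> 'b::real_normed_vector"
  assumes "\<And>j. j \<in> J \<Longrightarrow> f j differentiable (at x)"
  shows "partial_d (\<lambda>x. \<Sum>j\<in>J. f j x) i x = (\<Sum>j\<in>J. partial_d (f j) i x)"
    and "(\<lambda>x. \<Sum>j\<in>J. f j x) differentiable (at x)"
proof -
  have d: "((\<lambda>x. \<Sum>j\<in>J. f j x) has_derivative (\<lambda>h. \<Sum>j\<in>J. frechet_derivative (f j) (at x) h)) (at x)"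
    using assms frechet_derivative_works by (intro has_derivative_sum) blast
  show "partial_d (\<lambda>x. \<Sum>j\<in>J. f j x) i x = (\<Sum>j\<in>J. partial_d (f j) i x)"
    using partial_d_eqI[OF d] by (simp add: partial_d_def)
  show "(\<lambda>x. \<Sum>j\<in>J. f j x) differentiable (at x)" using d by (auto simp: differentiable_def)
qed

lemma C1_on_sum:
  fixes f :: "'i \<Rightarrow> real^'n \<Rightarrow> 'b::real_normed_vector"
  assumes f: "\<And>j. j \<in> J \<Longrightarrow> C1_on G (f j)"
  shows "C1_on G (\<lambda>x. \<Sum>j\<in>J. f j x)"
proof -
  have "continuous_on G (\<lambda>x. \<Sum>j\<in>J. partial_d (f j) i x)" for i
    using f by (intro continuous_on_sum) (auto simp: C1_on_def)
  moreover have "partial_d (\<lambda>x. \<Sum>j\<in>J. f j x) i x = (\<Sum>j\<in>J. partial_d (f j) i x)" if "x \<in> G" for i x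
    using f that by (intro partial_d_sum) (auto simp: C1_on_def)
  ultimately have "continuous_on G (\<lambda>x. partial_d (\<lambda>x. \<Sum>j\<in>J. f j x) i x)" for i
    by (simp cong: continuous_on_cong)
  thus ?thesis using f by (auto simp: C1_on_def intro!: partial_d_sum(2))
qed

lemma C1_on_cmult: "C1_on G f \<Longrightarrow> C1_on G (\<lambda>x. c * f x :: real)"
  using C1_on_mult[OF C1_on_const] .

section \<open>Impulse responses of the innovation filter\<close>

locale causal_filter =
  fixes a b :: "real^'p \<Rightarrow> nat \<Rightarrow> real" and \<theta>s :: "real^'p" and G D :: "(real^'p) set"
  assumes G_open: "open G" and D: "compact D" "D \<subseteq> G" and \<theta>s: "\<theta>s \<in> interior D"
    and a0: "\<forall>\<theta>. a \<theta> 0 = 1" and a_C3: "\<forall>j. Ck_on 3 G (\<lambda>\<theta>. a \<theta> j)"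
    and b_inv: "\<forall>\<theta>\<in>G. b \<theta> 0 = 1 \<and> (\<forall>j>0. (\<Sum>k\<le>j. a \<theta> k * b \<theta> (j - k)) = 0)"
    and stable: "\<forall>C. compact C \<and> C \<subseteq> G \<longrightarrow>
                 (\<exists>c>0. \<exists>\<alpha>. 0 < \<alpha> \<and> \<alpha> < 1 \<and>
                   (\<forall>\<theta>\<in>C. \<forall>j. \<forall>is. length is \<le> 3 \<longrightarrow>
                      \<bar>dpart is (\<lambda>\<theta>. a \<theta> j) \<theta>\<bar> \<le> c * \<alpha> ^ j \<and>
                      \<bar>dpart is (\<lambda>\<theta>. b \<theta> j) \<theta>\<bar> \<le> c * \<alpha> ^ j))"
begin

lemma \<theta>s_D: "\<theta>s \<in> D" using \<theta>s interior_subset by blast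
lemma \<theta>s_G: "\<theta>s \<in> G" using \<theta>s_D D by blast

text \<open>The bounds in \<open>stable\<close> concern values of \<open>dpart\<close> and say
  nothing about differentiability of \<open>b\<close>. The inversion identity expresses
  \<open>b \<theta> j\<close> as a polynomial in coefficients of \<open>a\<close> and earlier
  coefficients of \<open>b\<close>, so smoothness follows by strong induction on the lag.\<close>

lemma b_C1: "C1_on G (\<lambda>\<theta>. b \<theta> j)"
proof (induction j rule: less_induct)
  case (less j)
  show ?case
  proof (cases "j = 0")
    case True
    have "C1_on G (\<lambda>\<theta>. b \<theta> 0) \<longleftrightarrow> C1_on G (\<lambda>\<theta>. 1 :: real)"
      using b_inv by (intro C1_on_cong G_open) auto
    thus ?thesis using True C1_on_const by simp
  next
    case False
    have "b \<theta> j = (\<Sum>k\<in>{1..j}. (-1) * (a \<theta> k * b \<theta> (j - k)))" if "\<theta> \<in> G" for \<theta>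
    proof -
      have "{..j} = insert 0 {1..j}" using False by auto
      hence "(\<Sum>k\<le>j. a \<theta> k * b \<theta> (j - k)) = a \<theta> 0 * b \<theta> (j - 0) + (\<Sum>k\<in>{1..j}. a \<theta> k * b \<theta> (j - k))"
        by simp
      thus ?thesis using b_inv that False a0 by (simp add: sum_negf)
    qed
    hence "C1_on G (\<lambda>\<theta>. b \<theta> j) \<longleftrightarrow> C1_on G (\<lambda>\<theta>. \<Sum>k\<in>{1..j}. (-1) * (a \<theta> k * b \<theta> (j - k)))"
      by (intro C1_on_cong G_open)
    moreover have "C1_on G (\<lambda>\<theta>. \<Sum>k\<in>{1..j}. (-1) * (a \<theta> k * b \<theta> (j - k)))"
    proof (intro C1_on_sum C1_on_cmult C1_on_mult)
      fix k assume "k \<in> {1..j}"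
      thus "C1_on G (\<lambda>\<theta>. b \<theta> (j - k))" using less[of "j - k"] by simp
      show "C1_on G (\<lambda>\<theta>. a \<theta> k)" using a_C3 Ck_on_imp_C1_on[of 1 G "\<lambda>\<theta>. a \<theta> k"]
        by (simp only: numeral_3_eq_3 One_nat_def)
    qed
    ultimately show ?thesis by simp
  qed
qed

definition db :: "real^'p \<Rightarrow> 'p \<Rightarrow> nat \<Rightarrow> real" where "db \<theta> i j = partial_d (\<lambda>\<theta>. b \<theta> j) i \<theta>"
text \<open>Impulse response of the inverse filter at \<theta> applied after the true filter, which
  maps the noise to the stationary innovation; at \<theta>s it is the unit impulse.\<close>

definition cf :: "real^'p \<Rightarrow> nat \<Rightarrow> real" where "cf \<theta> = b \<theta> \<star>\<^sub>c a \<theta>s"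
definition dcf :: "real^'p \<Rightarrow> 'p \<Rightarrow> nat \<Rightarrow> real" where "dcf \<theta> i = db \<theta> i \<star>\<^sub>c a \<theta>s"

text \<open>The true parameter is adjoined to \<open>C\<close> so that one pair of constants bounds
  both \<open>a \<theta>s\<close> and \<open>b\<close> over \<open>C\<close>. A rate \<beta> midway
  between \<alpha> and 1 then leaves room for their convolution.\<close>

lemma compact_bounds:
  assumes C: "compact C" "C \<subseteq> G"
  obtains c \<alpha> \<beta> K where "c > 0" "0 < \<alpha>" "\<alpha> < \<beta>" "\<beta> < 1" "K > 0"
    "\<And>j::nat. real (Suc j) * \<alpha> ^ j \<le> K * \<beta> ^ j" "\<And>j. \<bar>a \<theta>s j\<bar> \<le> c * \<alpha> ^ j"
    "\<And>\<theta> j. \<theta> \<in> C \<Longrightarrow> \<bar>b \<theta> j\<bar> \<le> c * \<alpha> ^ j" "\<And>\<theta> i j. \<theta> \<in> C \<Longrightarrow> \<bar>db \<theta> i j\<bar> \<le> c * \<alpha> ^ j"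
    "\<And>\<theta> j. \<theta> \<in> C \<Longrightarrow> \<bar>cf \<theta> j\<bar> \<le> c * c * K * \<beta> ^ j" "\<And>\<theta> i j. \<theta> \<in> C \<Longrightarrow> \<bar>dcf \<theta> i j\<bar> \<le> c * c * K * \<beta> ^ j"
proof -
  have "compact (insert \<theta>s C)" "insert \<theta>s C \<subseteq> G" using C \<theta>s_G by auto
  then obtain c \<alpha> where c: "c > 0" "0 < \<alpha>" "\<alpha> < 1" and bd: "\<And>\<theta> j is. \<theta> \<in> insert \<theta>s C \<Longrightarrow> length is \<le> 3 \<Longrightarrow>
                      \<bar>dpart is (\<lambda>\<theta>. a \<theta> j) \<theta>\<bar> \<le> c * \<alpha> ^ j \<and> \<bar>dpart is (\<lambda>\<theta>. b \<theta> j) \<theta>\<bar> \<le> c * \<alpha> ^ j"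
    using stable by metis
  define \<beta> where "\<beta> = (1 + \<alpha>) / 2"
  have \<beta>: "\<alpha> < \<beta>" "\<beta> < 1" using c by (auto simp: \<beta>_def)
  obtain K where K: "K > 0" "\<And>j::nat. real (Suc j) * \<alpha> ^ j \<le> K * \<beta> ^ j"
    using geometric_polynomial_bound[OF c(2) \<beta>(1)] by blast
  have A: "\<bar>a \<theta>s j\<bar> \<le> c * \<alpha> ^ j" for j using bd[of \<theta>s "[]" j] by simp
  have Bb: "\<bar>b \<theta> j\<bar> \<le> c * \<alpha> ^ j" if "\<theta> \<in> C" for \<theta> j using bd[of \<theta> "[]" j] that by simp
  have dB: "\<bar>db \<theta> i j\<bar> \<le> c * \<alpha> ^ j" if "\<theta> \<in> C" for \<theta> i j using bd[of \<theta> "[i]" j] that by (simp add: db_def)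
  show thesis
  proof (rule that[OF c(1,2) \<beta> K A])
    fix \<theta> j assume \<theta>: "\<theta> \<in> C"
    show "\<bar>b \<theta> j\<bar> \<le> c * \<alpha> ^ j" by (rule Bb[OF \<theta>])
    show "\<bar>cf \<theta> j\<bar> \<le> c * c * K * \<beta> ^ j"
      unfolding cf_def by (rule conv_bound[OF Bb[OF \<theta>] A K(2)]) (use c in auto)
    fix i
    show "\<bar>db \<theta> i j\<bar> \<le> c * \<alpha> ^ j" by (rule dB[OF \<theta>])
    show "\<bar>dcf \<theta> i j\<bar> \<le> c * c * K * \<beta> ^ j"
      unfolding dcf_def by (rule conv_bound[OF dB[OF \<theta>] A K(2)]) (use c in auto)
  qed
qed

lemma b_differentiable: "\<theta> \<in> G \<Longrightarrow> (\<lambda>\<theta>. b \<theta> j) differentiable (at \<theta>)"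
  using b_C1 by (simp add: C1_on_def)

lemma cf_C1: "C1_on G (\<lambda>\<theta>. cf \<theta> m)"
  unfolding cf_def conv_def by (intro C1_on_sum C1_on_mult b_C1 C1_on_const)

lemma cf_differentiable: "\<theta> \<in> G \<Longrightarrow> (\<lambda>\<theta>. cf \<theta> m) differentiable (at \<theta>)"
  using cf_C1 by (simp add: C1_on_def)

lemma partial_d_cf:
  assumes "\<theta> \<in> G"
  shows "partial_d (\<lambda>\<theta>. cf \<theta> m) i \<theta> = dcf \<theta> i m"
proof -
  have c: "(\<lambda>x::real^'p. c) differentiable (at \<theta>)" and c0: "partial_d (\<lambda>x. c) i \<theta> = 0" for c :: real
    using partial_d_eqI[OF has_derivative_const, of c i \<theta>] by auto
  have "partial_d (\<lambda>\<theta>. cf \<theta> m) i \<theta> = (\<Sum>k\<le>m. partial_d (\<lambda>\<theta>. b \<theta> k * a \<theta>s (m - k)) i \<theta>)"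
    unfolding cf_def conv_def by (intro partial_d_sum(1) partial_d_mult(2) b_differentiable assms c)
  also have "\<dots> = dcf \<theta> i m"
    by (simp add: dcf_def conv_def db_def partial_d_mult(1)[OF b_differentiable[OF assms] c] c0)
  finally show ?thesis .
qed

lemma dcf_continuous: "continuous_on G (\<lambda>\<theta>. dcf \<theta> i m)"
proof -
  have "continuous_on G (\<lambda>\<theta>. partial_d (\<lambda>\<theta>. cf \<theta> m) i \<theta>)" using cf_C1 by (simp add: C1_on_def)
  thus ?thesis by (simp add: partial_d_cf cong: continuous_on_cong)
qed

lemma cf_true: "cf \<theta>s m = (if m = 0 then 1 else 0)"
proof -
  have "cf \<theta>s m = (\<Sum>k\<le>m. a \<theta>s k * b \<theta>s (m - k))"
    unfolding cf_def conv_def by (rule sum.reindex_bij_witness[of _ "\<lambda>k. m - k" "\<lambda>k. m - k"]) auto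
  thus ?thesis using b_inv \<theta>s_G a0 by (cases "m = 0") auto
qed

lemma cf_0: "\<theta> \<in> G \<Longrightarrow> cf \<theta> 0 = 1"
  using b_inv a0 by (simp add: cf_def conv_def)

text \<open>The leading coefficient is constantly 1 on the open set \<open>G\<close>, so the
  derivative of the innovation involves only past noise. As \<open>cf \<theta>s\<close> is
  concentrated at lag 0, this makes the score vanish at \<theta>s term by term.\<close>

lemma dcf_0: assumes "\<theta> \<in> G" shows "dcf \<theta> i 0 = 0"
proof -
  have "partial_d (\<lambda>\<theta>. cf \<theta> 0) i \<theta> = partial_d (\<lambda>\<theta>. 1 :: real) i \<theta>"
    by (rule partial_d_cong_open[OF G_open assms]) (rule cf_0)
  thus ?thesis using partial_d_cf[OF assms] partial_d_eqI[OF has_derivative_const] by metis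
qed

text \<open>Half the gradient of the squared norm of \<open>cf\<close>; multiplied by the noise
  variance, it is the gradient of \<open>W_P\<close>.\<close>

definition score :: "real^'p \<Rightarrow> real^'p" where
  "score \<theta> = (\<chi> i. \<Sum>m. cf \<theta> m * dcf \<theta> i m)"

end

lemma abs_product_le:
  fixes x y E t :: real
  assumes "\<bar>x\<bar> \<le> E * t" "\<bar>y\<bar> \<le> E * t"
  shows "\<bar>x * y\<bar> \<le> E * E * (t * t)"
  using mult_mono[OF assms order_trans[OF abs_ge_zero assms(1)] abs_ge_zero]
  by (simp add: abs_mult mult_ac)

context causal_filter
begin

lemma geometric_square_summable: "0 < \<beta> \<Longrightarrow> \<beta> < 1 \<Longrightarrow> summable (\<lambda>m. E * (\<beta> ^ m * \<beta> ^ m))" for E \<beta> :: real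
  using mult_strict_mono[of \<beta> 1 \<beta> 1]
  by (intro summable_mult) (auto simp: power_mult_distrib[symmetric] intro!: summable_geometric)

lemma cf_lipschitz_on:
  assumes S: "convex S" "S \<subseteq> G" and E: "\<And>\<theta> i m. \<theta> \<in> S \<Longrightarrow> \<bar>dcf \<theta> i m\<bar> \<le> E * \<beta> ^ m" and xy: "x \<in> S" "y \<in> S"
  shows "\<bar>cf x m - cf y m\<bar> \<le> real CARD('p) * E * \<beta> ^ m * norm (x - y)"
proof -
  have "norm (cf x m - cf y m) \<le> real CARD('p) * (E * \<beta> ^ m) * norm (x - y)"
  proof (rule partial_d_lipschitz[OF S(1) _ _ xy, where f = "\<lambda>\<theta>. cf \<theta> m"])
    fix z assume "z \<in> S"
    hence z: "z \<in> G" "z \<in> S" using S by auto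
    show "(\<lambda>\<theta>. cf \<theta> m) differentiable (at z)" by (rule cf_differentiable[OF z(1)])
    show "norm (partial_d (\<lambda>\<theta>. cf \<theta> m) i z) \<le> E * \<beta> ^ m" for i
      using E[OF z(2)] by (simp add: partial_d_cf[OF z(1)])
  qed
  thus ?thesis by (simp add: mult.assoc)
qed

lemma cf_has_derivative:
  assumes "\<theta> \<in> G"
  shows "((\<lambda>\<theta>. cf \<theta> m) has_derivative (\<lambda>h. \<Sum>i\<in>UNIV. h $ i * dcf \<theta> i m)) (at \<theta>)"
  using has_derivative_partial_d[OF cf_differentiable[OF assms, of m]] by (simp add: partial_d_cf[OF assms])

lemma directional_bound:
  fixes h :: "real^'p" and d :: "'p \<Rightarrow> real"
  assumes "\<And>i. \<bar>d i\<bar> \<le> B"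
  shows "\<bar>\<Sum>i\<in>UNIV. h $ i * d i\<bar> \<le> real CARD('p) * B * norm h"
proof -
  have "\<bar>\<Sum>i\<in>UNIV. h $ i * d i\<bar> \<le> (\<Sum>i\<in>(UNIV::'p set). norm h * B)"
    using assms component_le_norm_cart[of h]
    by (intro order_trans[OF sum_abs sum_mono]) (auto simp: abs_mult intro!: mult_mono)
  thus ?thesis by (simp add: mult_ac)
qed

text \<open>The summands are quadratic in \<open>cf\<close>, so their Lipschitz constants and
  derivatives near \<theta> decay like \<open>\<beta> ^ m * \<beta> ^ m\<close>. The closed ball
  provides both compactness for uniform bounds and convexity for the mean value inequality.\<close>

lemma cf_square_sum_has_derivative:
  assumes \<theta>: "\<theta> \<in> G"
  shows "((\<lambda>\<theta>. \<Sum>m. (cf \<theta> m)\<^sup>2) has_derivative (\<lambda>h. (2 *\<^sub>R score \<theta>) \<bullet> h)) (at \<theta>)"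
proof -
  obtain \<rho> where \<rho>: "\<rho> > 0" "cball \<theta> \<rho> \<subseteq> G" using open_contains_cball G_open \<theta> by metis
  obtain c \<alpha> \<beta> K where bd: "c > 0" "0 < \<alpha>" "\<alpha> < \<beta>" "\<beta> < 1" "K > 0"
    and cf_bd: "\<And>\<theta>' j. \<theta>' \<in> cball \<theta> \<rho> \<Longrightarrow> \<bar>cf \<theta>' j\<bar> \<le> c * c * K * \<beta> ^ j"
    and dcf_bd: "\<And>\<theta>' i j. \<theta>' \<in> cball \<theta> \<rho> \<Longrightarrow> \<bar>dcf \<theta>' i j\<bar> \<le> c * c * K * \<beta> ^ j"
    using compact_bounds[OF compact_cball \<rho>(2)] by metis
  define E where "E = c * c * K"
  have E: "E \<ge> 0" using bd by (simp add: E_def)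
  have \<theta>b: "\<theta> \<in> cball \<theta> \<rho>" using \<rho> by simp
  let ?n = "real CARD('p)"
  have \<beta>: "0 < \<beta>" "\<beta> < 1" using bd by auto
  have "((\<lambda>\<theta>. \<Sum>m. (cf \<theta> m)\<^sup>2) has_derivative (\<lambda>h. \<Sum>m. 2 * cf \<theta> m * (\<Sum>i\<in>UNIV. h $ i * dcf \<theta> i m))) (at \<theta>)"
  proof (rule has_derivative_series_dominated[OF _ \<rho>(1), where B = "\<lambda>m. (2 * E * (?n * E)) * (\<beta> ^ m * \<beta> ^ m)"])
    show "((\<lambda>\<theta>. (cf \<theta> m)\<^sup>2) has_derivative (\<lambda>h. 2 * cf \<theta> m * (\<Sum>i\<in>UNIV. h $ i * dcf \<theta> i m))) (at \<theta>)" for m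
      by (rule has_derivative_eq_rhs[OF has_derivative_power[OF cf_has_derivative[OF \<theta>]]]) (simp add: fun_eq_iff mult_ac)
    show "\<bar>(cf x m)\<^sup>2 - (cf \<theta> m)\<^sup>2\<bar> \<le> (2 * E * (?n * E)) * (\<beta> ^ m * \<beta> ^ m) * norm (x - \<theta>)" if "norm (x - \<theta>) < \<rho>" for m x
    proof -
      have x: "x \<in> cball \<theta> \<rho>" using that by (simp add: dist_norm norm_minus_commute)
      have "(cf x m)\<^sup>2 - (cf \<theta> m)\<^sup>2 = (cf x m + cf \<theta> m) * (cf x m - cf \<theta> m)"
        by (simp add: power2_eq_square algebra_simps)
      hence "\<bar>(cf x m)\<^sup>2 - (cf \<theta> m)\<^sup>2\<bar> = \<bar>cf x m + cf \<theta> m\<bar> * \<bar>cf x m - cf \<theta> m\<bar>" by (simp add: abs_mult)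
      also have "\<dots> \<le> (2 * E * \<beta> ^ m) * (?n * E * \<beta> ^ m * norm (x - \<theta>))"
      proof (rule mult_mono)
        show "\<bar>cf x m + cf \<theta> m\<bar> \<le> 2 * E * \<beta> ^ m"
          using cf_bd[OF x, of m] cf_bd[OF \<theta>b, of m] unfolding E_def by linarith
        show "\<bar>cf x m - cf \<theta> m\<bar> \<le> ?n * E * \<beta> ^ m * norm (x - \<theta>)"
          by (rule cf_lipschitz_on[OF convex_cball \<rho>(2) _ x \<theta>b]) (use dcf_bd in \<open>simp add: E_def\<close>)
      qed (use E \<beta> in auto)
      finally show ?thesis by (simp add: mult_ac)
    qed
    show "\<bar>2 * cf \<theta> m * (\<Sum>i\<in>UNIV. h $ i * dcf \<theta> i m)\<bar> \<le> (2 * E * (?n * E)) * (\<beta> ^ m * \<beta> ^ m) * norm h" for m h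
    proof -
      have "\<bar>2 * cf \<theta> m * (\<Sum>i\<in>UNIV. h $ i * dcf \<theta> i m)\<bar> = (2 * \<bar>cf \<theta> m\<bar>) * \<bar>\<Sum>i\<in>UNIV. h $ i * dcf \<theta> i m\<bar>"
        by (simp add: abs_mult)
      also have "\<dots> \<le> (2 * (E * \<beta> ^ m)) * (?n * (E * \<beta> ^ m) * norm h)"
        using cf_bd[OF \<theta>b] dcf_bd[OF \<theta>b] E \<beta> by (intro mult_mono directional_bound) (auto simp: E_def)
      finally show ?thesis by (simp add: mult_ac)
    qed
    show "summable (\<lambda>m. (2 * E * (?n * E)) * (\<beta> ^ m * \<beta> ^ m))" by (rule geometric_square_summable[OF \<beta>])
    show "summable (\<lambda>m. (cf \<theta> m)\<^sup>2)"
    proof (rule abs_suminf_le(1)[OF _ geometric_square_summable[OF \<beta>, of "E * E"]])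
      show "\<bar>(cf \<theta> m)\<^sup>2\<bar> \<le> E * E * (\<beta> ^ m * \<beta> ^ m)" for m
        unfolding power2_eq_square E_def by (intro abs_product_le cf_bd[OF \<theta>b])
    qed
  qed
  moreover have "(\<Sum>m. 2 * cf \<theta> m * (\<Sum>i\<in>UNIV. h $ i * dcf \<theta> i m)) = (2 *\<^sub>R score \<theta>) \<bullet> h" for h :: "real^'p"
  proof -
    have s: "summable (\<lambda>m. cf \<theta> m * dcf \<theta> i m)" for i
    proof (rule abs_suminf_le(1)[OF _ geometric_square_summable[OF \<beta>, of "E * E"]])
      show "\<bar>cf \<theta> m * dcf \<theta> i m\<bar> \<le> E * E * (\<beta> ^ m * \<beta> ^ m)" for m
        unfolding E_def by (intro abs_product_le cf_bd[OF \<theta>b] dcf_bd[OF \<theta>b])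
    qed
    have "(\<Sum>m. 2 * cf \<theta> m * (\<Sum>i\<in>UNIV. h $ i * dcf \<theta> i m)) = (\<Sum>m. \<Sum>i\<in>UNIV. (2 * h $ i) * (cf \<theta> m * dcf \<theta> i m))"
      by (simp add: sum_distrib_left mult_ac)
    also have "\<dots> = (\<Sum>i\<in>UNIV. \<Sum>m. (2 * h $ i) * (cf \<theta> m * dcf \<theta> i m))"
      by (rule suminf_sum) (intro summable_mult s)
    also have "\<dots> = (2 *\<^sub>R score \<theta>) \<bullet> h"
      unfolding suminf_mult[OF s] by (simp add: score_def inner_vec_def mult_ac)
    finally show ?thesis .
  qed
  ultimately show ?thesis by simp
qed

lemma score_continuous: "continuous_on D score"
  unfolding score_def
proof (rule continuous_on_vec_lambda)
  fix i
  obtain c \<alpha> \<beta> K where bd: "c > 0" "0 < \<alpha>" "\<alpha> < \<beta>" "\<beta> < 1" "K > 0"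
    and cf_bd: "\<And>\<theta>' j. \<theta>' \<in> D \<Longrightarrow> \<bar>cf \<theta>' j\<bar> \<le> c * c * K * \<beta> ^ j"
    and dcf_bd: "\<And>\<theta>' i j. \<theta>' \<in> D \<Longrightarrow> \<bar>dcf \<theta>' i j\<bar> \<le> c * c * K * \<beta> ^ j"
    using compact_bounds[OF D] by metis
  define E where "E = c * c * K"
  have E: "E \<ge> 0" using bd by (simp add: E_def)
  have \<beta>: "0 < \<beta>" "\<beta> < 1" using bd by auto
  have "uniform_limit D (\<lambda>n \<theta>. \<Sum>m<n. cf \<theta> m * dcf \<theta> i m) (\<lambda>\<theta>. \<Sum>m. cf \<theta> m * dcf \<theta> i m) sequentially"
  proof (rule Weierstrass_m_test[OF _ geometric_square_summable[OF \<beta>, of "E * E"]])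
    show "norm (cf \<theta> m * dcf \<theta> i m) \<le> E * E * (\<beta> ^ m * \<beta> ^ m)" if "\<theta> \<in> D" for m \<theta>
      unfolding E_def real_norm_def by (intro abs_product_le cf_bd[OF that] dcf_bd[OF that])
  qed
  thus "continuous_on D (\<lambda>\<theta>. \<Sum>m. cf \<theta> m * dcf \<theta> i m)"
  proof (rule uniform_limit_theorem[rotated])
    show "\<forall>\<^sub>F n in sequentially. continuous_on D (\<lambda>\<theta>. \<Sum>m<n. cf \<theta> m * dcf \<theta> i m)"
    proof (intro always_eventually allI continuous_on_sum continuous_on_mult)
      show "continuous_on D (\<lambda>\<theta>. cf \<theta> m)" for m
        using C1_on_continuous[OF cf_C1] D(2) by (rule continuous_on_subset)
      show "continuous_on D (\<lambda>\<theta>. dcf \<theta> i m)" for m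
        using dcf_continuous D(2) by (rule continuous_on_subset)
    qed
  qed simp
qed

text \<open>At \<theta>s each summand has a vanishing factor: \<open>cf\<close> at positive lags,
  \<open>dcf\<close> at lag 0. The derivative is therefore a Gram form of the sensitivities
  \<open>dcf \<theta>s\<close>, with no second derivative of the inverse filter.\<close>

lemma score_component_has_derivative:
  "((\<lambda>\<theta>. score \<theta> $ i) has_derivative (\<lambda>h. \<Sum>m. (\<Sum>j\<in>UNIV. h $ j * dcf \<theta>s j m) * dcf \<theta>s i m)) (at \<theta>s)"
proof -
  obtain \<rho> where \<rho>: "\<rho> > 0" "cball \<theta>s \<rho> \<subseteq> G" using open_contains_cball G_open \<theta>s_G by metis
  obtain c \<alpha> \<beta> K where bd: "c > 0" "0 < \<alpha>" "\<alpha> < \<beta>" "\<beta> < 1" "K > 0"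
    and cf_bd: "\<And>\<theta>' j. \<theta>' \<in> cball \<theta>s \<rho> \<Longrightarrow> \<bar>cf \<theta>' j\<bar> \<le> c * c * K * \<beta> ^ j"
    and dcf_bd: "\<And>\<theta>' i j. \<theta>' \<in> cball \<theta>s \<rho> \<Longrightarrow> \<bar>dcf \<theta>' i j\<bar> \<le> c * c * K * \<beta> ^ j"
    using compact_bounds[OF compact_cball \<rho>(2)] by metis
  define E where "E = c * c * K"
  have E: "E \<ge> 0" using bd by (simp add: E_def)
  have \<theta>b: "\<theta>s \<in> cball \<theta>s \<rho>" using \<rho> by simp
  let ?n = "real CARD('p)"
  have \<beta>: "0 < \<beta>" "\<beta> < 1" using bd by auto
  have base: "cf \<theta>s m * dcf \<theta>s i m = 0" for m
    using cf_true[of m] dcf_0[OF \<theta>s_G, of i] by simp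
  have "((\<lambda>\<theta>. \<Sum>m. cf \<theta> m * dcf \<theta> i m) has_derivative (\<lambda>h. \<Sum>m. (\<Sum>j\<in>UNIV. h $ j * dcf \<theta>s j m) * dcf \<theta>s i m)) (at \<theta>s)"
  proof (rule has_derivative_series_dominated[OF _ \<rho>(1), where B = "\<lambda>m. (?n * E * E) * (\<beta> ^ m * \<beta> ^ m)"])
    have L: "\<bar>cf x m - cf \<theta>s m\<bar> \<le> ?n * E * \<beta> ^ m * norm (x - \<theta>s)" if "norm (x - \<theta>s) < \<rho>" for m x
    proof -
      have x: "x \<in> cball \<theta>s \<rho>" using that by (simp add: dist_norm norm_minus_commute)
      show ?thesis by (rule cf_lipschitz_on[OF convex_cball \<rho>(2) _ x \<theta>b]) (use dcf_bd in \<open>simp add: E_def\<close>)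
    qed
    show *: "\<bar>cf x m * dcf x i m - cf \<theta>s m * dcf \<theta>s i m\<bar> \<le> (?n * E * E) * (\<beta> ^ m * \<beta> ^ m) * norm (x - \<theta>s)"
      if x: "norm (x - \<theta>s) < \<rho>" for m x
    proof (cases "m = 0")
      case True
      have "x \<in> G" using x \<rho>(2) by (auto simp: dist_norm norm_minus_commute)
      thus ?thesis using True dcf_0 \<theta>s_G E \<beta> by simp
    next
      case False
      have xb: "x \<in> cball \<theta>s \<rho>" using x by (simp add: dist_norm norm_minus_commute)
      have "\<bar>cf x m * dcf x i m - cf \<theta>s m * dcf \<theta>s i m\<bar> = \<bar>cf x m - cf \<theta>s m\<bar> * \<bar>dcf x i m\<bar>"
        using False by (simp add: cf_true abs_mult)
      also have "\<dots> \<le> (?n * E * \<beta> ^ m * norm (x - \<theta>s)) * (E * \<beta> ^ m)"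
        using L[OF x] dcf_bd[OF xb] E \<beta> by (intro mult_mono) (auto simp: E_def)
      finally show ?thesis by (simp add: mult_ac)
    qed
    show "((\<lambda>\<theta>. cf \<theta> m * dcf \<theta> i m) has_derivative (\<lambda>h. (\<Sum>j\<in>UNIV. h $ j * dcf \<theta>s j m) * dcf \<theta>s i m)) (at \<theta>s)" for m
    proof (cases "m = 0")
      case True
      have "((\<lambda>\<theta>. cf \<theta> 0 * dcf \<theta> i 0) has_derivative (\<lambda>h. 0)) (at \<theta>s)"
        by (rule has_derivative_transform_within_open[OF has_derivative_const[of 0] G_open \<theta>s_G]) (simp add: dcf_0)
      thus ?thesis using True by (simp add: dcf_0[OF \<theta>s_G])
    next
      case False
      \<comment> \<open>The second factor is only continuous; the product is differentiable because the first factor vanishes at \<^term>\<open>\<theta>s\<close>.\<close>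
      have lim: "((\<lambda>y. dcf y i m) \<longlongrightarrow> dcf \<theta>s i m) (at \<theta>s)"
        using dcf_continuous[of i m] G_open \<theta>s_G by (simp add: continuous_on_eq_continuous_at isCont_def)
      show ?thesis
        unfolding has_derivative_at_within
      proof (intro conjI)
        let ?d = "\<lambda>h::real^'p. \<Sum>j\<in>UNIV. h $ j * dcf \<theta>s j m"
        have dd: "((\<lambda>\<theta>. cf \<theta> m) has_derivative ?d) (at \<theta>s)" by (rule cf_has_derivative[OF \<theta>s_G])
        hence bl: "bounded_linear ?d" by (rule has_derivative_bounded_linear)
        thus "bounded_linear (\<lambda>h. ?d h * dcf \<theta>s i m)" by (rule bounded_linear_mult_const)
        have r0: "((\<lambda>y. (cf y m - ?d (y - \<theta>s)) /\<^sub>R norm (y - \<theta>s)) \<longlongrightarrow> 0) (at \<theta>s)"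
          using dd False unfolding has_derivative_at_within by (simp add: cf_true)
        obtain B where B: "\<And>h. norm (?d h) \<le> norm h * B" using bounded_linear.bounded[OF bl] by blast
        have r1: "((\<lambda>y. (?d (y - \<theta>s) / norm (y - \<theta>s)) * (dcf y i m - dcf \<theta>s i m)) \<longlongrightarrow> 0) (at \<theta>s)"
        proof (rule Lim_null_comparison)
          have "((\<lambda>y. \<bar>B\<bar> * \<bar>dcf y i m - dcf \<theta>s i m\<bar>) \<longlongrightarrow> \<bar>B\<bar> * \<bar>dcf \<theta>s i m - dcf \<theta>s i m\<bar>) (at \<theta>s)"
            by (intro tendsto_intros lim)
          thus "((\<lambda>y. \<bar>B\<bar> * \<bar>dcf y i m - dcf \<theta>s i m\<bar>) \<longlongrightarrow> 0) (at \<theta>s)" by simp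
          show "\<forall>\<^sub>F y in at \<theta>s. norm ((?d (y - \<theta>s) / norm (y - \<theta>s)) * (dcf y i m - dcf \<theta>s i m)) \<le> \<bar>B\<bar> * \<bar>dcf y i m - dcf \<theta>s i m\<bar>"
          proof (rule always_eventually, rule allI)
            fix y
            have "\<bar>?d (y - \<theta>s) / norm (y - \<theta>s)\<bar> \<le> \<bar>B\<bar>"
            proof (cases "y = \<theta>s")
              case False
              hence n: "norm (y - \<theta>s) > 0" by simp
              have "\<bar>?d (y - \<theta>s)\<bar> \<le> norm (y - \<theta>s) * \<bar>B\<bar>"
                using B[of "y - \<theta>s"] mult_left_mono[OF abs_ge_self[of B] norm_ge_zero[of "y - \<theta>s"]] by simp
              thus ?thesis using n by (simp add: abs_divide pos_divide_le_eq mult.commute)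
            qed simp
            thus "norm ((?d (y - \<theta>s) / norm (y - \<theta>s)) * (dcf y i m - dcf \<theta>s i m)) \<le> \<bar>B\<bar> * \<bar>dcf y i m - dcf \<theta>s i m\<bar>"
              unfolding real_norm_def abs_mult by (rule mult_right_mono) simp
          qed
        qed
        have "((\<lambda>y. ((cf y m - ?d (y - \<theta>s)) /\<^sub>R norm (y - \<theta>s)) * dcf y i m + (?d (y - \<theta>s) / norm (y - \<theta>s)) * (dcf y i m - dcf \<theta>s i m)) \<longlongrightarrow> 0 * dcf \<theta>s i m + 0) (at \<theta>s)"
          by (intro tendsto_add tendsto_mult r0 r1 lim)
        moreover have "((cf y m - ?d (y - \<theta>s)) /\<^sub>R norm (y - \<theta>s)) * dcf y i m + (?d (y - \<theta>s) / norm (y - \<theta>s)) * (dcf y i m - dcf \<theta>s i m)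
            = (cf y m * dcf y i m - cf \<theta>s m * dcf \<theta>s i m - ?d (y - \<theta>s) * dcf \<theta>s i m) /\<^sub>R norm (y - \<theta>s)" for y
          using False by (simp add: cf_true divide_inverse algebra_simps)
        ultimately show "((\<lambda>y. (cf y m * dcf y i m - cf \<theta>s m * dcf \<theta>s i m - ?d (y - \<theta>s) * dcf \<theta>s i m) /\<^sub>R norm (y - \<theta>s)) \<longlongrightarrow> 0) (at \<theta>s)"
          by simp
      qed
    qed
    show "\<bar>(\<Sum>j\<in>UNIV. h $ j * dcf \<theta>s j m) * dcf \<theta>s i m\<bar> \<le> (?n * E * E) * (\<beta> ^ m * \<beta> ^ m) * norm h" for m h
    proof -
      have "\<bar>(\<Sum>j\<in>UNIV. h $ j * dcf \<theta>s j m) * dcf \<theta>s i m\<bar> \<le> (?n * (E * \<beta> ^ m) * norm h) * (E * \<beta> ^ m)"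
        unfolding abs_mult using dcf_bd[OF \<theta>b] E \<beta> by (intro mult_mono directional_bound) (auto simp: E_def)
      thus ?thesis by (simp add: mult_ac)
    qed
    show "summable (\<lambda>m. (?n * E * E) * (\<beta> ^ m * \<beta> ^ m))" by (rule geometric_square_summable[OF \<beta>])
    show "summable (\<lambda>m. cf \<theta>s m * dcf \<theta>s i m)" by (simp add: base)
  qed
  thus ?thesis by (simp add: score_def)
qed

text \<open>\<open>D\<close> need not be convex, so the mean value inequality is used only on a ball
  around \<theta>s. Outside it the distance to \<theta>s is at least the radius, and the decay of
  both kernels suffices.\<close>

lemma b_lipschitz:
  assumes c: "c > 0" "0 < \<alpha>" and b: "\<And>\<theta> j. \<theta> \<in> D \<Longrightarrow> \<bar>b \<theta> j\<bar> \<le> c * \<alpha> ^ j"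
    and db: "\<And>\<theta> i j. \<theta> \<in> D \<Longrightarrow> \<bar>db \<theta> i j\<bar> \<le> c * \<alpha> ^ j"
  obtains \<Lambda> where "\<Lambda> > 0" "\<And>\<theta> j. \<theta> \<in> D \<Longrightarrow> \<bar>b \<theta> j - b \<theta>s j\<bar> \<le> \<Lambda> * norm (\<theta> - \<theta>s) * \<alpha> ^ j"
proof -
  obtain \<rho> where \<rho>: "\<rho> > 0" "cball \<theta>s \<rho> \<subseteq> D" using \<theta>s mem_interior_cball by metis
  let ?\<Lambda> = "real CARD('p) * c + 2 * c / \<rho>"
  show thesis
  proof (rule that[of ?\<Lambda>])
    show "?\<Lambda> > 0" using c \<rho> by (simp add: add_nonneg_pos)
    fix \<theta> j assume \<theta>: "\<theta> \<in> D"
    show "\<bar>b \<theta> j - b \<theta>s j\<bar> \<le> ?\<Lambda> * norm (\<theta> - \<theta>s) * \<alpha> ^ j"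
    proof (cases "norm (\<theta> - \<theta>s) \<le> \<rho>")
      case True
      have "norm (b \<theta> j - b \<theta>s j) \<le> real CARD('p) * (c * \<alpha> ^ j) * norm (\<theta> - \<theta>s)"
      proof (rule partial_d_lipschitz[OF convex_cball, where f = "\<lambda>\<theta>. b \<theta> j"])
        fix z assume z: "z \<in> cball \<theta>s \<rho>"
        show "(\<lambda>\<theta>. b \<theta> j) differentiable (at z)" using z \<rho>(2) D(2) by (intro b_differentiable) auto
        show "norm (partial_d (\<lambda>\<theta>. b \<theta> j) i z) \<le> c * \<alpha> ^ j" for i
          using db[of z i j] z \<rho>(2) by (auto simp: db_def)
      qed (use True \<rho>(1) in \<open>auto simp: dist_norm norm_minus_commute\<close>)
      also have "\<dots> = real CARD('p) * c * (norm (\<theta> - \<theta>s) * \<alpha> ^ j)" by simp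
      also have "\<dots> \<le> ?\<Lambda> * (norm (\<theta> - \<theta>s) * \<alpha> ^ j)" using c \<rho> by (intro mult_right_mono) auto
      finally show ?thesis by (simp add: mult.assoc)
    next
      case False
      have "\<bar>b \<theta> j - b \<theta>s j\<bar> \<le> 2 * c * \<alpha> ^ j" using b[OF \<theta>, of j] b[OF \<theta>s_D, of j] by linarith
      also have "\<dots> = (2 * c / \<rho>) * (\<rho> * \<alpha> ^ j)" using \<rho>(1) by simp
      also have "\<dots> \<le> ?\<Lambda> * (norm (\<theta> - \<theta>s) * \<alpha> ^ j)" using c \<rho> False by (intro mult_mono mult_right_mono) auto
      finally show ?thesis by (simp add: mult.assoc)
    qed
  qed
qed

end

subsection \<open>The score of the characteristic function criterion\<close>

text \<open>The gradient in \<eta> of \<open>herm_form A (\<lambda>k. m k - f k \<eta>)\<close>.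
  Inserting for \<open>m\<close> one observation, the empirical means or the true characteristic
  function gives the scores of one summand, of the average and of the limit. \<open>A\<close> occurs
  with its transpose because both slots of the form are differentiated.\<close>

definition ecf_score :: "real^'k^'k \<Rightarrow> ('k::finite \<Rightarrow> real^'q \<Rightarrow> complex) \<Rightarrow> ('k \<Rightarrow> complex) \<Rightarrow> real^'q \<Rightarrow> real^'q" where
  "ecf_score A f m \<eta> = (\<chi> i. - Re (\<Sum>k\<in>UNIV. \<Sum>l\<in>UNIV. partial_d (f k) i \<eta> * of_real (A $ k $ l + A $ l $ k) * cnj (m l - f l \<eta>)))"

text \<open>Conjugation preserves real parts and exchanges the roles of \<open>x\<close> and
  \<open>y\<close> at the price of transposing \<open>A\<close>.\<close>

lemma Re_cnj_symmetrize:
  fixes A :: "real^'k^'k"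
  shows "Re (\<Sum>k\<in>UNIV. \<Sum>l\<in>UNIV. x k * of_real (A $ k $ l) * cnj (y l) + y k * of_real (A $ k $ l) * cnj (x l))
       = Re (\<Sum>k\<in>UNIV. \<Sum>l\<in>UNIV. x k * of_real (A $ k $ l + A $ l $ k) * cnj (y l))"
proof -
  have "Re (\<Sum>k\<in>UNIV. \<Sum>l\<in>UNIV. y k * of_real (A $ k $ l) * cnj (x l)) = (\<Sum>k\<in>UNIV. \<Sum>l\<in>UNIV. Re (x l * of_real (A $ k $ l) * cnj (y k)))"
    by (simp add: algebra_simps)
  also have "\<dots> = (\<Sum>l\<in>UNIV. \<Sum>k\<in>UNIV. Re (x l * of_real (A $ k $ l) * cnj (y k)))" by (rule sum.swap)
  finally show ?thesis by (simp add: sum.distrib algebra_simps)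
qed

lemma herm_form_has_derivative:
  fixes f :: "'k::finite \<Rightarrow> real^'q \<Rightarrow> complex"
  assumes f: "\<And>k. f k differentiable (at \<eta>)"
  shows "((\<lambda>\<eta>. herm_form A (\<lambda>k. m k - f k \<eta>)) has_derivative (\<lambda>h. ecf_score A f m \<eta> \<bullet> h)) (at \<eta>)"
proof -
  let ?D = "\<lambda>k h. \<Sum>i\<in>UNIV. (h $ i) *\<^sub>R partial_d (f k) i \<eta>"
  have d: "((\<lambda>\<eta>. m k - f k \<eta>) has_derivative (\<lambda>h. - ?D k h)) (at \<eta>)" for k
    using has_derivative_diff[OF has_derivative_const has_derivative_partial_d[OF f[of k]]] by simp
  have dc: "((\<lambda>\<eta>. cnj (m k - f k \<eta>)) has_derivative (\<lambda>h. cnj (- ?D k h))) (at \<eta>)" for k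
    by (rule bounded_linear.has_derivative[OF bounded_linear_cnj d])
  have "((\<lambda>\<eta>. herm_form A (\<lambda>k. m k - f k \<eta>)) has_derivative
     (\<lambda>h. Re (\<Sum>k\<in>UNIV. \<Sum>l\<in>UNIV. (m k - f k \<eta>) * of_real (A $ k $ l) * cnj (- ?D l h) + (- ?D k h) * of_real (A $ k $ l) * cnj (m l - f l \<eta>)))) (at \<eta>)"
    unfolding herm_form_def
    by (intro bounded_linear.has_derivative[OF bounded_linear_Re] has_derivative_sum)
       (rule has_derivative_eq_rhs[OF has_derivative_mult[OF has_derivative_mult_left[OF d] dc]], simp)
  moreover have "Re (\<Sum>k\<in>UNIV. \<Sum>l\<in>UNIV. (m k - f k \<eta>) * of_real (A $ k $ l) * cnj (- ?D l h) + (- ?D k h) * of_real (A $ k $ l) * cnj (m l - f l \<eta>))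
      = ecf_score A f m \<eta> \<bullet> h" for h
  proof -
    have "Re (\<Sum>k\<in>UNIV. \<Sum>l\<in>UNIV. (m k - f k \<eta>) * of_real (A $ k $ l) * cnj (- ?D l h) + (- ?D k h) * of_real (A $ k $ l) * cnj (m l - f l \<eta>))
      = Re (\<Sum>k\<in>UNIV. \<Sum>l\<in>UNIV. (- ?D k h) * of_real (A $ k $ l) * cnj (m l - f l \<eta>) + (m k - f k \<eta>) * of_real (A $ k $ l) * cnj (- ?D l h))"
      by (simp only: add.commute)
    also have "\<dots> = Re (\<Sum>k\<in>UNIV. \<Sum>l\<in>UNIV. (- ?D k h) * of_real (A $ k $ l + A $ l $ k) * cnj (m l - f l \<eta>))"
      by (rule Re_cnj_symmetrize)
    also have "(\<Sum>k\<in>UNIV. \<Sum>l\<in>UNIV. (- ?D k h) * of_real (A $ k $ l + A $ l $ k) * cnj (m l - f l \<eta>))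
      = (\<Sum>k\<in>UNIV. \<Sum>l\<in>UNIV. \<Sum>i\<in>UNIV. - (of_real (h $ i) * (partial_d (f k) i \<eta> * of_real (A $ k $ l + A $ l $ k) * cnj (m l - f l \<eta>))))"
      by (simp only: scaleR_conv_of_real sum_distrib_right sum_negf mult_minus_left mult.assoc)
    also have "\<dots> = (\<Sum>k\<in>UNIV. \<Sum>i\<in>UNIV. \<Sum>l\<in>UNIV. - (of_real (h $ i) * (partial_d (f k) i \<eta> * of_real (A $ k $ l + A $ l $ k) * cnj (m l - f l \<eta>))))"
      by (intro sum.cong refl sum.swap)
    also have "\<dots> = (\<Sum>i\<in>UNIV. \<Sum>k\<in>UNIV. \<Sum>l\<in>UNIV. - (of_real (h $ i) * (partial_d (f k) i \<eta> * of_real (A $ k $ l + A $ l $ k) * cnj (m l - f l \<eta>))))"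
      by (rule sum.swap)
    also have "\<dots> = (\<Sum>i\<in>UNIV. of_real (h $ i) * - (\<Sum>k\<in>UNIV. \<Sum>l\<in>UNIV. partial_d (f k) i \<eta> * of_real (A $ k $ l + A $ l $ k) * cnj (m l - f l \<eta>)))"
      by (simp only: sum_distrib_left sum_negf mult_minus_right)
    also have "Re \<dots> = ecf_score A f m \<eta> \<bullet> h"
      unfolding inner_vec_def ecf_score_def Re_sum by (simp add: mult.commute)
    finally show ?thesis .
  qed
  ultimately show ?thesis by simp
qed

lemma sum_ecf_score:
  fixes A :: "real^'k^'k" and f :: "'k::finite \<Rightarrow> real^'q \<Rightarrow> complex" and e :: "'i \<Rightarrow> 'k \<Rightarrow> complex"
  assumes "finite I"
  shows "(\<Sum>n\<in>I. ecf_score A f (e n) \<eta>) = real (card I) *\<^sub>R ecf_score A f (\<lambda>l. (\<Sum>n\<in>I. e n l) / of_nat (card I)) \<eta>"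
proof (cases "I = {}")
  case False
  hence c: "card I \<noteq> 0" using assms by simp
  have "(\<Sum>n\<in>I. \<Sum>k\<in>UNIV. \<Sum>l\<in>UNIV. g k l * cnj (e n l - f l \<eta>)) = of_nat (card I) * (\<Sum>k\<in>UNIV. \<Sum>l\<in>UNIV. g k l * cnj ((\<Sum>n\<in>I. e n l) / of_nat (card I) - f l \<eta>))"
    for g :: "'k \<Rightarrow> 'k \<Rightarrow> complex"
  proof -
    have 1: "(\<Sum>n\<in>I. g k l * cnj (e n l - f l \<eta>)) = of_nat (card I) * (g k l * cnj ((\<Sum>n\<in>I. e n l) / of_nat (card I) - f l \<eta>))" for k l
    proof -
      have "(\<Sum>n\<in>I. g k l * cnj (e n l - f l \<eta>)) = g k l * cnj (\<Sum>n\<in>I. e n l - f l \<eta>)"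
        by (simp add: sum_distrib_left cnj_sum)
      also have "(\<Sum>n\<in>I. e n l - f l \<eta>) = of_nat (card I) * ((\<Sum>n\<in>I. e n l) / of_nat (card I) - f l \<eta>)"
        using c by (simp add: sum_subtractf right_diff_distrib)
      finally show ?thesis by (simp add: mult_ac)
    qed
    have "(\<Sum>n\<in>I. \<Sum>k\<in>UNIV. \<Sum>l\<in>UNIV. g k l * cnj (e n l - f l \<eta>)) = (\<Sum>k\<in>UNIV. \<Sum>n\<in>I. \<Sum>l\<in>UNIV. g k l * cnj (e n l - f l \<eta>))"
      by (rule sum.swap)
    also have "\<dots> = (\<Sum>k\<in>UNIV. \<Sum>l\<in>UNIV. \<Sum>n\<in>I. g k l * cnj (e n l - f l \<eta>))"
      by (intro sum.cong refl sum.swap)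
    finally show ?thesis unfolding 1 by (simp only: sum_distrib_left)
  qed
  note * = this
  show ?thesis
    unfolding vec_eq_iff
  proof
    fix i
    let ?g = "\<lambda>k l. partial_d (f k) i \<eta> * of_real (A $ k $ l + A $ l $ k)"
    have "(\<Sum>n\<in>I. ecf_score A f (e n) \<eta>) $ i = - Re (\<Sum>n\<in>I. \<Sum>k\<in>UNIV. \<Sum>l\<in>UNIV. ?g k l * cnj (e n l - f l \<eta>))"
      by (simp only: sum_component ecf_score_def vec_lambda_beta sum_negf Re_sum)
    also have "\<dots> = (real (card I) *\<^sub>R ecf_score A f (\<lambda>l. (\<Sum>n\<in>I. e n l) / of_nat (card I)) \<eta>) $ i"
      unfolding * by (simp only: vector_scaleR_component ecf_score_def vec_lambda_beta) simp
    finally show "(\<Sum>n\<in>I. ecf_score A f (e n) \<eta>) $ i = (real (card I) *\<^sub>R ecf_score A f (\<lambda>l. (\<Sum>n\<in>I. e n l) / of_nat (card I)) \<eta>) $ i" .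
  qed
qed simp

section \<open>Taylor bounds on a compact domain\<close>

text \<open>A Lipschitz bound relative to the interior point \<open>x0\<close> only. On a ball it is
  the mean value inequality; elsewhere in the possibly nonconvex \<open>D\<close> boundedness is
  enough, as the distance to \<open>x0\<close> is bounded below.\<close>

lemma C1_on_lipschitz_at:
  fixes g :: "real^'n \<Rightarrow> 'b::real_normed_vector"
  assumes g: "C1_on G g" and D: "compact D" "D \<subseteq> G" and x0: "x0 \<in> interior D"
  obtains B where "B > 0" "\<And>y. y \<in> D \<Longrightarrow> norm (g y) \<le> B" "\<And>y i. y \<in> D \<Longrightarrow> norm (partial_d g i y) \<le> B"
    "\<And>y. y \<in> D \<Longrightarrow> norm (g y - g x0) \<le> B * norm (y - x0)"
proof -
  obtain \<rho> where \<rho>: "\<rho> > 0" "cball x0 \<rho> \<subseteq> D" using x0 mem_interior_cball by metis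
  have x0D: "x0 \<in> D" using x0 interior_subset by blast
  have bdd: "\<exists>B>0. \<forall>y\<in>D. norm (h y) \<le> B" if "continuous_on G h" for h :: "real^'n \<Rightarrow> 'b"
  proof -
    have "compact (h ` D)" using continuous_on_subset[OF that D(2)] D(1) by (rule compact_continuous_image)
    then obtain B where "\<forall>x\<in>h ` D. norm x \<le> B" using compact_imp_bounded[of "h ` D"] by (auto simp: bounded_iff)
    thus ?thesis by (intro exI[of _ "\<bar>B\<bar> + 1"]) (auto intro: order_trans)
  qed
  obtain B1 where B1: "B1 > 0" "\<And>y. y \<in> D \<Longrightarrow> norm (g y) \<le> B1" using bdd[OF C1_on_continuous[OF g]] by blast
  have "\<forall>i. \<exists>B>0. \<forall>y\<in>D. norm (partial_d g i y) \<le> B" using g by (intro allI bdd) (simp add: C1_on_def)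
  then obtain Bp where Bp: "\<And>i. Bp i > 0" "\<And>i y. y \<in> D \<Longrightarrow> norm (partial_d g i y) \<le> Bp i" by metis
  define B2 where "B2 = (\<Sum>i\<in>UNIV. Bp i)"
  have B2: "norm (partial_d g i y) \<le> B2" if "y \<in> D" for i y
  proof -
    have "Bp i \<le> B2" unfolding B2_def using Bp(1) by (intro member_le_sum) (auto intro: less_imp_le)
    thus ?thesis using Bp(2)[OF that, of i] by linarith
  qed
  have B20: "B2 \<ge> 0" unfolding B2_def using Bp(1) by (intro sum_nonneg) (auto intro: less_imp_le)
  define B where "B = B1 + B2 + real CARD('n) * B2 + 2 * B1 / \<rho>"
  have B: "B1 \<le> B" "B2 \<le> B" "real CARD('n) * B2 \<le> B" "2 * B1 / \<rho> \<le> B"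
    using B1(1) B20 \<rho>(1) by (auto simp: B_def add_increasing add_increasing2)
  show thesis
  proof (rule that[of B])
    show "B > 0" using B1(1) B(1) by linarith
    show "norm (g y) \<le> B" if "y \<in> D" for y using B1(2)[OF that] B(1) by linarith
    show "norm (partial_d g i y) \<le> B" if "y \<in> D" for y i using B2[OF that, of i] B(2) by linarith
    fix y assume y: "y \<in> D"
    show "norm (g y - g x0) \<le> B * norm (y - x0)"
    proof (cases "norm (y - x0) \<le> \<rho>")
      case True
      have "norm (g y - g x0) \<le> real CARD('n) * B2 * norm (y - x0)"
      proof (rule partial_d_lipschitz[OF convex_cball])
        fix z assume z: "z \<in> cball x0 \<rho>"
        have "z \<in> G" using z \<rho>(2) D(2) by blast
        thus "g differentiable (at z)" using g by (simp add: C1_on_def)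
        show "norm (partial_d g i z) \<le> B2" for i using B2 z \<rho>(2) by auto
      qed (use True \<rho>(1) in \<open>auto simp: dist_norm norm_minus_commute\<close>)
      also have "\<dots> \<le> B * norm (y - x0)" using B(3) by (intro mult_right_mono) auto
      finally show ?thesis .
    next
      case False
      have "norm (g y - g x0) \<le> norm (g y) + norm (g x0)" by (rule norm_triangle_ineq4)
      also have "\<dots> \<le> 2 * B1" using B1(2)[OF y] B1(2)[OF x0D] by simp
      also have "\<dots> = 2 * B1 / \<rho> * \<rho>" using \<rho>(1) by simp
      also have "\<dots> \<le> B * norm (y - x0)" using False B(1,4) \<rho>(1) B1(1) by (intro mult_mono) auto
      finally show ?thesis .
    qed
  qed
qed

text \<open>A quadratic Taylor remainder on all of \<open>D\<close>, again by a ball and its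
  complement: outside the ball a linear bound becomes quadratic after division by the
  radius.\<close>

lemma C2_on_bounds:
  fixes f :: "real^'n \<Rightarrow> 'b::real_normed_vector"
  assumes f: "Ck_on 3 G f" and D: "compact D" "D \<subseteq> G" and x0: "x0 \<in> interior D"
  obtains B where "B > 0"
    "\<And>y i. y \<in> D \<Longrightarrow> norm (partial_d f i y) \<le> B"
    "\<And>y. y \<in> D \<Longrightarrow> norm (f y - f x0) \<le> B * norm (y - x0)"
    "\<And>y i. y \<in> D \<Longrightarrow> norm (partial_d f i y - partial_d f i x0) \<le> B * norm (y - x0)"
    "\<And>y. y \<in> D \<Longrightarrow> norm (f y - f x0 - (\<Sum>j\<in>UNIV. ((y - x0) $ j) *\<^sub>R partial_d f j x0)) \<le> B * (norm (y - x0))\<^sup>2"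
proof -
  have C1: "C1_on G f" and C1': "\<And>i. C1_on G (\<lambda>x. partial_d f i x)"
    using f by (auto simp: numeral_3_eq_3 C1_on_def)
  obtain \<rho> where \<rho>: "\<rho> > 0" "cball x0 \<rho> \<subseteq> D" using x0 mem_interior_cball by metis
  have x0D: "x0 \<in> D" using x0 interior_subset by blast
  obtain B1 where B1: "B1 > 0" "\<And>y. y \<in> D \<Longrightarrow> norm (f y) \<le> B1" "\<And>y i. y \<in> D \<Longrightarrow> norm (partial_d f i y) \<le> B1"
    "\<And>y. y \<in> D \<Longrightarrow> norm (f y - f x0) \<le> B1 * norm (y - x0)"
    using C1_on_lipschitz_at[OF C1 D x0] by metis
  have "\<forall>i. \<exists>B>0. \<forall>y\<in>D. norm (partial_d f i y - partial_d f i x0) \<le> B * norm (y - x0)"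
    using C1_on_lipschitz_at[OF C1' D x0] by metis
  then obtain Bp where Bp: "\<And>i. Bp i > 0" "\<And>i y. y \<in> D \<Longrightarrow> norm (partial_d f i y - partial_d f i x0) \<le> Bp i * norm (y - x0)" by metis
  define B2 where "B2 = (\<Sum>i\<in>UNIV. Bp i)"
  have B20: "B2 \<ge> 0" unfolding B2_def using Bp(1) by (intro sum_nonneg) (auto intro: less_imp_le)
  have B2: "norm (partial_d f i y - partial_d f i x0) \<le> B2 * norm (y - x0)" if "y \<in> D" for i y
  proof -
    have "Bp i \<le> B2" unfolding B2_def using Bp(1) by (intro member_le_sum) (auto intro: less_imp_le)
    hence "Bp i * norm (y - x0) \<le> B2 * norm (y - x0)" by (intro mult_right_mono) auto
    thus ?thesis using Bp(2)[OF that, of i] by linarith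
  qed
  let ?n = "real CARD('n)"
  let ?T = "\<lambda>y. \<Sum>j\<in>UNIV. ((y - x0) $ j) *\<^sub>R partial_d f j x0"
  define B where "B = B1 + B2 + ?n * B2 + (B1 + ?n * B1) / \<rho>"
  have B: "B1 \<le> B" "B2 \<le> B" "?n * B2 \<le> B" "(B1 + ?n * B1) / \<rho> \<le> B"
    using B1(1) B20 \<rho>(1) by (auto simp: B_def add_increasing add_increasing2)
  show thesis
  proof (rule that[of B])
    show "B > 0" using B1(1) B(1) by linarith
    show "norm (partial_d f i y) \<le> B" if "y \<in> D" for y i using B1(3)[OF that, of i] B(1) by linarith
    fix y assume y: "y \<in> D"
    show "norm (f y - f x0) \<le> B * norm (y - x0)"
      using B1(4)[OF y] mult_right_mono[OF B(1), of "norm (y - x0)"] by simp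
    show "norm (partial_d f i y - partial_d f i x0) \<le> B * norm (y - x0)" for i
      using B2[OF y, of i] mult_right_mono[OF B(2), of "norm (y - x0)"] by simp
    show "norm (f y - f x0 - ?T y) \<le> B * (norm (y - x0))\<^sup>2"
    proof (cases "norm (y - x0) \<le> \<rho>")
      case True
      \<comment> \<open>Mean value inequality for \<open>f\<close> minus its linear part: on the
        ball of radius \<open>norm (y - x0)\<close> the partial derivatives of this difference are
        themselves of that order.\<close>
      let ?g = "\<lambda>x. f x - ?T x"
      have sub: "cball x0 (norm (y - x0)) \<subseteq> D" using True \<rho>(2) by auto
      have Tder: "(?T has_derivative (\<lambda>h. \<Sum>j\<in>UNIV. (h $ j) *\<^sub>R partial_d f j x0)) (at z)" for z
        by (auto intro!: derivative_eq_intros bounded_linear.has_derivative[OF bounded_linear_vec_nth] simp: fun_eq_iff)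
      have gder: "(?g has_derivative (\<lambda>h. (\<Sum>j\<in>UNIV. (h $ j) *\<^sub>R partial_d f j z) - (\<Sum>j\<in>UNIV. (h $ j) *\<^sub>R partial_d f j x0))) (at z)" if "z \<in> D" for z
        using C1 that D(2) by (intro has_derivative_diff has_derivative_partial_d Tder) (auto simp: C1_on_def)
      have "norm (?g y - ?g x0) \<le> ?n * (B2 * norm (y - x0)) * norm (y - x0)"
      proof (rule partial_d_lipschitz[OF convex_cball[of x0 "norm (y - x0)"]])
        fix z assume z: "z \<in> cball x0 (norm (y - x0))"
        hence zD: "z \<in> D" using sub by blast
        show "?g differentiable (at z)" using gder[OF zD] by (auto simp: differentiable_def)
        fix i
        have "partial_d ?g i z = partial_d f i z - partial_d f i x0"
          unfolding partial_d_eqI[OF gder[OF zD]] by (simp add: axis_def if_distrib[of "\<lambda>c. c *\<^sub>R _"] cong: if_cong)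
        moreover have "norm (partial_d f i z - partial_d f i x0) \<le> B2 * norm (y - x0)"
        proof -
          have "B2 * norm (z - x0) \<le> B2 * norm (y - x0)"
            using z B20 by (intro mult_left_mono) (auto simp: dist_norm norm_minus_commute)
          thus ?thesis using B2[OF zD, of i] by linarith
        qed
        ultimately show "norm (partial_d ?g i z) \<le> B2 * norm (y - x0)" by simp
      qed (auto simp: dist_norm norm_minus_commute)
      also have "\<dots> = ?n * B2 * (norm (y - x0))\<^sup>2" by (simp add: power2_eq_square)
      also have "\<dots> \<le> B * (norm (y - x0))\<^sup>2" using B(3) by (intro mult_right_mono) auto
      finally show ?thesis by (simp add: algebra_simps)
    next
      case False
      have "norm (?T y) \<le> (\<Sum>j\<in>(UNIV::'n set). norm (y - x0) * B1)"
      proof (rule order_trans[OF norm_sum sum_mono])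
        fix j
        show "norm (((y - x0) $ j) *\<^sub>R partial_d f j x0) \<le> norm (y - x0) * B1"
          unfolding norm_scaleR using B1(3)[OF x0D] component_le_norm_cart[of "y - x0" j] by (intro mult_mono) auto
      qed
      hence "norm (f y - f x0 - ?T y) \<le> (B1 + ?n * B1) * norm (y - x0)"
        using B1(4)[OF y] norm_triangle_ineq4[of "f y - f x0" "?T y"] by (simp add: algebra_simps)
      also have "\<dots> = (B1 + ?n * B1) / \<rho> * (\<rho> * norm (y - x0))" using \<rho>(1) by simp
      also have "\<dots> \<le> B * (norm (y - x0) * norm (y - x0))"
        using False B(1,4) \<rho>(1) B1(1) by (intro mult_mono mult_right_mono) auto
      finally show ?thesis by (simp add: power2_eq_square)
    qed
  qed
qed

section \<open>Polar form of the criterion\<close>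

text \<open>The real polar form of \<open>herm_form\<close>: \<open>bform A x x\<close> is twice the
  quadratic form.\<close>

definition bform :: "real^'k^'k \<Rightarrow> ('k::finite \<Rightarrow> complex) \<Rightarrow> ('k \<Rightarrow> complex) \<Rightarrow> real" where
  "bform A x y = Re (\<Sum>k\<in>UNIV. \<Sum>l\<in>UNIV. x k * of_real (A $ k $ l + A $ l $ k) * cnj (y l))"

lemma ecf_score_component: "ecf_score A f m \<eta> $ i = - bform A (\<lambda>k. partial_d (f k) i \<eta>) (\<lambda>l. m l - f l \<eta>)"
  by (simp only: ecf_score_def bform_def vec_lambda_beta)

lemma bform_diff_left: "bform A (\<lambda>k. x k - x' k) y = bform A x y - bform A x' y"
  by (simp only: bform_def left_diff_distrib sum_subtractf minus_complex.sel)

lemma bform_diff_right: "bform A x (\<lambda>k. y k - y' k) = bform A x y - bform A x y'"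
  by (simp only: bform_def complex_cnj_diff right_diff_distrib sum_subtractf minus_complex.sel)

lemma bform_sym: "bform A x y = bform A y x"
proof -
  have "bform A x y = (\<Sum>k\<in>UNIV. \<Sum>l\<in>UNIV. Re (y l * of_real (A $ l $ k + A $ k $ l) * cnj (x k)))"
    unfolding bform_def Re_sum by (intro sum.cong refl) (simp add: algebra_simps)
  also have "\<dots> = bform A y x" unfolding bform_def Re_sum by (rule sum.swap)
  finally show ?thesis .
qed

lemma bform_scaleR_right: "bform A x (\<lambda>l. c *\<^sub>R y l) = c * bform A x y"
proof -
  have "(\<Sum>k\<in>UNIV. \<Sum>l\<in>UNIV. x k * of_real (A $ k $ l + A $ l $ k) * cnj (c *\<^sub>R y l))
     = c *\<^sub>R (\<Sum>k\<in>UNIV. \<Sum>l\<in>UNIV. x k * of_real (A $ k $ l + A $ l $ k) * cnj (y l))"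
    unfolding scaleR_sum_right by (intro sum.cong refl) (simp add: scaleR_conv_of_real mult_ac)
  thus ?thesis by (simp only: bform_def scaleR_complex.sel)
qed

lemma bform_sum_right: "finite J \<Longrightarrow> bform A x (\<lambda>l. \<Sum>j\<in>J. y j l) = (\<Sum>j\<in>J. bform A x (y j))"
proof (induction J rule: finite_induct)
  case empty thus ?case by (simp add: bform_def)
next
  case (insert j J)
  have "bform A x (\<lambda>l. y j l + z l) = bform A x (y j) + bform A x z" for z
    by (simp only: bform_def complex_cnj_add distrib_left sum.distrib plus_complex.sel)
  thus ?case using insert by simp
qed

definition bform_norm :: "real^'k^'k \<Rightarrow> real" where
  "bform_norm A = (\<Sum>k\<in>UNIV. \<Sum>l\<in>(UNIV::'k::finite set). \<bar>A $ k $ l + A $ l $ k\<bar>)"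

lemma bform_norm_nonneg: "bform_norm A \<ge> 0"
  by (simp add: bform_norm_def sum_nonneg)

lemma bform_bound:
  assumes x: "\<And>k. cmod (x k) \<le> X" and y: "\<And>k. cmod (y k) \<le> Y"
  shows "\<bar>bform A x y\<bar> \<le> bform_norm A * X * Y"
proof -
  have X: "X \<ge> 0" using x norm_ge_zero order_trans by blast
  have "\<bar>bform A x y\<bar> \<le> cmod (\<Sum>k\<in>UNIV. \<Sum>l\<in>UNIV. x k * of_real (A $ k $ l + A $ l $ k) * cnj (y l))"
    unfolding bform_def by (rule abs_Re_le_cmod)
  also have "\<dots> \<le> (\<Sum>k\<in>UNIV. \<Sum>l\<in>UNIV. X * \<bar>A $ k $ l + A $ l $ k\<bar> * Y)"
  proof (intro order_trans[OF norm_sum sum_mono] order_trans[OF norm_sum sum_mono])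
    fix k l
    show "cmod (x k * of_real (A $ k $ l + A $ l $ k) * cnj (y l)) \<le> X * \<bar>A $ k $ l + A $ l $ k\<bar> * Y"
      unfolding norm_mult complex_mod_cnj norm_of_real using x y X by (intro mult_mono) auto
  qed
  also have "\<dots> = bform_norm A * X * Y"
    by (simp add: bform_norm_def sum_distrib_left sum_distrib_right mult_ac)
  finally show ?thesis .
qed

text \<open>The score is affine in \<open>m\<close>, so every influence of the data reduces to the
  form evaluated at \<open>m - m'\<close>, and the constant is the same for all \<open>m\<close>.
  The estimates are those that \<open>z_estimator_expansion\<close> asks of the random score and of
  its limit; \<open>M\<close> is the Gram matrix of the derivatives of \<open>f\<close> and turns
  out to be the Hessian of \<open>W_E\<close>.\<close>

lemma ecf_score_bounds:
  fixes f :: "'k::finite \<Rightarrow> real^'q \<Rightarrow> complex" and A :: "real^'k^'k"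
  assumes f: "\<And>k. Ck_on 3 G (f k)" and D: "compact D" "D \<subseteq> G" and x0: "x0 \<in> interior D"
  defines "M \<equiv> \<lambda>i j. bform A (\<lambda>k. partial_d (f k) i x0) (\<lambda>l. partial_d (f l) j x0)"
  obtains C where "C > 0"
    "\<And>m. continuous_on D (ecf_score A f m)"
    "\<And>m m' y. y \<in> D \<Longrightarrow> norm (ecf_score A f m y - ecf_score A f m' y) \<le> C * (\<Sum>l\<in>UNIV. cmod (m l - m' l))"
    "\<And>m m' y. y \<in> D \<Longrightarrow> norm (ecf_score A f m y - ecf_score A f m x0 - (ecf_score A f m' y - ecf_score A f m' x0))
        \<le> C * (\<Sum>l\<in>UNIV. cmod (m l - m' l)) * norm (y - x0)"
    "\<And>y. y \<in> D \<Longrightarrow> norm (ecf_score A f (\<lambda>l. f l x0) y - (\<chi> i. \<Sum>j\<in>UNIV. M i j * (y - x0) $ j)) \<le> C * (norm (y - x0))\<^sup>2"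
proof -
  \<comment> \<open>Bundling the bounds for one \<open>k\<close> in a predicate allows the constants
    for all \<open>k\<close> to be chosen at once; their sum then serves every
    \<open>k\<close>.\<close>
  define P where "P k B \<longleftrightarrow> B > 0 \<and> (\<forall>y\<in>D. \<forall>i. norm (partial_d (f k) i y) \<le> B) \<and>
    (\<forall>y\<in>D. norm (f k y - f k x0) \<le> B * norm (y - x0)) \<and>
    (\<forall>y\<in>D. \<forall>i. norm (partial_d (f k) i y - partial_d (f k) i x0) \<le> B * norm (y - x0)) \<and>
    (\<forall>y\<in>D. norm (f k y - f k x0 - (\<Sum>j\<in>UNIV. ((y - x0) $ j) *\<^sub>R partial_d (f k) j x0)) \<le> B * (norm (y - x0))\<^sup>2)" for k B
  have "\<exists>B. P k B" for k
    unfolding P_def by (rule C2_on_bounds[OF f[of k] D x0]) blast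
  then obtain Bk where P: "\<And>k. P k (Bk k)" by metis
  have Bk: "\<And>k. Bk k > 0" "\<And>k y i. y \<in> D \<Longrightarrow> norm (partial_d (f k) i y) \<le> Bk k"
    "\<And>k y. y \<in> D \<Longrightarrow> norm (f k y - f k x0) \<le> Bk k * norm (y - x0)"
    "\<And>k y i. y \<in> D \<Longrightarrow> norm (partial_d (f k) i y - partial_d (f k) i x0) \<le> Bk k * norm (y - x0)"
    "\<And>k y. y \<in> D \<Longrightarrow> norm (f k y - f k x0 - (\<Sum>j\<in>UNIV. ((y - x0) $ j) *\<^sub>R partial_d (f k) j x0)) \<le> Bk k * (norm (y - x0))\<^sup>2"
    using P unfolding P_def by blast+
  define B where "B = (\<Sum>k\<in>UNIV. Bk k)"
  have BkB: "Bk k \<le> B" for k unfolding B_def using Bk(1) by (intro member_le_sum) (auto intro: less_imp_le)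
  have B0: "B \<ge> 0" unfolding B_def using Bk(1) by (intro sum_nonneg) (auto intro: less_imp_le)
  have b1: "norm (partial_d (f k) i y) \<le> B" if "y \<in> D" for k i y using Bk(2)[OF that, of k i] BkB[of k] by linarith
  have lift: "a \<le> B * t" if "a \<le> Bk k * t" "t \<ge> 0" for a t k
    using that mult_right_mono[OF BkB[of k] that(2)] by linarith
  have b2: "norm (f k y - f k x0) \<le> B * norm (y - x0)" if "y \<in> D" for k y by (rule lift[OF Bk(3)[OF that]]) simp
  have b3: "norm (partial_d (f k) i y - partial_d (f k) i x0) \<le> B * norm (y - x0)" if "y \<in> D" for k i y
    by (rule lift[OF Bk(4)[OF that]]) simp
  have b4: "norm (f k y - f k x0 - (\<Sum>j\<in>UNIV. ((y - x0) $ j) *\<^sub>R partial_d (f k) j x0)) \<le> B * (norm (y - x0))\<^sup>2" if "y \<in> D" for k y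
    by (rule lift[OF Bk(5)[OF that]]) simp
  have x0D: "x0 \<in> D" using x0 interior_subset by blast
  let ?q = "real CARD('q)" and ?N = "bform_norm A"
  have N0: "?N \<ge> 0" by (rule bform_norm_nonneg)
  have vec: "norm v \<le> ?q * t" if "\<And>i. \<bar>v $ i\<bar> \<le> t" for v :: "real^'q" and t
    using norm_le_l1_cart[of v] sum_bounded_above[of UNIV "\<lambda>i. \<bar>v $ i\<bar>" t] that by fastforce
  have comp: "(ecf_score A f m y - ecf_score A f m' y) $ i = - bform A (\<lambda>k. partial_d (f k) i y) (\<lambda>l. m l - m' l)" for m m' y i
    unfolding vector_minus_component ecf_score_component
    using bform_diff_right[of A "\<lambda>k. partial_d (f k) i y" "\<lambda>l. m l - f l y" "\<lambda>l. m' l - f l y"] by simp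
  have single: "cmod (m l - m' l) \<le> (\<Sum>l\<in>UNIV. cmod (m l - m' l))" for m m' :: "'k \<Rightarrow> complex" and l
    by (rule member_le_sum) auto
  define C where "C = ?q * (?N * B + 2 * (?N * B * B)) + 1"
  have C: "?q * (?N * B) \<le> C" "?q * (2 * (?N * B * B)) \<le> C" "C > 0"
    using N0 B0 by (auto simp: C_def distrib_left add_nonneg_pos)
  show thesis
  proof (rule that[OF C(3)])
    fix m
    show "continuous_on D (ecf_score A f m)"
      unfolding ecf_score_def
    proof (intro continuous_on_vec_lambda continuous_intros)
      fix k and i :: 'q
      have "C1_on G (f k)" using f[of k] by (auto simp: numeral_3_eq_3 C1_on_def)
      thus "continuous_on D (\<lambda>x. partial_d (f k) i x)" "continuous_on D (f k)"
        using continuous_on_subset[OF _ D(2)] C1_on_continuous[of G "f k"] by (auto simp: C1_on_def)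
    qed
    fix m' y assume y: "y \<in> D"
    let ?d = "\<Sum>l\<in>UNIV. cmod (m l - m' l)"
    have d0: "?d \<ge> 0" by (intro sum_nonneg) simp
    have "norm (ecf_score A f m y - ecf_score A f m' y) \<le> ?q * (?N * B * ?d)"
      unfolding vec_eq_iff
      by (rule vec) (simp only: comp abs_minus_cancel, intro bform_bound b1[OF y] single)
    also have "\<dots> = (?q * (?N * B)) * ?d" by simp
    also have "\<dots> \<le> C * ?d" using C(1) d0 by (rule mult_right_mono)
    finally show "norm (ecf_score A f m y - ecf_score A f m' y) \<le> C * ?d" .
    have "norm ((ecf_score A f m y - ecf_score A f m' y) - (ecf_score A f m x0 - ecf_score A f m' x0)) \<le> ?q * (?N * (B * norm (y - x0)) * ?d)"
    proof (rule vec)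
      fix i
      have "((ecf_score A f m y - ecf_score A f m' y) - (ecf_score A f m x0 - ecf_score A f m' x0)) $ i
         = - bform A (\<lambda>k. partial_d (f k) i y - partial_d (f k) i x0) (\<lambda>l. m l - m' l)"
        unfolding vector_minus_component[of "ecf_score A f m y - ecf_score A f m' y"] comp bform_diff_left by simp
      thus "\<bar>((ecf_score A f m y - ecf_score A f m' y) - (ecf_score A f m x0 - ecf_score A f m' x0)) $ i\<bar> \<le> ?N * (B * norm (y - x0)) * ?d"
        by (simp only: abs_minus_cancel) (intro bform_bound b3[OF y] single)
    qed
    also have "\<dots> = (?q * (?N * B)) * (?d * norm (y - x0))" by simp
    also have "\<dots> \<le> C * (?d * norm (y - x0))" using C(1) d0 by (intro mult_right_mono) auto
    finally show "norm (ecf_score A f m y - ecf_score A f m x0 - (ecf_score A f m' y - ecf_score A f m' x0)) \<le> C * ?d * norm (y - x0)"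
      by (simp add: algebra_simps)
  next
    fix y assume y: "y \<in> D"
    let ?h = "norm (y - x0)"
    have "norm (ecf_score A f (\<lambda>l. f l x0) y - (\<chi> i. \<Sum>j\<in>UNIV. M i j * (y - x0) $ j)) \<le> ?q * (?N * (B * ?h) * (B * ?h) + ?N * B * (B * ?h\<^sup>2))"
    proof (rule vec)
      fix i
      let ?e = "\<lambda>l. f l y - f l x0" and ?p = "\<lambda>z k. partial_d (f k) i z"
      let ?T = "\<lambda>l. \<Sum>j\<in>UNIV. ((y - x0) $ j) *\<^sub>R partial_d (f l) j x0"
      have "ecf_score A f (\<lambda>l. f l x0) y $ i = bform A (?p y) ?e"
      proof -
        have "- bform A (?p y) (\<lambda>l. f l x0 - f l y) = bform A (?p y) ?e"
          unfolding bform_diff_right by simp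
        thus ?thesis by (simp only: ecf_score_component)
      qed
      moreover have "(\<Sum>j\<in>UNIV. M i j * (y - x0) $ j) = bform A (?p x0) ?T"
        by (simp only: bform_sum_right[OF finite] bform_scaleR_right M_def mult.commute)
      \<comment> \<open>Both arguments of the first form are of first order in
        \<open>y - x0\<close>; the second form carries the Taylor remainder of
        \<open>f\<close>.\<close>
      ultimately have eq: "(ecf_score A f (\<lambda>l. f l x0) y - (\<chi> i. \<Sum>j\<in>UNIV. M i j * (y - x0) $ j)) $ i
          = bform A (\<lambda>k. ?p y k - ?p x0 k) ?e + bform A (?p x0) (\<lambda>l. ?e l - ?T l)"
        by (simp add: bform_diff_left bform_diff_right del: vector_minus_component)
          (simp only: vector_minus_component vec_lambda_beta)
      have 1: "\<bar>bform A (\<lambda>k. ?p y k - ?p x0 k) ?e\<bar> \<le> ?N * (B * ?h) * (B * ?h)"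
        by (rule bform_bound[OF b3[OF y] b2[OF y]])
      have 2: "\<bar>bform A (?p x0) (\<lambda>l. ?e l - ?T l)\<bar> \<le> ?N * B * (B * ?h\<^sup>2)"
        by (rule bform_bound[OF b1[OF x0D] b4[OF y]])
      show "\<bar>(ecf_score A f (\<lambda>l. f l x0) y - (\<chi> i. \<Sum>j\<in>UNIV. M i j * (y - x0) $ j)) $ i\<bar> \<le> ?N * (B * ?h) * (B * ?h) + ?N * B * (B * ?h\<^sup>2)"
        unfolding eq by (rule order_trans[OF abs_triangle_ineq add_mono[OF 1 2]])
    qed
    also have "\<dots> = (?q * (2 * (?N * B * B))) * ?h\<^sup>2" by (simp add: power2_eq_square algebra_simps)
    also have "\<dots> \<le> C * ?h\<^sup>2" using C(2) by (intro mult_right_mono) auto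
    finally show "norm (ecf_score A f (\<lambda>l. f l x0) y - (\<chi> i. \<Sum>j\<in>UNIV. M i j * (y - x0) $ j)) \<le> C * ?h\<^sup>2" .
  qed
qed

lemma quadratic_imp_has_derivative:
  fixes w :: "'a::euclidean_space \<Rightarrow> 'b::real_normed_vector"
  assumes x0: "x0 \<in> interior D" and L: "bounded_linear L" and w0: "w x0 = 0"
    and quad: "\<And>y. y \<in> D \<Longrightarrow> norm (w y - L (y - x0)) \<le> C * (norm (y - x0))\<^sup>2"
  shows "(w has_derivative L) (at x0)"
  unfolding has_derivative_at_alt
proof (intro conjI L allI impI)
  fix e :: real assume e: "e > 0"
  obtain \<rho> where \<rho>: "\<rho> > 0" "cball x0 \<rho> \<subseteq> D" using x0 mem_interior_cball by metis
  show "\<exists>d>0. \<forall>y. norm (y - x0) < d \<longrightarrow> norm (w y - w x0 - L (y - x0)) \<le> e * norm (y - x0)"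
  proof (intro exI[of _ "min \<rho> (e / (\<bar>C\<bar> + 1))"] conjI allI impI)
    show "0 < min \<rho> (e / (\<bar>C\<bar> + 1))" using \<rho> e by simp
    fix y assume y: "norm (y - x0) < min \<rho> (e / (\<bar>C\<bar> + 1))"
    have "y \<in> D" using y \<rho>(2) by (auto simp: dist_norm norm_minus_commute)
    hence "norm (w y - L (y - x0)) \<le> C * (norm (y - x0))\<^sup>2" by (rule quad)
    also have "\<dots> \<le> (\<bar>C\<bar> + 1) * (norm (y - x0))\<^sup>2" by (intro mult_right_mono) auto
    also have "\<dots> = ((\<bar>C\<bar> + 1) * norm (y - x0)) * norm (y - x0)" by (simp add: power2_eq_square)
    also have "\<dots> \<le> e * norm (y - x0)"
    proof (rule mult_right_mono)
      have "norm (y - x0) \<le> e / (\<bar>C\<bar> + 1)" using y by simp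
      thus "(\<bar>C\<bar> + 1) * norm (y - x0) \<le> e" by (simp add: pos_le_divide_eq mult.commute add_nonneg_pos)
    qed simp
    finally show "norm (w y - w x0 - L (y - x0)) \<le> e * norm (y - x0)" using w0 by simp
  qed
qed

subsection \<open>Rate of the prediction error stage\<close>

lemma norm_iexp_diff_le: "norm (iexp x - iexp y) \<le> \<bar>x - y\<bar>"
proof -
  have "iexp x - iexp y = iexp y * (iexp (x - y) - 1)"
    by (simp add: right_diff_distrib exp_add[symmetric] algebra_simps)
  hence "norm (iexp x - iexp y) = norm (iexp (x - y) - 1)" by (simp add: norm_mult)
  also have "\<dots> \<le> \<bar>x - y\<bar>" using iexp_approx1[of "x - y" 0] by simp
  finally show ?thesis .
qed

lemma conv_trunc: "j < n \<Longrightarrow> (trunc n x \<star>\<^sub>c a) j = (x \<star>\<^sub>c a) j"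
  by (simp add: conv_def trunc_def)

lemma lin_trunc: "lin (trunc n x) y m = (\<Sum>j<n. x j * y (m - int j))"
  unfolding lin_def by (subst suminf_finite[of "{..<n}"]) (auto simp: trunc_def)

section \<open>Score of the prediction error criterion\<close>

locale filtered_noise = iid_noise M Z r + causal_filter a b \<theta>s G D
  for M :: "'w measure" and Z r and a b :: "real^'p \<Rightarrow> nat \<Rightarrow> real" and \<theta>s G D
begin

abbreviation \<epsilon> :: "real^'p \<Rightarrow> nat \<Rightarrow> 'w \<Rightarrow> real" where "\<epsilon> \<equiv> eps b a \<theta>s Z"

definition d\<epsilon> :: "real^'p \<Rightarrow> 'p \<Rightarrow> nat \<Rightarrow> 'w \<Rightarrow> real" where
  "d\<epsilon> \<theta> i n \<omega> = (\<Sum>j<n. db \<theta> i j * dy a \<theta>s Z (int n - int j) \<omega>)"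

lemma dy_lin: "dy a \<theta>s Z n \<omega> = lin (a \<theta>s) (\<lambda>n. Z n \<omega>) n"
  by (simp add: dy_def lin_def)

lemma eps_lin: "\<epsilon> \<theta> n \<omega> = lin (trunc n (b \<theta>)) (lin (a \<theta>s) (\<lambda>n. Z n \<omega>)) (int n)"
  by (simp add: eps_def dy_lin lin_trunc)

lemma d\<epsilon>_lin: "d\<epsilon> \<theta> i n \<omega> = lin (trunc n (db \<theta> i)) (lin (a \<theta>s) (\<lambda>n. Z n \<omega>)) (int n)"
  by (simp add: d\<epsilon>_def dy_lin lin_trunc)

lemma eps_has_derivative:
  assumes \<theta>: "\<theta> \<in> G"
  shows "((\<lambda>\<theta>. \<epsilon> \<theta> n \<omega>) has_derivative (\<lambda>h. \<Sum>i\<in>UNIV. h $ i * d\<epsilon> \<theta> i n \<omega>)) (at \<theta>)"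
proof -
  have "((\<lambda>\<theta>. \<epsilon> \<theta> n \<omega>) has_derivative (\<lambda>h. \<Sum>j<n. (\<Sum>i\<in>UNIV. (h $ i) *\<^sub>R db \<theta> i j) * dy a \<theta>s Z (int n - int j) \<omega>)) (at \<theta>)"
    unfolding eps_def db_def
    by (intro has_derivative_sum has_derivative_mult_left has_derivative_partial_d b_differentiable \<theta>)
  moreover have "(\<Sum>j<n. (\<Sum>i\<in>UNIV. (h $ i) *\<^sub>R db \<theta> i j) * dy a \<theta>s Z (int n - int j) \<omega>) = (\<Sum>i\<in>UNIV. h $ i * d\<epsilon> \<theta> i n \<omega>)" for h :: "real^'p"
    unfolding d\<epsilon>_def sum_distrib_right sum_distrib_left by (subst sum.swap) (simp add: mult_ac)
  ultimately show ?thesis by simp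
qed

lemma gradient_V_P:
  assumes \<theta>: "\<theta> \<in> G"
  shows "gradient (\<lambda>\<theta>. V_P b a \<theta>s Z N \<theta> \<omega>) \<theta> = (\<chi> i. \<Sum>n=1..N. \<epsilon> \<theta> n \<omega> * d\<epsilon> \<theta> i n \<omega>)"
proof (rule gradient_eqI)
  have "((\<lambda>\<theta>. V_P b a \<theta>s Z N \<theta> \<omega>) has_derivative (\<lambda>h. 1/2 * (\<Sum>n=1..N. 2 * \<epsilon> \<theta> n \<omega> * (\<Sum>i\<in>UNIV. h $ i * d\<epsilon> \<theta> i n \<omega>)))) (at \<theta>)"
    unfolding V_P_def
  proof (intro has_derivative_mult_right has_derivative_sum)
    fix n
    show "((\<lambda>\<theta>. (\<epsilon> \<theta> n \<omega>)\<^sup>2) has_derivative (\<lambda>h. 2 * \<epsilon> \<theta> n \<omega> * (\<Sum>i\<in>UNIV. h $ i * d\<epsilon> \<theta> i n \<omega>))) (at \<theta>)"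
      by (rule has_derivative_eq_rhs[OF has_derivative_power[OF eps_has_derivative[OF \<theta>]]]) (simp add: fun_eq_iff mult_ac)
  qed
  moreover have "1/2 * (\<Sum>n=1..N. 2 * \<epsilon> \<theta> n \<omega> * (\<Sum>i\<in>UNIV. h $ i * d\<epsilon> \<theta> i n \<omega>)) = (\<chi> i. \<Sum>n=1..N. \<epsilon> \<theta> n \<omega> * d\<epsilon> \<theta> i n \<omega>) \<bullet> h" for h :: "real^'p"
  proof -
    have "1/2 * (\<Sum>n=1..N. 2 * \<epsilon> \<theta> n \<omega> * (\<Sum>i\<in>UNIV. h $ i * d\<epsilon> \<theta> i n \<omega>)) = (\<Sum>n=1..N. \<Sum>i\<in>UNIV. \<epsilon> \<theta> n \<omega> * d\<epsilon> \<theta> i n \<omega> * h $ i)"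
      by (simp add: sum_distrib_left mult_ac)
    also have "\<dots> = (\<Sum>i\<in>UNIV. \<Sum>n=1..N. \<epsilon> \<theta> n \<omega> * d\<epsilon> \<theta> i n \<omega> * h $ i)" by (rule sum.swap)
    finally show ?thesis by (simp add: inner_vec_def sum_distrib_right)
  qed
  ultimately show "((\<lambda>\<theta>. V_P b a \<theta>s Z N \<theta> \<omega>) has_derivative (\<lambda>h. (\<chi> i. \<Sum>n=1..N. \<epsilon> \<theta> n \<omega> * d\<epsilon> \<theta> i n \<omega>) \<bullet> h)) (at \<theta>)"
    by simp
qed

lemma gradient_V_P_continuous: "continuous_on D (\<lambda>\<theta>. gradient (\<lambda>\<theta>. V_P b a \<theta>s Z N \<theta> \<omega>) \<theta>)"
proof -
  have b: "continuous_on D (\<lambda>\<theta>. b \<theta> j)" and db: "continuous_on D (\<lambda>\<theta>. db \<theta> i j)" for i j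
    using b_C1[of j] continuous_on_subset[OF _ D(2)] C1_on_continuous[OF b_C1[of j]] by (auto simp: C1_on_def db_def)
  have "continuous_on D (\<lambda>\<theta>. \<chi> i. \<Sum>n=1..N. \<epsilon> \<theta> n \<omega> * d\<epsilon> \<theta> i n \<omega>)"
    unfolding eps_def d\<epsilon>_def
    by (intro continuous_on_vec_lambda continuous_on_sum continuous_on_mult continuous_on_const b db)
  moreover have "gradient (\<lambda>\<theta>. V_P b a \<theta>s Z N \<theta> \<omega>) \<theta> = (\<chi> i. \<Sum>n=1..N. \<epsilon> \<theta> n \<omega> * d\<epsilon> \<theta> i n \<omega>)" if "\<theta> \<in> D" for \<theta>
    using that D(2) by (intro gradient_V_P) auto
  ultimately show ?thesis by (simp cong: continuous_on_cong)
qed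

text \<open>The identity is almost sure only: the two iterated series may be regrouped along
  summable paths, and elsewhere their values are arbitrary.\<close>

lemma eps_star_AE:
  assumes \<theta>: "\<theta> \<in> G"
  shows "AE \<omega> in M. eps_star b a \<theta>s Z \<theta> n \<omega> = lin (cf \<theta>) (\<lambda>n. Z n \<omega>) n"
proof -
  obtain c \<alpha> \<beta> K where bd: "c > 0" "0 < \<alpha>" "\<alpha> < \<beta>" "\<beta> < 1" "K > 0"
    "\<And>j::nat. real (Suc j) * \<alpha> ^ j \<le> K * \<beta> ^ j" "\<And>j. \<bar>a \<theta>s j\<bar> \<le> c * \<alpha> ^ j"
    "\<And>\<theta>' j. \<theta>' \<in> {\<theta>} \<Longrightarrow> \<bar>b \<theta>' j\<bar> \<le> c * \<alpha> ^ j"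
    using compact_bounds[of "{\<theta>}"] \<theta> by (metis compact_insert compact_empty empty_subsetI insert_subset)
  have \<beta>: "0 < \<beta>" "\<beta> < 1" using bd by auto
  show ?thesis
    using U_summable[OF \<beta>]
  proof eventually_elim
    case (elim \<omega>)
    then interpret summable_path "\<lambda>n. Z n \<omega>" \<beta> by unfold_locales (use \<beta> in auto)
    have "lin (b \<theta>) (lin (a \<theta>s) (\<lambda>n. Z n \<omega>)) n = lin (cf \<theta>) (\<lambda>n. Z n \<omega>) n"
      unfolding cf_def by (rule lin_lin[OF _ bd(7) bd(6)]) (use bd in auto)
    thus ?case by (simp add: eps_star_def dy_lin lin_def[of "b \<theta>"])
  qed
qed

lemma dy_measurable [measurable]: "dy a \<theta>s Z n \<in> borel_measurable M"
  unfolding dy_def by measurable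

lemma eps_star_measurable [measurable]: "eps_star b a \<theta>s Z \<theta> n \<in> borel_measurable M"
  unfolding eps_star_def by measurable

lemma W_P_eq:
  assumes \<theta>: "\<theta> \<in> G"
  shows "W_P M b a \<theta>s Z \<theta> = 1/2 * \<sigma>2 * (\<Sum>m. (cf \<theta> m)\<^sup>2)"
proof -
  obtain c \<alpha> \<beta> K where bd: "c > 0" "0 < \<alpha>" "\<alpha> < \<beta>" "\<beta> < 1" "K > 0"
    "\<And>\<theta>' j. \<theta>' \<in> {\<theta>} \<Longrightarrow> \<bar>cf \<theta>' j\<bar> \<le> c * c * K * \<beta> ^ j"
    using compact_bounds[of "{\<theta>}"] \<theta> by (metis compact_insert compact_empty empty_subsetI insert_subset)
  have [measurable]: "(\<lambda>\<omega>. lin x (\<lambda>n. Z n \<omega>) n) \<in> borel_measurable M" for x n unfolding lin_def by measurable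
  have "(LINT \<omega>|M. (eps_star b a \<theta>s Z \<theta> 0 \<omega>)\<^sup>2) = (LINT \<omega>|M. (lin (cf \<theta>) (\<lambda>n. Z n \<omega>) 0)\<^sup>2)"
    using eps_star_AE[OF \<theta>, of 0] by (intro integral_cong_AE) (auto elim: eventually_mono)
  also have "\<dots> = \<sigma>2 * (\<Sum>m. (cf \<theta> m)\<^sup>2)"
    by (rule expectation_lin_square[of \<beta> _ "c * c * K"]) (use bd in auto)
  finally show ?thesis by (simp add: W_P_def)
qed

lemma gradient_W_P:
  assumes \<theta>: "\<theta> \<in> G"
  shows "gradient (W_P M b a \<theta>s Z) \<theta> = \<sigma>2 *\<^sub>R score \<theta>"
proof (rule gradient_eqI)
  have "((\<lambda>\<theta>. 1/2 * \<sigma>2 * (\<Sum>m. (cf \<theta> m)\<^sup>2)) has_derivative (\<lambda>h. 1/2 * \<sigma>2 * ((2 *\<^sub>R score \<theta>) \<bullet> h))) (at \<theta>)"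
    by (intro has_derivative_mult_right cf_square_sum_has_derivative \<theta>)
  hence "(W_P M b a \<theta>s Z has_derivative (\<lambda>h. 1/2 * \<sigma>2 * ((2 *\<^sub>R score \<theta>) \<bullet> h))) (at \<theta>)"
    by (rule has_derivative_transform_within_open[OF _ G_open \<theta>]) (simp add: W_P_eq)
  thus "(W_P M b a \<theta>s Z has_derivative (\<lambda>h. (\<sigma>2 *\<^sub>R score \<theta>) \<bullet> h)) (at \<theta>)" by simp
qed

definition pe_slope :: "real^'p \<Rightarrow> real^'p" where
  "pe_slope h = (\<chi> i. \<sigma>2 * (\<Sum>m. (\<Sum>j\<in>UNIV. h $ j * dcf \<theta>s j m) * dcf \<theta>s i m))"

lemma pe_slope: "((\<lambda>\<theta>. \<sigma>2 *\<^sub>R score \<theta>) has_derivative pe_slope) (at \<theta>s)"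
proof -
  have "((\<lambda>\<theta>. (\<sigma>2 *\<^sub>R score \<theta>) \<bullet> k) has_derivative (\<lambda>h. pe_slope h \<bullet> k)) (at \<theta>s)" if k: "k \<in> Basis" for k
  proof -
    obtain i where i: "k = axis i 1" using k by (auto simp: Basis_vec_def)
    have "((\<lambda>\<theta>. \<sigma>2 * score \<theta> $ i) has_derivative (\<lambda>h. \<sigma>2 * (\<Sum>m. (\<Sum>j\<in>UNIV. h $ j * dcf \<theta>s j m) * dcf \<theta>s i m))) (at \<theta>s)"
      by (intro has_derivative_mult_right score_component_has_derivative)
    thus ?thesis by (simp add: i inner_axis pe_slope_def)
  qed
  thus ?thesis by (subst has_derivative_componentwise_within) auto
qed

text \<open>Row \<open>i\<close> of \<open>hessian\<close> holds the derivatives in direction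
  \<open>i\<close>, so the matrix of \<open>pe_slope\<close> is the transpose of the Hessian and
  inherits its invertibility.\<close>

lemma pe_slope_injective:
  assumes inv: "invertible (hessian (W_P M b a \<theta>s Z) \<theta>s)" and h: "pe_slope h = 0"
  shows "h = 0"
proof -
  let ?H = "hessian (W_P M b a \<theta>s Z) \<theta>s"
  have H: "?H $ i $ j = pe_slope (axis i 1) $ j" for i j
  proof -
    have "partial_d (\<lambda>y. gradient (W_P M b a \<theta>s Z) y $ j) i \<theta>s = partial_d (\<lambda>y. \<sigma>2 * score y $ j) i \<theta>s"
      by (rule partial_d_cong_open[OF G_open \<theta>s_G]) (simp add: gradient_W_P)
    also have "\<dots> = \<sigma>2 * (\<Sum>m. (\<Sum>k\<in>UNIV. axis i 1 $ k * dcf \<theta>s k m) * dcf \<theta>s j m)"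
      by (rule partial_d_eqI) (intro has_derivative_mult_right score_component_has_derivative)
    finally show ?thesis by (simp add: hessian_def pe_slope_def)
  qed
  have lin: "linear pe_slope" using pe_slope has_derivative_linear by blast
  have "transpose ?H *v h = pe_slope h"
  proof -
    have e: "h = (\<Sum>i\<in>UNIV. (h $ i) *\<^sub>R axis i 1)"
      by (simp add: vec_eq_iff axis_def if_distrib cong: if_cong)
    have "pe_slope h = (\<Sum>i\<in>UNIV. (h $ i) *\<^sub>R pe_slope (axis i 1))"
      by (subst e) (simp add: linear_sum[OF lin] linear_cmul[OF lin])
    thus ?thesis by (simp add: vec_eq_iff matrix_vector_mult_def transpose_def H mult.commute)
  qed
  moreover have "invertible (transpose ?H)" using inv by (rule transpose_invertible)
  ultimately show ?thesis using h by (metis invertible_def matrix_vector_mul_assoc matrix_vector_mul_lid matrix_vector_mult_0_right)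
qed

end

section \<open>From the noise error to the empirical characteristic function\<close>

context filtered_noise
begin

definition ecf_mean :: "('k \<Rightarrow> real) \<Rightarrow> nat \<Rightarrow> real^'p \<Rightarrow> 'w \<Rightarrow> 'k \<Rightarrow> complex" where
  "ecf_mean u N \<theta> \<omega> l = (\<Sum>n=1..N. iexp (u l * \<epsilon> \<theta> n \<omega>)) / of_nat N"

text \<open>Along a good path all series converge and \<open>U\<close> is nonnegative, so the
  protective absolute values drop out and each summand is bounded by the whole.\<close>

lemma noise_error_parts:
  assumes \<beta>: "0 < \<beta>" and good: "good_path \<beta> N \<omega>"
  shows "(\<Sum>j. \<beta> ^ j * (\<Sum>k. \<beta> ^ k * \<bar>cov_error j k N \<omega>\<bar>)) + (1 / real N) * (\<Sum>n. \<beta> ^ n * (U \<beta> 0 \<omega> * U \<beta> (int n) \<omega>)) \<le> noise_error \<beta> u N \<omega>"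
    and "(1 / real N) * U \<beta> 0 \<omega> \<le> noise_error \<beta> u N \<omega>"
    and "(\<Sum>j. \<beta> ^ j * \<bar>abs_error j N \<omega>\<bar>) \<le> noise_error \<beta> u N \<omega>"
    and "cmod (ecf_error (u k) N \<omega>) \<le> noise_error \<beta> u N \<omega>"
    and "0 \<le> noise_error \<beta> u N \<omega>"
    and "summable (\<lambda>j. \<beta> ^ j * (\<Sum>k. \<beta> ^ k * \<bar>cov_error j k N \<omega>\<bar>))"
    and "summable (\<lambda>n. \<beta> ^ n * (U \<beta> 0 \<omega> * U \<beta> (int n) \<omega>))"
proof -
  interpret summable_path "\<lambda>n. Z n \<omega>" \<beta> using good by (simp add: good_path_def)
  have UV: "U \<beta> n \<omega> = V n" for n by (simp add: U_def V_def)
  have U0: "\<bar>U \<beta> n \<omega>\<bar> = U \<beta> n \<omega>" for n unfolding UV using V_nonneg by simp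
  have s1: "\<And>j. summable (\<lambda>k. \<beta> ^ k * \<bar>cov_error j k N \<omega>\<bar>)" using good by (simp add: good_path_def)
  have in0: "0 \<le> (\<Sum>k. \<beta> ^ k * \<bar>cov_error j k N \<omega>\<bar>)" for j
    using \<beta> by (intro suminf_nonneg s1) auto
  hence ab: "\<bar>\<Sum>k. \<beta> ^ k * \<bar>cov_error j k N \<omega>\<bar>\<bar> = (\<Sum>k. \<beta> ^ k * \<bar>cov_error j k N \<omega>\<bar>)" for j by simp
  show s2: "summable (\<lambda>j. \<beta> ^ j * (\<Sum>k. \<beta> ^ k * \<bar>cov_error j k N \<omega>\<bar>))"
    and s3: "summable (\<lambda>n. \<beta> ^ n * (U \<beta> 0 \<omega> * U \<beta> (int n) \<omega>))"
    using good unfolding good_path_def ab U0 by auto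
  have s4: "summable (\<lambda>j. \<beta> ^ j * \<bar>abs_error j N \<omega>\<bar>)" using good by (simp add: good_path_def)
  let ?T1 = "\<Sum>j. \<beta> ^ j * (\<Sum>k. \<beta> ^ k * \<bar>cov_error j k N \<omega>\<bar>)"
  let ?T2 = "(1 / real N) * (\<Sum>n. \<beta> ^ n * (U \<beta> 0 \<omega> * U \<beta> (int n) \<omega>))"
  let ?T3 = "(1 / real N) * U \<beta> 0 \<omega>"
  let ?T4 = "\<Sum>j. \<beta> ^ j * \<bar>abs_error j N \<omega>\<bar>"
  let ?T5 = "\<Sum>k\<in>UNIV. cmod (ecf_error (u k) N \<omega>)"
  have eq: "noise_error \<beta> u N \<omega> = ?T1 + ?T2 + ?T3 + ?T4 + ?T5"
    unfolding noise_error_def ab U0 ..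
  have "0 \<le> ?T1" using \<beta> in0 by (intro suminf_nonneg s2) auto
  moreover have "0 \<le> ?T2" using \<beta> V_nonneg by (intro mult_nonneg_nonneg suminf_nonneg s3) (auto simp: UV)
  moreover have "0 \<le> ?T3" using V_nonneg by (simp add: UV)
  moreover have "0 \<le> ?T4" using \<beta> by (intro suminf_nonneg s4) auto
  moreover have "cmod (ecf_error (u k) N \<omega>) \<le> ?T5" by (rule member_le_sum) auto
  moreover have "0 \<le> ?T5" by (intro sum_nonneg) simp
  ultimately show "?T1 + ?T2 \<le> noise_error \<beta> u N \<omega>" "?T3 \<le> noise_error \<beta> u N \<omega>" "?T4 \<le> noise_error \<beta> u N \<omega>"
    "cmod (ecf_error (u k) N \<omega>) \<le> noise_error \<beta> u N \<omega>" "0 \<le> noise_error \<beta> u N \<omega>"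
    unfolding eq by linarith+
qed

text \<open>Three errors are added: replacing the estimated parameter by \<theta>s, replacing the
  innovations at \<theta>s by the noise, and sampling the noise. The first is the error of the
  estimator times the average of the Lipschitz constants \<open>V\<close>; the point is that this
  product is still linear in \<open>noise_error\<close>.\<close>

lemma ecf_rate:
  fixes u :: "'k::finite \<Rightarrow> real"
  assumes unique: "\<forall>\<theta>\<in>D. gradient (W_P M b a \<theta>s Z) \<theta> = 0 \<longleftrightarrow> \<theta> = \<theta>s"
    and nonsing: "invertible (hessian (W_P M b a \<theta>s Z) \<theta>s)"
    and \<theta>h: "\<forall>N. \<forall>\<omega>\<in>space M. \<theta>h N \<omega> \<in> D \<and>
                 ((\<exists>\<theta>\<in>D. gradient (\<lambda>\<theta>. V_P b a \<theta>s Z N \<theta> \<omega>) \<theta> = 0) \<longrightarrow>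
                    gradient (\<lambda>\<theta>. V_P b a \<theta>s Z N \<theta> \<omega>) (\<theta>h N \<omega>) = 0)"
  obtains \<beta> C where "0 < \<beta>" "\<beta> < 1" "C > 0"
    "\<And>N \<omega>. \<lbrakk>N \<ge> 1; \<omega> \<in> space M; good_path \<beta> N \<omega>\<rbrakk> \<Longrightarrow>
       (\<Sum>l\<in>UNIV. cmod (ecf_mean u N (\<theta>h N \<omega>) \<omega> l - expectation (\<lambda>\<omega>. iexp (u l * Z 0 \<omega>)))) \<le> C * noise_error \<beta> u N \<omega>"
proof -
  obtain c \<alpha> \<beta> K where bd: "c > 0" "0 < \<alpha>" "\<alpha> < \<beta>" "\<beta> < 1" "K > 0"
    and K: "\<And>j::nat. real (Suc j) * \<alpha> ^ j \<le> K * \<beta> ^ j" and a_bd: "\<And>j. \<bar>a \<theta>s j\<bar> \<le> c * \<alpha> ^ j"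
    and b_bd: "\<And>\<theta> j. \<theta> \<in> D \<Longrightarrow> \<bar>b \<theta> j\<bar> \<le> c * \<alpha> ^ j" and db_bd: "\<And>\<theta> i j. \<theta> \<in> D \<Longrightarrow> \<bar>db \<theta> i j\<bar> \<le> c * \<alpha> ^ j"
    and cf_bd: "\<And>\<theta> j. \<theta> \<in> D \<Longrightarrow> \<bar>cf \<theta> j\<bar> \<le> c * c * K * \<beta> ^ j"
    and dcf_bd: "\<And>\<theta> i j. \<theta> \<in> D \<Longrightarrow> \<bar>dcf \<theta> i j\<bar> \<le> c * c * K * \<beta> ^ j"
    using compact_bounds[OF D] by metis
  have \<beta>: "0 < \<beta>" "\<beta> < 1" using bd by auto
  define E where "E = c * c * K"
  have E: "E > 0" using bd by (simp add: E_def)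
  obtain \<Lambda> where \<Lambda>: "\<Lambda> > 0" "\<And>\<theta> j. \<theta> \<in> D \<Longrightarrow> \<bar>b \<theta> j - b \<theta>s j\<bar> \<le> \<Lambda> * norm (\<theta> - \<theta>s) * \<alpha> ^ j"
    using b_lipschitz[OF bd(1,2) b_bd db_bd] by metis
  \<comment> \<open>Truncation only decreases coefficients, so the truncated cascades obey the same
    geometric bound as the stationary ones, uniformly in \<open>n\<close> and \<theta>.\<close>
  have tr: "\<bar>(trunc n (b \<theta>) \<star>\<^sub>c a \<theta>s) j\<bar> \<le> E * \<beta> ^ j" "\<bar>(trunc n (db \<theta> i) \<star>\<^sub>c a \<theta>s) j\<bar> \<le> E * \<beta> ^ j" if "\<theta> \<in> D" for n \<theta> i j
    unfolding E_def using bd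
    by (auto intro!: conv_bound[OF trunc_bound[OF b_bd[OF that]] a_bd K] conv_bound[OF trunc_bound[OF db_bd[OF that]] a_bd K])
  let ?p = "real CARD('p)"
  have eps_path: "\<epsilon> \<theta> n \<omega> = lin (trunc n (b \<theta>) \<star>\<^sub>c a \<theta>s) (\<lambda>n. Z n \<omega>) (int n)"
     "d\<epsilon> \<theta> i n \<omega> = lin (trunc n (db \<theta> i) \<star>\<^sub>c a \<theta>s) (\<lambda>n. Z n \<omega>) (int n)"
    if good: "good_path \<beta> N \<omega>" and \<theta>: "\<theta> \<in> D" for N \<omega> \<theta> n i
  proof -
    interpret summable_path "\<lambda>n. Z n \<omega>" \<beta> using good by (simp add: good_path_def)
    show "\<epsilon> \<theta> n \<omega> = lin (trunc n (b \<theta>) \<star>\<^sub>c a \<theta>s) (\<lambda>n. Z n \<omega>) (int n)"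
      unfolding eps_lin by (rule lin_lin[OF trunc_bound[OF b_bd[OF \<theta>]] a_bd K]) (use bd in auto)
    show "d\<epsilon> \<theta> i n \<omega> = lin (trunc n (db \<theta> i) \<star>\<^sub>c a \<theta>s) (\<lambda>n. Z n \<omega>) (int n)"
      unfolding d\<epsilon>_lin by (rule lin_lin[OF trunc_bound[OF db_bd[OF \<theta>]] a_bd K]) (use bd in auto)
  qed
  define v where "v N \<omega> \<theta> = (1 / real N) *\<^sub>R gradient (\<lambda>\<theta>. V_P b a \<theta>s Z N \<theta> \<omega>) \<theta>" for N \<omega> \<theta>
  have v_close: "norm (v N \<omega> \<theta> - \<sigma>2 *\<^sub>R score \<theta>) \<le> ?p * (4 * E\<^sup>2) * noise_error \<beta> u N \<omega>"
    if good: "good_path \<beta> N \<omega>" and \<theta>: "\<theta> \<in> D" for N \<omega> \<theta>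
  proof -
    interpret summable_path "\<lambda>n. Z n \<omega>" \<beta> using good by (simp add: good_path_def)
    have UV: "U \<beta> n \<omega> = V n" for n by (simp add: U_def V_def)
    note parts = noise_error_parts[OF \<beta>(1) good, unfolded UV]
    have "\<bar>(v N \<omega> \<theta> - \<sigma>2 *\<^sub>R score \<theta>) $ i\<bar> \<le> 4 * E\<^sup>2 * noise_error \<beta> u N \<omega>" for i
    proof -
      have eq: "(v N \<omega> \<theta> - \<sigma>2 *\<^sub>R score \<theta>) $ i = (1 / real N) * (\<Sum>n=1..N. lin (trunc n (b \<theta>) \<star>\<^sub>c a \<theta>s) (\<lambda>n. Z n \<omega>) (int n) * lin (trunc n (db \<theta> i) \<star>\<^sub>c a \<theta>s) (\<lambda>n. Z n \<omega>) (int n)) - \<sigma>2 * (\<Sum>m. cf \<theta> m * dcf \<theta> i m)"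
        using \<theta> D(2) by (simp add: v_def gradient_V_P subset_iff score_def eps_path[OF good \<theta>])
      have "\<bar>(v N \<omega> \<theta> - \<sigma>2 *\<^sub>R score \<theta>) $ i\<bar> \<le> 4 * E\<^sup>2 * ((\<Sum>j. \<beta> ^ j * (\<Sum>k. \<beta> ^ k * \<bar>cov_error j k N \<omega>\<bar>)) + (1 / real N) * (\<Sum>n. \<beta> ^ n * (V 0 * V (int n))))"
        unfolding eq
      proof (rule lin_product_average_perturbed)
        show "\<bar>cf \<theta> j\<bar> \<le> E * \<beta> ^ j" "\<bar>dcf \<theta> i j\<bar> \<le> E * \<beta> ^ j" for j
          using cf_bd[OF \<theta>] dcf_bd[OF \<theta>] by (auto simp: E_def)
        show "\<bar>(trunc n (b \<theta>) \<star>\<^sub>c a \<theta>s) j\<bar> \<le> E * \<beta> ^ j" "\<bar>(trunc n (db \<theta> i) \<star>\<^sub>c a \<theta>s) j\<bar> \<le> E * \<beta> ^ j" for n j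
          using tr[OF \<theta>] by auto
        show "(trunc n (b \<theta>) \<star>\<^sub>c a \<theta>s) j = cf \<theta> j" "(trunc n (db \<theta> i) \<star>\<^sub>c a \<theta>s) j = dcf \<theta> i j" if "j < n" for n j
          using that by (simp_all add: conv_trunc cf_def dcf_def)
        show "cov_error j k N \<omega> = (1 / real N) * (\<Sum>n=1..N. Z (int n - int j) \<omega> * Z (int n - int k) \<omega>) - (if j = k then \<sigma>2 else 0)" for j k
          by (rule cov_error_def)
        show "summable (\<lambda>k. \<beta> ^ k * \<bar>cov_error j k N \<omega>\<bar>)" for j using good by (simp add: good_path_def)
      qed (rule parts)+
      also have "\<dots> \<le> 4 * E\<^sup>2 * noise_error \<beta> u N \<omega>"
        by (intro mult_left_mono parts(1)) simp
      finally show ?thesis .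
    qed
    hence "(\<Sum>i\<in>UNIV. \<bar>(v N \<omega> \<theta> - \<sigma>2 *\<^sub>R score \<theta>) $ i\<bar>) \<le> ?p * (4 * E\<^sup>2 * noise_error \<beta> u N \<omega>)"
      by (intro sum_bounded_above)
    thus ?thesis using norm_le_l1_cart[of "v N \<omega> \<theta> - \<sigma>2 *\<^sub>R score \<theta>"] by simp
  qed
  have zero: "\<sigma>2 *\<^sub>R score \<theta> = 0 \<longleftrightarrow> \<theta> = \<theta>s" if "\<theta> \<in> D" for \<theta>
    using unique that D(2) gradient_W_P by (metis subsetD)
  obtain C1 where C1: "C1 > 0" "\<And>v \<delta> x. \<lbrakk>continuous_on D v; \<And>y. y \<in> D \<Longrightarrow> norm (v y - \<sigma>2 *\<^sub>R score y) \<le> \<delta>; x \<in> D;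
        (\<exists>y\<in>D. v y = 0) \<longrightarrow> v x = 0\<rbrakk> \<Longrightarrow> norm (x - \<theta>s) \<le> C1 * \<delta>"
  proof -
    have cont: "continuous_on D (\<lambda>\<theta>. \<sigma>2 *\<^sub>R score \<theta>)" by (intro continuous_intros score_continuous)
    show ?thesis
      using z_estimator[OF D(1) \<theta>s cont zero pe_slope pe_slope_injective[OF nonsing]] that by metis
  qed
  define C2 where "C2 = C1 * (?p * (4 * E\<^sup>2))"
  have C2: "C2 \<ge> 0" using C1(1) by (simp add: C2_def)
  have theta_rate: "norm (\<theta>h N \<omega> - \<theta>s) \<le> C2 * noise_error \<beta> u N \<omega>"
    if N: "N \<ge> 1" and \<omega>: "\<omega> \<in> space M" and good: "good_path \<beta> N \<omega>" for N \<omega>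
  proof -
    have "norm (\<theta>h N \<omega> - \<theta>s) \<le> C1 * (?p * (4 * E\<^sup>2) * noise_error \<beta> u N \<omega>)"
    proof (rule C1(2)[of "v N \<omega>"])
      show "continuous_on D (v N \<omega>)" unfolding v_def by (intro continuous_on_scaleR continuous_on_const gradient_V_P_continuous)
      show "\<And>y. y \<in> D \<Longrightarrow> norm (v N \<omega> y - \<sigma>2 *\<^sub>R score y) \<le> ?p * (4 * E\<^sup>2) * noise_error \<beta> u N \<omega>"
        by (rule v_close[OF good])
      show "\<theta>h N \<omega> \<in> D" using \<theta>h \<omega> by blast
      show "(\<exists>y\<in>D. v N \<omega> y = 0) \<longrightarrow> v N \<omega> (\<theta>h N \<omega>) = 0" using \<theta>h \<omega> N by (auto simp: v_def)
    qed
    thus ?thesis by (simp add: C2_def mult.assoc)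
  qed
  \<comment> \<open>The expected value of \<open>V\<close>, whose weights sum to
    \<open>1 / (1 - \<beta>)\<close>.\<close>
  define \<mu> where "\<mu> = expectation (\<lambda>\<omega>. \<bar>Z 0 \<omega>\<bar>) / (1 - \<beta>)"
  have \<mu>: "\<mu> \<ge> 0" using \<beta> by (simp add: \<mu>_def)
  \<comment> \<open>The summands belong to the change of parameter, the initial conditions and the
    sampling error. The 2 bounds the distance of two empirical means when the noise error exceeds
    1.\<close>
  define Cl where "Cl l = \<bar>u l\<bar> * (\<Lambda> * c * K) * C2 * (1 + \<mu>) + 2 + \<bar>u l\<bar> * (2 * E) / (1 - \<beta>) + 1" for l
  have Cl: "Cl l > 0" for l
  proof -
    have "0 \<le> \<bar>u l\<bar> * (\<Lambda> * c * K) * C2 * (1 + \<mu>)" using \<Lambda>(1) bd C2 \<mu> by simp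
    moreover have "0 \<le> \<bar>u l\<bar> * (2 * E) / (1 - \<beta>)" using E \<beta> by simp
    ultimately show ?thesis unfolding Cl_def by linarith
  qed
  have main: "cmod (ecf_mean u N (\<theta>h N \<omega>) \<omega> l - expectation (\<lambda>\<omega>. iexp (u l * Z 0 \<omega>))) \<le> Cl l * noise_error \<beta> u N \<omega>"
    if N: "N \<ge> 1" and \<omega>: "\<omega> \<in> space M" and good: "good_path \<beta> N \<omega>" for N \<omega> l
  proof -
    interpret summable_path "\<lambda>n. Z n \<omega>" \<beta> using good by (simp add: good_path_def)
    have UV: "U \<beta> n \<omega> = V n" for n by (simp add: U_def V_def)
    note parts = noise_error_parts(1-5)[where u = u, OF \<beta>(1) good, unfolded UV]
    let ?H = "noise_error \<beta> u N \<omega>" and ?\<theta> = "\<theta>h N \<omega>"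
    have \<theta>D: "?\<theta> \<in> D" using \<theta>h \<omega> by blast
    have N0: "real N > 0" using N by simp
    have avg: "cmod (x - y) \<le> (1 / real N) * (\<Sum>n=1..N. \<bar>u l\<bar> * \<bar>s n - t n\<bar>)"
      if "x = (\<Sum>n=1..N. iexp (u l * s n)) / of_nat N" "y = (\<Sum>n=1..N. iexp (u l * t n)) / of_nat N" for x y and s t :: "nat \<Rightarrow> real"
    proof -
      have "cmod (x - y) = cmod (\<Sum>n=1..N. iexp (u l * s n) - iexp (u l * t n)) / real N"
        using that by (simp add: sum_subtractf norm_divide flip: diff_divide_distrib)
      moreover have "cmod (\<Sum>n=1..N. iexp (u l * s n) - iexp (u l * t n)) \<le> (\<Sum>n=1..N. \<bar>u l\<bar> * \<bar>s n - t n\<bar>)"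
      proof (rule order_trans[OF norm_sum sum_mono])
        fix n
        show "cmod (iexp (u l * s n) - iexp (u l * t n)) \<le> \<bar>u l\<bar> * \<bar>s n - t n\<bar>"
          using norm_iexp_diff_le[of "u l * s n" "u l * t n"] by (simp add: abs_mult[symmetric] right_diff_distrib)
      qed
      ultimately show ?thesis using N0 by (simp add: divide_right_mono)
    qed
    let ?m0 = "(\<Sum>n=1..N. iexp (u l * Z (int n) \<omega>)) / of_nat N"
    have A: "cmod (ecf_mean u N ?\<theta> \<omega> l - ecf_mean u N \<theta>s \<omega> l) \<le> (\<bar>u l\<bar> * (\<Lambda> * c * K) * C2 * (1 + \<mu>) + 2) * ?H"
    \<comment> \<open>The average of \<open>V\<close> is at most \<mu> plus the noise error, so
      without this split the bound would be quadratic in the noise error. If it is at most 1 the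
      average of \<open>V\<close> is bounded; otherwise the boundedness of the means
      suffices.\<close>
    proof (cases "?H \<le> 1")
      case True
      let ?t = "norm (?\<theta> - \<theta>s)"
      have diff: "\<bar>\<epsilon> ?\<theta> n \<omega> - \<epsilon> \<theta>s n \<omega>\<bar> \<le> \<Lambda> * ?t * c * K * V (int n)" for n
      proof -
        have kb: "\<bar>trunc n (\<lambda>j. b ?\<theta> j - b \<theta>s j) j\<bar> \<le> (\<Lambda> * ?t) * \<alpha> ^ j" for j
          using \<Lambda>(1) bd by (intro trunc_bound \<Lambda>(2)[OF \<theta>D]) auto
        have "\<epsilon> ?\<theta> n \<omega> - \<epsilon> \<theta>s n \<omega> = lin (trunc n (\<lambda>j. b ?\<theta> j - b \<theta>s j)) (lin (a \<theta>s) (\<lambda>n. Z n \<omega>)) (int n)"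
          by (simp add: eps_lin lin_trunc left_diff_distrib sum_subtractf)
        also have "\<dots> = lin (trunc n (\<lambda>j. b ?\<theta> j - b \<theta>s j) \<star>\<^sub>c a \<theta>s) (\<lambda>n. Z n \<omega>) (int n)"
          by (rule lin_lin[OF kb a_bd K]) (use \<Lambda>(1) bd in auto)
        finally have "\<epsilon> ?\<theta> n \<omega> - \<epsilon> \<theta>s n \<omega> = lin (trunc n (\<lambda>j. b ?\<theta> j - b \<theta>s j) \<star>\<^sub>c a \<theta>s) (\<lambda>n. Z n \<omega>) (int n)" .
        moreover have "\<bar>lin (trunc n (\<lambda>j. b ?\<theta> j - b \<theta>s j) \<star>\<^sub>c a \<theta>s) (\<lambda>n. Z n \<omega>) (int n)\<bar> \<le> \<Lambda> * ?t * c * K * V (int n)"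
          by (rule lin_le, rule conv_bound[OF kb a_bd K]) (use \<Lambda>(1) bd in auto)
        ultimately show ?thesis by simp
      qed
      have Vbar: "(1 / real N) * (\<Sum>n=1..N. V (int n)) \<le> 1 + \<mu>"
      proof -
        have "(\<lambda>j. (1 / real N) * (\<Sum>n=1..N. \<beta> ^ j * \<bar>Z (int n - int j) \<omega>\<bar>)) sums ((1 / real N) * (\<Sum>n=1..N. V (int n)))"
          unfolding V_def by (intro sums_mult sums_sum summable_sums summ)
        moreover have "(1 / real N) * (\<Sum>n=1..N. \<beta> ^ j * \<bar>Z (int n - int j) \<omega>\<bar>) = \<beta> ^ j * abs_error j N \<omega> + \<beta> ^ j * expectation (\<lambda>\<omega>. \<bar>Z 0 \<omega>\<bar>)" for j
          by (simp add: abs_error_def sum_distrib_left[symmetric] algebra_simps)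
        ultimately have S: "(\<lambda>j. \<beta> ^ j * abs_error j N \<omega> + \<beta> ^ j * expectation (\<lambda>\<omega>. \<bar>Z 0 \<omega>\<bar>)) sums ((1 / real N) * (\<Sum>n=1..N. V (int n)))"
          by simp
        have s4: "summable (\<lambda>j. \<beta> ^ j * \<bar>abs_error j N \<omega>\<bar>)" using good by (simp add: good_path_def)
        have g: "(\<lambda>j. \<beta> ^ j * expectation (\<lambda>\<omega>. \<bar>Z 0 \<omega>\<bar>)) sums \<mu>"
          using sums_mult2[OF geometric_sums[of \<beta>], of "expectation (\<lambda>\<omega>. \<bar>Z 0 \<omega>\<bar>)"] \<beta> by (simp add: \<mu>_def)
        have "(1 / real N) * (\<Sum>n=1..N. V (int n)) \<le> (\<Sum>j. \<beta> ^ j * \<bar>abs_error j N \<omega>\<bar>) + \<mu>"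
          by (rule sums_le[OF _ S sums_add[OF summable_sums[OF s4] g]]) (use \<beta> in \<open>simp add: mult_left_mono\<close>)
        thus ?thesis using parts(3) True by linarith
      qed
      have "cmod (ecf_mean u N ?\<theta> \<omega> l - ecf_mean u N \<theta>s \<omega> l) \<le> (1 / real N) * (\<Sum>n=1..N. \<bar>u l\<bar> * \<bar>\<epsilon> ?\<theta> n \<omega> - \<epsilon> \<theta>s n \<omega>\<bar>)"
        by (rule avg) (simp_all add: ecf_mean_def)
      also have "\<dots> \<le> (1 / real N) * (\<Sum>n=1..N. \<bar>u l\<bar> * (\<Lambda> * ?t * c * K * V (int n)))"
        using diff by (intro mult_left_mono sum_mono) auto
      also have "\<dots> = \<bar>u l\<bar> * (\<Lambda> * c * K) * (?t * ((1 / real N) * (\<Sum>n=1..N. V (int n))))"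
        by (simp add: sum_distrib_left mult_ac)
      also have "\<dots> \<le> \<bar>u l\<bar> * (\<Lambda> * c * K) * ((C2 * ?H) * (1 + \<mu>))"
      proof (intro mult_left_mono)
        show "?t * ((1 / real N) * (\<Sum>n=1..N. V (int n))) \<le> (C2 * ?H) * (1 + \<mu>)"
        proof (rule mult_mono[OF theta_rate[OF N \<omega> good] Vbar])
          show "0 \<le> C2 * ?H" using C2 parts(5) by simp
          show "0 \<le> (1 / real N) * (\<Sum>n=1..N. V (int n))" using V_nonneg by (simp add: sum_nonneg)
        qed
      qed (use \<Lambda>(1) bd in auto)
      also have "\<dots> = (\<bar>u l\<bar> * (\<Lambda> * c * K) * C2 * (1 + \<mu>)) * ?H" by (simp add: mult_ac)
      also have "\<dots> \<le> (\<bar>u l\<bar> * (\<Lambda> * c * K) * C2 * (1 + \<mu>) + 2) * ?H" using parts(5) by (intro mult_right_mono) auto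
      finally show ?thesis .
    next
      case False
      have m1: "cmod (ecf_mean u N \<theta> \<omega> l) \<le> 1" for \<theta>
      proof -
        have "cmod (\<Sum>n=1..N. iexp (u l * \<epsilon> \<theta> n \<omega>)) \<le> (\<Sum>n=1..N. 1)"
          by (rule order_trans[OF norm_sum sum_mono]) simp
        thus ?thesis using N0 by (simp add: ecf_mean_def norm_divide)
      qed
      have "cmod (ecf_mean u N ?\<theta> \<omega> l - ecf_mean u N \<theta>s \<omega> l) \<le> 2"
        using norm_triangle_ineq4[of "ecf_mean u N ?\<theta> \<omega> l" "ecf_mean u N \<theta>s \<omega> l"] m1[of ?\<theta>] m1[of \<theta>s] by linarith
      also have "\<dots> \<le> 2 * ?H" using False by simp
      also have "\<dots> \<le> (\<bar>u l\<bar> * (\<Lambda> * c * K) * C2 * (1 + \<mu>) + 2) * ?H"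
        using parts(5) \<Lambda>(1) bd C2 \<mu> by (intro mult_right_mono) auto
      finally show ?thesis .
    qed
    have B: "cmod (ecf_mean u N \<theta>s \<omega> l - ?m0) \<le> (\<bar>u l\<bar> * (2 * E) / (1 - \<beta>)) * ?H"
    proof -
      \<comment> \<open>At \<theta>s the stationary cascade is the identity, so the innovation
        differs from the noise only through the initial conditions, whose influence decays
        geometrically.\<close>
      have diff: "\<bar>\<epsilon> \<theta>s n \<omega> - Z (int n) \<omega>\<bar> \<le> 2 * E * V 0 * \<beta> ^ n" for n
      proof -
        have "lin (cf \<theta>s) (\<lambda>n. Z n \<omega>) (int n) = Z (int n) \<omega>"
          unfolding lin_def by (subst suminf_finite[of "{0}"]) (auto simp: cf_true)
        hence "\<epsilon> \<theta>s n \<omega> - Z (int n) \<omega> = lin (\<lambda>j. (trunc n (b \<theta>s) \<star>\<^sub>c a \<theta>s) j - cf \<theta>s j) (\<lambda>n. Z n \<omega>) (int n)"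
          using lin_diff[OF tr(1)[OF \<theta>s_D, of n] cf_bd[OF \<theta>s_D]] by (simp add: eps_path[OF good \<theta>s_D])
        moreover have "\<bar>lin (\<lambda>j. (trunc n (b \<theta>s) \<star>\<^sub>c a \<theta>s) j - cf \<theta>s j) (\<lambda>n. Z n \<omega>) (int n)\<bar> \<le> 2 * E * \<beta> ^ n * V 0"
        proof (rule lin_tail)
          show "\<bar>(trunc n (b \<theta>s) \<star>\<^sub>c a \<theta>s) j - cf \<theta>s j\<bar> \<le> 2 * E * \<beta> ^ j" for j
            using tr(1)[OF \<theta>s_D, of n j] cf_bd[OF \<theta>s_D, of j] unfolding E_def by linarith
        qed (simp add: conv_trunc cf_def)
        ultimately show ?thesis by (simp add: mult_ac)
      qed
      have geo: "(\<Sum>n=1..N. \<beta> ^ n) \<le> 1 / (1 - \<beta>)"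
      proof -
        have "(\<Sum>n=1..N. \<beta> ^ n) \<le> (\<Sum>n. \<beta> ^ n)"
          using \<beta> by (intro sum_le_suminf summable_geometric) auto
        thus ?thesis using \<beta> by (simp add: suminf_geometric)
      qed
      have "cmod (ecf_mean u N \<theta>s \<omega> l - ?m0) \<le> (1 / real N) * (\<Sum>n=1..N. \<bar>u l\<bar> * \<bar>\<epsilon> \<theta>s n \<omega> - Z (int n) \<omega>\<bar>)"
        by (rule avg) (simp_all add: ecf_mean_def)
      also have "\<dots> \<le> (1 / real N) * (\<Sum>n=1..N. \<bar>u l\<bar> * (2 * E * V 0 * \<beta> ^ n))"
        using diff by (intro mult_left_mono sum_mono) auto
      also have "\<dots> = (\<bar>u l\<bar> * (2 * E)) * ((1 / real N) * V 0) * (\<Sum>n=1..N. \<beta> ^ n)"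
      proof -
        have "(\<Sum>n=1..N. \<bar>u l\<bar> * (2 * E * V 0 * \<beta> ^ n)) = \<bar>u l\<bar> * (2 * E * V 0) * (\<Sum>n=1..N. \<beta> ^ n)"
          by (simp only: sum_distrib_left mult.assoc)
        thus ?thesis by (simp only: mult_ac)
      qed
      also have "\<dots> \<le> (\<bar>u l\<bar> * (2 * E)) * ?H * (1 / (1 - \<beta>))"
        using E \<beta> V_nonneg[of 0] parts(5)
        by (intro mult_mono geo mult_left_mono parts(2)) (auto intro!: sum_nonneg)
      finally show ?thesis by (simp add: mult_ac)
    qed
    have Cc: "cmod (?m0 - expectation (\<lambda>\<omega>. iexp (u l * Z 0 \<omega>))) \<le> ?H"
      using parts(4)[of l] by (simp add: ecf_error_def)
    have "cmod (ecf_mean u N ?\<theta> \<omega> l - expectation (\<lambda>\<omega>. iexp (u l * Z 0 \<omega>)))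
       \<le> cmod (ecf_mean u N ?\<theta> \<omega> l - ecf_mean u N \<theta>s \<omega> l) + cmod (ecf_mean u N \<theta>s \<omega> l - ?m0) + cmod (?m0 - expectation (\<lambda>\<omega>. iexp (u l * Z 0 \<omega>)))"
      using dist_triangle[of "ecf_mean u N ?\<theta> \<omega> l" "expectation (\<lambda>\<omega>. iexp (u l * Z 0 \<omega>))" "ecf_mean u N \<theta>s \<omega> l"]
        dist_triangle[of "ecf_mean u N \<theta>s \<omega> l" "expectation (\<lambda>\<omega>. iexp (u l * Z 0 \<omega>))" ?m0]
      unfolding dist_norm by linarith
    also have "\<dots> \<le> Cl l * ?H"
      using A B Cc by (simp add: Cl_def distrib_right)
    finally show ?thesis .
  qed
  show thesis
  proof (rule that[OF \<beta>])
    show "(\<Sum>l\<in>UNIV. Cl l) > 0" using Cl by (intro sum_pos) auto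
    fix N \<omega> assume "N \<ge> 1" "\<omega> \<in> space M" "good_path \<beta> N \<omega>"
    thus "(\<Sum>l\<in>UNIV. cmod (ecf_mean u N (\<theta>h N \<omega>) \<omega> l - expectation (\<lambda>\<omega>. iexp (u l * Z 0 \<omega>)))) \<le> (\<Sum>l\<in>UNIV. Cl l) * noise_error \<beta> u N \<omega>"
      unfolding sum_distrib_right by (intro sum_mono main)
  qed
qed

end

section \<open>Limit criterion of the second stage\<close>

text \<open>The cross term is linear in \<open>e - m\<close>, so it disappears under expectation
  when \<open>m\<close> is the mean of \<open>e\<close>.\<close>

lemma herm_form_shift:
  "herm_form A (\<lambda>k. e k - y k) = herm_form A (\<lambda>k. e k - m k) + herm_form A (\<lambda>k. m k - y k)
     + bform A (\<lambda>k. m k - y k) (\<lambda>k. e k - m k)"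
proof -
  let ?x = "\<lambda>k. m k - y k" and ?z = "\<lambda>k. e k - m k"
  have "(e k - y k) * of_real (A $ k $ l) * cnj (e l - y l) = ?z k * of_real (A $ k $ l) * cnj (?z l) + ?x k * of_real (A $ k $ l) * cnj (?x l)
      + (?x k * of_real (A $ k $ l) * cnj (?z l) + ?z k * of_real (A $ k $ l) * cnj (?x l))" for k l
    by (simp add: algebra_simps)
  thus ?thesis
    unfolding herm_form_def bform_def Re_cnj_symmetrize[symmetric]
    by (simp only: sum.distrib plus_complex.sel)
qed

text \<open>A bias-variance decomposition: the fluctuation term does not involve \<open>y\<close>,
  so derivatives with respect to a parameter in \<open>y\<close> see only the form at the
  mean.\<close>

lemma (in prob_space) expectation_herm_form:
  fixes e :: "'a \<Rightarrow> 'k::finite \<Rightarrow> complex"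
  assumes [measurable]: "\<And>k. (\<lambda>\<omega>. e \<omega> k) \<in> borel_measurable M" and bdd: "\<And>\<omega> k. cmod (e \<omega> k) \<le> B"
  defines "m \<equiv> \<lambda>k. expectation (\<lambda>\<omega>. e \<omega> k)"
  shows "expectation (\<lambda>\<omega>. herm_form A (\<lambda>k. e \<omega> k - y k)) =
     expectation (\<lambda>\<omega>. herm_form A (\<lambda>k. e \<omega> k - m k)) + herm_form A (\<lambda>k. m k - y k)"
proof -
  have [measurable]: "cnj \<in> borel_measurable borel"
    by (intro borel_measurable_continuous_onI continuous_on_cnj continuous_on_id)
  have int: "integrable M (\<lambda>\<omega>. e \<omega> k)" for k
    using bdd by (intro integrable_const_bound[of _ B]) auto
  have int2: "integrable M (\<lambda>\<omega>. e \<omega> k * cnj (e \<omega> l))" for k l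
  proof (rule integrable_const_bound[of _ "B * B"])
    have "cmod (e \<omega> k * cnj (e \<omega> l)) \<le> B * B" for \<omega>
      unfolding norm_mult complex_mod_cnj using bdd order_trans[OF norm_ge_zero bdd] by (intro mult_mono) auto
    thus "AE \<omega> in M. cmod (e \<omega> k * cnj (e \<omega> l)) \<le> B * B" by simp
  qed measurable
  have ih: "integrable M (\<lambda>\<omega>. herm_form A (\<lambda>k. e \<omega> k - z k))" for z
  proof -
    have "integrable M (\<lambda>\<omega>. (e \<omega> k - z k) * of_real (A $ k $ l) * cnj (e \<omega> l - z l))" for k l
    proof -
      have "integrable M (\<lambda>\<omega>. of_real (A $ k $ l) * (e \<omega> k * cnj (e \<omega> l) - cnj (z l) * e \<omega> k - z k * cnj (e \<omega> l) + z k * cnj (z l)))"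
        using int int2 by (intro integrable_mult_right Bochner_Integration.integrable_add Bochner_Integration.integrable_diff integrable_cnj) auto
      thus ?thesis by (simp add: algebra_simps)
    qed
    thus ?thesis unfolding herm_form_def by (intro integrable_Re Bochner_Integration.integrable_sum)
  qed
  have ib: "integrable M (\<lambda>\<omega>. x * of_real c * cnj (e \<omega> l - m l))" and eb: "expectation (\<lambda>\<omega>. x * of_real c * cnj (e \<omega> l - m l)) = 0" for x c l
  proof -
    have i: "integrable M (\<lambda>\<omega>. e \<omega> l - m l)" using int by simp
    show "integrable M (\<lambda>\<omega>. x * of_real c * cnj (e \<omega> l - m l))"
      by (intro integrable_mult_right integrable_cnj i)
    have "expectation (\<lambda>\<omega>. cnj (e \<omega> l - m l)) = cnj (expectation (\<lambda>\<omega>. e \<omega> l - m l))" by (rule Bochner_Integration.integral_cnj)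
    also have "expectation (\<lambda>\<omega>. e \<omega> l - m l) = 0" using int by (simp add: m_def prob_space)
    finally show "expectation (\<lambda>\<omega>. x * of_real c * cnj (e \<omega> l - m l)) = 0" by (simp only: integral_mult_right_zero complex_cnj_zero mult_zero_right)
  qed
  have B1: "integrable M (\<lambda>\<omega>. bform A x (\<lambda>k. e \<omega> k - m k))" for x
    unfolding bform_def by (intro integrable_Re Bochner_Integration.integrable_sum ib)
  have B2: "expectation (\<lambda>\<omega>. bform A x (\<lambda>k. e \<omega> k - m k)) = 0" for x
  proof -
    have i3: "integrable M (\<lambda>\<omega>. \<Sum>k\<in>UNIV. \<Sum>l\<in>UNIV. x k * of_real (A $ k $ l + A $ l $ k) * cnj (e \<omega> l - m l))"
      by (intro Bochner_Integration.integrable_sum ib)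
    have "expectation (\<lambda>\<omega>. \<Sum>k\<in>UNIV. \<Sum>l\<in>UNIV. x k * of_real (A $ k $ l + A $ l $ k) * cnj (e \<omega> l - m l)) = 0"
      by (subst Bochner_Integration.integral_sum, intro Bochner_Integration.integrable_sum ib,
          rule sum.neutral, rule ballI, subst Bochner_Integration.integral_sum, rule ib) (simp only: eb sum.neutral_const)
    thus ?thesis unfolding bform_def using integral_Re[OF i3] by simp
  qed
  have "expectation (\<lambda>\<omega>. herm_form A (\<lambda>k. e \<omega> k - y k)) =
    expectation (\<lambda>\<omega>. herm_form A (\<lambda>k. e \<omega> k - m k) + herm_form A (\<lambda>k. m k - y k) + bform A (\<lambda>k. m k - y k) (\<lambda>k. e \<omega> k - m k))"
    by (intro Bochner_Integration.integral_cong refl herm_form_shift)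
  also have "\<dots> = expectation (\<lambda>\<omega>. herm_form A (\<lambda>k. e \<omega> k - m k)) + herm_form A (\<lambda>k. m k - y k)"
    using ih[of m] B1 by (simp add: B2 prob_space)
  finally show ?thesis .
qed

context filtered_noise
begin

lemma gradient_V_E:
  fixes u :: "'k::finite \<Rightarrow> real"
  assumes f: "\<And>k. (\<lambda>\<eta>. \<phi> (u k) \<eta>) differentiable (at \<eta>)" and N: "N \<ge> 1"
  shows "gradient (\<lambda>\<eta>. V_E K u \<phi> b a \<theta>s Z N \<theta> \<eta> \<omega>) \<eta> =
    real N *\<^sub>R ecf_score (matrix_inv K) (\<lambda>k. \<phi> (u k)) (ecf_mean u N \<theta> \<omega>) \<eta>"
proof (rule gradient_eqI)
  let ?A = "matrix_inv K" and ?f = "\<lambda>k. \<phi> (u k)" and ?e = "\<lambda>n k. iexp (u k * \<epsilon> \<theta> n \<omega>)"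
  have "((\<lambda>\<eta>. V_E K u \<phi> b a \<theta>s Z N \<theta> \<eta> \<omega>) has_derivative (\<lambda>h. \<Sum>n=1..N. ecf_score ?A ?f (?e n) \<eta> \<bullet> h)) (at \<eta>)"
    unfolding V_E_def hvec_def by (intro has_derivative_sum herm_form_has_derivative f)
  also have "(\<lambda>h. \<Sum>n=1..N. ecf_score ?A ?f (?e n) \<eta> \<bullet> h) = (\<lambda>h. (\<Sum>n=1..N. ecf_score ?A ?f (?e n) \<eta>) \<bullet> h)"
    by (simp add: inner_sum_left)
  also have "(\<Sum>n=1..N. ecf_score ?A ?f (?e n) \<eta>) = real N *\<^sub>R ecf_score ?A ?f (ecf_mean u N \<theta> \<omega>) \<eta>"
    by (subst sum_ecf_score) (simp_all add: ecf_mean_def[abs_def])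
  finally show "((\<lambda>\<eta>. V_E K u \<phi> b a \<theta>s Z N \<theta> \<eta> \<omega>) has_derivative (\<lambda>h. (real N *\<^sub>R ecf_score ?A ?f (ecf_mean u N \<theta> \<omega>) \<eta>) \<bullet> h)) (at \<eta>)" .
qed

text \<open>At \<theta>s the stationary innovation is almost surely the noise itself;
  \<open>c\<close> is the fluctuation term of the decomposition, free of \<eta>.\<close>

lemma W_E_eq:
  fixes u :: "'k::finite \<Rightarrow> real"
  shows "\<exists>c. \<forall>\<eta>. W_E M K u \<phi> b a \<theta>s Z \<theta>s \<eta> =
    c + herm_form (matrix_inv K) (\<lambda>k. expectation (\<lambda>\<omega>. iexp (u k * Z 0 \<omega>)) - \<phi> (u k) \<eta>)"
proof (intro exI allI)
  fix \<eta>
  have z: "AE \<omega> in M. eps_star b a \<theta>s Z \<theta>s 0 \<omega> = Z 0 \<omega>"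
  proof -
    have "lin (cf \<theta>s) (\<lambda>n. Z n \<omega>) 0 = Z 0 \<omega>" for \<omega>
      unfolding lin_def by (subst suminf_finite[of "{0}"]) (auto simp: cf_true)
    thus ?thesis using eps_star_AE[OF \<theta>s_G, of 0] by simp
  qed
  have "W_E M K u \<phi> b a \<theta>s Z \<theta>s \<eta> = expectation (\<lambda>\<omega>. herm_form (matrix_inv K) (\<lambda>k. iexp (u k * Z 0 \<omega>) - \<phi> (u k) \<eta>))"
    unfolding W_E_def hvec_def herm_form_def
    by (rule integral_cong_AE) (use z in \<open>auto elim!: eventually_mono\<close>)
  thus "W_E M K u \<phi> b a \<theta>s Z \<theta>s \<eta> =
    expectation (\<lambda>\<omega>. herm_form (matrix_inv K) (\<lambda>k. iexp (u k * Z 0 \<omega>) - expectation (\<lambda>\<omega>. iexp (u k * Z 0 \<omega>))))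
     + herm_form (matrix_inv K) (\<lambda>k. expectation (\<lambda>\<omega>. iexp (u k * Z 0 \<omega>)) - \<phi> (u k) \<eta>)"
    by (subst (asm) expectation_herm_form[where B = 1]) auto
qed

lemma gradient_W_E:
  fixes u :: "'k::finite \<Rightarrow> real"
  assumes f: "\<And>k. (\<lambda>\<eta>. \<phi> (u k) \<eta>) differentiable (at \<eta>)"
  shows "gradient (W_E M K u \<phi> b a \<theta>s Z \<theta>s) \<eta> =
    ecf_score (matrix_inv K) (\<lambda>k. \<phi> (u k)) (\<lambda>k. expectation (\<lambda>\<omega>. iexp (u k * Z 0 \<omega>))) \<eta>"
proof (rule gradient_eqI)
  obtain c where c: "\<And>\<eta>. W_E M K u \<phi> b a \<theta>s Z \<theta>s \<eta> =
    c + herm_form (matrix_inv K) (\<lambda>k. expectation (\<lambda>\<omega>. iexp (u k * Z 0 \<omega>)) - \<phi> (u k) \<eta>)"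
    using W_E_eq by blast
  have "((\<lambda>\<eta>. c + herm_form (matrix_inv K) (\<lambda>k. expectation (\<lambda>\<omega>. iexp (u k * Z 0 \<omega>)) - \<phi> (u k) \<eta>)) has_derivative
     (\<lambda>h. 0 + ecf_score (matrix_inv K) (\<lambda>k. \<phi> (u k)) (\<lambda>k. expectation (\<lambda>\<omega>. iexp (u k * Z 0 \<omega>))) \<eta> \<bullet> h)) (at \<eta>)"
    by (intro has_derivative_add has_derivative_const herm_form_has_derivative f)
  thus "(W_E M K u \<phi> b a \<theta>s Z \<theta>s has_derivative
     (\<lambda>h. ecf_score (matrix_inv K) (\<lambda>k. \<phi> (u k)) (\<lambda>k. expectation (\<lambda>\<omega>. iexp (u k * Z 0 \<omega>))) \<eta> \<bullet> h)) (at \<eta>)"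
    by (simp add: c[abs_def])
qed

end

subsection \<open>Second-order expansion\<close>

theorem theorem5:
  fixes M :: "'w measure"
    and h :: real and Q :: nat
    and dZ :: "int \<Rightarrow> 'w \<Rightarrow> real"
    and G\<theta> :: "(real^'p) set" and G\<eta> :: "(real^'q) set"
    and bL sL :: "real^'q \<Rightarrow> real" and \<nu> :: "real^'q \<Rightarrow> real measure"
    and \<phi> :: "real \<Rightarrow> real^'q \<Rightarrow> complex"
    and a b :: "real^'p \<Rightarrow> nat \<Rightarrow> real"
    and \<theta>s :: "real^'p" and \<eta>s :: "real^'q"
    and u :: "'k::finite \<Rightarrow> real" and K :: "real^'k^'k"
    and D\<theta> :: "(real^'p) set" and D\<eta> :: "(real^'q) set"
    and Ds\<rho> :: "((real^'p) \<times> (real^'q)) set"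
    and \<theta>h :: "nat \<Rightarrow> 'w \<Rightarrow> real^'p" and \<eta>h :: "nat \<Rightarrow> 'w \<Rightarrow> real^'q"
  assumes M: "prob_space M"
    and h_pos: "h > 0" and Q_ge: "Q \<ge> 2"
    (* parametrized family of Levy laws; phi(.,eta) is the char. function of dZ_n under eta *)
    and G\<eta>_open: "open G\<eta>" and \<eta>s_in: "\<eta>s \<in> G\<eta>"
    and levy: "\<forall>\<eta>\<in>G\<eta>. levy_measure (\<nu> \<eta>) \<and> sL \<eta> \<ge> 0 \<and>
                 (\<forall>x. \<phi> x \<eta> = exp (of_real h * levy_exponent (bL \<eta>) (sL \<eta>) (\<nu> \<eta>) x))"
    and \<phi>_C3: "\<forall>x. Ck_on 3 G\<eta> (\<lambda>\<eta>. \<phi> x \<eta>)"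
    (* i.i.d. increments with true parameter eta*, mean zero *)
    and indep: "prob_space.indep_vars M (\<lambda>_. borel) dZ UNIV"
    and law: "\<forall>n x. char (distr M borel (dZ n)) x = \<phi> x \<eta>s"
    and mean0: "\<forall>n. integrable M (dZ n) \<and> prob_space.expectation M (dZ n) = 0"
    (* Condition 1 *)
    and cond1: "\<forall>r::real. 1 \<le> r \<and> r \<le> real Q \<longrightarrow>
                 (\<integral>\<^sup>+ x. ennreal (indicator {x. \<bar>x\<bar> \<ge> 1} x * \<bar>x\<bar> powr r) \<partial>(\<nu> \<eta>s)) < \<infinity>"
    (* filter A(theta): innovation form, finite dimensional, C^3; b = impulse response of A^{-1}(theta) *)
    and G\<theta>_open: "open G\<theta>" and \<theta>s_in: "\<theta>s \<in> G\<theta>"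
    and a0: "\<forall>\<theta>. a \<theta> 0 = 1"
    and a_findim: "\<forall>\<theta>\<in>G\<theta>. \<exists>d (c::nat \<Rightarrow> real) j0. \<forall>j\<ge>j0.
                     a \<theta> (j + d) = (\<Sum>i<d. c i * a \<theta> (j + i))"
    and a_C3: "\<forall>j. Ck_on 3 G\<theta> (\<lambda>\<theta>. a \<theta> j)"
    and b_inv: "\<forall>\<theta>\<in>G\<theta>. b \<theta> 0 = 1 \<and> (\<forall>j>0. (\<Sum>k\<le>j. a \<theta> k * b \<theta> (j - k)) = 0)"
    (* Condition 2 *)
    and cond2: "\<forall>C. compact C \<and> C \<subseteq> G\<theta> \<longrightarrow>
                 (\<exists>c>0. \<exists>\<alpha>. 0 < \<alpha> \<and> \<alpha> < 1 \<and>
                   (\<forall>\<theta>\<in>C. \<forall>j. \<forall>is. length is \<le> 3 \<longrightarrow>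
                      \<bar>dpart is (\<lambda>\<theta>. a \<theta> j) \<theta>\<bar> \<le> c * \<alpha> ^ j \<and>
                      \<bar>dpart is (\<lambda>\<theta>. b \<theta> j) \<theta>\<bar> \<le> c * \<alpha> ^ j))"
    (* ECF weights *)
    and K_sym: "transpose K = K"
    and K_pd: "\<forall>x. x \<noteq> 0 \<longrightarrow> x \<bullet> (K *v x) > 0"
    (* domains *)
    and D_cpt: "compact D\<theta>" "compact D\<eta>" "compact Ds\<rho>"
    and Ds_in: "(\<theta>s, \<eta>s) \<in> Ds\<rho>" "Ds\<rho> \<subseteq> interior (D\<theta> \<times> D\<eta>)"
    and D_sub: "D\<theta> \<subseteq> G\<theta>" "D\<eta> \<subseteq> G\<eta>"
    (* Condition 3' *)
    and cond3: "\<forall>\<theta>\<in>D\<theta>. gradient (W_P M b a \<theta>s dZ) \<theta> = 0 \<longleftrightarrow> \<theta> = \<theta>s"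
               "\<forall>\<eta>\<in>D\<eta>. gradient (W_E M K u \<phi> b a \<theta>s dZ \<theta>s) \<eta> = 0 \<longleftrightarrow> \<eta> = \<eta>s"
    (* nonsingularity *)
    and RE_nonsing: "invertible (hessian (W_E M K u \<phi> b a \<theta>s dZ \<theta>s) \<eta>s)"
    and WP_nonsing: "invertible (hessian (W_P M b a \<theta>s dZ) \<theta>s)"
    (* PE estimator: measurably chosen solution in D_theta of sum eps_n eps_n,theta = 0 *)
    and \<theta>h_meas: "\<forall>N. \<theta>h N \<in> borel_measurable M"
    and \<theta>h_sol: "\<forall>N. \<forall>\<omega>\<in>space M. \<theta>h N \<omega> \<in> D\<theta> \<and>
                 ((\<exists>\<theta>\<in>D\<theta>. gradient (\<lambda>\<theta>. V_P b a \<theta>s dZ N \<theta> \<omega>) \<theta> = 0) \<longrightarrow>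
                    gradient (\<lambda>\<theta>. V_P b a \<theta>s dZ N \<theta> \<omega>) (\<theta>h N \<omega>) = 0)"
    (* ECF estimator: measurably chosen solution in D_eta of V_{E,N,eta}(theta_hat_N, eta) = 0 *)
    and \<eta>h_meas: "\<forall>N. \<eta>h N \<in> borel_measurable M"
    and \<eta>h_sol: "\<forall>N. \<forall>\<omega>\<in>space M. \<eta>h N \<omega> \<in> D\<eta> \<and>
                 ((\<exists>\<eta>\<in>D\<eta>. gradient (\<lambda>\<eta>. V_E K u \<phi> b a \<theta>s dZ N (\<theta>h N \<omega>) \<eta> \<omega>) \<eta> = 0) \<longrightarrow>
                    gradient (\<lambda>\<eta>. V_E K u \<phi> b a \<theta>s dZ N (\<theta>h N \<omega>) \<eta> \<omega>) (\<eta>h N \<omega>) = 0)"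
  shows "\<forall>s::real. 1 \<le> s \<and> s \<le> real Q / (2 * real (CARD('p) + CARD('q))) \<longrightarrow>
           (\<exists>C. \<forall>N\<ge>1.
              (\<integral>\<^sup>+ \<omega>. ennreal (norm (\<eta>h N \<omega> - \<eta>s +
                   (1 / real N) *\<^sub>R (matrix_inv (hessian (W_E M K u \<phi> b a \<theta>s dZ \<theta>s) \<eta>s) *v
                      gradient (\<lambda>\<eta>. V_E K u \<phi> b a \<theta>s dZ N (\<theta>h N \<omega>) \<eta> \<omega>) \<eta>s)) powr s) \<partial>M)
              \<le> ennreal ((C / real N) powr s))"
proof (intro allI impI)
  fix s :: real
  assume s: "1 \<le> s \<and> s \<le> real Q / (2 * real (CARD('p) + CARD('q)))"
  \<comment> \<open>The remainder is bounded by the square of \<open>noise_error\<close>, so its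
    \<open>s\<close>-th moment is a moment of order \<open>2 * s\<close> of the latter.\<close>
  define r where "r = 2 * s"
  have r2: "r \<ge> 2" using s by (simp add: r_def)
  \<comment> \<open>As both dimensions are at least 1, the range of \<open>s\<close> gives
    \<open>4 * s \<le> Q\<close>, the moment order that \<open>iid_noise\<close> requires.\<close>
  have rQ: "2 * r \<le> real Q"
  proof -
    have "real (CARD('p) + CARD('q)) \<ge> 2"
      using zero_less_card_finite[where 'a = 'p] zero_less_card_finite[where 'a = 'q] by linarith
    hence "s * (2 * 2) \<le> s * (2 * real (CARD('p) + CARD('q)))" using s by (intro mult_left_mono) auto
    also have "\<dots> \<le> real Q" using s \<open>real (CARD('p) + CARD('q)) \<ge> 2\<close> by (simp add: pos_le_divide_eq)
    finally show ?thesis by (simp add: r_def)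
  qed
  interpret M: prob_space M by (rule M)
  have dZ_meas [measurable]: "dZ n \<in> borel_measurable M" for n
    using indep by (auto simp: M.indep_vars_def)
  have rd: "real_distribution (distr M borel (dZ n))" for n
    unfolding real_distribution_def real_distribution_axioms_def by (auto intro!: M.prob_space_distr)
  have same: "distr M borel (dZ n) = distr M borel (dZ 0)" for n
    using Levy_uniqueness[OF rd rd] law by (simp add: fun_eq_iff)
  have Q1: "1 \<le> real Q \<and> real Q \<le> real Q" using Q_ge by simp
  have "(\<integral>\<^sup>+x. ennreal (\<bar>x\<bar> powr real Q) \<partial>distr M borel (dZ 0)) < \<infinity>"
  proof (rule levy_moment[OF rd _ h_pos])
    show "levy_measure (\<nu> \<eta>s)" "sL \<eta>s \<ge> 0" using levy \<eta>s_in by auto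
    show "(\<integral>\<^sup>+ x. ennreal (indicator {x. \<bar>x\<bar> \<ge> 1} x * \<bar>x\<bar> powr real Q) \<partial>(\<nu> \<eta>s)) < \<infinity>"
      using cond1 Q1 by blast
    show "char (distr M borel (dZ 0)) x = exp (of_real h * levy_exponent (bL \<eta>s) (sL \<eta>s) (\<nu> \<eta>s) x)" for x
      using law levy \<eta>s_in by simp
  qed (use Q_ge in simp)
  hence "(\<integral>\<^sup>+\<omega>. ennreal (\<bar>dZ 0 \<omega>\<bar> powr real Q) \<partial>M) < \<infinity>"
    by (subst (asm) nn_integral_distr) auto
  hence "integrable M (\<lambda>\<omega>. \<bar>dZ 0 \<omega>\<bar> powr real Q)"
    by (intro integrableI_nonneg) auto
  hence mom: "integrable M (\<lambda>\<omega>. \<bar>dZ 0 \<omega>\<bar> powr (2 * r))"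
    by (rule M.moment_integrable_mono[OF dZ_meas]) (use r2 rQ in auto)
  have int_D: "\<theta>s \<in> interior D\<theta>" "\<eta>s \<in> interior D\<eta>"
    using Ds_in by (auto simp: interior_Times)
  interpret filtered_noise M dZ r a b \<theta>s G\<theta> D\<theta>
  proof unfold_locales
    show "prob_space.expectation M (dZ 0) = 0" using mean0 by blast
  qed (fact indep same r2 mom G\<theta>_open D_cpt(1) D_sub(1) int_D(1) a0 a_C3 b_inv cond2)+

  let ?f = "\<lambda>k. \<phi> (u k)" and ?A = "matrix_inv K"
  let ?m = "\<lambda>k. \<phi> (u k) \<eta>s" and ?H = "hessian (W_E M K u \<phi> b a \<theta>s dZ \<theta>s) \<eta>s"
  have mean_phi: "M.expectation (\<lambda>\<omega>. iexp (x * dZ 0 \<omega>)) = \<phi> x \<eta>s" for x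
  proof -
    have "char (distr M borel (dZ 0)) x = M.expectation (\<lambda>\<omega>. iexp (x * dZ 0 \<omega>))"
      unfolding char_def by (subst integral_distr) auto
    thus ?thesis using law by simp
  qed
  have f_C3: "Ck_on 3 G\<eta> (?f k)" for k using \<phi>_C3 by simp
  have f_diff: "(\<lambda>\<eta>. \<phi> (u k) \<eta>) differentiable (at \<eta>)" if "\<eta> \<in> G\<eta>" for k \<eta>
    using f_C3[of k] that by (simp add: numeral_3_eq_3)
  \<comment> \<open>The limit estimating function: on \<open>G\<eta>\<close> it is the gradient of
    \<open>W_E\<close>, and the random score differs from it only in the means inserted.\<close>
  define w where "w = ecf_score ?A ?f ?m"
  have grad_W: "gradient (W_E M K u \<phi> b a \<theta>s dZ \<theta>s) \<eta> = w \<eta>" if "\<eta> \<in> G\<eta>" for \<eta>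
    using gradient_W_E[where \<phi> = \<phi> and u = u and K = K, OF f_diff[OF that]]
    unfolding mean_phi w_def .
  define Mx where "Mx i j = bform ?A (\<lambda>k. partial_d (?f k) i \<eta>s) (\<lambda>l. partial_d (?f l) j \<eta>s)" for i j
  obtain C2 where C2: "C2 > 0" "\<And>m. continuous_on D\<eta> (ecf_score ?A ?f m)"
    "\<And>m m' y. y \<in> D\<eta> \<Longrightarrow> norm (ecf_score ?A ?f m y - ecf_score ?A ?f m' y) \<le> C2 * (\<Sum>l\<in>UNIV. cmod (m l - m' l))"
    "\<And>m m' y. y \<in> D\<eta> \<Longrightarrow> norm (ecf_score ?A ?f m y - ecf_score ?A ?f m \<eta>s - (ecf_score ?A ?f m' y - ecf_score ?A ?f m' \<eta>s))
        \<le> C2 * (\<Sum>l\<in>UNIV. cmod (m l - m' l)) * norm (y - \<eta>s)"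
    "\<And>y. y \<in> D\<eta> \<Longrightarrow> norm (w y - (\<chi> i. \<Sum>j\<in>UNIV. Mx i j * (y - \<eta>s) $ j)) \<le> C2 * (norm (y - \<eta>s))\<^sup>2"
    by (rule ecf_score_bounds[where f = ?f and A = ?A, OF f_C3 D_cpt(2) D_sub(2) int_D(2), folded Mx_def w_def])
      (rule that; assumption)
  define L where "L h = (\<chi> i. \<Sum>j\<in>UNIV. Mx i j * h $ j)" for h :: "real^'q"
  have L_mat: "L h = (\<chi> i j. Mx i j) *v h" for h by (simp add: L_def matrix_vector_mult_def)
  have w0: "w \<eta>s = 0"
    by (simp add: w_def vec_eq_iff ecf_score_component bform_def)
  have w_der: "(w has_derivative L) (at \<eta>s)"
  proof (rule quadratic_imp_has_derivative[where w = w and C = C2, OF int_D(2)])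
    show "w \<eta>s = 0" by (rule w0)
    show "bounded_linear L"
      unfolding L_mat[abs_def] using matrix_vector_mul_linear linear_conv_bounded_linear by blast
    show "norm (w y - L (y - \<eta>s)) \<le> C2 * (norm (y - \<eta>s))\<^sup>2" if "y \<in> D\<eta>" for y
      using C2(5)[OF that] by (simp add: L_def)
  qed
  \<comment> \<open>\<open>hessian\<close> differentiates component \<open>j\<close> in direction
    \<open>i\<close>, which yields \<open>Mx j i\<close>; symmetry of the polar form identifies the
    Hessian with the matrix of \<open>L\<close>, so that its inverse undoes
    \<open>L\<close>.\<close>
  have H: "?H = (\<chi> i j. Mx i j)"
  proof -
    have "?H $ i $ j = Mx i j" for i j
    proof -
      have "partial_d (\<lambda>y. gradient (W_E M K u \<phi> b a \<theta>s dZ \<theta>s) y $ j) i \<eta>s = partial_d (\<lambda>y. w y $ j) i \<eta>s"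
        by (rule partial_d_cong_open[OF G\<eta>_open \<eta>s_in]) (simp add: grad_W)
      also have "\<dots> = L (axis i 1) $ j"
        by (rule partial_d_eqI) (rule bounded_linear.has_derivative[OF bounded_linear_vec_nth w_der])
      also have "\<dots> = Mx j i"
        by (simp add: L_def axis_def if_distrib cong: if_cong)
      also have "\<dots> = Mx i j" unfolding Mx_def by (rule bform_sym)
      finally show ?thesis by (simp add: hessian_def)
    qed
    thus ?thesis by (simp add: vec_eq_iff)
  qed
  have L'_L: "matrix_inv ?H *v L h = h" for h
  proof -
    have "\<exists>B. ?H ** B = mat 1 \<and> B ** ?H = mat 1" using RE_nonsing unfolding invertible_def .
    from someI_ex[OF this] have "matrix_inv ?H ** ?H = mat 1" unfolding matrix_inv_def by (rule conjunct2)
    thus ?thesis unfolding L_mat H[symmetric] matrix_vector_mul_assoc by simp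
  qed
  have L'_lin: "linear ((*v) (matrix_inv ?H))" by (rule matrix_vector_mul_linear)
  have zero: "w \<eta> = 0 \<longleftrightarrow> \<eta> = \<eta>s" if "\<eta> \<in> D\<eta>" for \<eta>
    using cond3(2) that D_sub(2) grad_W by (metis subsetD)
  have w_cont: "continuous_on D\<eta> w" unfolding w_def by (rule C2(2))
  have w_quad: "norm (w y - L (y - \<eta>s)) \<le> C2 * (norm (y - \<eta>s))\<^sup>2" if "y \<in> D\<eta>" for y
    using C2(5)[OF that] by (simp add: L_def)
  obtain C3 where C3: "C3 > 0"
    "\<And>v \<delta> x. \<lbrakk>continuous_on D\<eta> v; \<And>y. y \<in> D\<eta> \<Longrightarrow> norm (v y - w y) \<le> \<delta>;
        \<And>y. y \<in> D\<eta> \<Longrightarrow> norm (v y - v \<eta>s - (w y - w \<eta>s)) \<le> \<delta> * norm (y - \<eta>s); x \<in> D\<eta>;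
        (\<exists>y\<in>D\<eta>. v y = 0) \<longrightarrow> v x = 0\<rbrakk> \<Longrightarrow> norm (x - \<eta>s + matrix_inv ?H *v v \<eta>s) \<le> C3 * \<delta>\<^sup>2"
    using z_estimator_expansion[OF D_cpt(2) int_D(2) w_cont zero w_der L'_lin L'_L w_quad] that by metis
  obtain \<beta> C4 where \<beta>: "0 < \<beta>" "\<beta> < 1" and C4: "C4 > 0"
    "\<And>N \<omega>. \<lbrakk>N \<ge> 1; \<omega> \<in> space M; good_path \<beta> N \<omega>\<rbrakk> \<Longrightarrow>
       (\<Sum>l\<in>UNIV. cmod (ecf_mean u N (\<theta>h N \<omega>) \<omega> l - M.expectation (\<lambda>\<omega>. iexp (u l * dZ 0 \<omega>)))) \<le> C4 * noise_error \<beta> u N \<omega>"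
    by (rule ecf_rate[where u = u, OF cond3(1) WP_nonsing \<theta>h_sol]) (rule that; assumption)
  obtain C5 where C5: "root_n_bounded M r C5 (noise_error \<beta> u)" using noise_error_bound[OF \<beta>] by blast
  \<comment> \<open>The perturbation is at most \<open>C2 * C4\<close> times the noise error, and
    the remainder at most \<open>C3\<close> times the square of the perturbation.\<close>
  define C6 where "C6 = C3 * (C2 * C4)\<^sup>2"
  have C6: "C6 > 0" using C2(1) C3(1) C4(1) by (simp add: C6_def)
  define rem where "rem N \<omega> = \<eta>h N \<omega> - \<eta>s + (1 / real N) *\<^sub>R (matrix_inv ?H *v
      gradient (\<lambda>\<eta>. V_E K u \<phi> b a \<theta>s dZ N (\<theta>h N \<omega>) \<eta> \<omega>) \<eta>s)" for N \<omega>
  have rem_le: "norm (rem N \<omega>) \<le> C6 * (noise_error \<beta> u N \<omega>)\<^sup>2"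
    if N: "N \<ge> 1" and \<omega>: "\<omega> \<in> space M" and good: "good_path \<beta> N \<omega>" for N \<omega>
  proof -
    define v where "v = ecf_score ?A ?f (ecf_mean u N (\<theta>h N \<omega>) \<omega>)"
    define \<delta> where "\<delta> = C2 * (\<Sum>l\<in>UNIV. cmod (ecf_mean u N (\<theta>h N \<omega>) \<omega> l - ?m l))"
    have grad_V: "gradient (\<lambda>\<eta>. V_E K u \<phi> b a \<theta>s dZ N (\<theta>h N \<omega>) \<eta> \<omega>) \<eta> = real N *\<^sub>R v \<eta>" if "\<eta> \<in> G\<eta>" for \<eta>
      unfolding v_def by (rule gradient_V_E[where \<phi> = \<phi> and u = u, OF f_diff[OF that] N])
    have "norm (\<eta>h N \<omega> - \<eta>s + matrix_inv ?H *v v \<eta>s) \<le> C3 * \<delta>\<^sup>2"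
    proof (rule C3(2))
      show "continuous_on D\<eta> v" unfolding v_def by (rule C2(2))
      show "norm (v y - w y) \<le> \<delta>" if "y \<in> D\<eta>" for y
        unfolding v_def w_def \<delta>_def by (rule C2(3)[OF that])
      show "norm (v y - v \<eta>s - (w y - w \<eta>s)) \<le> \<delta> * norm (y - \<eta>s)" if "y \<in> D\<eta>" for y
        unfolding v_def w_def \<delta>_def by (rule C2(4)[OF that])
      show "\<eta>h N \<omega> \<in> D\<eta>" using \<eta>h_sol \<omega> by blast
      have g0: "gradient (\<lambda>\<eta>. V_E K u \<phi> b a \<theta>s dZ N (\<theta>h N \<omega>) \<eta> \<omega>) y = 0 \<longleftrightarrow> v y = 0" if "y \<in> D\<eta>" for y
        using grad_V[of y] that D_sub(2) N by auto
      show "(\<exists>y\<in>D\<eta>. v y = 0) \<longrightarrow> v (\<eta>h N \<omega>) = 0" using \<eta>h_sol \<omega> g0 by blast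
    qed
    also have "C3 * \<delta>\<^sup>2 \<le> C3 * (C2 * (C4 * noise_error \<beta> u N \<omega>))\<^sup>2"
    proof (intro mult_left_mono power_mono)
      have "(\<Sum>l\<in>UNIV. cmod (ecf_mean u N (\<theta>h N \<omega>) \<omega> l - ?m l)) \<le> C4 * noise_error \<beta> u N \<omega>"
        using C4(2)[OF N \<omega> good] unfolding mean_phi .
      thus "\<delta> \<le> C2 * (C4 * noise_error \<beta> u N \<omega>)" unfolding \<delta>_def using C2(1) by (intro mult_left_mono) auto
      show "0 \<le> \<delta>" unfolding \<delta>_def using C2(1) by (intro mult_nonneg_nonneg sum_nonneg) auto
    qed (use C3(1) in simp)
    also have "\<dots> = C6 * (noise_error \<beta> u N \<omega>)\<^sup>2" by (simp add: C6_def power_mult_distrib mult_ac)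
    finally show ?thesis
      using N grad_V[OF \<eta>s_in] by (simp add: rem_def matrix_vector_mult_scaleR)
  qed
  have C50: "C5 \<ge> 0" using C5 by (simp add: root_n_bounded_def)
  show "\<exists>C. \<forall>N\<ge>1. (\<integral>\<^sup>+ \<omega>. ennreal (norm (\<eta>h N \<omega> - \<eta>s +
                   (1 / real N) *\<^sub>R (matrix_inv ?H *v
                      gradient (\<lambda>\<eta>. V_E K u \<phi> b a \<theta>s dZ N (\<theta>h N \<omega>) \<eta> \<omega>) \<eta>s)) powr s) \<partial>M)
              \<le> ennreal ((C / real N) powr s)"
    unfolding rem_def[symmetric]
  \<comment> \<open>\<open>C5\<close> already bounds a moment rather than a norm, hence its
    \<open>s\<close>-th root: raised to the power \<open>s\<close>, the witness gives
    \<open>C6 powr s * C5\<close>.\<close>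
  proof (intro exI[of _ "C6 * C5 powr (1 / s)"] allI impI)
    fix N :: nat assume N: "N \<ge> 1"
    have [measurable]: "noise_error \<beta> u N \<in> borel_measurable M" using C5 N by (simp add: root_n_bounded_def)
    have "(\<integral>\<^sup>+ \<omega>. ennreal (norm (rem N \<omega>) powr s) \<partial>M) \<le> (\<integral>\<^sup>+ \<omega>. ennreal (C6 powr s) * ennreal (\<bar>noise_error \<beta> u N \<omega>\<bar> powr r) \<partial>M)"
    proof (rule nn_integral_mono_AE, use AE_good_path[OF \<beta> N] AE_space in eventually_elim)
      case (elim \<omega>)
      have "norm (rem N \<omega>) powr s \<le> (C6 * \<bar>noise_error \<beta> u N \<omega>\<bar> powr 2) powr s"
        using rem_le[OF N elim(2) elim(1)] s by (intro powr_mono2) auto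
      also have "\<dots> = C6 powr s * \<bar>noise_error \<beta> u N \<omega>\<bar> powr r"
        using C6 by (simp only: powr_mult powr_powr r_def)
      finally show ?case by (simp add: ennreal_mult'[symmetric] ennreal_leI)
    qed
    also have "\<dots> = ennreal (C6 powr s) * (\<integral>\<^sup>+ \<omega>. ennreal (\<bar>noise_error \<beta> u N \<omega>\<bar> powr r) \<partial>M)"
      by (rule nn_integral_cmult) measurable
    also have "\<dots> \<le> ennreal (C6 powr s) * ennreal (C5 * real N powr (- r / 2))"
      using C5 N by (intro mult_left_mono) (auto simp: root_n_bounded_def)
    also have "\<dots> = ennreal (C6 powr s * (C5 * real N powr (- s)))"
      by (simp add: ennreal_mult'[symmetric] r_def)
    also have "C6 powr s * (C5 * real N powr (- s)) = (C6 * C5 powr (1 / s) / real N) powr s"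
      using C6 C50 s N by (simp add: powr_mult powr_divide powr_powr powr_minus_divide)
    finally show "(\<integral>\<^sup>+ \<omega>. ennreal (norm (rem N \<omega>) powr s) \<partial>M) \<le> ennreal ((C6 * C5 powr (1 / s) / real N) powr s)" .
  qed
qed

end
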